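(* Let $f$ be a smooth real-valued function of finite type of two variables, defined in a sufficiently small neighborhood $U\subset\mathbb{R}^2$ of the origin, with $f(0,0)=0$ and $\nabla f(0,0)=0$, and let $\psi\in C_0^\infty(U)$. Let $h$ be the height of $f$ and let $m\in\{0,1\}$ be the multiplicity of its Newton polyhedron. Let $0<\alpha<1$ and $\beta>0$. (i) If $h>1$, then for all $\lambda\gg 1$ (i.e. for all sufficiently large real $\lambda$) $$\left|\int_{U}E_{\alpha,\beta}(i\lambda f(x_1,x_2))\,\psi(x)\,dx\right|\le \frac{C\,|\ln\lambda|^{m}\,\|\psi\|_{L^\infty(\overline U)}}{\lambda^{1/h}}.$$ (ii) If $h=1$, then for all $\lambda\gg1$ $$\left|\int_{U}E_{\alpha,\beta}(i\lambda f(x_1,x_2))\,\psi(x)\,dx\right|\le \frac{C\,|\ln\lambda|^{2}\,\|\psi\|_{L^\infty(\overline U)}}{\lambda}.$$ Here the constants $C$ are independent of the phase $f$, the amplitude $\psi$ and $\lambda$.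
   Context: Mittag-Leffler function: $E_{\alpha,\beta}(z)=\sum_{k=0}^\infty \frac{z^k}{\Gamma(\alpha k+\beta)}$. Let $f$ be a smooth real-valued function near the origin in $\mathbb{R}^2$ with $f(0,0)=0$, $\nabla f(0,0)=0$, and Taylor series $f(x_1,x_2)\sim\sum_{j,k\ge0}c_{jk}x_1^jx_2^k$ at the origin. The Taylor support is $\{(j,k)\in\mathbb{N}^2: c_{jk}\ne 0\}$ (with $0\in\mathbb{N}$); $f$ is of finite type (at the origin) if its Taylor support is nonempty. The Newton polyhedron of $f$ is the convex hull of the union of all quadrants $(j,k)+\mathbb{R}_+^2$, with $(j,k)$ in the Taylor support. A face is an edge or a vertex. The distance $d=d(f)$ is the coordinate $d$ of the point $(d,d)$ at which the bisectrix $t_1=t_2$ meets the boundary of the Newton polyhedron. The principal face $\pi(f)$ is the face of minimal dimension containing $(d,d)$. The principal part of $f$ is $f_\pi(x_1,x_2)=\sum_{(j,k)\in\pi(f)}c_{jk}x_1^jx_2^k$. A local smooth coordinate system at the origin is a smooth coordinate system defined near the origin which preserves $0$. For such a coordinate system $x$, $d_x$ denotes the distance of $f$ expressed in the coordinates $x$. The height of $f$ is $h=h(f)=\sup\{d_x\}$, the supremum being over all local smooth coordinate systems $x$ at the origin. Multiplicity of the Newton polyhedron: when the principal face $\pi$ (in given coordinates) is a point or a compact edge, $f_\pi$ is a weighted homogeneous polynomial, and $\nu:=\max_{S^1}\operatorname{ord}(f_\pi)$ is the maximal order of the roots of $f_\pi$ on the unit circle centered at the origin. If there exists a coordinate system $x$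 such that $\nu=d_x$, then $m=1$; otherwise $m=0$.
   Formalization: The constant C may depend on the neighbourhood U, whose admissible size depends on f, so effectively on f; full independence of f fails, e.g. for f = ε(x1^4+x2^4) as ε tends to 0. C remains independent of ψ and λ. *)

theory Defs
  imports "HOL-Analysis.Analysis" "HOL-Probability.Essential_Supremum"
begin

definition mittag_leffler :: "real \<Rightarrow> real \<Rightarrow> complex \<Rightarrow> complex" where
  "mittag_leffler \<alpha> \<beta> z = (\<Sum>k. z ^ k / Gamma (complex_of_real (\<alpha> * real k + \<beta>)))"


section \<open>Smooth functions and Taylor coefficients\<close>

(* Intended for open S; in finite dimension this is the usual class C^n. *)
primrec Ck_on :: "nat \<Rightarrow> 'a::real_normed_vector set \<Rightarrow> ('a \<Rightarrow> 'b::real_normed_vector) \<Rightarrow> bool" where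
  "Ck_on 0 S f \<longleftrightarrow> continuous_on S f"
| "Ck_on (Suc n) S f \<longleftrightarrow>
     (\<forall>x\<in>S. f differentiable at x) \<and> (\<forall>v. Ck_on n S (\<lambda>x. frechet_derivative f (at x) v))"

definition smooth_on :: "'a::real_normed_vector set \<Rightarrow> ('a \<Rightarrow> 'b::real_normed_vector) \<Rightarrow> bool" where
  "smooth_on S f \<longleftrightarrow> (\<forall>n. Ck_on n S f)"

definition partial_deriv :: "nat \<Rightarrow> nat \<Rightarrow> (real \<times> real \<Rightarrow> real) \<Rightarrow> real \<times> real \<Rightarrow> real" where
  "partial_deriv j k f =
     ((\<lambda>g x. frechet_derivative g (at x) (1, 0)) ^^ j)
       (((\<lambda>g x. frechet_derivative g (at x) (0, 1)) ^^ k) f)"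

definition taylor_coeff :: "(real \<times> real \<Rightarrow> real) \<Rightarrow> nat \<Rightarrow> nat \<Rightarrow> real" where
  "taylor_coeff f j k = partial_deriv j k f (0, 0) / (fact j * fact k)"

definition taylor_support :: "(real \<times> real \<Rightarrow> real) \<Rightarrow> (nat \<times> nat) set" where
  "taylor_support f = {(j, k). taylor_coeff f j k \<noteq> 0}"

definition finite_type :: "(real \<times> real \<Rightarrow> real) \<Rightarrow> bool" where
  "finite_type f \<longleftrightarrow> taylor_support f \<noteq> {}"

(* Functions are total; only the values near the origin matter. *)
definition phase_function :: "(real \<times> real \<Rightarrow> real) \<Rightarrow> bool" where
  "phase_function f \<longleftrightarrow>
     (\<exists>V. open V \<and> (0, 0) \<in> V \<and> smooth_on V f) \<and>
     f (0, 0) = 0 \<and> (f has_derivative (\<lambda>_. 0)) (at (0, 0)) \<and> finite_type f"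


section \<open>The Newton polyhedron\<close>

definition newton_polyhedron :: "(real \<times> real \<Rightarrow> real) \<Rightarrow> (real \<times> real) set" where
  "newton_polyhedron f =
     convex hull (\<Union>(j, k)\<in>taylor_support f. {(s, t). real j \<le> s \<and> real k \<le> t})"

definition newton_distance :: "(real \<times> real \<Rightarrow> real) \<Rightarrow> real" where
  "newton_distance f = (THE d. (d, d) \<in> frontier (newton_polyhedron f))"

definition newton_face :: "(real \<times> real \<Rightarrow> real) \<Rightarrow> (real \<times> real) set \<Rightarrow> bool" where
  "newton_face f F \<longleftrightarrow>
     F edge_of newton_polyhedron f \<or>
     (\<exists>p. p extreme_point_of newton_polyhedron f \<and> F = {p})"

definition principal_face :: "(real \<times> real \<Rightarrow> real) \<Rightarrow> (real \<times> real) set" where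
  "principal_face f =
     (let p = (newton_distance f, newton_distance f)
      in THE F. newton_face f F \<and> p \<in> F \<and>
           (\<forall>G. newton_face f G \<and> p \<in> G \<longrightarrow> aff_dim F \<le> aff_dim G))"

(* Only meaningful when the principal face is bounded (a vertex or a compact edge);
   otherwise the index set may be infinite. *)
definition principal_part :: "(real \<times> real \<Rightarrow> real) \<Rightarrow> real \<times> real \<Rightarrow> real" where
  "principal_part f = (\<lambda>(x1, x2).
     \<Sum>(j, k) \<in> {(j, k). (real j, real k) \<in> principal_face f}. taylor_coeff f j k * x1 ^ j * x2 ^ k)"

(* Order of vanishing of g at p; it is 0 when g does not vanish at p. *)
definition vanishing_order :: "(real \<times> real \<Rightarrow> real) \<Rightarrow> real \<times> real \<Rightarrow> nat" where
  "vanishing_order g p = (LEAST n. \<exists>j k. j + k = n \<and> partial_deriv j k g p \<noteq> 0)"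

definition max_root_order :: "(real \<times> real \<Rightarrow> real) \<Rightarrow> nat" where
  "max_root_order f = Max (vanishing_order (principal_part f) ` sphere (0, 0) 1)"


section \<open>Height and multiplicity\<close>

(* A local smooth coordinate system x at the origin is represented by the inverse \<phi> of its
   coordinate map, so that f expressed in the coordinates x is f \<circ> \<phi>. *)
definition local_coordinates :: "(real \<times> real \<Rightarrow> real \<times> real) \<Rightarrow> bool" where
  "local_coordinates \<phi> \<longleftrightarrow>
     \<phi> (0, 0) = (0, 0) \<and>
     (\<exists>V W \<theta>. open V \<and> open W \<and> (0, 0) \<in> V \<and> homeomorphism V W \<phi> \<theta> \<and>
        smooth_on V \<phi> \<and> smooth_on W \<theta>)"

(* For f of finite type the supremum is a real number: the order of vanishing of f at the
   origin does not depend on the coordinates and bounds every distance. *)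
definition height :: "(real \<times> real \<Rightarrow> real) \<Rightarrow> real" where
  "height f = (SUP \<phi>\<in>{\<phi>. local_coordinates \<phi>}. newton_distance (f \<circ> \<phi>))"

definition newton_multiplicity :: "(real \<times> real \<Rightarrow> real) \<Rightarrow> nat" where
  "newton_multiplicity f =
     (if \<exists>\<phi>. local_coordinates \<phi> \<and> bounded (principal_face (f \<circ> \<phi>)) \<and>
             real (max_root_order (f \<circ> \<phi>)) = newton_distance (f \<circ> \<phi>)
      then 1 else 0)"


section \<open>Amplitudes\<close>

(* Elements of the space of smooth functions with compact support in U, extended by 0. *)
definition test_function_on :: "(real \<times> real) set \<Rightarrow> (real \<times> real \<Rightarrow> complex) \<Rightarrow> bool" where
  "test_function_on U \<psi> \<longleftrightarrow>
     smooth_on UNIV \<psi> \<and> compact (closure {x. \<psi> x \<noteq> 0}) \<and> closure {x. \<psi> x \<noteq> 0} \<subseteq> U"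

definition Linf_norm_on :: "(real \<times> real) set \<Rightarrow> (real \<times> real \<Rightarrow> complex) \<Rightarrow> real" where
  "Linf_norm_on A \<psi> = real_of_ereal (esssup (restrict_space lborel A) (\<lambda>x. ereal (norm (\<psi> x))))"

end

theory Submission
  imports Defs "HOL-Complex_Analysis.Complex_Analysis"
begin

text \<open>The proof separates the special function from the phase. On the imaginary axis the
Mittag-Leffler function decays like \<open>M / (1 + |y|)\<close> (\<open>ml_decay\<close>), so the oscillatory integral
is at most \<open>M\<close> times the sup norm of the amplitude times the integral of
\<open>1 / (1 + lam |f|)\<close> over a small ball. No cancellation is used, and everything comes down to the
size of the sublevel sets \<open>{|f| \<le> \<epsilon>}\<close> near the origin: they have measure
\<open>O(\<epsilon>^(1/h) ln(1/\<epsilon>)^l)\<close> (\<open>ball_bound\<close>), where \<open>h\<close> is the height and \<open>l\<close> the multiplicity. A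
dyadic decomposition in the size of \<open>lam |f|\<close> turns this into the two bounds. For \<open>h > 1\<close> the
dyadic sum is geometric; for \<open>h = 1\<close> all of its \<open>O(ln lam)\<close> terms are of the same size, which costs
one further logarithm.

\<^bold>\<open>Sublevel sets.\<close> Fix coordinates and a weight \<open>m \<ge> 1\<close> for the second variable, and let \<open>q\<close> be such
that the Taylor support lies in \<open>j + m k \<ge> q\<close>. Then \<open>x^(-q) g(x, x^m z)\<close> converges, uniformly for
bounded \<open>z\<close>, to a polynomial \<open>P(z)\<close> whose coefficients sit on the line \<open>j + m k = q\<close>
(\<open>weighted_limit\<close>). In the horn around the curve \<open>y = z x^m\<close>, where \<open>z\<close> is a root of \<open>P\<close> of order
\<open>N\<close>, the \<open>N\<close>-th derivative in \<open>y\<close> is at least a constant times \<open>x^(q - m N)\<close>, and van der Corput's lemma on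
each vertical section gives a bound which is integrated over \<open>x\<close> (\<open>section_bound\<close>,
\<open>horn_bound_root\<close>). With \<open>d = q / (1 + m)\<close>, which never exceeds the height (\<open>weight_le_height\<close>), there
are three cases. If \<open>N < d\<close> the bound is \<open>\<epsilon>^(1/d)\<close>. If \<open>N = d\<close> there is an additional logarithm, and
moving the root to \<open>0\<close> by a shear puts a vertex of the Newton polyhedron on the bisectrix, so that
the multiplicity is \<open>1\<close> and the logarithm is allowed (\<open>critical_root_multiplicity\<close>). If \<open>N > d\<close> the
bound is \<open>\<epsilon>^(1/N)\<close>, which suffices only when \<open>N \<le> h\<close>.

In the remaining case \<open>d \<le> h < N\<close> the weight \<open>m\<close> is an integer if \<open>z \<noteq> 0\<close>
(\<open>high_root_integer_slope\<close>), so a smooth shear moves the root to \<open>0\<close>, and the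
argument is repeated along the next edge of the Newton polyhedron, whose weight \<open>m1\<close> exceeds \<open>m\<close>
(\<open>next_slope\<close>, \<open>horn_bound_combine\<close>). This recursion terminates (\<open>horn_bound_high_root\<close>): along the
new edge either the order of the root drops, or it stays equal to \<open>N\<close>, and then \<open>m1\<close> is an integer
which the inequality \<open>d \<le> h\<close>, applied to \<open>m1\<close>, bounds by a number that does not change in the course of the
recursion. It is here that the height enters as a supremum over all coordinate systems.

\<^bold>\<open>Decay of the Mittag-Leffler function.\<close> Since \<open>E_{\<alpha>,\<beta>}(z) = (E_{\<alpha>,\<beta>-\<alpha>}(z) - 1/\<Gamma>(\<beta>-\<alpha>)) / z\<close>,
it suffices to bound \<open>E_{\<alpha>,\<gamma>}\<close> on the imaginary axis for every real \<open>\<gamma>\<close>. The function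
\<open>u(t) = E_{\<alpha>,1}(z t^\<alpha>)\<close> solves the Volterra equation \<open>u = 1 + (z/\<Gamma>(\<alpha>)) t^(\<alpha>-1) * u\<close>. Pairing it
with the conjugate of \<open>u\<close> and using that the quadratic form of the kernel \<open>t^(\<alpha>-1)\<close> takes values in
a sector \<open>|Im Q| \<le> L Re Q\<close> (\<open>frac_form_sector\<close>) bounds the \<open>L^2\<close> norm of \<open>u\<close> on \<open>[0,1]\<close>,
uniformly for \<open>z\<close> in a thin sector around the imaginary axis (\<open>ml_L2_bound\<close>). The Beta integral
(\<open>ml_convolution\<close>) passes from there to \<open>\<gamma> > 3/2\<close>, and Cauchy's estimate for the derivative lowers
\<open>\<gamma>\<close> by \<open>1\<close> on a smaller sector (\<open>ml_bounded_lower\<close>).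

\<^bold>\<open>The constant.\<close> In the statement \<open>C\<close> is a function of \<open>U\<close> alone, whereas the radius of the
ball that contains \<open>U\<close> is chosen after \<open>f\<close>. The function \<open>C U = 1 / diameter U\<close> works: the bounds above hold
with a constant depending on \<open>f\<close>, and a small enough radius makes \<open>1 / diameter U\<close> exceed it.\<close>

section \<open>Functions of class C^n\<close>

lemma frechet_derivative_cong_open:
  assumes "open S" "x \<in> S" "\<And>y. y \<in> S \<Longrightarrow> f y = g y"
  shows "frechet_derivative f (at x) = frechet_derivative g (at x)"
proof -
  have "(f has_derivative D) (at x) = (g has_derivative D) (at x)" for D
    using assms has_derivative_transform_within_open[of f D x UNIV S g]
      has_derivative_transform_within_open[of g D x UNIV S f] by auto
  then show ?thesis
    unfolding frechet_derivative_def by simp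
qed

text \<open>The class is defined through total Frechet derivatives, which on an open set depend only on the
values there; this allows functions to be replaced by formulas valid on the open set only.\<close>

lemma Ck_on_cong:
  assumes "open S" "\<And>x. x \<in> S \<Longrightarrow> f x = g x" "Ck_on n S f"
  shows "Ck_on n S g"
  using assms(2,3)
proof (induction n arbitrary: f g)
  case 0
  then show ?case using continuous_on_cong by force
next
  case (Suc n)
  have d: "g differentiable at x" if "x \<in> S" for x
  proof -
    have "f differentiable at x"
      using Suc.prems(2) that by simp
    then obtain D where "(f has_derivative D) (at x)"
      unfolding differentiable_def by blast
    then have "(g has_derivative D) (at x)"
      by (rule has_derivative_transform_within_open[OF _ assms(1) that]) (rule Suc.prems(1))
    then show ?thesis by (auto simp: differentiable_def)
  qed
  have "Ck_on n S (\<lambda>x. frechet_derivative g (at x) v)" for v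
  proof (rule Suc.IH)
    show "Ck_on n S (\<lambda>x. frechet_derivative f (at x) v)" using Suc.prems(2) by simp
    show "\<And>x. x \<in> S \<Longrightarrow> frechet_derivative f (at x) v = frechet_derivative g (at x) v"
      by (rule fun_cong[OF frechet_derivative_cong_open[OF assms(1)]]) (use Suc.prems(1) in auto)
  qed
  with d show ?case by simp
qed

lemma Ck_on_subset: "Ck_on n S f \<Longrightarrow> T \<subseteq> S \<Longrightarrow> Ck_on n T f"
proof (induction n arbitrary: f)
  case 0
  then show ?case using continuous_on_subset by auto
next
  case (Suc n)
  then show ?case by (auto simp: subset_iff)
qed

text \<open>Not immediate from the definition, where \<open>n\<close> counts the derivatives still to be taken: the
induction needs that a differentiable function is continuous.\<close>

lemma Ck_on_Suc_imp: "Ck_on (Suc n) S f \<Longrightarrow> Ck_on n S f"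
proof (induction n arbitrary: f)
  case 0
  then show ?case
    by (auto intro!: differentiable_imp_continuous_on differentiable_at_imp_differentiable_on)
next
  case (Suc n)
  then show ?case by simp
qed

lemma Ck_on_const: "Ck_on n S (\<lambda>x. c)"
  by (induction n arbitrary: c) auto

lemma Ck_on_bounded_linear: "bounded_linear L \<Longrightarrow> Ck_on n S L"
proof (induction n)
  case 0
  then show ?case by (simp add: linear_continuous_on)
next
  case (Suc n)
  have "frechet_derivative L (at x) = L" for x
    using bounded_linear_imp_has_derivative[OF Suc.prems] frechet_derivative_at by metis
  then show ?case
    using Suc.prems bounded_linear_imp_differentiable Ck_on_const by auto
qed

lemma Ck_on_add:
  assumes "open S" "Ck_on n S f" "Ck_on n S g"
  shows "Ck_on n S (\<lambda>x. f x + g x)"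
  using assms(2,3)
proof (induction n arbitrary: f g)
  case 0
  then show ?case by (simp add: continuous_on_add)
next
  case (Suc n)
  have *: "frechet_derivative (\<lambda>x. f x + g x) (at x) v
      = frechet_derivative f (at x) v + frechet_derivative g (at x) v" if "x \<in> S" for x v
  proof -
    have "((\<lambda>x. f x + g x) has_derivative
        (\<lambda>v. frechet_derivative f (at x) v + frechet_derivative g (at x) v)) (at x)"
      using Suc.prems that by (auto intro!: has_derivative_add simp: frechet_derivative_works[symmetric])
    from frechet_derivative_at[OF this] show ?thesis by metis
  qed
  have "Ck_on n S (\<lambda>x. frechet_derivative f (at x) v + frechet_derivative g (at x) v)" for v
    using Suc.prems by (intro Suc.IH) simp_all
  then have "Ck_on n S (\<lambda>x. frechet_derivative (\<lambda>x. f x + g x) (at x) v)" for v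
    by (rule Ck_on_cong[OF assms(1), rotated]) (simp add: *)
  then show ?case using Suc.prems by auto
qed

lemma (in bounded_bilinear) Ck_on_prod:
  assumes "open S" "Ck_on n S f" "Ck_on n S g"
  shows "Ck_on n S (\<lambda>x. prod (f x) (g x))"
  using assms(2,3)
proof (induction n arbitrary: f g)
  case 0
  then show ?case by (simp add: continuous_on)
next
  case (Suc n)
  have D: "((\<lambda>x. prod (f x) (g x)) has_derivative
        (\<lambda>v. prod (f x) (frechet_derivative g (at x) v) + prod (frechet_derivative f (at x) v) (g x))) (at x)"
      if "x \<in> S" for x
      using Suc.prems that by (intro FDERIV) (simp_all add: frechet_derivative_works[symmetric])
  have *: "frechet_derivative (\<lambda>x. prod (f x) (g x)) (at x) v
      = prod (f x) (frechet_derivative g (at x) v) + prod (frechet_derivative f (at x) v) (g x)" 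
    if "x \<in> S" for x v
    by (rule fun_cong[OF frechet_derivative_at[OF D[OF that], symmetric]])
  have "Ck_on n S (\<lambda>x. prod (f x) (frechet_derivative g (at x) v) + prod (frechet_derivative f (at x) v) (g x))" for v
    using Suc.prems Ck_on_Suc_imp[OF Suc.prems(1)] Ck_on_Suc_imp[OF Suc.prems(2)]
    by (intro Ck_on_add assms(1) Suc.IH) simp_all
  then have "Ck_on n S (\<lambda>x. frechet_derivative (\<lambda>x. prod (f x) (g x)) (at x) v)" for v
    by (rule Ck_on_cong[OF assms(1), rotated]) (simp add: *)
  then show ?case using D by (auto simp: differentiable_def)
qed

lemma Ck_on_linear_compose:
  assumes "open S" "bounded_linear L" "Ck_on n S f"
  shows "Ck_on n S (\<lambda>x. L (f x))"
  using assms(3)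
proof (induction n arbitrary: f)
  case 0
  then show ?case using assms(2) bounded_linear.continuous_on by auto
next
  case (Suc n)
  have D: "((\<lambda>x. L (f x)) has_derivative (\<lambda>v. L (frechet_derivative f (at x) v))) (at x)" if "x \<in> S" for x
    using Suc.prems that by (intro bounded_linear.has_derivative[OF assms(2)]) (auto simp: frechet_derivative_works[symmetric])
  have *: "frechet_derivative (\<lambda>x. L (f x)) (at x) v = L (frechet_derivative f (at x) v)" if "x \<in> S" for x v
    by (rule fun_cong[OF frechet_derivative_at[OF D[OF that], symmetric]])
  have "Ck_on n S (\<lambda>x. frechet_derivative (\<lambda>x. L (f x)) (at x) v)" for v
    by (rule Ck_on_cong[OF assms(1) _ Suc.IH]) (use Suc.prems * in auto)
  then show ?case using D by (auto simp: differentiable_def)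
qed

lemma frechet_derivative_prod_expand:
  fixes f :: "real \<times> real \<Rightarrow> 'a::real_normed_vector"
  assumes "f differentiable (at p)"
  shows "frechet_derivative f (at p) v =
    fst v *\<^sub>R frechet_derivative f (at p) (1, 0) + snd v *\<^sub>R frechet_derivative f (at p) (0, 1)"
proof -
  have lin: "linear (frechet_derivative f (at p))"
    using assms linear_frechet_derivative by blast
  have v: "v = fst v *\<^sub>R (1, 0) + snd v *\<^sub>R (0, 1)"
    by (simp add: prod_eq_iff)
  show ?thesis
    by (subst v) (simp only: linear_add[OF lin] linear_scale[OF lin])
qed

text \<open>By the chain rule and \<open>frechet_derivative_prod_expand\<close> the derivative of \<open>f \<circ> \<phi>\<close> is a
combination, with coefficients of class \<open>C^n\<close>, of the two partial derivatives of \<open>f\<close> composed with \<open>\<phi>\<close>,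
so the induction stays within compositions of this form.\<close>

lemma Ck_on_compose:
  fixes f :: "real \<times> real \<Rightarrow> 'a::real_normed_vector"
  assumes "open V" "open W" "\<phi> ` V \<subseteq> W" "Ck_on n W f" "Ck_on n V \<phi>"
  shows "Ck_on n V (\<lambda>x. f (\<phi> x))"
  using assms(4,5)
proof (induction n arbitrary: f)
  case 0
  then show ?case using assms(3) by (auto intro: continuous_on_compose2)
next
  case (Suc n)
  let ?D = "\<lambda>x v. fst (frechet_derivative \<phi> (at x) v) *\<^sub>R frechet_derivative f (at (\<phi> x)) (1, 0)
     + snd (frechet_derivative \<phi> (at x) v) *\<^sub>R frechet_derivative f (at (\<phi> x)) (0, 1)"
  have fd: "f differentiable (at (\<phi> x))" if "x \<in> V" for x
    using Suc.prems(1) assms(3) that by auto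
  have D: "((\<lambda>x. f (\<phi> x)) has_derivative (\<lambda>v. ?D x v)) (at x)" if "x \<in> V" for x
  proof -
    have "((\<lambda>x. f (\<phi> x)) has_derivative 
      (\<lambda>v. frechet_derivative f (at (\<phi> x)) (frechet_derivative \<phi> (at x) v))) (at x)"
      using Suc.prems that fd[OF that] 
      by (intro has_derivative_compose[of \<phi> _ x UNIV f]) (auto simp: frechet_derivative_works[symmetric])
    also have "(\<lambda>v. frechet_derivative f (at (\<phi> x)) (frechet_derivative \<phi> (at x) v)) = ?D x"
      using frechet_derivative_prod_expand[OF fd[OF that]] by blast
    finally show ?thesis .
  qed
  have *: "frechet_derivative (\<lambda>x. f (\<phi> x)) (at x) v = ?D x v" if "x \<in> V" for x v
    by (rule fun_cong[OF frechet_derivative_at[OF D[OF that], symmetric]])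
  have C: "Ck_on n V (\<lambda>x. frechet_derivative f (at (\<phi> x)) v)" for v
    by (rule Suc.IH[OF _ Ck_on_Suc_imp[OF Suc.prems(2)]]) (rule conjunct2[OF Suc.prems(1)[unfolded Ck_on.simps], THEN spec])
  have P: "Ck_on n V (\<lambda>x. frechet_derivative \<phi> (at x) v)" for v
    using Suc.prems(2) by simp
  have "Ck_on n V (\<lambda>x. ?D x v)" for v
    by (intro Ck_on_add bounded_bilinear.Ck_on_prod[OF bounded_bilinear_scaleR] assms(1) C
        Ck_on_linear_compose[OF assms(1) bounded_linear_fst] Ck_on_linear_compose[OF assms(1) bounded_linear_snd] P)
  then have "Ck_on n V (\<lambda>x. frechet_derivative (\<lambda>x. f (\<phi> x)) (at x) v)" for v
    by (rule Ck_on_cong[OF assms(1), rotated]) (use * in auto)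
  then show ?case using D by (auto simp: differentiable_def)
qed

lemma smooth_on_compose:
  fixes f :: "real \<times> real \<Rightarrow> 'a::real_normed_vector"
  assumes "open V" "open W" "\<phi> ` V \<subseteq> W" "smooth_on W f" "smooth_on V \<phi>"
  shows "smooth_on V (\<lambda>x. f (\<phi> x))"
  using assms Ck_on_compose unfolding smooth_on_def by blast

lemma smooth_on_subset: "smooth_on S f \<Longrightarrow> T \<subseteq> S \<Longrightarrow> smooth_on T f"
  unfolding smooth_on_def using Ck_on_subset by blast

lemma smooth_on_differentiable: "smooth_on S f \<Longrightarrow> x \<in> S \<Longrightarrow> f differentiable (at x)"
  unfolding smooth_on_def by (metis Ck_on.simps(2))

lemma smooth_on_frechet_derivative: "smooth_on S f \<Longrightarrow> smooth_on S (\<lambda>x. frechet_derivative f (at x) v)"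
  unfolding smooth_on_def by (metis Ck_on.simps(2))

lemma smooth_on_continuous_on: "smooth_on S f \<Longrightarrow> continuous_on S f"
  unfolding smooth_on_def by (metis Ck_on.simps(1))

lemma smooth_on_const: "smooth_on S (\<lambda>x. c)"
  by (simp add: smooth_on_def Ck_on_const)

lemma smooth_on_bounded_linear: "bounded_linear L \<Longrightarrow> smooth_on S L"
  by (simp add: smooth_on_def Ck_on_bounded_linear)

lemma smooth_on_linear_compose:
  "open S \<Longrightarrow> bounded_linear L \<Longrightarrow> smooth_on S f \<Longrightarrow> smooth_on S (\<lambda>x. L (f x))"
  by (simp add: smooth_on_def Ck_on_linear_compose)

lemma smooth_on_add:
  "open S \<Longrightarrow> smooth_on S f \<Longrightarrow> smooth_on S g \<Longrightarrow> smooth_on S (\<lambda>x. f x + g x)"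
  by (simp add: smooth_on_def Ck_on_add)

lemma smooth_on_mult:
  fixes f g :: "_ \<Rightarrow> real"
  shows "open S \<Longrightarrow> smooth_on S f \<Longrightarrow> smooth_on S g \<Longrightarrow> smooth_on S (\<lambda>x. f x * g x)"
  by (simp add: smooth_on_def bounded_bilinear.Ck_on_prod[OF bounded_bilinear_mult])

lemma smooth_on_power:
  fixes f :: "_ \<Rightarrow> real"
  shows "open S \<Longrightarrow> smooth_on S f \<Longrightarrow> smooth_on S (\<lambda>x. f x ^ n)"
  by (induction n) (simp_all add: smooth_on_const smooth_on_mult)

lemma smooth_on_Pair:
  fixes f g :: "_ \<Rightarrow> real"
  assumes "open S" "smooth_on S f" "smooth_on S g"
  shows "smooth_on S (\<lambda>x. (f x, g x))"
proof -
  have 1: "bounded_linear (\<lambda>t::real. (t, 0::real))" and 2: "bounded_linear (\<lambda>t::real. (0::real, t))"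
    by (intro bounded_linear_Pair bounded_linear_ident bounded_linear_zero)+
  have "smooth_on S (\<lambda>x. (f x, 0) + (0, g x))"
    using smooth_on_add smooth_on_linear_compose[OF assms(1) 1 assms(2)]
      smooth_on_linear_compose[OF assms(1) 2 assms(3)] assms(1) by blast
  then show ?thesis by simp
qed

section \<open>Taylor expansion and edge polynomials\<close>

definition D1 :: "(real \<times> real \<Rightarrow> real) \<Rightarrow> real \<times> real \<Rightarrow> real" where
  "D1 g p = frechet_derivative g (at p) (1, 0)"

definition D2 :: "(real \<times> real \<Rightarrow> real) \<Rightarrow> real \<times> real \<Rightarrow> real" where
  "D2 g p = frechet_derivative g (at p) (0, 1)"

lemma partial_deriv_eq: "partial_deriv j k g = (D1 ^^ j) ((D2 ^^ k) g)"
proof -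
  have "D1 = (\<lambda>g x. frechet_derivative g (at x) (1, 0))" "D2 = (\<lambda>g x. frechet_derivative g (at x) (0, 1))"
    by (auto simp: fun_eq_iff D1_def D2_def)
  then show ?thesis unfolding partial_deriv_def by simp
qed

lemma smooth_on_D1: "smooth_on V g \<Longrightarrow> smooth_on V (D1 g)"
  using smooth_on_frechet_derivative[of V g "(1, 0)"] unfolding D1_def[abs_def] by simp

lemma smooth_on_D2: "smooth_on V g \<Longrightarrow> smooth_on V (D2 g)"
  using smooth_on_frechet_derivative[of V g "(0, 1)"] unfolding D2_def[abs_def] by simp

lemma smooth_on_D1_iter: "smooth_on V g \<Longrightarrow> smooth_on V ((D1 ^^ j) g)"
  by (induction j) (auto intro: smooth_on_D1)

lemma smooth_on_D2_iter: "smooth_on V g \<Longrightarrow> smooth_on V ((D2 ^^ j) g)"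
  by (induction j) (auto intro: smooth_on_D2)

lemma has_real_derivative_D1:
  assumes "smooth_on V g" "(x, y) \<in> V"
  shows "((\<lambda>t. g (t, y)) has_real_derivative D1 g (x, y)) (at x)"
proof -
  have "(g has_derivative frechet_derivative g (at (x, y))) (at (x, y))"
    using smooth_on_differentiable[OF assms] frechet_derivative_works by blast
  moreover have "((\<lambda>t. (t, y)) has_derivative (\<lambda>t. (t, 0))) (at x)"
    by (intro derivative_intros)
  ultimately have "((\<lambda>t. g (t, y)) has_derivative (\<lambda>t. frechet_derivative g (at (x, y)) (t, 0))) (at x)"
    by (intro has_derivative_compose[of "\<lambda>t. (t, y)" _ x UNIV g]) auto
  also have "(\<lambda>t. frechet_derivative g (at (x, y)) (t, 0)) = (\<lambda>t. D1 g (x, y) * t)"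
  proof
    fix t :: real
    show "frechet_derivative g (at (x, y)) (t, 0) = D1 g (x, y) * t"
      using frechet_derivative_prod_expand[OF smooth_on_differentiable[OF assms], of "(t, 0)"]
      by (simp add: D1_def)
  qed
  finally show ?thesis
    unfolding has_field_derivative_def by (simp add: mult_commute_abs)
qed

lemma has_real_derivative_D2:
  assumes "smooth_on V g" "(x, y) \<in> V"
  shows "((\<lambda>t. g (x, t)) has_real_derivative D2 g (x, y)) (at y)"
proof -
  have "(g has_derivative frechet_derivative g (at (x, y))) (at (x, y))"
    using smooth_on_differentiable[OF assms] frechet_derivative_works by blast
  moreover have "((\<lambda>t. (x, t)) has_derivative (\<lambda>t. (0, t))) (at y)"
    by (intro derivative_intros)
  ultimately have "((\<lambda>t. g (x, t)) has_derivative (\<lambda>t. frechet_derivative g (at (x, y)) (0, t))) (at y)"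
    by (intro has_derivative_compose[of "\<lambda>t. (x, t)" _ y UNIV g]) auto
  also have "(\<lambda>t. frechet_derivative g (at (x, y)) (0, t)) = (\<lambda>t. D2 g (x, y) * t)"
  proof
    fix t :: real
    show "frechet_derivative g (at (x, y)) (0, t) = D2 g (x, y) * t"
      using frechet_derivative_prod_expand[OF smooth_on_differentiable[OF assms], of "(0, t)"]
      by (simp add: D2_def)
  qed
  finally show ?thesis
    unfolding has_field_derivative_def by (simp add: mult_commute_abs)
qed

text \<open>Only the germ at the origin of a phase matters, but \<open>smooth_on\<close> needs a definite open set.\<close>

definition germ_smooth :: "(real \<times> real \<Rightarrow> real) \<Rightarrow> bool" where
  "germ_smooth g \<longleftrightarrow> (\<exists>V. open V \<and> (0, 0) \<in> V \<and> smooth_on V g)"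

lemma germ_smooth_D2_iter: "germ_smooth g \<Longrightarrow> germ_smooth ((D2 ^^ k) g)"
  unfolding germ_smooth_def using smooth_on_D2_iter by blast

lemma open_contains_square:
  assumes "open V" "(0, 0) \<in> V"
  shows "\<exists>\<delta>>0. \<delta> \<le> 1 \<and> {-\<delta>..\<delta>} \<times> {-\<delta>..\<delta>} \<subseteq> (V :: (real \<times> real) set)"
proof -
  obtain e where e: "e > 0" "ball (0, 0) e \<subseteq> V"
    using assms open_contains_ball by blast
  have "{-\<delta>..\<delta>} \<times> {-\<delta>..\<delta>} \<subseteq> V" if "\<delta> = min 1 (e / 3)" for \<delta>
  proof
    fix p assume p: "p \<in> {-\<delta>..\<delta>} \<times> {-\<delta>..\<delta>}"
    obtain x y where xy: "p = (x, y)" by (cases p)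
    have "norm p \<le> norm x + norm y" unfolding xy by (rule norm_Pair_le)
    also have "\<dots> \<le> 2 * \<delta>" using p xy by (auto simp: abs_le_iff)
    also have "\<dots> < e" using that e by auto
    finally have "p \<in> ball (0, 0) e" by (simp add: dist_norm norm_minus_commute zero_prod_def[symmetric])
    then show "p \<in> V" using e by blast
  qed
  then show ?thesis using e by (intro exI[of _ "min 1 (e/3)"]) auto
qed

text \<open>One-dimensional Taylor expansion in \<open>y\<close>, followed by an expansion of each coefficient in
\<open>x\<close>. All remainders are bounded because the derivatives are continuous on a compact square.
Truncating both indices at the same \<open>K\<close> gives a remainder in \<open>|x|^K + |y|^K\<close> instead of the usual
total degree, which is just as good for the weighted limits below.\<close>

lemma taylor_bound:
  assumes "germ_smooth g"
  shows "\<exists>\<delta>>0. \<exists>A\<ge>0. \<forall>x y. \<bar>x\<bar> \<le> \<delta> \<longrightarrow> \<bar>y\<bar> \<le> \<delta> \<longrightarrow>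
    \<bar>g (x, y) - (\<Sum>k<K. \<Sum>j<K. taylor_coeff g j k * x ^ j * y ^ k)\<bar> \<le> A * (\<bar>x\<bar> ^ K + \<bar>y\<bar> ^ K)"
proof -
  obtain V where V: "open V" "(0, 0) \<in> V" "smooth_on V g"
    using assms unfolding germ_smooth_def by blast
  obtain \<delta> where \<delta>: "\<delta> > 0" "\<delta> \<le> 1" "{-\<delta>..\<delta>} \<times> {-\<delta>..\<delta>} \<subseteq> V"
    using open_contains_square[OF V(1,2)] by blast
  let ?B = "{-\<delta>..\<delta>} \<times> {-\<delta>..\<delta>}"
  have "\<exists>M. \<forall>p\<in>?B. \<bar>(D1 ^^ j) ((D2 ^^ k) g) p\<bar> \<le> M" for j k
  proof -
    have "compact ((D1 ^^ j) ((D2 ^^ k) g) ` ?B)"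
      using smooth_on_continuous_on[OF smooth_on_subset[OF smooth_on_D1_iter[OF smooth_on_D2_iter[OF V(3)]] \<delta>(3)]]
      by (intro compact_continuous_image compact_Times) auto
    then show ?thesis
      by (metis (no_types, lifting) bounded_iff compact_imp_bounded image_eqI real_norm_def)
  qed
  then obtain M where M: "\<And>j k p. p \<in> ?B \<Longrightarrow> \<bar>(D1 ^^ j) ((D2 ^^ k) g) p\<bar> \<le> M j k"
    by metis
  define A where "A = max (\<bar>M 0 K\<bar>) (\<Sum>k<K. \<bar>M K k\<bar>)"
  have A0: "A \<ge> 0" unfolding A_def by simp
  have "\<bar>g (x, y) - (\<Sum>k<K. \<Sum>j<K. taylor_coeff g j k * x ^ j * y ^ k)\<bar> \<le> A * (\<bar>x\<bar> ^ K + \<bar>y\<bar> ^ K)"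
    if x: "\<bar>x\<bar> \<le> \<delta>" and y: "\<bar>y\<bar> \<le> \<delta>" for x y
  proof -
    have inB: "(s, t) \<in> ?B" if "\<bar>s\<bar> \<le> \<bar>x\<bar>" "\<bar>t\<bar> \<le> \<bar>y\<bar>" for s t
      using that x y by auto
    have inV: "(s, t) \<in> V" if "\<bar>s\<bar> \<le> \<bar>x\<bar>" "\<bar>t\<bar> \<le> \<bar>y\<bar>" for s t
      using inB[OF that] \<delta>(3) by blast
    have "\<exists>t. \<bar>t\<bar> \<le> \<bar>y\<bar> \<and> g (x, y) = (\<Sum>k<K. (D2 ^^ k) g (x, 0) / fact k * y ^ k) + (D2 ^^ K) g (x, t) / fact K * y ^ K"
    proof (rule Maclaurin_bi_le[where diff = "\<lambda>k t. (D2 ^^ k) g (x, t)" and f = "\<lambda>t. g (x, t)"])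
      show "\<forall>m t. m < K \<and> \<bar>t\<bar> \<le> \<bar>y\<bar> \<longrightarrow> DERIV (\<lambda>t. (D2 ^^ m) g (x, t)) t :> (D2 ^^ Suc m) g (x, t)"
        using has_real_derivative_D2[OF smooth_on_D2_iter[OF V(3)]] inV by auto
    qed simp
    then obtain t where t: "\<bar>t\<bar> \<le> \<bar>y\<bar>"
      "g (x, y) = (\<Sum>k<K. (D2 ^^ k) g (x, 0) / fact k * y ^ k) + (D2 ^^ K) g (x, t) / fact K * y ^ K" by blast
    have "\<exists>s. \<bar>s\<bar> \<le> \<bar>x\<bar> \<and> (D2 ^^ k) g (x, 0) = (\<Sum>j<K. (D1 ^^ j) ((D2 ^^ k) g) (0, 0) / fact j * x ^ j)
       + (D1 ^^ K) ((D2 ^^ k) g) (s, 0) / fact K * x ^ K" for k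
    proof (rule Maclaurin_bi_le[where diff = "\<lambda>j s. (D1 ^^ j) ((D2 ^^ k) g) (s, 0)" and f = "\<lambda>s. (D2 ^^ k) g (s, 0)"])
      show "\<forall>m t. m < K \<and> \<bar>t\<bar> \<le> \<bar>x\<bar> \<longrightarrow> DERIV (\<lambda>s. (D1 ^^ m) ((D2 ^^ k) g) (s, 0)) t :> (D1 ^^ Suc m) ((D2 ^^ k) g) (t, 0)"
        using has_real_derivative_D1[OF smooth_on_D1_iter[OF smooth_on_D2_iter[OF V(3)]]] inV by auto
    qed simp
    then have "\<exists>s. \<forall>k. \<bar>s k\<bar> \<le> \<bar>x\<bar> \<and> (D2 ^^ k) g (x, 0) = (\<Sum>j<K. (D1 ^^ j) ((D2 ^^ k) g) (0, 0) / fact j * x ^ j)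
       + (D1 ^^ K) ((D2 ^^ k) g) (s k, 0) / fact K * x ^ K" by (intro choice allI)
    then obtain s where s: "\<And>k. \<bar>s k\<bar> \<le> \<bar>x\<bar>" "\<And>k. (D2 ^^ k) g (x, 0) = (\<Sum>j<K. (D1 ^^ j) ((D2 ^^ k) g) (0, 0) / fact j * x ^ j)
       + (D1 ^^ K) ((D2 ^^ k) g) (s k, 0) / fact K * x ^ K" by blast
    have e: "g (x, y) - (\<Sum>k<K. \<Sum>j<K. taylor_coeff g j k * x ^ j * y ^ k)
       = (D2 ^^ K) g (x, t) / fact K * y ^ K
         + (\<Sum>k<K. (D1 ^^ K) ((D2 ^^ k) g) (s k, 0) / fact K * x ^ K / fact k * y ^ k)"
      unfolding t(2) s(2)
      by (simp add: taylor_coeff_def partial_deriv_eq add_divide_distrib distrib_right sum.distrib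
          sum_divide_distrib sum_distrib_right)
    have "\<bar>g (x, y) - (\<Sum>k<K. \<Sum>j<K. taylor_coeff g j k * x ^ j * y ^ k)\<bar> \<le> \<bar>(D2 ^^ K) g (x, t) / fact K * y ^ K\<bar>
         + (\<Sum>k<K. \<bar>(D1 ^^ K) ((D2 ^^ k) g) (s k, 0) / fact K * x ^ K / fact k * y ^ k\<bar>)"
      unfolding e by (rule order_trans[OF abs_triangle_ineq add_left_mono[OF sum_abs]])
    also have "\<dots> \<le> \<bar>M 0 K\<bar> * \<bar>y\<bar> ^ K + (\<Sum>k<K. \<bar>M K k\<bar> * \<bar>x\<bar> ^ K)"
    proof (rule add_mono[OF _ sum_mono])
      have f0: "inverse (fact n :: real) \<le> 1" for n
        by (rule inverse_le_1_iff[THEN iffD2]) (simp add: fact_ge_1)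
      have f1: "v / fact n \<le> v" if "v \<ge> 0" for v :: real and n
        using mult_left_mono[OF f0[of n] that] by (simp only: divide_inverse mult_1_right)
      have "\<bar>(D2 ^^ K) g (x, t)\<bar> \<le> \<bar>M 0 K\<bar>"
        using M[OF inB[of x t], of 0 K] t(1) by auto
      then have 0: "\<bar>(D2 ^^ K) g (x, t)\<bar> / fact K \<le> \<bar>M 0 K\<bar>"
        using f1[of "\<bar>(D2 ^^ K) g (x, t)\<bar>" K] by linarith
      have "\<bar>(D2 ^^ K) g (x, t) / fact K * y ^ K\<bar> = \<bar>(D2 ^^ K) g (x, t)\<bar> / fact K * \<bar>y\<bar> ^ K"
        by (simp add: abs_mult power_abs)
      also have "\<dots> \<le> \<bar>M 0 K\<bar> * \<bar>y\<bar> ^ K"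
        by (rule mult_right_mono[OF 0]) simp
      finally show "\<bar>(D2 ^^ K) g (x, t) / fact K * y ^ K\<bar> \<le> \<bar>M 0 K\<bar> * \<bar>y\<bar> ^ K" .
      fix k assume "k \<in> {..<K}"
      have "\<bar>(D1 ^^ K) ((D2 ^^ k) g) (s k, 0)\<bar> \<le> \<bar>M K k\<bar>"
        using M[OF inB[of "s k" 0], of K k] s(1)[of k] by auto
      then have 1: "\<bar>(D1 ^^ K) ((D2 ^^ k) g) (s k, 0)\<bar> / fact K \<le> \<bar>M K k\<bar>"
        using f1[of "\<bar>(D1 ^^ K) ((D2 ^^ k) g) (s k, 0)\<bar>" K] by linarith
      have "\<bar>y\<bar> ^ k \<le> 1" using y \<delta>(2) by (intro power_le_one) auto
      with f1[OF zero_le_power[OF abs_ge_zero]] have 2: "\<bar>y\<bar> ^ k / fact k \<le> 1"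
        by (rule order_trans)
      have "\<bar>(D1 ^^ K) ((D2 ^^ k) g) (s k, 0) / fact K * x ^ K / fact k * y ^ k\<bar>
        = (\<bar>(D1 ^^ K) ((D2 ^^ k) g) (s k, 0)\<bar> / fact K) * \<bar>x\<bar> ^ K * (\<bar>y\<bar> ^ k / fact k)"
        by (simp add: abs_mult power_abs)
      also have "\<dots> \<le> (\<bar>M K k\<bar> * \<bar>x\<bar> ^ K) * 1"
        by (rule mult_mono[OF mult_right_mono[OF 1] 2]) simp_all
      finally show "\<bar>(D1 ^^ K) ((D2 ^^ k) g) (s k, 0) / fact K * x ^ K / fact k * y ^ k\<bar> \<le> \<bar>M K k\<bar> * \<bar>x\<bar> ^ K"
        by simp
    qed
    also have "\<dots> = \<bar>M 0 K\<bar> * \<bar>y\<bar> ^ K + (\<Sum>k<K. \<bar>M K k\<bar>) * \<bar>x\<bar> ^ K"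
      by (simp add: sum_distrib_right)
    also have "\<dots> \<le> A * \<bar>y\<bar> ^ K + A * \<bar>x\<bar> ^ K"
      unfolding A_def by (intro add_mono mult_right_mono) auto
    finally show ?thesis by (simp add: algebra_simps)
  qed
  with \<delta>(1) A0 show ?thesis by blast
qed

text \<open>The Newton polyhedron lies above the line \<open>s + m t = q\<close>.\<close>

definition weight_ge :: "(real \<times> real \<Rightarrow> real) \<Rightarrow> real \<Rightarrow> real \<Rightarrow> bool" where
  "weight_ge g m q \<longleftrightarrow> (\<forall>(j, k)\<in>taylor_support g. q \<le> real j + m * real k)"

text \<open>For a supporting line \<open>j + m k = q\<close> of the Newton polyhedron this is the weighted
homogeneous part of \<open>g\<close> on that line, evaluated at \<open>(1, z)\<close>. It is a single monomial when the line
touches the polyhedron in a vertex.\<close>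

definition edge_poly :: "(real \<times> real \<Rightarrow> real) \<Rightarrow> real \<Rightarrow> real \<Rightarrow> real poly" where
  "edge_poly g m q = (\<Sum>(j, k)\<in>{(j, k). real j + m * real k = q}. monom (taylor_coeff g j k) k)"

lemma finite_weight_le:
  assumes "m > 0"
  shows "finite {(j, k). real j + m * real k \<le> q}"
proof (rule finite_subset)
  show "{(j, k). real j + m * real k \<le> q} \<subseteq> {..nat \<lceil>q\<rceil>} \<times> {..nat \<lceil>q / m\<rceil>}"
  proof clarify
    fix j k assume a: "real j + m * real k \<le> q"
    have "m * real k \<ge> 0" using assms by simp
    then have "real j \<le> q" using a by linarith
    moreover have "real k \<le> q / m" using a assms by (simp add: field_simps)
    ultimately show "j \<in> {..nat \<lceil>q\<rceil>} \<and> k \<in> {..nat \<lceil>q / m\<rceil>}"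
      by (simp add: le_nat_iff) linarith
  qed
qed auto

lemma finite_weight_eq: "m > 0 \<Longrightarrow> finite {(j, k). real j + m * real k = q}"
  by (rule finite_subset[OF _ finite_weight_le[of m q]]) auto

lemma coeff_edge_poly:
  assumes "m > 0" "real j + m * real k = q"
  shows "coeff (edge_poly g m q) k = taylor_coeff g j k"
proof -
  have "coeff (edge_poly g m q) k = (\<Sum>(i, l)\<in>{(j, k). real j + m * real k = q}. if l = k then taylor_coeff g i l else 0)"
    unfolding edge_poly_def by (simp add: coeff_sum case_prod_beta if_distrib cong: if_cong)
  also have "\<dots> = (\<Sum>p\<in>{(j, k)}. case p of (i, l) \<Rightarrow> if l = k then taylor_coeff g i l else 0)"
    using assms by (intro sum.mono_neutral_right finite_weight_eq) (auto split: if_splits)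
  finally show ?thesis by simp
qed

lemma coeff_edge_poly_0:
  assumes "m > 0" "\<And>j. real j + m * real k = q \<Longrightarrow> taylor_coeff g j k = 0"
  shows "coeff (edge_poly g m q) k = 0"
proof -
  have "coeff (edge_poly g m q) k = (\<Sum>(i, l)\<in>{(j, k). real j + m * real k = q}. if l = k then taylor_coeff g i l else 0)"
    unfolding edge_poly_def by (simp add: coeff_sum case_prod_beta if_distrib cong: if_cong)
  also have "\<dots> = 0"
    using assms by (intro sum.neutral) auto
  finally show ?thesis .
qed

lemma coeff_edge_poly_nonzeroE:
  assumes "m > 0" "coeff (edge_poly g m q) k \<noteq> 0"
  obtains j where "real j + m * real k = q" "(j, k) \<in> taylor_support g" "coeff (edge_poly g m q) k = taylor_coeff g j k"
  using assms coeff_edge_poly_0[OF assms(1), of k q g] coeff_edge_poly[OF assms(1)] 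
  unfolding taylor_support_def by auto

lemma taylor_coeff_D2: "taylor_coeff (D2 g) j k = real (Suc k) * taylor_coeff g j (Suc k)"
proof -
  have "partial_deriv j k (D2 g) = partial_deriv j (Suc k) g"
    unfolding partial_deriv_eq by (simp add: funpow_swap1)
  then show ?thesis
    unfolding taylor_coeff_def by (simp add: divide_simps del: of_nat_Suc)
qed

lemma edge_poly_D2:
  assumes "m > 0"
  shows "edge_poly (D2 g) m (q - m) = pderiv (edge_poly g m q)"
proof (rule poly_eqI)
  fix k
  show "coeff (edge_poly (D2 g) m (q - m)) k = coeff (pderiv (edge_poly g m q)) k"
  proof (cases "\<exists>j. real j + m * real k = q - m")
    case True
    then obtain j where j: "real j + m * real k = q - m" by blast
    then have "real j + m * real (Suc k) = q" by (simp add: algebra_simps)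
    then show ?thesis
      using coeff_edge_poly[OF assms j] coeff_edge_poly[OF assms]
      by (simp add: coeff_pderiv taylor_coeff_D2)
  next
    case False
    then have "\<nexists>j. real j + m * real (Suc k) = q" by (auto simp: algebra_simps)
    then have "coeff (edge_poly g m q) (Suc k) = 0" by (intro coeff_edge_poly_0[OF assms]) blast
    moreover have "coeff (edge_poly (D2 g) m (q - m)) k = 0" using False by (intro coeff_edge_poly_0[OF assms]) blast
    ultimately show ?thesis by (simp add: coeff_pderiv)
  qed
qed

lemma weight_ge_D2:
  assumes "weight_ge g m q"
  shows "weight_ge (D2 g) m (q - m)"
  unfolding weight_ge_def
proof clarify
  fix j k assume "(j, k) \<in> taylor_support (D2 g)"
  then have "(j, Suc k) \<in> taylor_support g"
    by (simp add: taylor_support_def taylor_coeff_D2)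
  then show "q - m \<le> real j + m * real k"
    using assms unfolding weight_ge_def by (force simp: algebra_simps)
qed

lemma weight_ge_D2_iter: "weight_ge g m q \<Longrightarrow> weight_ge ((D2 ^^ N) g) m (q - m * real N)"
proof (induction N)
  case (Suc N)
  then have "weight_ge (D2 ((D2 ^^ N) g)) m (q - m * real N - m)"
    by (intro weight_ge_D2)
  then show ?case by (simp add: algebra_simps)
qed simp

lemma edge_poly_D2_iter:
  assumes "m > 0"
  shows "edge_poly ((D2 ^^ N) g) m (q - m * real N) = (pderiv ^^ N) (edge_poly g m q)"
proof (induction N)
  case (Suc N)
  have eq: "q - m * real (Suc N) = q - m * real N - m" by (simp add: algebra_simps)
  show ?case
    unfolding eq using Suc edge_poly_D2[OF assms, of "(D2 ^^ N) g" "q - m * real N"] by simp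
qed simp

lemma uniform_limit_zero_bound:
  assumes "\<forall>\<^sub>F x in F. \<forall>z\<in>S. \<bar>u x z\<bar> \<le> b x" "(b \<longlongrightarrow> 0) F"
  shows "uniform_limit S u (\<lambda>z. 0 :: real) F"
proof (rule uniform_limitI)
  fix e :: real assume "e > 0"
  then have "\<forall>\<^sub>F x in F. b x < e"
    using order_tendstoD(2)[OF assms(2)] by blast
  with assms(1) show "\<forall>\<^sub>F x in F. \<forall>z\<in>S. dist (u x z) 0 < e"
    by eventually_elim (auto simp: dist_real_def intro: le_less_trans)
qed

lemma uniform_limit_sum:
  fixes u :: "'i \<Rightarrow> 'a \<Rightarrow> 'b \<Rightarrow> real"
  assumes "\<And>i. i \<in> I \<Longrightarrow> uniform_limit S (u i) (l i) F"
  shows "uniform_limit S (\<lambda>x z. \<Sum>i\<in>I. u i x z) (\<lambda>z. \<Sum>i\<in>I. l i z) F"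
  using assms by (induction I rule: infinite_finite_induct) (auto intro: uniform_limit_add uniform_limit_const)

lemma powr_tendsto_0_at_right: "s > 0 \<Longrightarrow> ((\<lambda>x::real. x powr s) \<longlongrightarrow> 0) (at_right 0)"
  by real_asymp

text \<open>Substituting \<open>y = x^m z\<close> gives the monomial \<open>x^j y^k\<close> the size \<open>x^(j + m k)\<close>. After division by
\<open>x^q\<close> the monomials on the line survive, those above it tend to \<open>0\<close>, and the Taylor remainder of order
\<open>K > q\<close> is negligible because \<open>m \<ge> 1\<close> makes \<open>|y|\<close> at most a multiple of \<open>x\<close>.\<close>

lemma weighted_limit:
  assumes g: "germ_smooth g" and m: "m \<ge> 1" and w: "weight_ge g m q"
  shows "uniform_limit {-B..B} (\<lambda>x z. g (x, x powr m * z) / x powr q) (poly (edge_poly g m q)) (at_right 0)"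
proof -
  \<comment> \<open>Beyond order \<open>q\<close> in both variables the Taylor remainder is \<open>o(x^q)\<close>.\<close>
  define K where "K = nat \<lceil>\<bar>q\<bar>\<rceil> + 1"
  have K: "real K > q" "K > 0" unfolding K_def by linarith+
  define B' where "B' = \<bar>B\<bar>"
  obtain \<delta> A where A: "\<delta> > 0" "A \<ge> 0" "\<And>x y. \<bar>x\<bar> \<le> \<delta> \<Longrightarrow> \<bar>y\<bar> \<le> \<delta> \<Longrightarrow>
    \<bar>g (x, y) - (\<Sum>k<K. \<Sum>j<K. taylor_coeff g j k * x ^ j * y ^ k)\<bar> \<le> A * (\<bar>x\<bar> ^ K + \<bar>y\<bar> ^ K)"
    using taylor_bound[OF g, of K] by blast
  define T where "T = (\<lambda>x z. \<Sum>k<K. \<Sum>j<K. taylor_coeff g j k * x powr (real j + m * real k - q) * z ^ k)"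
  define L where "L = (\<lambda>z::real. \<Sum>k<K. \<Sum>j<K. if real j + m * real k = q then taylor_coeff g j k * z ^ k else 0)"
  have ev: "\<forall>\<^sub>F x in at_right 0. 0 < x \<and> x < c" if "c > 0" for c :: real
    using that eventually_at_right_real by (auto simp: eventually_conj_iff eventually_at_right_less greaterThanLessThan_iff)
  have tm: "uniform_limit {-B..B} (\<lambda>x z. taylor_coeff g j k * x powr (real j + m * real k - q) * z ^ k)
       (\<lambda>z. if real j + m * real k = q then taylor_coeff g j k * z ^ k else 0) (at_right 0)" for j k
  proof -
    let ?s = "real j + m * real k - q"
    consider "?s = 0" | "taylor_coeff g j k = 0" | "?s > 0"
      using w unfolding weight_ge_def taylor_support_def by fastforce
    then show "uniform_limit {-B..B} (\<lambda>x z. taylor_coeff g j k * x powr ?s * z ^ k)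
       (\<lambda>z. if real j + m * real k = q then taylor_coeff g j k * z ^ k else 0) (at_right 0)"
    proof cases
      case 1
      then have e: "real j + m * real k = q" by simp
      have "\<forall>\<^sub>F x in at_right 0. \<forall>z\<in>{-B..B}. taylor_coeff g j k * z ^ k = taylor_coeff g j k * x powr ?s * z ^ k"
        using ev[of 1, OF zero_less_one] by eventually_elim (simp add: 1)
      moreover have "uniform_limit {-B..B} (\<lambda>x z. taylor_coeff g j k * z ^ k) (\<lambda>z. taylor_coeff g j k * z ^ k) (at_right (0::real))"
        by (rule uniform_limit_const)
      ultimately show ?thesis
        unfolding e by (subst uniform_limit_cong[symmetric]) auto
    next
      case 2
      show ?thesis unfolding 2 by (simp add: uniform_limit_const cong: if_cong)
    next
      case 3
      then have ne: "real j + m * real k \<noteq> q" by simp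
      have "uniform_limit {-B..B} (\<lambda>x z. taylor_coeff g j k * x powr ?s * z ^ k) (\<lambda>z. 0) (at_right 0)"
      proof (rule uniform_limit_zero_bound)
        show "\<forall>\<^sub>F x in at_right 0. \<forall>z\<in>{-B..B}. \<bar>taylor_coeff g j k * x powr ?s * z ^ k\<bar> \<le> \<bar>taylor_coeff g j k\<bar> * B' ^ k * x powr ?s"
        proof (intro always_eventually allI ballI)
          fix x z assume z: "z \<in> {-B..B}"
          have "\<bar>z\<bar> ^ k \<le> B' ^ k" using z by (intro power_mono) (auto simp: B'_def)
          then have "\<bar>z\<bar> ^ k * x powr ?s \<le> B' ^ k * x powr ?s"
            by (rule mult_right_mono) simp
          then show "\<bar>taylor_coeff g j k * x powr ?s * z ^ k\<bar> \<le> \<bar>taylor_coeff g j k\<bar> * B' ^ k * x powr ?s"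
            by (simp add: abs_mult power_abs mult.assoc mult_left_mono mult.commute[of "x powr _"])
        qed
        show "((\<lambda>x. \<bar>taylor_coeff g j k\<bar> * B' ^ k * x powr ?s) \<longlongrightarrow> 0) (at_right 0)"
          using tendsto_mult_right_zero[OF powr_tendsto_0_at_right[OF 3]] by blast
      qed
      then show ?thesis using ne by simp
    qed
  qed
  have 1: "uniform_limit {-B..B} T L (at_right 0)"
    unfolding T_def L_def by (rule uniform_limit_sum, rule uniform_limit_sum, rule tm)
  have 2: "uniform_limit {-B..B} (\<lambda>x z. g (x, x powr m * z) / x powr q - T x z) (\<lambda>z. 0) (at_right 0)"
  proof (rule uniform_limit_zero_bound)
    define c where "c = min 1 (min \<delta> (\<delta> / (1 + B')))"
    have c: "c > 0" using A(1) by (auto simp: c_def B'_def)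
    show "((\<lambda>x. A * (1 + B' ^ K) * x powr (real K - q)) \<longlongrightarrow> 0) (at_right 0)"
      using tendsto_mult_right_zero[OF powr_tendsto_0_at_right, of "real K - q"] K by auto
    show "\<forall>\<^sub>F x in at_right 0. \<forall>z\<in>{-B..B}. \<bar>g (x, x powr m * z) / x powr q - T x z\<bar> \<le> A * (1 + B' ^ K) * x powr (real K - q)"
      using ev[OF c]
    proof eventually_elim
      case (elim x)
      show ?case
      proof
        fix z assume z: "z \<in> {-B..B}"
        let ?y = "x powr m * z"
        have x: "0 < x" "x < 1" "x \<le> \<delta>" "x * (1 + B') \<le> \<delta>"
          using elim by (auto simp: c_def B'_def field_simps)
        have "x powr m \<le> x powr 1" using x m by (intro powr_mono') auto
        then have xm: "x powr m \<le> x" using x by simp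
        have "\<bar>?y\<bar> = x powr m * \<bar>z\<bar>" by (simp add: abs_mult)
        also have "\<dots> \<le> x * B'" using xm z x by (intro mult_mono) (auto simp: B'_def)
        finally have y: "\<bar>?y\<bar> \<le> x * B'" .
        then have y': "\<bar>?y\<bar> \<le> \<delta>" using x by (simp add: algebra_simps)
        have "\<bar>?y\<bar> ^ K \<le> x ^ K * B' ^ K"
          using power_mono[OF y, of K] by (simp add: power_mult_distrib)
        then have b: "A * (\<bar>x\<bar> ^ K + \<bar>?y\<bar> ^ K) \<le> A * (x ^ K + x ^ K * B' ^ K)"
          using A(2) x by (intro mult_left_mono) auto
        have t: "taylor_coeff g j k * x ^ j * ?y ^ k / x powr q = taylor_coeff g j k * x powr (real j + m * real k - q) * z ^ k" for j k
        proof -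
          have "(x powr m) ^ k = x powr (m * real k)" using x by (simp add: powr_powr flip: powr_realpow)
          then show ?thesis
            using x by (simp add: powr_diff powr_add powr_realpow power_mult_distrib)
        qed
        have "T x z = (\<Sum>k<K. \<Sum>j<K. taylor_coeff g j k * x ^ j * ?y ^ k) / x powr q"
          unfolding T_def sum_divide_distrib t ..
        then have "\<bar>g (x, ?y) / x powr q - T x z\<bar> = \<bar>g (x, ?y) - (\<Sum>k<K. \<Sum>j<K. taylor_coeff g j k * x ^ j * ?y ^ k)\<bar> / x powr q"
          by (simp add: diff_divide_distrib[symmetric])
        also have "\<dots> \<le> A * (x ^ K + x ^ K * B' ^ K) / x powr q"
          using A(3)[of x ?y] x y' b by (intro divide_right_mono) auto
        also have "\<dots> = A * (1 + B' ^ K) * x powr (real K - q)"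
          using x by (simp add: powr_diff powr_realpow algebra_simps)
        finally show "\<bar>g (x, ?y) / x powr q - T x z\<bar> \<le> A * (1 + B' ^ K) * x powr (real K - q)" .
      qed
    qed
  qed
  have "L z = poly (edge_poly g m q) z" for z
  proof -
    have sub: "{(j, k). real j + m * real k = q} \<subseteq> {..<K} \<times> {..<K}"
    proof (rule subrelI)
      fix j k assume "(j, k) \<in> {(j, k). real j + m * real k = q}"
      then have e: "real j + m * real k = q" by simp
      have "real k \<le> m * real k" using m by (simp add: mult_le_cancel_right1)
      moreover have "0 \<le> m * real k" using m by simp
      ultimately have "real j < real K" "real k < real K" using e K by linarith+
      then show "(j, k) \<in> {..<K} \<times> {..<K}" by simp
    qed
    have "poly (edge_poly g m q) z = (\<Sum>(j, k)\<in>{(j, k). real j + m * real k = q}. taylor_coeff g j k * z ^ k)"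
      unfolding edge_poly_def by (simp add: poly_sum poly_monom case_prod_beta)
    also have "\<dots> = (\<Sum>(j, k)\<in>{..<K} \<times> {..<K}. if real j + m * real k = q then taylor_coeff g j k * z ^ k else 0)"
      using sub by (intro sum.mono_neutral_cong_left) auto
    also have "\<dots> = L z"
      unfolding L_def by (subst sum.swap) (simp add: sum.cartesian_product)
    finally show ?thesis by simp
  qed
  then have "L = poly (edge_poly g m q)" by blast
  with uniform_limit_add[OF 1 2] show ?thesis by simp
qed

section \<open>Sublevel sets of functions with a large derivative\<close>

lemma growth_of_deriv_ge:
  fixes g :: "real \<Rightarrow> real"
  assumes d: "\<And>y. y \<in> {a..b} \<Longrightarrow> (g has_real_derivative g' y) (at y within {a..b})"
    and g': "\<And>y. y \<in> {a..b} \<Longrightarrow> c \<le> g' y" and uv: "a \<le> u" "u \<le> v" "v \<le> b"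
  shows "c * (v - u) \<le> g v - g u"
proof -
  have "\<exists>z\<in>{u..v}. g v - g u = (\<lambda>t. g' z * t) (v - u)"
  proof (rule mvt_very_simple[OF uv(2)])
    fix x assume "u \<le> x" "x \<le> v"
    then have "(g has_real_derivative g' x) (at x within {u..v})"
      using uv by (intro DERIV_subset[OF d]) auto
    then show "(g has_derivative (\<lambda>t. g' x * t)) (at x within {u..v})"
      by (simp add: has_field_derivative_def)
  qed
  then obtain z where z: "z \<in> {u..v}" "g v - g u = g' z * (v - u)" by blast
  show ?thesis
    unfolding z(2) using uv z(1) by (intro mult_right_mono g') auto
qed

text \<open>Van der Corput's sublevel estimate, by induction on the number of derivatives. The family
\<open>g 0, g 1, ...\<close> stands for a function with its successive derivatives. Since \<open>g (Suc n)\<close> grows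
at rate at least \<open>c\<close>, it is smaller than \<open>c t\<close> in modulus only on an interval of length
\<open>4 t\<close>; off that interval the induction hypothesis applies with \<open>c t\<close> in place of \<open>c\<close>, and the choice
\<open>t = (\<epsilon>/c)^(1/(n+2))\<close> balances the two contributions. The constant depends on \<open>n\<close> only, so
that it is uniform over the vertical sections to which the estimate is applied.\<close>

lemma van_der_corput_pos:
  "\<exists>C>0. \<forall>(g :: nat \<Rightarrow> real \<Rightarrow> real) a b c \<epsilon>. 0 < c \<longrightarrow> 0 < \<epsilon> \<longrightarrow>
     (\<forall>i\<le>n. \<forall>y\<in>{a..b}. (g i has_real_derivative g (Suc i) y) (at y within {a..b})) \<longrightarrow>
     (\<forall>y\<in>{a..b}. c \<le> g (Suc n) y) \<longrightarrow>
     emeasure lborel {y\<in>{a..b}. \<bar>g 0 y\<bar> \<le> \<epsilon>} \<le> ennreal (C * (\<epsilon> / c) powr (1 / real (Suc n)))"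
proof (induction n)
  case 0
  have "emeasure lborel {y\<in>{a..b}. \<bar>g 0 y\<bar> \<le> \<epsilon>} \<le> ennreal (4 * (\<epsilon> / c) powr (1 / real (Suc 0)))"
    if c: "0 < c" and e: "0 < \<epsilon>"
      and d: "\<forall>i\<le>0. \<forall>y\<in>{a..b}. (g i has_real_derivative g (Suc i) y) (at y within {a..b})"
      and g: "\<forall>y\<in>{a..b}. c \<le> g (Suc 0) y"
    for g :: "nat \<Rightarrow> real \<Rightarrow> real" and a b c \<epsilon>
  proof (cases "\<exists>x\<in>{a..b}. \<bar>g 0 x\<bar> \<le> \<epsilon>")
    case True
    then obtain x where x: "x \<in> {a..b}" "\<bar>g 0 x\<bar> \<le> \<epsilon>" by blast
    have grow: "c * (v - u) \<le> g 0 v - g 0 u" if "a \<le> u" "u \<le> v" "v \<le> b" for u v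
      using growth_of_deriv_ge[of a b "g 0" "g (Suc 0)" c u v] d g that by auto
    have "{y\<in>{a..b}. \<bar>g 0 y\<bar> \<le> \<epsilon>} \<subseteq> {x - 2 * (\<epsilon> / c)..x + 2 * (\<epsilon> / c)}"
    proof
      fix y assume "y \<in> {y\<in>{a..b}. \<bar>g 0 y\<bar> \<le> \<epsilon>}"
      then have y: "y \<in> {a..b}" "\<bar>g 0 y\<bar> \<le> \<epsilon>" by auto
      have "c * \<bar>y - x\<bar> \<le> 2 * \<epsilon>"
        using grow[of x y] grow[of y x] x y by (cases "x \<le> y") (auto simp: abs_le_iff)
      then have "\<bar>y - x\<bar> \<le> 2 * (\<epsilon> / c)" using c by (simp add: field_simps)
      then show "y \<in> {x - 2 * (\<epsilon> / c)..x + 2 * (\<epsilon> / c)}" by auto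
    qed
    then have "emeasure lborel {y\<in>{a..b}. \<bar>g 0 y\<bar> \<le> \<epsilon>} \<le> emeasure lborel {x - 2 * (\<epsilon> / c)..x + 2 * (\<epsilon> / c)}"
      by (rule emeasure_mono) simp
    also have "\<dots> = ennreal (4 * (\<epsilon> / c))" using c e by simp
    finally show ?thesis using c e by simp
  next
    case False
    then have *: "{y\<in>{a..b}. \<bar>g 0 y\<bar> \<le> \<epsilon>} = {}" by blast
    show ?thesis unfolding * by simp
  qed
  then show ?case by (intro exI[of _ 4]) auto
next
  case (Suc n)
  then obtain C where C: "C > 0" and C': "\<forall>(g :: nat \<Rightarrow> real \<Rightarrow> real) a b c \<epsilon>. 0 < c \<longrightarrow> 0 < \<epsilon> \<longrightarrow>
     (\<forall>i\<le>n. \<forall>y\<in>{a..b}. (g i has_real_derivative g (Suc i) y) (at y within {a..b})) \<longrightarrow>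
     (\<forall>y\<in>{a..b}. c \<le> g (Suc n) y) \<longrightarrow>
     emeasure lborel {y\<in>{a..b}. \<bar>g 0 y\<bar> \<le> \<epsilon>} \<le> ennreal (C * (\<epsilon> / c) powr (1 / real (Suc n)))"
    by (elim exE conjE)
  note IH = C'[rule_format]
  have "emeasure lborel {y\<in>{a..b}. \<bar>g 0 y\<bar> \<le> \<epsilon>} \<le> ennreal ((4 + 2 * C) * (\<epsilon> / c) powr (1 / real (Suc (Suc n))))"
    if c: "0 < c" and e: "0 < \<epsilon>"
      and d: "\<forall>i\<le>Suc n. \<forall>y\<in>{a..b}. (g i has_real_derivative g (Suc i) y) (at y within {a..b})"
      and g: "\<forall>y\<in>{a..b}. c \<le> g (Suc (Suc n)) y"
    for g :: "nat \<Rightarrow> real \<Rightarrow> real" and a b c \<epsilon>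
  proof -
    define t where "t = (\<epsilon> / c) powr (1 / real (Suc (Suc n)))"
    have t: "t > 0" "t ^ Suc (Suc n) = \<epsilon> / c"
    proof -
      show "t > 0" using c e by (simp add: t_def)
      have "t ^ Suc (Suc n) = t powr real (Suc (Suc n))" using \<open>t > 0\<close> by (simp only: powr_realpow)
      also have "\<dots> = \<epsilon> / c" using c e by (simp add: t_def powr_powr del: of_nat_Suc)
      finally show "t ^ Suc (Suc n) = \<epsilon> / c" .
    qed
    have \<delta>: "c * t > 0" using c t by simp
    have scale: "(\<epsilon> / (c * t)) powr (1 / real (Suc n)) = t"
    proof -
      have "\<epsilon> / (c * t) = t ^ Suc n" using t c by (simp add: field_simps)
      also have "\<dots> = t powr real (Suc n)" using t by (simp only: powr_realpow)
      finally show ?thesis using t by (simp add: powr_powr del: of_nat_Suc)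
    qed
    have grow: "c * (v - u) \<le> g (Suc n) v - g (Suc n) u" if "a \<le> u" "u \<le> v" "v \<le> b" for u v
      using growth_of_deriv_ge[of a b "g (Suc n)" "g (Suc (Suc n))" c u v] d g that by auto
    have part: "emeasure lborel {y\<in>{u..v}. \<bar>g 0 y\<bar> \<le> \<epsilon>} \<le> ennreal (C * t)"
      if uv: "a \<le> u" "v \<le> b" and s: "(\<forall>y\<in>{u..v}. c * t \<le> g (Suc n) y) \<or> (\<forall>y\<in>{u..v}. g (Suc n) y \<le> - (c * t))" for u v
    proof -
      have d': "(g i has_real_derivative g (Suc i) y) (at y within {u..v})" if "i \<le> n" "y \<in> {u..v}" for i y
        by (rule DERIV_subset[of _ _ _ "{a..b}"]) (use d that uv in auto)
      from s show ?thesis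
      proof
        assume "\<forall>y\<in>{u..v}. c * t \<le> g (Suc n) y"
        then show ?thesis
          using IH[where g = g and a = u and b = v and c = "c * t" and \<epsilon> = \<epsilon>] \<delta> e d' unfolding scale by simp
      next
        assume "\<forall>y\<in>{u..v}. g (Suc n) y \<le> - (c * t)"
        then have "c * t \<le> - g (Suc n) y" if "y \<in> {u..v}" for y using that by force
        moreover have "((\<lambda>y. - g i y) has_real_derivative - g (Suc i) y) (at y within {u..v})" if "i \<le> n" "y \<in> {u..v}" for i y
          using d'[OF that] by (rule DERIV_minus)
        ultimately show ?thesis
          using IH[where g = "\<lambda>i y. - g i y" and a = u and b = v and c = "c * t" and \<epsilon> = \<epsilon>] \<delta> e unfolding scale by simp
      qed
    qed
    have cont: "continuous_on {a..b} (g 0)"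
      by (rule DERIV_continuous_on[of _ _ "g (Suc 0)"]) (use d in auto)
    have meas: "{y\<in>{u..v}. \<bar>g 0 y\<bar> \<le> \<epsilon>} \<in> sets lborel" if "a \<le> u" "v \<le> b" for u v
    proof -
      have "continuous_on {u..v} (\<lambda>y. \<bar>g 0 y\<bar>)"
        using that by (intro continuous_on_rabs continuous_on_subset[OF cont]) auto
      then have "closed ({u..v} \<inter> (\<lambda>y. \<bar>g 0 y\<bar>) -` {..\<epsilon>})"
        by (intro continuous_closed_preimage) auto
      moreover have "{u..v} \<inter> (\<lambda>y. \<bar>g 0 y\<bar>) -` {..\<epsilon>} = {y\<in>{u..v}. \<bar>g 0 y\<bar> \<le> \<epsilon>}" by auto
      ultimately show ?thesis by (metis borel_closed sets_lborel)
    qed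
    show ?thesis
    proof (cases "\<exists>x\<in>{a..b}. \<bar>g (Suc n) x\<bar> \<le> c * t")
      case True
      then obtain x where x: "x \<in> {a..b}" "\<bar>g (Suc n) x\<bar> \<le> c * t" by blast
      let ?L = "{y\<in>{a..min b (x - 2 * t)}. \<bar>g 0 y\<bar> \<le> \<epsilon>}"
      let ?R = "{y\<in>{max a (x + 2 * t)..b}. \<bar>g 0 y\<bar> \<le> \<epsilon>}"
      let ?M = "{x - 2 * t..x + 2 * t}"
      have L: "emeasure lborel ?L \<le> ennreal (C * t)"
      proof (intro part disjI2 ballI)
        fix y assume y: "y \<in> {a..min b (x - 2 * t)}"
        have "c * (2 * t) \<le> c * (x - y)" using y c by (intro mult_left_mono) auto
        then show "g (Suc n) y \<le> - (c * t)" using grow[of y x] x y t by auto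
      qed auto
      have R: "emeasure lborel ?R \<le> ennreal (C * t)"
      proof (intro part disjI1 ballI)
        fix y assume y: "y \<in> {max a (x + 2 * t)..b}"
        have "c * (2 * t) \<le> c * (y - x)" using y c by (intro mult_left_mono) auto
        then show "c * t \<le> g (Suc n) y" using grow[of x y] x y t by auto
      qed auto
      have sub: "{y\<in>{a..b}. \<bar>g 0 y\<bar> \<le> \<epsilon>} \<subseteq> ?L \<union> ?M \<union> ?R" by auto
      have mL: "?L \<in> sets lborel" and mR: "?R \<in> sets lborel" by (rule meas; simp)+
      have "emeasure lborel {y\<in>{a..b}. \<bar>g 0 y\<bar> \<le> \<epsilon>} \<le> emeasure lborel (?L \<union> ?M \<union> ?R)"
        by (rule emeasure_mono[OF sub]) (intro sets.Un mL mR, simp)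
      also have "\<dots> \<le> emeasure lborel ?L + emeasure lborel ?M + emeasure lborel ?R"
        by (rule order_trans[OF emeasure_subadditive[OF sets.Un[OF mL] mR] add_right_mono[OF emeasure_subadditive[OF mL]]]) simp_all
      also have "\<dots> \<le> ennreal (C * t) + ennreal (4 * t) + ennreal (C * t)"
        using t by (intro add_mono L R) simp
      also have "\<dots> = ennreal ((4 + 2 * C) * t)"
        using C t by (simp add: algebra_simps flip: ennreal_plus)
      finally show ?thesis unfolding t_def .
    next
      case False
      have "(\<forall>y\<in>{a..b}. c * t \<le> g (Suc n) y) \<or> (\<forall>y\<in>{a..b}. g (Suc n) y \<le> - (c * t))"
      proof (rule ccontr)
        assume "\<not> ?thesis"
        then obtain u v where uv: "u \<in> {a..b}" "v \<in> {a..b}" "g (Suc n) u < c * t" "g (Suc n) v > - (c * t)"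
          by (auto simp: not_le)
        moreover have "\<not> \<bar>g (Suc n) u\<bar> \<le> c * t" "\<not> \<bar>g (Suc n) v\<bar> \<le> c * t" using False uv(1,2) by blast+
        ultimately have "g (Suc n) u \<le> 0" "g (Suc n) v \<ge> 0" by linarith+
        moreover have "continuous_on {a..b} (g (Suc n))"
          by (rule DERIV_continuous_on[of _ _ "g (Suc (Suc n))"]) (use d in auto)
        then have "connected (g (Suc n) ` {a..b})"
          by (intro connected_continuous_image) auto
        ultimately have "0 \<in> g (Suc n) ` {a..b}"
          using uv connected_contains_Icc[of "g (Suc n) ` {a..b}" "g (Suc n) u" "g (Suc n) v"] by auto
        then obtain w where "w \<in> {a..b}" "g (Suc n) w = 0" by force
        then have "\<bar>g (Suc n) w\<bar> \<le> c * t" using \<delta> by simp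
        then show False using False \<open>w \<in> {a..b}\<close> by blast
      qed
      from part[OF order_refl order_refl this]
      have "emeasure lborel {y\<in>{a..b}. \<bar>g 0 y\<bar> \<le> \<epsilon>} \<le> ennreal (C * t)" .
      also have "\<dots> \<le> ennreal ((4 + 2 * C) * t)"
        using C t by (intro ennreal_leI mult_right_mono) auto
      finally show ?thesis unfolding t_def .
    qed
  qed
  then show ?case using C by (intro exI[of _ "4 + 2 * C"]) auto
qed

section \<open>Weights and the Newton distance\<close>

lemma weighted_limit_pointwise:
  assumes "germ_smooth g" "m \<ge> 1" "weight_ge g m q"
  shows "((\<lambda>x. g (x, x powr m * z) / x powr q) \<longlongrightarrow> poly (edge_poly g m q) z) (at_right 0)"
  by (rule tendsto_uniform_limitI[OF weighted_limit[OF assms, of "\<bar>z\<bar>"]]) auto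

text \<open>Converse of \<open>weighted_limit\<close>: were there support points below the line, the lowest
parallel line through one of them would have an edge polynomial which vanishes on \<open>[-1,1]\<close>
and hence identically.\<close>

lemma weight_ge_if_limit:
  assumes g: "germ_smooth g" and m: "m \<ge> 1"
    and lim: "\<And>z. z \<in> {-1..1} \<Longrightarrow> ((\<lambda>x. g (x, x powr m * z) / x powr q) \<longlongrightarrow> l z) (at_right 0)"
  shows "weight_ge g m q"
proof (rule ccontr)
  assume no: "\<not> weight_ge g m q"
  define S where "S = (\<lambda>(j, k). real j + m * real k) ` {(j, k). (j, k) \<in> taylor_support g \<and> real j + m * real k < q}"
  have "finite {(j, k). (j, k) \<in> taylor_support g \<and> real j + m * real k < q}"
    by (rule finite_subset[OF _ finite_weight_le[of m q]]) (use m in auto)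
  then have fin: "finite S" unfolding S_def by (rule finite_imageI)
  obtain j1 k1 where "(j1, k1) \<in> taylor_support g" "real j1 + m * real k1 < q"
    using no unfolding weight_ge_def by (force simp: not_le)
  then have ne: "S \<noteq> {}" unfolding S_def by blast
  define q0 where "q0 = Min S"
  have "q0 \<in> S" unfolding q0_def by (rule Min_in[OF fin ne])
  then obtain j0 k0 where jk: "(j0, k0) \<in> taylor_support g" "real j0 + m * real k0 = q0" "q0 < q"
    unfolding S_def by auto
  have w: "weight_ge g m q0"
    unfolding weight_ge_def
  proof clarify
    fix j k assume jk': "(j, k) \<in> taylor_support g"
    show "q0 \<le> real j + m * real k"
    proof (cases "real j + m * real k < q")
      case True
      then have "real j + m * real k \<in> S" using jk' unfolding S_def by force
      then show ?thesis unfolding q0_def by (rule Min_le[OF fin])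
    qed (use jk in auto)
  qed
  have z: "poly (edge_poly g m q0) z = 0" if "z \<in> {-1..1}" for z
  proof -
    have "((\<lambda>x. g (x, x powr m * z) / x powr q * x powr (q - q0)) \<longlongrightarrow> l z * 0) (at_right 0)"
      by (intro tendsto_mult lim that powr_tendsto_0_at_right) (use jk in simp)
    moreover have "\<forall>\<^sub>F x in at_right 0. g (x, x powr m * z) / x powr q * x powr (q - q0) = g (x, x powr m * z) / x powr q0"
      using eventually_at_right_less[of "0::real"] by eventually_elim (simp add: powr_diff)
    ultimately have "((\<lambda>x. g (x, x powr m * z) / x powr q0) \<longlongrightarrow> 0) (at_right 0)"
      by (simp add: tendsto_cong)
    then show ?thesis
      using tendsto_unique[OF trivial_limit_at_right_real] weighted_limit_pointwise[OF g m w, of z] by blast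
  qed
  have "edge_poly g m q0 = 0"
  proof (rule ccontr)
    assume "edge_poly g m q0 \<noteq> 0"
    then have "finite {x. poly (edge_poly g m q0) x = 0}" by (rule poly_roots_finite)
    then have "finite {-1..1::real}" by (rule finite_subset[rotated]) (use z in auto)
    then show False using infinite_Icc[of "-1" "1::real"] by simp
  qed
  then show False using coeff_edge_poly[of m j0 k0 q0 g] jk m by (simp add: taylor_support_def)
qed

text \<open>Edge polynomials are determined by asymptotics. This computes them after a change of
coordinates without any manipulation of Taylor coefficients.\<close>

lemma edge_poly_unique:
  assumes g: "germ_smooth g" and m: "m \<ge> 1"
    and lim: "\<And>z. z \<in> {-1..1} \<Longrightarrow> ((\<lambda>x. g (x, x powr m * z) / x powr q) \<longlongrightarrow> poly P z) (at_right 0)"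
  shows "weight_ge g m q" "edge_poly g m q = P"
proof -
  show w: "weight_ge g m q" by (rule weight_ge_if_limit[OF assms])
  have z: "poly (edge_poly g m q - P) z = 0" if "z \<in> {-1..1}" for z
    using tendsto_unique[OF trivial_limit_at_right_real weighted_limit_pointwise[OF g m w, of z] lim[OF that]] by simp
  show "edge_poly g m q = P"
  proof (rule ccontr)
    assume "edge_poly g m q \<noteq> P"
    then have "finite {x. poly (edge_poly g m q - P) x = 0}" by (intro poly_roots_finite) simp
    then have "finite {-1..1::real}" by (rule finite_subset[rotated]) (use z in auto)
    then show False using infinite_Icc[of "-1" "1::real"] by simp
  qed
qed

lemma bound_of_order:
  assumes g: "germ_smooth g" and w: "weight_ge g 1 (real n)"
  shows "\<exists>\<delta>>0. \<exists>A\<ge>0. \<forall>x y. \<bar>x\<bar> \<le> \<delta> \<longrightarrow> \<bar>y\<bar> \<le> \<delta> \<longrightarrow> \<bar>g (x, y)\<bar> \<le> A * max \<bar>x\<bar> \<bar>y\<bar> ^ n"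
proof -
  obtain \<delta> A where A: "\<delta> > 0" "A \<ge> 0" "\<And>x y. \<bar>x\<bar> \<le> \<delta> \<Longrightarrow> \<bar>y\<bar> \<le> \<delta> \<Longrightarrow>
    \<bar>g (x, y) - (\<Sum>k<n. \<Sum>j<n. taylor_coeff g j k * x ^ j * y ^ k)\<bar> \<le> A * (\<bar>x\<bar> ^ n + \<bar>y\<bar> ^ n)"
    using taylor_bound[OF g, of n] by blast
  define B where "B = (\<Sum>k<n. \<Sum>j<n. \<bar>taylor_coeff g j k\<bar>)"
  have B0: "B \<ge> 0" unfolding B_def by (intro sum_nonneg) simp
  have "\<bar>g (x, y)\<bar> \<le> (2 * A + B) * max \<bar>x\<bar> \<bar>y\<bar> ^ n" if x: "\<bar>x\<bar> \<le> min 1 \<delta>" and y: "\<bar>y\<bar> \<le> min 1 \<delta>" for x y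
  proof -
    define M where "M = max \<bar>x\<bar> \<bar>y\<bar>"
    have M: "\<bar>x\<bar> \<le> M" "\<bar>y\<bar> \<le> M" "M \<le> 1" "0 \<le> M" using x y by (auto simp: M_def)
    have t: "\<bar>taylor_coeff g j k * x ^ j * y ^ k\<bar> \<le> \<bar>taylor_coeff g j k\<bar> * M ^ n" for j k
    proof (cases "taylor_coeff g j k = 0")
      case False
      then have "real n \<le> real j + real k" using w unfolding weight_ge_def taylor_support_def by auto
      then have le: "n \<le> j + k" by linarith
      have "\<bar>x\<bar> ^ j * \<bar>y\<bar> ^ k \<le> M ^ j * M ^ k" using M by (intro mult_mono power_mono) auto
      also have "\<dots> \<le> M ^ n" unfolding power_add[symmetric] using M le by (intro power_decreasing) auto
      finally have "\<bar>taylor_coeff g j k\<bar> * (\<bar>x\<bar> ^ j * \<bar>y\<bar> ^ k) \<le> \<bar>taylor_coeff g j k\<bar> * M ^ n"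
        by (rule mult_left_mono) simp
      then show ?thesis by (simp only: abs_mult power_abs mult.assoc)
    qed simp
    have s: "\<bar>\<Sum>k<n. \<Sum>j<n. taylor_coeff g j k * x ^ j * y ^ k\<bar> \<le> B * M ^ n"
    proof -
      have "\<bar>\<Sum>k<n. \<Sum>j<n. taylor_coeff g j k * x ^ j * y ^ k\<bar> \<le> (\<Sum>k<n. \<Sum>j<n. \<bar>taylor_coeff g j k\<bar> * M ^ n)"
        by (rule order_trans[OF sum_abs sum_mono], rule order_trans[OF sum_abs sum_mono], rule t)
      also have "\<dots> = B * M ^ n" by (simp only: B_def sum_distrib_right)
      finally show ?thesis .
    qed
    have "A * (\<bar>x\<bar> ^ n + \<bar>y\<bar> ^ n) \<le> A * (M ^ n + M ^ n)"
      using M A by (intro mult_left_mono add_mono power_mono) auto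
    then have "\<bar>g (x, y)\<bar> \<le> B * M ^ n + A * (M ^ n + M ^ n)"
      using A(3)[of x y] s x y by linarith
    then show ?thesis unfolding M_def[symmetric] by (simp add: algebra_simps)
  qed
  then show ?thesis using A B0 by (intro exI[of _ "min 1 \<delta>"] conjI exI[of _ "2 * A + B"]) auto
qed

lemma newton_polyhedron_upward:
  assumes "(a, b) \<in> newton_polyhedron g" "a \<le> s" "b \<le> t"
  shows "(s, t) \<in> newton_polyhedron g"
proof -
  let ?U = "\<Union>(j, k)\<in>taylor_support g. {(s, t). real j \<le> s \<and> real k \<le> t}"
  let ?v = "(s - a, t - b)"
  have "(\<lambda>p. ?v + p) ` ?U \<subseteq> ?U"
    using assms by (fastforce simp: image_iff)
  then have "convex hull ((\<lambda>p. ?v + p) ` ?U) \<subseteq> convex hull ?U" by (rule hull_mono)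
  then have "(\<lambda>p. ?v + p) ` (convex hull ?U) \<subseteq> convex hull ?U"
    by (simp only: convex_hull_translation)
  then have "?v + (a, b) \<in> convex hull ?U"
    using assms(1) unfolding newton_polyhedron_def by blast
  then show ?thesis unfolding newton_polyhedron_def by simp
qed

lemma newton_polyhedron_weight:
  assumes "m \<ge> 0" "weight_ge g m q" "(s, t) \<in> newton_polyhedron g"
  shows "q \<le> s + m * t"
proof -
  let ?H = "{p. q \<le> (1, m) \<bullet> p} :: (real \<times> real) set"
  have "newton_polyhedron g \<subseteq> ?H"
    unfolding newton_polyhedron_def
  proof (rule hull_minimal)
    show "convex ?H" using convex_halfspace_ge[of q "(1, m)"] by (simp add: inner_commute)
    show "(\<Union>(j, k)\<in>taylor_support g. {(s, t). real j \<le> s \<and> real k \<le> t}) \<subseteq> ?H"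
    proof clarsimp
      fix j k s t assume "(j, k) \<in> taylor_support g" and a: "real j \<le> s" "real k \<le> t"
      then have "q \<le> real j + m * real k" using assms(2) unfolding weight_ge_def by auto
      also have "\<dots> \<le> s + m * t" using a assms(1) by (intro add_mono mult_left_mono) auto
      finally show "q \<le> s + m * t" .
    qed
  qed
  then show ?thesis using assms(3) by auto
qed

lemma newton_polyhedron_supportI: "(j, k) \<in> taylor_support g \<Longrightarrow> (real j, real k) \<in> newton_polyhedron g"
  unfolding newton_polyhedron_def by (rule hull_inc) auto

lemma newton_polyhedron_nonneg:
  assumes "(s, t) \<in> newton_polyhedron g"
  shows "0 \<le> s" "0 \<le> t"
proof -
  have "newton_polyhedron g \<subseteq> {p. 0 \<le> (1, 0) \<bullet> p}" "newton_polyhedron g \<subseteq> {p. 0 \<le> (0, 1) \<bullet> p}"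
    unfolding newton_polyhedron_def
    using convex_halfspace_ge[of 0 "(1, 0) :: real \<times> real"] convex_halfspace_ge[of 0 "(0, 1) :: real \<times> real"]
    by (intro hull_minimal; force simp: inner_commute)+
  then show "0 \<le> s" "0 \<le> t" using assms by auto
qed

text \<open>The diagonal ray enters the polyhedron at a single point, since the polyhedron is closed
under increasing either coordinate. Hence \<open>newton_distance\<close>, defined by a definite
description on the frontier, is the infimum of the diagonal points, and bounds on it can be
proved one side at a time.\<close>

lemma newton_distance_eq_Inf:
  assumes "finite_type g"
  shows "newton_distance g = Inf {d. (d, d) \<in> newton_polyhedron g}"
    "{d. (d, d) \<in> newton_polyhedron g} \<noteq> {}" "bdd_below {d. (d, d) \<in> newton_polyhedron g}"
proof -
  let ?N = "newton_polyhedron g"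
  let ?D = "{d. (d, d) \<in> ?N}"
  obtain j k where jk: "(j, k) \<in> taylor_support g" using assms unfolding finite_type_def by auto
  have "(real (max j k), real (max j k)) \<in> ?N"
    by (rule newton_polyhedron_upward[OF newton_polyhedron_supportI[OF jk]]) auto
  then show ne: "?D \<noteq> {}" by blast
  show bd: "bdd_below ?D" by (rule bdd_belowI[of _ 0]) (auto dest: newton_polyhedron_nonneg)
  define d0 where "d0 = Inf ?D"
  have gt: "(t, t) \<in> ?N" if t: "t > d0" for t
  proof -
    obtain d where "d \<in> ?D" "d < t" using cInf_lessD[OF ne, of t] t unfolding d0_def by blast
    then show ?thesis using newton_polyhedron_upward[of d d g t t] by auto
  qed
  have lt: "(t, t) \<notin> ?N" if "t < d0" for t
    using cInf_lower[OF _ bd, of t] that unfolding d0_def by auto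
  have comp: "\<bar>fst p - t\<bar> \<le> dist p (t, t)" "\<bar>snd p - t\<bar> \<le> dist p (t, t)" for p :: "real \<times> real" and t
    using dist_fst_le[of p "(t, t)"] dist_snd_le[of p "(t, t)"] by (auto simp: dist_real_def)
  have upN: "p \<in> ?N" if "(d, d) \<in> ?N" "d \<le> fst p" "d \<le> snd p" for p d
    using newton_polyhedron_upward[of d d g "fst p" "snd p"] that by simp
  have upN2: "(d, d) \<in> ?N" if "p \<in> ?N" "fst p \<le> d" "snd p \<le> d" for p d
    using newton_polyhedron_upward[of "fst p" "snd p" g d d] that by simp
  have int: "(t, t) \<in> interior ?N" if t: "t > d0" for t
  proof -
    have "ball (t, t) ((t - d0) / 2) \<subseteq> ?N"
    proof
      fix p assume "p \<in> ball (t, t) ((t - d0) / 2)"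
      then have "dist p (t, t) < (t - d0) / 2" by (simp add: dist_commute)
      then show "p \<in> ?N"
        using comp[of p t] t by (intro upN[OF gt[of "(t + d0) / 2"]]) (auto simp: abs_le_iff field_simps)
    qed
    then show ?thesis using t unfolding mem_interior by (intro exI[of _ "(t - d0) / 2"]) simp
  qed
  have ncl: "(t, t) \<notin> closure ?N" if t: "t < d0" for t
  proof
    assume "(t, t) \<in> closure ?N"
    then obtain p where "p \<in> ?N" "dist p (t, t) < (d0 - t) / 2"
      using t unfolding closure_approachable by (metis diff_gt_0_iff_gt half_gt_zero)
    then have "((t + d0) / 2, (t + d0) / 2) \<in> ?N"
      using comp[of p t] t by (intro upN2[of p]) (auto simp: abs_le_iff field_simps)
    then show False using lt[of "(t + d0) / 2"] t by (auto simp: field_simps)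
  qed
  have cl: "(d0, d0) \<in> closure ?N"
    unfolding closure_approachable
  proof (intro allI impI)
    fix e :: real assume e: "e > 0"
    have "dist (d0 + e / 3, d0 + e / 3) (d0, d0) \<le> e / 3 + e / 3"
      unfolding dist_prod_def using e real_sqrt_sum_squares_triangle_ineq[of "e/3" 0 0 "e/3"]
      by (simp add: dist_real_def)
    then show "\<exists>y\<in>?N. dist y (d0, d0) < e" using gt[of "d0 + e / 3"] e by force
  qed
  have nint: "(d0, d0) \<notin> interior ?N"
  proof
    assume "(d0, d0) \<in> interior ?N"
    then obtain e where e: "e > 0" "ball (d0, d0) e \<subseteq> ?N" unfolding mem_interior by blast
    have "dist (d0, d0) (d0 - e / 3, d0 - e / 3) \<le> e / 3 + e / 3"
      unfolding dist_prod_def using e real_sqrt_sum_squares_triangle_ineq[of "e/3" 0 0 "e/3"]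
      by (simp add: dist_real_def)
    then have "(d0 - e / 3, d0 - e / 3) \<in> ?N" using e by (intro subsetD[OF e(2)]) auto
    then show False using lt[of "d0 - e / 3"] e by simp
  qed
  show "newton_distance g = d0"
    unfolding newton_distance_def
  proof (rule the_equality)
    show "(d0, d0) \<in> frontier ?N" using cl nint by (simp add: frontier_def)
    fix d assume "(d, d) \<in> frontier ?N"
    then show "d = d0" using int[of d] ncl[of d] by (cases d d0 rule: linorder_cases) (auto simp: frontier_def)
  qed
qed

lemma newton_distance_ge:
  assumes "finite_type g" "m \<ge> 0" "weight_ge g m q"
  shows "q / (1 + m) \<le> newton_distance g"
  unfolding newton_distance_eq_Inf(1)[OF assms(1)]
proof (rule cInf_greatest[OF newton_distance_eq_Inf(2)[OF assms(1)]])
  fix d assume "d \<in> {d. (d, d) \<in> newton_polyhedron g}"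
  then have "q \<le> d + m * d" using newton_polyhedron_weight[OF assms(2,3), of d d] by simp
  then show "q / (1 + m) \<le> d" using assms(2) by (simp add: field_simps)
qed

lemma newton_distance_le:
  assumes "(t, t) \<in> newton_polyhedron g" "finite_type g"
  shows "newton_distance g \<le> t"
  unfolding newton_distance_eq_Inf(1)[OF assms(2)]
  by (rule cInf_lower[OF _ newton_distance_eq_Inf(3)[OF assms(2)]]) (use assms in simp)

section \<open>Coordinate changes and the height\<close>

lemma germ_smooth_compose:
  assumes "germ_smooth f" "local_coordinates \<phi>"
  shows "germ_smooth (f \<circ> \<phi>)"
proof -
  obtain U where U: "open U" "(0, 0) \<in> U" "smooth_on U f" using assms(1) unfolding germ_smooth_def by blast
  obtain V W \<theta> where V: "\<phi> (0, 0) = (0, 0)" "open V" "open W" "(0, 0) \<in> V" "homeomorphism V W \<phi> \<theta>" "smooth_on V \<phi>"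
    using assms(2) unfolding local_coordinates_def by blast
  let ?V = "V \<inter> \<phi> -` U"
  have "open ?V"
    by (rule continuous_open_preimage[OF smooth_on_continuous_on[OF V(6)] V(2) U(1)])
  moreover have "smooth_on ?V (\<lambda>x. f (\<phi> x))"
    by (rule smooth_on_compose[OF \<open>open ?V\<close> U(1) _ U(3)]) (use smooth_on_subset[OF V(6)] in auto)
  ultimately show ?thesis unfolding germ_smooth_def o_def using V U by (intro exI[of _ ?V]) auto
qed

text \<open>The total order of vanishing does not increase under a change of coordinates: if \<open>f \<circ> \<phi>\<close>
vanished to order \<open>n > j0 + k0\<close>, then, the inverse chart being Lipschitz at the
origin, \<open>f\<close> would be bounded by a multiple of \<open>norm u ^ n\<close>, so that no support point \<open>(j0, k0)\<close> could exist.
This keeps \<open>f \<circ> \<phi>\<close> of finite type and bounds all Newton distances at once.\<close>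

lemma order_transfer:
  assumes f: "germ_smooth f" and \<phi>: "local_coordinates \<phi>" and jk: "(j0, k0) \<in> taylor_support f"
  shows "\<exists>j k. (j, k) \<in> taylor_support (f \<circ> \<phi>) \<and> j + k \<le> j0 + k0"
proof (rule ccontr)
  assume no: "\<not> ?thesis"
  define n where "n = j0 + k0 + 1"
  have w: "weight_ge (f \<circ> \<phi>) 1 (real n)"
    unfolding weight_ge_def
  proof clarify
    fix j k assume "(j, k) \<in> taylor_support (f \<circ> \<phi>)"
    then have "\<not> j + k \<le> j0 + k0" using no by blast
    then show "real n \<le> real j + 1 * real k" unfolding n_def by linarith
  qed
  obtain \<delta> A where A: "\<delta> > 0" "A \<ge> 0" "\<And>x y. \<bar>x\<bar> \<le> \<delta> \<Longrightarrow> \<bar>y\<bar> \<le> \<delta> \<Longrightarrow> \<bar>(f \<circ> \<phi>) (x, y)\<bar> \<le> A * max \<bar>x\<bar> \<bar>y\<bar> ^ n"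
    using bound_of_order[OF germ_smooth_compose[OF f \<phi>] w] by blast
  obtain V W \<theta> where V: "\<phi> (0, 0) = (0, 0)" "open V" "open W" "(0, 0) \<in> V" "homeomorphism V W \<phi> \<theta>" "smooth_on V \<phi>" "smooth_on W \<theta>"
    using \<phi> unfolding local_coordinates_def by blast
  have inv: "\<phi> (\<theta> w) = w" if "w \<in> W" for w using V(5) that unfolding homeomorphism_def by blast
  have W0: "(0, 0) \<in> W" using V(1,4,5) unfolding homeomorphism_def by (metis image_eqI)
  have th0: "\<theta> (0, 0) = (0, 0)" using V(1,4,5) unfolding homeomorphism_def by metis
  obtain D where D: "(\<theta> has_derivative D) (at (0, 0))"
    using smooth_on_differentiable[OF V(7) W0] unfolding differentiable_def by blast
  obtain K where K: "K > 0" "\<And>u. norm (D u) \<le> norm u * K"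
    using bounded_linear.pos_bounded[OF has_derivative_bounded_linear[OF D]] by blast
  obtain e1 where e1: "e1 > 0" "\<And>u. norm u < e1 \<Longrightarrow> norm (\<theta> u - D u) \<le> norm u"
  proof -
    have "\<exists>d>0. \<forall>y. norm (y - (0, 0)) < d \<longrightarrow> norm (\<theta> y - \<theta> (0, 0) - D (y - (0, 0))) \<le> 1 * norm (y - (0, 0))"
      using D unfolding has_derivative_at_alt by (meson zero_less_one)
    then obtain d where d: "d > 0" "\<And>y. norm (y - (0, 0)) < d \<Longrightarrow> norm (\<theta> y - \<theta> (0, 0) - D (y - (0, 0))) \<le> 1 * norm (y - (0, 0))"
      by blast
    have z: "y - (0, 0) = y" "\<theta> y - (0, 0) = \<theta> y" for y :: "real \<times> real" by (simp_all add: zero_prod_def[symmetric])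
    show ?thesis by (rule that[OF d(1)]) (use d(2) in \<open>simp add: z th0\<close>)
  qed
  have lip: "norm (\<theta> u) \<le> (K + 1) * norm u" if "norm u < e1" for u
    using norm_triangle_ineq[of "\<theta> u - D u" "D u"] e1(2)[OF that] K(2)[of u] by (simp add: algebra_simps)
  obtain e2 where e2: "e2 > 0" "ball (0, 0) e2 \<subseteq> W" using V(3) W0 open_contains_ball by blast
  have bound: "\<bar>f u\<bar> \<le> A * ((K + 1) * norm u) ^ n" if u: "norm u < min (min e1 e2) (\<delta> / (K + 1))" for u
  proof -
    have "u \<in> W" using u e2 by (auto simp: dist_norm zero_prod_def[symmetric])
    then have fu: "f u = (f \<circ> \<phi>) (fst (\<theta> u), snd (\<theta> u))" by (simp add: inv)
    have l: "norm (\<theta> u) \<le> (K + 1) * norm u" by (rule lip) (use u in simp)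
    have cmp: "\<bar>fst w\<bar> \<le> norm w" "\<bar>snd w\<bar> \<le> norm w" for w :: "real \<times> real"
      using norm_fst_le[of "fst w" "snd w"] norm_snd_le[of "snd w" "fst w"] by simp_all
    have d: "(K + 1) * norm u \<le> \<delta>" using u K by (simp add: field_simps)
    have 1: "\<bar>fst (\<theta> u)\<bar> \<le> \<delta>" "\<bar>snd (\<theta> u)\<bar> \<le> \<delta>"
      using cmp[of "\<theta> u"] l d by linarith+
    have "max \<bar>fst (\<theta> u)\<bar> \<bar>snd (\<theta> u)\<bar> \<le> (K + 1) * norm u"
      using cmp[of "\<theta> u"] l by linarith
    then have "max \<bar>fst (\<theta> u)\<bar> \<bar>snd (\<theta> u)\<bar> ^ n \<le> ((K + 1) * norm u) ^ n"
      by (intro power_mono) auto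
    then have "A * max \<bar>fst (\<theta> u)\<bar> \<bar>snd (\<theta> u)\<bar> ^ n \<le> A * ((K + 1) * norm u) ^ n"
      using A(2) by (rule mult_left_mono)
    then show ?thesis using A(3)[OF 1] unfolding fu by linarith
  qed
  \<comment> \<open>The exponent \<open>n - 1/2\<close> lies strictly between the total orders \<open>j0 + k0 = n - 1\<close> and \<open>n\<close>, so that the limit is \<open>0\<close>.\<close>
  have "weight_ge f 1 (real n - 1 / 2)"
  proof (rule weight_ge_if_limit[OF f order_refl])
    fix z :: real assume z: "z \<in> {-1..1}"
    define e where "e = min (min e1 e2) (\<delta> / (K + 1)) / 2"
    have e: "e > 0" using e1 e2 A K by (simp add: e_def)
    have "\<forall>\<^sub>F x in at_right 0. 0 < x \<and> x < e"
      using e eventually_at_right_real[OF e] by (auto elim: eventually_mono)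
    then have ev: "\<forall>\<^sub>F x in at_right 0. norm (f (x, x powr 1 * z) / x powr (real n - 1 / 2)) \<le> A * (2 * (K + 1)) ^ n * x powr (1 / 2)"
    proof eventually_elim
      case (elim x)
      have "norm (x, x powr 1 * z) \<le> norm x + norm (x powr 1 * z)" by (rule norm_Pair_le)
      also have "\<dots> \<le> 2 * x" using elim z mult_left_mono[of "\<bar>z\<bar>" 1 x] by (auto simp: abs_mult)
      finally have nx: "norm (x, x powr 1 * z) \<le> 2 * x" .
      have "\<bar>f (x, x powr 1 * z)\<bar> \<le> A * ((K + 1) * norm (x, x powr 1 * z)) ^ n"
        by (rule bound) (use nx elim in \<open>simp add: e_def\<close>)
      also have "\<dots> \<le> A * ((K + 1) * (2 * x)) ^ n"
        using A K nx by (intro mult_left_mono power_mono) auto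
      also have "\<dots> = A * (2 * (K + 1)) ^ n * x powr real n"
        using elim by (simp add: powr_realpow power_mult_distrib mult_ac)
      finally have "\<bar>f (x, x powr 1 * z)\<bar> / x powr (real n - 1 / 2) \<le> A * (2 * (K + 1)) ^ n * x powr real n / x powr (real n - 1 / 2)"
        by (rule divide_right_mono) simp
      also have "\<dots> = A * (2 * (K + 1)) ^ n * (x powr real n / x powr (real n - 1 / 2))" by simp
      also have "x powr real n / x powr (real n - 1 / 2) = x powr (1 / 2)"
        unfolding powr_diff[symmetric] by simp
      finally show ?case by simp
    qed
    show "((\<lambda>x. f (x, x powr 1 * z) / x powr (real n - 1 / 2)) \<longlongrightarrow> 0) (at_right 0)"
      by (rule Lim_null_comparison[OF ev]) (intro tendsto_mult_right_zero powr_tendsto_0_at_right, simp)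
  qed
  then show False using jk unfolding weight_ge_def n_def by force
qed

lemma phase_germ_smooth: "phase_function f \<Longrightarrow> germ_smooth f"
  unfolding phase_function_def germ_smooth_def by blast

context
  fixes f \<phi>
  assumes f: "phase_function f" and \<phi>: "local_coordinates \<phi>"
begin

lemma chart_germ_smooth: "germ_smooth (f \<circ> \<phi>)"
  by (rule germ_smooth_compose[OF phase_germ_smooth[OF f] \<phi>])

lemma chart_finite_type: "finite_type (f \<circ> \<phi>)"
proof -
  obtain j k where "(j, k) \<in> taylor_support f" using f unfolding phase_function_def finite_type_def by auto
  then show ?thesis
    using order_transfer[OF phase_germ_smooth[OF f] \<phi>] unfolding finite_type_def by blast
qed

lemma chart_zero: "(f \<circ> \<phi>) (0, 0) = 0"
  using f \<phi> unfolding phase_function_def local_coordinates_def by simp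

lemma chart_support_nonzero: "(0, 0) \<notin> taylor_support (f \<circ> \<phi>)"
  using chart_zero by (simp add: taylor_support_def taylor_coeff_def partial_deriv_def)

end

text \<open>The supremum in the definition of the height is a conditional one and bounds its members
only because the set of distances is bounded, by \<open>order_transfer\<close>.\<close>

lemma newton_distance_le_height:
  assumes f: "phase_function f" and \<phi>: "local_coordinates \<phi>"
  shows "newton_distance (f \<circ> \<phi>) \<le> height f"
  unfolding height_def
proof (rule cSUP_upper)
  show "\<phi> \<in> {\<phi>. local_coordinates \<phi>}" using \<phi> by simp
  obtain j0 k0 where jk0: "(j0, k0) \<in> taylor_support f" using f unfolding phase_function_def finite_type_def by auto
  show "bdd_above ((\<lambda>\<phi>. newton_distance (f \<circ> \<phi>)) ` {\<phi>. local_coordinates \<phi>})"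
  proof (rule bdd_aboveI2)
    fix \<psi> assume "\<psi> \<in> {\<phi>. local_coordinates \<phi>}"
    then have \<psi>: "local_coordinates \<psi>" by simp
    obtain j k where jk: "(j, k) \<in> taylor_support (f \<circ> \<psi>)" "j + k \<le> j0 + k0"
      using order_transfer[OF phase_germ_smooth[OF f] \<psi> jk0] by blast
    have "(real (j0 + k0), real (j0 + k0)) \<in> newton_polyhedron (f \<circ> \<psi>)"
      by (rule newton_polyhedron_upward[OF newton_polyhedron_supportI[OF jk(1)]]) (use jk(2) in linarith)+
    then show "newton_distance (f \<circ> \<psi>) \<le> real (j0 + k0)"
      by (rule newton_distance_le[OF _ chart_finite_type[OF f \<psi>]])
  qed
qed

text \<open>The only way in which the height enters the estimates: every supporting line of the Newton
polyhedron, in every coordinate system, meets the bisectrix at a point \<open>(d, d)\<close> with \<open>d \<le> height f\<close>.\<close>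

lemma weight_le_height:
  assumes "phase_function f" "local_coordinates \<phi>" "m \<ge> 0" "weight_ge (f \<circ> \<phi>) m q"
  shows "q / (1 + m) \<le> height f"
  using newton_distance_ge[OF chart_finite_type[OF assms(1,2)] assms(3,4)] newton_distance_le_height[OF assms(1,2)]
  by linarith

lemma local_coordinates_comp:
  assumes "local_coordinates \<phi>" "local_coordinates \<sigma>"
  shows "local_coordinates (\<phi> \<circ> \<sigma>)"
proof -
  obtain V W \<theta> where V: "\<phi> (0, 0) = (0, 0)" "open V" "open W" "(0, 0) \<in> V" "homeomorphism V W \<phi> \<theta>" "smooth_on V \<phi>" "smooth_on W \<theta>"
    using assms(1) unfolding local_coordinates_def by blast
  obtain V' W' \<theta>' where V': "\<sigma> (0, 0) = (0, 0)" "open V'" "open W'" "(0, 0) \<in> V'" "homeomorphism V' W' \<sigma> \<theta>'" "smooth_on V' \<sigma>" "smooth_on W' \<theta>'"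
    using assms(2) unfolding local_coordinates_def by blast
  note h = V(5)[unfolded homeomorphism_def] V'(5)[unfolded homeomorphism_def]
  let ?V = "V' \<inter> \<sigma> -` V" and ?W = "W \<inter> \<theta> -` W'"
  have oV: "open ?V" by (rule continuous_open_preimage[OF smooth_on_continuous_on[OF V'(6)] V'(2) V(2)])
  have oW: "open ?W" by (rule continuous_open_preimage[OF smooth_on_continuous_on[OF V(7)] V(3) V'(3)])
  have sV: "smooth_on ?V (\<lambda>x. \<phi> (\<sigma> x))"
    by (rule smooth_on_compose[OF oV V(2) _ V(6)]) (use smooth_on_subset[OF V'(6)] in auto)
  have sW: "smooth_on ?W (\<lambda>x. \<theta>' (\<theta> x))"
    by (rule smooth_on_compose[OF oW V'(3) _ V'(7)]) (use smooth_on_subset[OF V(7)] in auto)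
  have a: "\<theta> (\<phi> x) = x" "\<phi> x \<in> W" if "x \<in> V" for x using h(1) that by auto
  have b: "\<phi> (\<theta> x) = x" "\<theta> x \<in> V" if "x \<in> W" for x using h(1) that by auto
  have a': "\<theta>' (\<sigma> x) = x" "\<sigma> x \<in> W'" if "x \<in> V'" for x using h(2) that by auto
  have b': "\<sigma> (\<theta>' x) = x" "\<theta>' x \<in> V'" if "x \<in> W'" for x using h(2) that by auto
  have "homeomorphism ?V ?W (\<lambda>x. \<phi> (\<sigma> x)) (\<lambda>x. \<theta>' (\<theta> x))"
  proof (rule homeomorphismI)
    show "continuous_on ?V (\<lambda>x. \<phi> (\<sigma> x))" by (rule smooth_on_continuous_on[OF sV])
    show "continuous_on ?W (\<lambda>x. \<theta>' (\<theta> x))" by (rule smooth_on_continuous_on[OF sW])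
    show "(\<lambda>x. \<phi> (\<sigma> x)) ` ?V \<subseteq> ?W"
    proof (rule image_subsetI)
      fix x assume "x \<in> ?V"
      then show "\<phi> (\<sigma> x) \<in> ?W" using a[of "\<sigma> x"] a'[of x] by simp
    qed
    show "(\<lambda>x. \<theta>' (\<theta> x)) ` ?W \<subseteq> ?V"
    proof (rule image_subsetI)
      fix x assume "x \<in> ?W"
      then show "\<theta>' (\<theta> x) \<in> ?V" using b[of x] b'[of "\<theta> x"] by simp
    qed
    show "\<theta>' (\<theta> (\<phi> (\<sigma> x))) = x" if "x \<in> ?V" for x using that a(1)[of "\<sigma> x"] a'(1)[of x] by simp
    show "\<phi> (\<sigma> (\<theta>' (\<theta> y))) = y" if "y \<in> ?W" for y using that b(1)[of y] b'(1)[of "\<theta> y"] by simp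
  qed
  then show ?thesis
    unfolding local_coordinates_def o_def using V V' oV oW sV sW
    by (intro conjI exI[of _ ?V] exI[of _ ?W] exI[of _ "\<lambda>x. \<theta>' (\<theta> x)"]) auto
qed

lemma local_coordinates_global:
  assumes "\<sigma> (0, 0) = (0, 0)" "smooth_on UNIV \<sigma>" "smooth_on UNIV \<tau>" "\<And>p. \<tau> (\<sigma> p) = p" "\<And>p. \<sigma> (\<tau> p) = p"
  shows "local_coordinates \<sigma>"
proof -
  have "homeomorphism UNIV UNIV \<sigma> \<tau>"
    using assms smooth_on_continuous_on by (intro homeomorphismI) auto
  then show ?thesis unfolding local_coordinates_def using assms
    by (intro conjI exI[of _ UNIV] exI[of _ \<tau>]) auto
qed

definition shear :: "real \<Rightarrow> nat \<Rightarrow> real \<times> real \<Rightarrow> real \<times> real" where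
  "shear c n p = (fst p, snd p + c * fst p ^ n)"

definition reflect :: "real \<times> real \<Rightarrow> real \<times> real" where
  "reflect p = (- fst p, snd p)"

definition swap :: "real \<times> real \<Rightarrow> real \<times> real" where
  "swap p = (snd p, fst p)"

lemma smooth_on_fst: "smooth_on S (fst :: real \<times> real \<Rightarrow> real)"
  and smooth_on_snd: "smooth_on S (snd :: real \<times> real \<Rightarrow> real)"
  by (intro smooth_on_bounded_linear bounded_linear_fst bounded_linear_snd)+

lemma smooth_on_shear: "smooth_on UNIV (shear c n)"
  unfolding shear_def[abs_def]
  by (intro smooth_on_Pair smooth_on_add smooth_on_mult smooth_on_power smooth_on_const smooth_on_fst smooth_on_snd open_UNIV)

lemma local_coordinates_shear: "n \<ge> 1 \<Longrightarrow> local_coordinates (shear c n)"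
  by (rule local_coordinates_global[of _ "shear (- c) n"]) (auto simp: shear_def smooth_on_shear[unfolded shear_def[abs_def]] intro: smooth_on_shear)

lemma local_coordinates_reflect: "local_coordinates reflect"
proof (rule local_coordinates_global[of _ reflect])
  show "smooth_on UNIV reflect" "smooth_on UNIV reflect"
    unfolding reflect_def[abs_def]
    by (intro smooth_on_Pair smooth_on_snd smooth_on_bounded_linear bounded_linear_minus bounded_linear_fst open_UNIV)+
qed (auto simp: reflect_def)

lemma local_coordinates_swap: "local_coordinates swap"
proof (rule local_coordinates_global[of _ swap])
  show "smooth_on UNIV swap" "smooth_on UNIV swap"
    unfolding swap_def[abs_def] by (intro smooth_on_Pair smooth_on_snd smooth_on_fst open_UNIV)+
qed (auto simp: swap_def)

lemma local_coordinates_id: "local_coordinates (\<lambda>p. p)"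
  by (rule local_coordinates_global[of _ "\<lambda>p. p"]) (auto intro: smooth_on_bounded_linear bounded_linear_ident)

text \<open>A shear along \<open>y = c x^n\<close> whose exponent equals the weight keeps the supporting line and
translates the edge polynomial by \<open>c\<close>. It follows from the asymptotic characterisation, because
\<open>(x, x^m z)\<close> is mapped to \<open>(x, x^m (z + c))\<close>.\<close>

lemma edge_poly_shear:
  assumes g: "germ_smooth g" and m: "m = real n" "n \<ge> 1" and w: "weight_ge g m q"
  shows "weight_ge (g \<circ> shear c n) m q" "edge_poly (g \<circ> shear c n) m q = pcompose (edge_poly g m q) [:c, 1:]"
proof -
  have m1: "m \<ge> 1" using m by simp
  have g': "germ_smooth (g \<circ> shear c n)"
    by (rule germ_smooth_compose[OF g local_coordinates_shear[OF m(2)]])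
  have lim: "((\<lambda>x. (g \<circ> shear c n) (x, x powr m * z) / x powr q) \<longlongrightarrow> poly (pcompose (edge_poly g m q) [:c, 1:]) z) (at_right 0)" for z
  proof -
    have "\<forall>\<^sub>F x in at_right 0. g (x, x powr m * (z + c)) / x powr q = (g \<circ> shear c n) (x, x powr m * z) / x powr q"
      using eventually_at_right_less[of "0::real"]
      by eventually_elim (simp add: shear_def m powr_realpow algebra_simps)
    moreover have "poly (pcompose (edge_poly g m q) [:c, 1:]) z = poly (edge_poly g m q) (z + c)"
      by (simp add: poly_pcompose add.commute)
    ultimately show ?thesis
      using weighted_limit_pointwise[OF g m1 w, of "z + c"] by (simp only: tendsto_cong)
  qed
  show "weight_ge (g \<circ> shear c n) m q" "edge_poly (g \<circ> shear c n) m q = pcompose (edge_poly g m q) [:c, 1:]"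
    using edge_poly_unique[OF g' m1 lim] by blast+
qed

text \<open>Together with \<open>edge_poly_shear\<close>: a root \<open>c\<close> of the edge polynomial is moved to \<open>0\<close> with its order.\<close>

lemma order_pcompose_shift:
  fixes P :: "real poly"
  assumes "P \<noteq> 0"
  shows "order 0 (pcompose P [:c, 1:]) = order c P"
proof -
  obtain R where R: "P = [:- c, 1:] ^ order c P * R" "\<not> [:- c, 1:] dvd R"
    using order_decomp[OF assms] by blast
  define R' where "R' = pcompose R [:c, 1:]"
  have pw: "pcompose (p ^ n) q = pcompose p q ^ n" for p q :: "real poly" and n
    by (induction n) (simp_all add: pcompose_mult pcompose_1)
  have "pcompose P [:c, 1:] = pcompose ([:- c, 1:] ^ order c P) [:c, 1:] * R'"
    unfolding R'_def by (subst R(1)) (rule pcompose_mult)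
  also have "pcompose ([:- c, 1:] ^ order c P) [:c, 1:] = [:- 0, 1:] ^ order c P"
    unfolding pw by (simp add: pcompose_pCons)
  finally have e: "pcompose P [:c, 1:] = [:- 0, 1:] ^ order c P * R'" .
  have "poly R' 0 = poly R c" unfolding R'_def by (simp add: poly_pcompose)
  then have R0: "poly R' 0 \<noteq> 0" using R(2) by (simp add: poly_eq_0_iff_dvd)
  then have "R' \<noteq> 0" by auto
  then have "[:- 0, 1:] ^ order c P * R' \<noteq> 0" by simp
  from order_mult[OF this, of 0] show ?thesis
    unfolding e order_power_n_n using order_0I[OF R0] by simp
qed

section \<open>A vertex on the bisectrix\<close>

text \<open>The principal part of a phase whose principal face is a vertex.\<close>

definition monomial_fun :: "real \<Rightarrow> nat \<Rightarrow> nat \<Rightarrow> real \<times> real \<Rightarrow> real" where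
  "monomial_fun c a b p = c * fst p ^ a * snd p ^ b"

lemma smooth_on_monomial_fun: "smooth_on UNIV (monomial_fun c a b)"
  unfolding monomial_fun_def[abs_def]
  by (intro smooth_on_mult smooth_on_power smooth_on_const smooth_on_fst smooth_on_snd open_UNIV)

lemma D1_monomial_fun: "D1 (monomial_fun c a b) = monomial_fun (c * real a) (a - 1) b"
proof (rule ext)
  fix p :: "real \<times> real"
  obtain x y where p: "p = (x, y)" by (cases p)
  have "((\<lambda>t. monomial_fun c a b (t, y)) has_real_derivative monomial_fun (c * real a) (a - 1) b (x, y)) (at x)"
    unfolding monomial_fun_def by (auto intro!: derivative_eq_intros)
  with has_real_derivative_D1[OF smooth_on_monomial_fun, of x y c a b]
  show "D1 (monomial_fun c a b) p = monomial_fun (c * real a) (a - 1) b p"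
    unfolding p using DERIV_unique by blast
qed

lemma D2_monomial_fun: "D2 (monomial_fun c a b) = monomial_fun (c * real b) a (b - 1)"
proof (rule ext)
  fix p :: "real \<times> real"
  obtain x y where p: "p = (x, y)" by (cases p)
  have "((\<lambda>t. monomial_fun c a b (x, t)) has_real_derivative monomial_fun (c * real b) a (b - 1) (x, y)) (at y)"
    unfolding monomial_fun_def by (auto intro!: derivative_eq_intros)
  with has_real_derivative_D2[OF smooth_on_monomial_fun, of x y c a b]
  show "D2 (monomial_fun c a b) p = monomial_fun (c * real b) a (b - 1) p"
    unfolding p using DERIV_unique by blast
qed

lemma partial_deriv_monomial_fun:
  "partial_deriv j k (monomial_fun c a b) = monomial_fun (c * (\<Prod>i<k. real (b - i)) * (\<Prod>i<j. real (a - i))) (a - j) (b - k)"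
proof -
  have 2: "(D2 ^^ k) (monomial_fun c a b) = monomial_fun (c * (\<Prod>i<k. real (b - i))) a (b - k)"
    by (induction k) (simp_all add: D2_monomial_fun mult_ac)
  have 1: "(D1 ^^ j) (monomial_fun c a b) = monomial_fun (c * (\<Prod>i<j. real (a - i))) (a - j) b" for c b
    by (induction j) (simp_all add: D1_monomial_fun mult_ac)
  show ?thesis unfolding partial_deriv_eq 2 1 ..
qed

text \<open>Away from the origin one coordinate is nonzero, and \<open>n\<close> derivatives in the other one leave a
nonzero multiple of the \<open>n\<close>-th power of the nonzero one.\<close>

lemma vanishing_order_monomial_fun:
  assumes "c \<noteq> 0" "p \<noteq> (0, 0)"
  shows "vanishing_order (monomial_fun c n n) p \<le> n"
proof -
  have nz: "(\<Prod>i<n. real (n - i)) \<noteq> 0" by auto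
  have "\<exists>j k. j + k = n \<and> partial_deriv j k (monomial_fun c n n) p \<noteq> 0"
  proof (cases "fst p = 0")
    case False
    then show ?thesis using assms(1) nz
      by (intro exI[of _ 0] exI[of _ n]) (simp add: partial_deriv_monomial_fun monomial_fun_def)
  next
    case True
    then have "snd p \<noteq> 0" using assms(2) by (auto simp: prod_eq_iff)
    then show ?thesis using assms(1) nz
      by (intro exI[of _ n] exI[of _ 0]) (simp add: partial_deriv_monomial_fun monomial_fun_def)
  qed
  then show ?thesis unfolding vanishing_order_def by (rule Least_le)
qed

text \<open>On the axis \<open>y = 0\<close> all \<open>n\<close> factors \<open>y\<close> have to be differentiated away, so the bound of
the previous lemma is attained on the unit circle.\<close>

lemma vanishing_order_monomial_fun_axis:
  assumes "c \<noteq> 0"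
  shows "vanishing_order (monomial_fun c n n) (1, 0) = n"
proof (rule antisym)
  show "vanishing_order (monomial_fun c n n) (1, 0) \<le> n" by (rule vanishing_order_monomial_fun[OF assms]) simp
  have nz: "(\<Prod>i<n. real (n - i)) \<noteq> 0" by auto
  have ex: "\<exists>m. \<exists>j k. j + k = m \<and> partial_deriv j k (monomial_fun c n n) (1, 0) \<noteq> 0"
    by (intro exI[of _ n] exI[of _ 0] exI[of _ n]) (use assms nz in \<open>simp add: partial_deriv_monomial_fun monomial_fun_def\<close>)
  have "\<exists>j k. j + k = vanishing_order (monomial_fun c n n) (1, 0) \<and> partial_deriv j k (monomial_fun c n n) (1, 0) \<noteq> 0"
    unfolding vanishing_order_def by (rule LeastI_ex[OF ex])
  then obtain j k where jk: "j + k = vanishing_order (monomial_fun c n n) (1, 0)" "partial_deriv j k (monomial_fun c n n) (1, 0) \<noteq> 0"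
    by blast
  from jk(2) have "(0::real) ^ (n - k) \<noteq> 0" by (auto simp: partial_deriv_monomial_fun monomial_fun_def)
  then have "n \<le> k" by (cases "n - k") auto
  then show "n \<le> vanishing_order (monomial_fun c n n) (1, 0)" using jk(1) by simp
qed

text \<open>The half plane above a line, together with one point of the line, is convex. It therefore
contains the whole polyhedron as soon as it contains the generating quadrants.\<close>

lemma newton_polyhedron_strict_vertex:
  assumes m: "m > 0" and w: "weight_ge g m q" and v: "real n + m * real n = q"
    and strict: "\<And>j k. (j, k) \<in> taylor_support g \<Longrightarrow> real j + m * real k = q \<Longrightarrow> (j, k) = (n, n)"
    and p: "p \<in> newton_polyhedron g" "fst p + m * snd p \<le> q"
  shows "p = (real n, real n)"
proof -
  let ?l = "\<lambda>p :: real \<times> real. fst p + m * snd p"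
  let ?v = "(real n, real n)"
  let ?C = "{p. q < ?l p} \<union> {?v}"
  have conv: "convex ?C"
  proof (rule convexI)
    fix x y u w assume x: "x \<in> ?C" and y: "y \<in> ?C" and uw: "0 \<le> u" "0 \<le> w" "u + w = (1::real)"
    have lx: "q \<le> ?l x" "?l x = q \<Longrightarrow> x = ?v" and ly: "q \<le> ?l y" "?l y = q \<Longrightarrow> y = ?v" using x y v by auto
    have l: "?l (u *\<^sub>R x + w *\<^sub>R y) = u * ?l x + w * ?l y" by (simp add: algebra_simps)
    have q: "q = u * q + w * q" using uw(3) by (simp flip: distrib_right)
    have 1: "u * q \<le> u * ?l x" "w * q \<le> w * ?l y" using lx ly uw by (auto intro: mult_left_mono)
    show "u *\<^sub>R x + w *\<^sub>R y \<in> ?C"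
    proof (cases "?l (u *\<^sub>R x + w *\<^sub>R y) = q")
      case True
      then have "u * ?l x = u * q" "w * ?l y = w * q" using 1 l q by linarith+
      then have "u = 0 \<or> x = ?v" "w = 0 \<or> y = ?v" using lx(2) ly(2) by auto
      then have "u *\<^sub>R x = u *\<^sub>R ?v" "w *\<^sub>R y = w *\<^sub>R ?v" by (auto simp: zero_prod_def)
      then have "u *\<^sub>R x + w *\<^sub>R y = (u + w) *\<^sub>R ?v" by (simp only: scaleR_left_distrib)
      then show ?thesis using uw(3) by simp
    next
      case False
      then show ?thesis using 1 l q by simp
    qed
  qed
  have sub: "newton_polyhedron g \<subseteq> ?C"
    unfolding newton_polyhedron_def
  proof (rule hull_minimal[of _ ?C convex, OF _ conv], rule subsetI)
    fix p assume "p \<in> (\<Union>(j, k)\<in>taylor_support g. {(s, t). real j \<le> s \<and> real k \<le> t})"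
    then obtain j k where jk: "(j, k) \<in> taylor_support g" "real j \<le> fst p" "real k \<le> snd p" by auto
    have q1: "q \<le> real j + m * real k" using w jk(1) unfolding weight_ge_def by auto
    have q2: "m * real k \<le> m * snd p" using m jk by simp
    show "p \<in> ?C"
    proof (cases "?l p = q")
      case True
      then have "fst p = real j" "m * snd p = m * real k" "real j + m * real k = q" using q1 q2 jk by linarith+
      then have "p = ?v" using strict[OF jk(1)] m by (auto simp: prod_eq_iff)
      then show ?thesis by simp
    next
      case False
      then show ?thesis using q1 q2 jk by simp
    qed
  qed
  then have "p \<in> ?C" using p(1) by blast
  then show ?thesis using p(2) by simp
qed

text \<open>If some line meets the support only in a point \<open>(n, n)\<close> of the bisectrix, that point is a
vertex and the principal face. The principal part is then the monomial \<open>c x^n y^n\<close>, whose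
maximal order of vanishing on the unit circle is \<open>n\<close>, which is the distance.\<close>

lemma vertex_multiplicity:
  assumes f: "phase_function f" and \<phi>: "local_coordinates \<phi>" and n: "n \<ge> 1"
    and m: "m > 0" and w: "weight_ge (f \<circ> \<phi>) m q" and v: "real n + m * real n = q"
    and mem: "(n, n) \<in> taylor_support (f \<circ> \<phi>)"
    and strict: "\<And>j k. (j, k) \<in> taylor_support (f \<circ> \<phi>) \<Longrightarrow> real j + m * real k = q \<Longrightarrow> (j, k) = (n, n)"
  shows "newton_multiplicity f = 1"
proof -
  let ?g = "f \<circ> \<phi>"
  let ?N = "newton_polyhedron ?g" and ?v = "(real n, real n)"
  have vN: "?v \<in> ?N" by (rule newton_polyhedron_supportI[OF mem])
  have d: "newton_distance ?g = real n"
  proof (rule antisym)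
    show "newton_distance ?g \<le> real n" by (rule newton_distance_le[OF vN chart_finite_type[OF f \<phi>]])
    have "real n = q / (1 + m)" using v m by (simp add: field_simps)
    then show "real n \<le> newton_distance ?g"
      using newton_distance_ge[OF chart_finite_type[OF f \<phi>] _ w] m by simp
  qed
  have ge: "q \<le> fst p + m * snd p" if "p \<in> ?N" for p
    using newton_polyhedron_weight[of m ?g q "fst p" "snd p"] m w that by simp
  have only: "p = ?v" if "p \<in> ?N" "fst p + m * snd p \<le> q" for p
    by (rule newton_polyhedron_strict_vertex[OF m w v strict that])
  have ext: "?v extreme_point_of ?N"
    unfolding extreme_point_of_def
  proof (intro conjI ballI notI)
    fix a b assume ab: "a \<in> ?N" "b \<in> ?N" "?v \<in> open_segment a b"
    then obtain u where u: "a \<noteq> b" "0 < u" "u < 1" "?v = (1 - u) *\<^sub>R a + u *\<^sub>R b"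
      unfolding in_segment by blast
    have "real n = (1 - u) * fst a + u * fst b" "real n = (1 - u) * snd a + u * snd b"
      using arg_cong[OF u(4), of fst] arg_cong[OF u(4), of snd] by simp_all
    then have "q = ((1 - u) * fst a + u * fst b) + m * ((1 - u) * snd a + u * snd b)"
      using v by simp
    then have q: "q = (1 - u) * (fst a + m * snd a) + u * (fst b + m * snd b)"
      by (simp add: algebra_simps)
    have 1: "(1 - u) * q \<le> (1 - u) * (fst a + m * snd a)" "u * q \<le> u * (fst b + m * snd b)"
      using ge ab u by (auto intro: mult_left_mono)
    have "(1 - u) * q + u * q = q" by (simp add: algebra_simps)
    then have "(1 - u) * (fst a + m * snd a) \<le> (1 - u) * q" "u * (fst b + m * snd b) \<le> u * q"
      using 1 q by linarith+
    then have "fst a + m * snd a \<le> q" "fst b + m * snd b \<le> q" using u by auto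
    then have "a = ?v" "b = ?v" using only ab by blast+
    then show False using u(1) by simp
  qed (rule vN)
  have pf: "principal_face ?g = {?v}"
    unfolding principal_face_def Let_def d
  proof (rule the_equality)
    have "newton_face ?g {?v}" unfolding newton_face_def using ext by blast
    moreover have "aff_dim {?v} \<le> aff_dim G" if "?v \<in> G" for G
      using that by (intro aff_dim_subset) simp
    ultimately show "newton_face ?g {?v} \<and> ?v \<in> {?v} \<and> (\<forall>G. newton_face ?g G \<and> ?v \<in> G \<longrightarrow> aff_dim {?v} \<le> aff_dim G)"
      by blast
    fix F assume F: "newton_face ?g F \<and> ?v \<in> F \<and> (\<forall>G. newton_face ?g G \<and> ?v \<in> G \<longrightarrow> aff_dim F \<le> aff_dim G)"
    then have "aff_dim F \<le> aff_dim {?v}" using \<open>newton_face ?g {?v}\<close> by blast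
    then have "aff_dim F \<le> 0" by simp
    then have "\<not> F edge_of ?N" unfolding edge_of_def by auto
    then obtain p where "F = {p}" using F unfolding newton_face_def by blast
    then show "F = {?v}" using F by blast
  qed
  define c where "c = taylor_coeff ?g n n"
  have c: "c \<noteq> 0" using mem by (simp add: c_def taylor_support_def)
  have idx: "{(j, k). (real j, real k) \<in> {?v}} = {(n, n)}" by auto
  have pp: "principal_part ?g = monomial_fun c n n"
    unfolding principal_part_def pf idx by (auto simp: monomial_fun_def c_def fun_eq_iff)
  have mr: "max_root_order ?g = n"
    unfolding max_root_order_def pp
  proof (rule Max_eqI)
    have le: "y \<le> n" if y: "y \<in> vanishing_order (monomial_fun c n n) ` sphere (0, 0) 1" for y
    proof -
      obtain p where p: "p \<in> sphere (0, 0) 1" "y = vanishing_order (monomial_fun c n n) p" using y by blast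
      then have "p \<noteq> (0, 0)" by auto
      then show ?thesis using vanishing_order_monomial_fun[OF c] p by simp
    qed
    then show "\<And>y. y \<in> vanishing_order (monomial_fun c n n) ` sphere (0, 0) 1 \<Longrightarrow> y \<le> n" .
    show "finite (vanishing_order (monomial_fun c n n) ` sphere (0, 0) 1)"
      by (rule finite_subset[of _ "{..n}"]) (use le in auto)
    have "(1, 0) \<in> sphere (0 :: real, 0 :: real) (1 :: real)" by (simp add: dist_Pair_Pair dist_real_def)
    then show "n \<in> vanishing_order (monomial_fun c n n) ` sphere (0, 0) 1"
      using vanishing_order_monomial_fun_axis[OF c, of n] by (metis image_eqI)
  qed
  have "local_coordinates \<phi> \<and> bounded (principal_face ?g) \<and> real (max_root_order ?g) = newton_distance ?g"
    unfolding pf mr d using \<phi> by simp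
  then show ?thesis unfolding newton_multiplicity_def by (auto simp del: comp_apply)
qed

section \<open>Sublevel bounds\<close>

text \<open>Only \<open>\<epsilon> \<le> 1/2\<close> is considered so that \<open>ln (1/\<epsilon>)\<close> is bounded below by \<open>ln 2\<close>; a logarithm can
then always be inserted at the cost of a constant. Measurability of the region and continuity of
the function on it are included because all sublevel sets have to be measurable.\<close>

definition sublevel_bound :: "real \<Rightarrow> nat \<Rightarrow> (real \<times> real \<Rightarrow> real) \<Rightarrow> (real \<times> real) set \<Rightarrow> bool" where
  "sublevel_bound h l g R \<longleftrightarrow> R \<in> sets borel \<and> continuous_on R g \<and>
     (\<exists>A\<ge>0. \<forall>\<epsilon>. 0 < \<epsilon> \<longrightarrow> \<epsilon> \<le> 1 / 2 \<longrightarrow>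
        emeasure lborel {p\<in>R. \<bar>g p\<bar> \<le> \<epsilon>} \<le> ennreal (A * (\<epsilon> powr (1 / h) * ln (1 / \<epsilon>) ^ l)))"

lemma sublevel_measurable:
  assumes "R \<in> sets borel" "continuous_on R (g :: real \<times> real \<Rightarrow> real)"
  shows "{p\<in>R. \<bar>g p\<bar> \<le> \<epsilon>} \<in> sets borel"
proof -
  have "g \<in> borel_measurable (restrict_space borel R)"
    by (rule borel_measurable_continuous_on_restrict[OF assms(2)])
  then have "g -` {-\<epsilon>..\<epsilon>} \<inter> space (restrict_space borel R) \<in> sets (restrict_space borel R)"
    by (rule measurable_sets) simp
  also have "g -` {-\<epsilon>..\<epsilon>} \<inter> space (restrict_space borel R) = {p\<in>R. \<bar>g p\<bar> \<le> \<epsilon>}"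
    by (auto simp: space_restrict_space abs_le_iff)
  finally show ?thesis using assms(1) by (simp add: sets_restrict_space_iff)
qed

lemma sublevel_bound_subset:
  assumes "sublevel_bound h l g R" "R' \<subseteq> R" "R' \<in> sets borel"
  shows "sublevel_bound h l g R'"
proof -
  obtain A where A: "A \<ge> 0" "\<And>\<epsilon>. 0 < \<epsilon> \<Longrightarrow> \<epsilon> \<le> 1 / 2 \<Longrightarrow>
        emeasure lborel {p\<in>R. \<bar>g p\<bar> \<le> \<epsilon>} \<le> ennreal (A * (\<epsilon> powr (1 / h) * ln (1 / \<epsilon>) ^ l))"
    and R: "R \<in> sets borel" "continuous_on R g"
    using assms(1) unfolding sublevel_bound_def by blast
  have "emeasure lborel {p\<in>R'. \<bar>g p\<bar> \<le> \<epsilon>} \<le> ennreal (A * (\<epsilon> powr (1 / h) * ln (1 / \<epsilon>) ^ l))" if "0 < \<epsilon>" "\<epsilon> \<le> 1 / 2" for \<epsilon>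
    by (rule order_trans[OF emeasure_mono A(2)[OF that]]) (use assms(2) sublevel_measurable[OF R] in auto)
  then show ?thesis unfolding sublevel_bound_def
    using assms(3) continuous_on_subset[OF R(2) assms(2)] A(1) by blast
qed

lemma sublevel_bound_union:
  assumes 1: "sublevel_bound h l g R1" and 2: "sublevel_bound h l g R2" and c: "continuous_on (R1 \<union> R2) g"
  shows "sublevel_bound h l g (R1 \<union> R2)"
proof -
  let ?w = "\<lambda>\<epsilon>. \<epsilon> powr (1 / h) * ln (1 / \<epsilon>) ^ l"
  obtain A1 where A1: "A1 \<ge> 0" "\<And>\<epsilon>. 0 < \<epsilon> \<Longrightarrow> \<epsilon> \<le> 1 / 2 \<Longrightarrow> emeasure lborel {p\<in>R1. \<bar>g p\<bar> \<le> \<epsilon>} \<le> ennreal (A1 * ?w \<epsilon>)"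
    and R1: "R1 \<in> sets borel" "continuous_on R1 g"
    using 1 unfolding sublevel_bound_def by blast
  obtain A2 where A2: "A2 \<ge> 0" "\<And>\<epsilon>. 0 < \<epsilon> \<Longrightarrow> \<epsilon> \<le> 1 / 2 \<Longrightarrow> emeasure lborel {p\<in>R2. \<bar>g p\<bar> \<le> \<epsilon>} \<le> ennreal (A2 * ?w \<epsilon>)"
    and R2: "R2 \<in> sets borel" "continuous_on R2 g"
    using 2 unfolding sublevel_bound_def by blast
  have "emeasure lborel {p\<in>R1 \<union> R2. \<bar>g p\<bar> \<le> \<epsilon>} \<le> ennreal ((A1 + A2) * ?w \<epsilon>)" if e: "0 < \<epsilon>" "\<epsilon> \<le> 1 / 2" for \<epsilon>
  proof -
    have w0: "?w \<epsilon> \<ge> 0" using e by (intro mult_nonneg_nonneg zero_le_power ln_ge_zero) auto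
    have "{p\<in>R1 \<union> R2. \<bar>g p\<bar> \<le> \<epsilon>} = {p\<in>R1. \<bar>g p\<bar> \<le> \<epsilon>} \<union> {p\<in>R2. \<bar>g p\<bar> \<le> \<epsilon>}" by auto
    then have "emeasure lborel {p\<in>R1 \<union> R2. \<bar>g p\<bar> \<le> \<epsilon>} \<le> emeasure lborel {p\<in>R1. \<bar>g p\<bar> \<le> \<epsilon>} + emeasure lborel {p\<in>R2. \<bar>g p\<bar> \<le> \<epsilon>}"
      using sublevel_measurable[OF R1] sublevel_measurable[OF R2] by (simp add: emeasure_subadditive)
    also have "\<dots> \<le> ennreal (A1 * ?w \<epsilon>) + ennreal (A2 * ?w \<epsilon>)"
      by (intro add_mono A1 A2 e)
    also have "\<dots> = ennreal ((A1 + A2) * ?w \<epsilon>)"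
      using A1(1) A2(1) w0 by (simp add: distrib_right flip: ennreal_plus)
    finally show ?thesis .
  qed
  then show ?thesis unfolding sublevel_bound_def
    using R1 R2 c A1(1) A2(1) by (intro conjI sets.Un exI[of _ "A1 + A2"]) auto
qed

text \<open>The coordinate changes needed below (shears, the swap and the reflection) preserve Lebesgue measure, so
sublevel bounds are transported without a Jacobian.\<close>

lemma sublevel_bound_transform:
  assumes pres: "\<sigma> \<in> borel_measurable borel" "distr lborel borel \<sigma> = lborel"
    and R: "R \<in> sets borel" "continuous_on R g" and sub: "\<And>p. \<sigma> p \<in> R \<Longrightarrow> p \<in> R'"
    and b: "sublevel_bound h l (g \<circ> \<sigma>) R'"
  shows "sublevel_bound h l g R"
proof -
  obtain A where A: "A \<ge> 0" "\<And>\<epsilon>. 0 < \<epsilon> \<Longrightarrow> \<epsilon> \<le> 1 / 2 \<Longrightarrow>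
        emeasure lborel {p\<in>R'. \<bar>(g \<circ> \<sigma>) p\<bar> \<le> \<epsilon>} \<le> ennreal (A * (\<epsilon> powr (1 / h) * ln (1 / \<epsilon>) ^ l))"
    and R': "R' \<in> sets borel" "continuous_on R' (g \<circ> \<sigma>)"
    using b unfolding sublevel_bound_def by blast
  have "emeasure lborel {p\<in>R. \<bar>g p\<bar> \<le> \<epsilon>} \<le> ennreal (A * (\<epsilon> powr (1 / h) * ln (1 / \<epsilon>) ^ l))" if "0 < \<epsilon>" "\<epsilon> \<le> 1 / 2" for \<epsilon>
  proof -
    have "emeasure lborel {p\<in>R. \<bar>g p\<bar> \<le> \<epsilon>} = emeasure (distr lborel borel \<sigma>) {p\<in>R. \<bar>g p\<bar> \<le> \<epsilon>}" by (simp only: pres(2))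
    also have "\<dots> = emeasure lborel (\<sigma> -` {p\<in>R. \<bar>g p\<bar> \<le> \<epsilon>} \<inter> space lborel)"
      using pres(1) by (intro emeasure_distr sublevel_measurable R) simp
    also have "\<dots> \<le> emeasure lborel {p\<in>R'. \<bar>(g \<circ> \<sigma>) p\<bar> \<le> \<epsilon>}"
      using sub sublevel_measurable[OF R', of \<epsilon>] by (intro emeasure_mono) auto
    also have "\<dots> \<le> ennreal (A * (\<epsilon> powr (1 / h) * ln (1 / \<epsilon>) ^ l))" by (rule A(2)[OF that])
    finally show ?thesis .
  qed
  then show ?thesis unfolding sublevel_bound_def using R A(1) by blast
qed

lemma emeasure_by_sections:
  assumes "S \<in> sets (borel :: (real \<times> real) measure)"
  shows "emeasure lborel S = (\<integral>\<^sup>+x. emeasure lborel (Pair x -` S) \<partial>lborel)"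
    and "Pair x -` S \<in> sets borel"
proof -
  have S: "S \<in> sets (lborel \<Otimes>\<^sub>M lborel)" using assms by (simp only: lborel_prod sets_lborel)
  show "emeasure lborel S = (\<integral>\<^sup>+x. emeasure lborel (Pair x -` S) \<partial>lborel)"
    using lborel.emeasure_pair_measure_alt[OF S] by (simp only: lborel_prod)
  show "Pair x -` S \<in> sets borel"
    using sets_Pair1[OF S, of x] by simp
qed

lemma emeasure_sections:
  assumes "S \<in> sets (borel :: (real \<times> real) measure)" "\<And>x. emeasure lborel {y. (x, y) \<in> S} \<le> b x"
  shows "emeasure lborel S \<le> (\<integral>\<^sup>+x. b x \<partial>lborel)"
proof -
  have "emeasure lborel S = (\<integral>\<^sup>+x. emeasure lborel (Pair x -` S) \<partial>lborel)"
    by (rule emeasure_by_sections[OF assms(1)])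
  also have "\<dots> \<le> (\<integral>\<^sup>+x. b x \<partial>lborel)"
    using assms(2) by (intro nn_integral_mono) (simp add: vimage_def)
  finally show ?thesis .
qed

text \<open>Each vertical section is translated, and Lebesgue measure on the line is translation invariant.\<close>

lemma distr_shear: "shear c n \<in> borel_measurable borel" "distr lborel borel (shear c n) = lborel"
proof -
  show m: "shear c n \<in> borel_measurable borel"
    by (intro borel_measurable_continuous_onI smooth_on_continuous_on[OF smooth_on_shear])
  show "distr lborel borel (shear c n) = lborel"
  proof (rule measure_eqI)
    fix S assume "S \<in> sets (distr lborel borel (shear c n))"
    then have S: "S \<in> sets borel" by simp
    have S': "shear c n -` S \<in> sets borel" using measurable_sets[OF m S] by simp
    have sec: "emeasure lborel (Pair x -` (shear c n -` S)) = emeasure lborel (Pair x -` S)" for x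
    proof -
      have P: "Pair x -` S \<in> sets borel"
        by (rule emeasure_by_sections(2)[OF S])
      have "emeasure lborel (Pair x -` S) = emeasure (distr lborel borel ((+) (c * x ^ n))) (Pair x -` S)"
        by (simp only: lborel_distr_plus)
      also have "\<dots> = emeasure lborel ((+) (c * x ^ n) -` (Pair x -` S))"
        using P by (subst emeasure_distr) auto
      also have "(+) (c * x ^ n) -` (Pair x -` S) = Pair x -` (shear c n -` S)"
        by (auto simp: shear_def add.commute)
      finally show ?thesis by simp
    qed
    have "emeasure (distr lborel borel (shear c n)) S = emeasure lborel (shear c n -` S)"
      using m S by (subst emeasure_distr) auto
    also have "\<dots> = emeasure lborel S"
      unfolding emeasure_by_sections(1)[OF S] emeasure_by_sections(1)[OF S'] sec ..
    finally show "emeasure (distr lborel borel (shear c n)) S = emeasure lborel S" .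
  qed simp
qed

lemma distr_swap: "swap \<in> borel_measurable borel" "distr lborel borel swap = lborel"
proof -
  have c: "continuous_on UNIV swap" unfolding swap_def[abs_def] by (intro continuous_intros)
  show m: "swap \<in> borel_measurable borel" by (rule borel_measurable_continuous_onI[OF c])
  have "(lborel :: (real \<times> real) measure) = distr (lborel \<Otimes>\<^sub>M lborel) (lborel \<Otimes>\<^sub>M lborel) (\<lambda>(x, y). (y, x))"
    using lborel_pair.distr_pair_swap[where ?'a = real and ?'b = real] by (simp add: lborel_prod)
  also have "\<dots> = distr lborel borel swap"
    by (rule distr_cong) (simp_all only: lborel_prod sets_lborel, auto simp: swap_def)
  finally show "distr lborel borel swap = lborel" by simp
qed

lemma distr_reflect: "reflect \<in> borel_measurable borel" "distr lborel borel reflect = lborel"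
proof -
  have c: "continuous_on UNIV reflect" unfolding reflect_def[abs_def] by (intro continuous_intros)
  show m: "reflect \<in> borel_measurable borel" by (rule borel_measurable_continuous_onI[OF c])
  have "sigma_finite_measure (distr lborel borel (\<lambda>y::real. y))"
    by (simp add: distr_id2 sets_lborel lborel.sigma_finite_measure_axioms)
  then have "distr lborel borel uminus \<Otimes>\<^sub>M distr lborel borel (\<lambda>y. y) = 
      distr (lborel \<Otimes>\<^sub>M lborel) (borel \<Otimes>\<^sub>M borel) (\<lambda>(x::real, y::real). (- x, y))"
    by (intro pair_measure_distr) auto
  then have "(lborel :: (real \<times> real) measure) = distr lborel borel (\<lambda>(x::real, y::real). (- x, y))"
    by (simp add: lborel_distr_uminus lborel_prod borel_prod distr_id2)
  also have "(\<lambda>(x::real, y::real). (- x, y)) = reflect" by (auto simp: reflect_def fun_eq_iff)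
  finally show "distr lborel borel reflect = lborel" by simp
qed

lemma nn_integral_powr_0:
  assumes "a > -1" "c \<ge> 0"
  shows "(\<integral>\<^sup>+x. ennreal (indicator {0..c} x * x powr a) \<partial>lborel) = ennreal (c powr (a + 1) / (a + 1))"
proof (rule nn_integral_has_integral_lborel)
  show "((\<lambda>x. indicator {0..c} x * x powr a) has_integral (c powr (a + 1) / (a + 1))) UNIV"
    using has_integral_powr_from_0[OF assms]
    by (subst (asm) has_integral_restrict_UNIV[symmetric], elim has_integral_eq[rotated]) (auto simp: indicator_def)
qed auto

lemma nn_integral_powr_inf:
  assumes "a < -1" "c > 0"
  shows "(\<integral>\<^sup>+x. ennreal (indicator {c..} x * x powr a) \<partial>lborel) = ennreal (- (c powr (a + 1)) / (a + 1))"
proof (rule nn_integral_has_integral_lborel)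
  show "((\<lambda>x. indicator {c..} x * x powr a) has_integral (- (c powr (a + 1)) / (a + 1))) UNIV"
    using has_integral_powr_to_inf[OF assms]
    by (subst (asm) has_integral_restrict_UNIV[symmetric], elim has_integral_eq[rotated]) (auto simp: indicator_def)
qed auto

lemma nn_integral_inverse:
  assumes "0 < c" "c \<le> 1"
  shows "(\<integral>\<^sup>+x. ennreal (indicator {c..1} x * x powr (-1)) \<partial>lborel) = ennreal (ln (1 / c))"
proof (rule nn_integral_has_integral_lborel)
  have "((\<lambda>x. x powr (-1)) has_integral (ln 1 - ln c)) {c..1}"
  proof (rule fundamental_theorem_of_calculus)
    fix x assume "x \<in> {c..1}"
    then have "x > 0" using assms by auto
    then have "(ln has_real_derivative x powr (-1)) (at x within {c..1})"
      by (auto intro!: derivative_eq_intros simp: powr_minus divide_inverse)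
    then show "(ln has_vector_derivative x powr (-1)) (at x within {c..1})"
      by (simp add: has_real_derivative_iff_has_vector_derivative)
  qed (use assms in auto)
  moreover have "ln 1 - ln c = ln (1 / c)" using assms by (simp add: ln_div)
  ultimately have "((\<lambda>x. x powr (-1)) has_integral (ln (1 / c))) {c..1}" by (simp only:)
  then show "((\<lambda>x. indicator {c..1} x * x powr (-1)) has_integral (ln (1 / c))) UNIV"
    by (subst (asm) has_integral_restrict_UNIV[symmetric], elim has_integral_eq[rotated]) (auto simp: indicator_def)
qed auto

section \<open>Horns and their vertical sections\<close>

lemma log_absorb:
  fixes \<epsilon> h e :: real
  assumes "0 < \<epsilon>" "\<epsilon> \<le> 1 / 2" "1 / h \<le> e"
  shows "\<epsilon> powr e \<le> (1 / ln 2 ^ l) * (\<epsilon> powr (1 / h) * ln (1 / \<epsilon>) ^ l)"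
proof -
  have "ln 2 \<le> ln (1 / \<epsilon>)" using assms by (intro ln_mono) (auto simp: field_simps)
  then have "ln 2 ^ l \<le> ln (1 / \<epsilon>) ^ l" by (intro power_mono) auto
  moreover have p: "(0::real) < ln 2 ^ l" by simp
  ultimately have 1: "1 \<le> ln (1 / \<epsilon>) ^ l / ln 2 ^ l" by (simp only: le_divide_eq_1_pos)
  have "\<epsilon> powr e \<le> \<epsilon> powr (1 / h)" using assms by (intro powr_mono') auto
  then have "\<epsilon> powr e * 1 \<le> \<epsilon> powr (1 / h) * (ln (1 / \<epsilon>) ^ l / ln 2 ^ l)"
    using 1 by (intro mult_mono) auto
  then show ?thesis by simp
qed

text \<open>Up to a constant this bounds the measure of the vertical section at \<open>x\<close> of a sublevel set in a
horn. The factor \<open>x^m\<close> is the width of the horn, and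
\<open>x^m (\<epsilon> / x^q)^s\<close> with \<open>s = 1/N\<close> is the van der Corput bound at a root of order \<open>N\<close>.\<close>

definition section_majorant :: "real \<Rightarrow> real \<Rightarrow> real \<Rightarrow> real \<Rightarrow> real \<Rightarrow> real" where
  "section_majorant m q s \<epsilon> x = indicator {0..1} x * (x powr m * min 1 ((\<epsilon> / x powr q) powr s))"

lemma section_majorant_measurable [measurable]: "section_majorant m q s \<epsilon> \<in> borel_measurable borel"
  unfolding section_majorant_def[abs_def] by measurable

lemma section_majorant_nonneg: "section_majorant m q s \<epsilon> x \<ge> 0"
  unfolding section_majorant_def by simp

lemma section_majorant_power:
  fixes x \<epsilon> :: real
  assumes "x > 0" "\<epsilon> > 0"
  shows "x powr m * (\<epsilon> / x powr q) powr s = \<epsilon> powr s * x powr (m - q * s)"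
  using assms by (simp add: powr_divide powr_powr powr_diff)

text \<open>The horn width is used to the left of \<open>x0\<close> and the van der Corput bound to its right.\<close>

lemma section_majorant_le_split:
  assumes "\<epsilon> > 0" "x0 > 0"
  shows "section_majorant m q s \<epsilon> x \<le> indicator {0..x0} x * x powr m + \<epsilon> powr s * (indicator ({x0..} \<inter> {0..1}) x * x powr (m - q * s))"
proof (cases "x \<in> {0..1}")
  case True
  show ?thesis
  proof (cases "x \<le> x0")
    case True
    have le: "x powr m * min 1 ((\<epsilon> / x powr q) powr s) \<le> x powr m"
      using mult_left_mono[of "min 1 ((\<epsilon> / x powr q) powr s)" 1 "x powr m"] by simp
    have nn: "0 \<le> \<epsilon> powr s * (indicator ({x0..} \<inter> {0..1}) x * x powr (m - q * s))"
      by (intro mult_nonneg_nonneg powr_ge_zero indicator_pos_le)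
    have c: "section_majorant m q s \<epsilon> x = x powr m * min 1 ((\<epsilon> / x powr q) powr s)" and i: "indicator {0..x0} x = (1 :: real)"
      using True \<open>x \<in> {0..1}\<close> by (simp_all add: section_majorant_def)
    show ?thesis unfolding c i mult_1_left by (rule add_increasing2[OF nn le])
  next
    case False
    then have x: "x > 0" using assms by simp
    have "x powr m * min 1 ((\<epsilon> / x powr q) powr s) \<le> x powr m * (\<epsilon> / x powr q) powr s"
      by (intro mult_left_mono) auto
    also have "\<dots> = \<epsilon> powr s * x powr (m - q * s)" by (rule section_majorant_power[OF x assms(1)])
    finally show ?thesis using False \<open>x \<in> {0..1}\<close> by (simp add: section_majorant_def)
  qed
next
  case False
  then have c: "section_majorant m q s \<epsilon> x = 0" by (simp add: section_majorant_def)
  show ?thesis unfolding c by (intro add_nonneg_nonneg mult_nonneg_nonneg powr_ge_zero indicator_pos_le)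
qed

lemma nn_integral_section_majorant_le:
  assumes e: "\<epsilon> > 0" and x0: "x0 > 0" and m: "m > -1"
    and tail: "(\<integral>\<^sup>+x. ennreal (indicator ({x0..} \<inter> {0..1}) x * x powr (m - q * s)) \<partial>lborel) \<le> ennreal B" and B: "B \<ge> 0"
  shows "(\<integral>\<^sup>+x. ennreal (section_majorant m q s \<epsilon> x) \<partial>lborel) \<le> ennreal (x0 powr (m + 1) / (m + 1) + \<epsilon> powr s * B)"
proof -
  have "(\<integral>\<^sup>+x. ennreal (section_majorant m q s \<epsilon> x) \<partial>lborel) \<le>
     (\<integral>\<^sup>+x. (ennreal (indicator {0..x0} x * x powr m) + ennreal (\<epsilon> powr s) * ennreal (indicator ({x0..} \<inter> {0..1}) x * x powr (m - q * s))) \<partial>lborel)"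
  proof (intro nn_integral_mono)
    fix x
    have "ennreal (section_majorant m q s \<epsilon> x) \<le> ennreal (indicator {0..x0} x * x powr m + \<epsilon> powr s * (indicator ({x0..} \<inter> {0..1}) x * x powr (m - q * s)))"
      by (intro ennreal_leI section_majorant_le_split e x0)
    then show "ennreal (section_majorant m q s \<epsilon> x) \<le> ennreal (indicator {0..x0} x * x powr m) + ennreal (\<epsilon> powr s) * ennreal (indicator ({x0..} \<inter> {0..1}) x * x powr (m - q * s))"
      by (simp add: ennreal_plus ennreal_mult)
  qed
  also have "\<dots> = (\<integral>\<^sup>+x. ennreal (indicator {0..x0} x * x powr m) \<partial>lborel) 
      + ennreal (\<epsilon> powr s) * (\<integral>\<^sup>+x. ennreal (indicator ({x0..} \<inter> {0..1}) x * x powr (m - q * s)) \<partial>lborel)"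
    by (subst nn_integral_add) (auto simp: nn_integral_cmult)
  also have "\<dots> \<le> ennreal (x0 powr (m + 1) / (m + 1)) + ennreal (\<epsilon> powr s) * ennreal B"
    using nn_integral_powr_0[OF m, of x0] x0 by (intro add_mono mult_left_mono tail) auto
  also have "\<dots> = ennreal (x0 powr (m + 1) / (m + 1) + \<epsilon> powr s * B)"
    using B m x0 by (simp add: ennreal_plus ennreal_mult)
  finally show ?thesis .
qed

text \<open>The van der Corput bound is integrable at infinity but not at \<open>0\<close>. Splitting at
\<open>x0 = \<epsilon>^(1/q)\<close>, where both bounds agree, makes the two contributions equally large.\<close>

lemma section_majorant_integral_above:
  assumes m: "m > -1" and q: "q > 0" and s: "s * q > m + 1"
  shows "\<exists>A\<ge>0. \<forall>\<epsilon>. 0 < \<epsilon> \<longrightarrow> \<epsilon> \<le> 1 / 2 \<longrightarrow> (\<integral>\<^sup>+x. ennreal (section_majorant m q s \<epsilon> x) \<partial>lborel) \<le> ennreal (A * \<epsilon> powr ((m + 1) / q))"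
proof -
  define A where "A = 1 / (m + 1) + 1 / (q * s - m - 1)"
  have A: "A \<ge> 0" using m s by (simp add: A_def mult.commute)
  have "(\<integral>\<^sup>+x. ennreal (section_majorant m q s \<epsilon> x) \<partial>lborel) \<le> ennreal (A * \<epsilon> powr ((m + 1) / q))" if e: "0 < \<epsilon>" for \<epsilon>
  proof -
    \<comment> \<open>The two bounds in \<open>section_majorant\<close> agree at this point.\<close>
    define x0 where "x0 = \<epsilon> powr (1 / q)"
    have x0: "x0 > 0" using e by (simp add: x0_def)
    have "(\<integral>\<^sup>+x. ennreal (indicator ({x0..} \<inter> {0..1}) x * x powr (m - q * s)) \<partial>lborel)
       \<le> (\<integral>\<^sup>+x. ennreal (indicator {x0..} x * x powr (m - q * s)) \<partial>lborel)"
      by (intro nn_integral_mono ennreal_leI mult_right_mono) (auto simp: indicator_def)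
    also have "\<dots> = ennreal (- (x0 powr (m - q * s + 1)) / (m - q * s + 1))"
      using s x0 by (intro nn_integral_powr_inf) (auto simp: mult.commute)
    also have "- (x0 powr (m - q * s + 1)) / (m - q * s + 1) = x0 powr (m - q * s + 1) / (q * s - m - 1)"
      using s by (simp add: field_simps)
    finally have "(\<integral>\<^sup>+x. ennreal (section_majorant m q s \<epsilon> x) \<partial>lborel)
        \<le> ennreal (x0 powr (m + 1) / (m + 1) + \<epsilon> powr s * (x0 powr (m - q * s + 1) / (q * s - m - 1)))"
      using s by (intro nn_integral_section_majorant_le e x0 m) (auto simp: mult.commute)
    also have "\<epsilon> powr s * (x0 powr (m - q * s + 1) / (q * s - m - 1)) = \<epsilon> powr ((m + 1) / q) / (q * s - m - 1)"
    proof -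
      have "s + (1 / q) * (m - q * s + 1) = (m + 1) / q" using q by (simp add: field_simps)
      then have "\<epsilon> powr s * x0 powr (m - q * s + 1) = \<epsilon> powr ((m + 1) / q)"
        using e by (simp add: x0_def powr_powr flip: powr_add)
      then show ?thesis by simp
    qed
    also have "x0 powr (m + 1) = \<epsilon> powr ((m + 1) / q)" using e by (simp add: x0_def powr_powr)
    finally show ?thesis by (simp add: A_def algebra_simps)
  qed
  then show ?thesis using A by blast
qed

text \<open>In the critical case the exponent of the van der Corput bound is exactly \<open>-1\<close>, and the
integral from \<open>\<epsilon>^(1/q)\<close> to \<open>1\<close> produces the logarithm.\<close>

lemma section_majorant_integral_equal:
  assumes m: "m > -1" and q: "q > 0" and s: "s * q = m + 1"
  shows "\<exists>A\<ge>0. \<forall>\<epsilon>. 0 < \<epsilon> \<longrightarrow> \<epsilon> \<le> 1 / 2 \<longrightarrow> (\<integral>\<^sup>+x. ennreal (section_majorant m q s \<epsilon> x) \<partial>lborel) \<le> ennreal (A * (\<epsilon> powr s * ln (1 / \<epsilon>)))"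
proof -
  define A where "A = 1 / ((m + 1) * ln 2) + 1 / q"
  have A: "A \<ge> 0" using m q by (simp add: A_def)
  have "(\<integral>\<^sup>+x. ennreal (section_majorant m q s \<epsilon> x) \<partial>lborel) \<le> ennreal (A * (\<epsilon> powr s * ln (1 / \<epsilon>)))" if e: "0 < \<epsilon>" "\<epsilon> \<le> 1 / 2" for \<epsilon>
  proof -
    define x0 where "x0 = \<epsilon> powr (1 / q)"
    have x0: "x0 > 0" "x0 \<le> 1" using e q powr_mono2[of "1 / q" \<epsilon> 1] by (auto simp: x0_def)
    have ex: "m - q * s = -1" using s by (simp add: mult.commute)
    have set: "{x0..} \<inter> {0..1} = {x0..1}" using x0 by auto
    have "(\<integral>\<^sup>+x. ennreal (indicator ({x0..} \<inter> {0..1}) x * x powr (m - q * s)) \<partial>lborel) = ennreal (ln (1 / x0))"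
      unfolding ex set by (rule nn_integral_inverse[OF x0])
    then have "(\<integral>\<^sup>+x. ennreal (section_majorant m q s \<epsilon> x) \<partial>lborel) \<le> ennreal (x0 powr (m + 1) / (m + 1) + \<epsilon> powr s * ln (1 / x0))"
      using x0 by (intro nn_integral_section_majorant_le e m) auto
    also have "x0 powr (m + 1) = \<epsilon> powr s" using e q by (simp add: x0_def powr_powr s[symmetric])
    also have "ln (1 / x0) = ln (1 / \<epsilon>) / q" using e by (simp add: x0_def ln_div ln_powr)
    also have "ennreal (\<epsilon> powr s / (m + 1) + \<epsilon> powr s * (ln (1 / \<epsilon>) / q)) \<le> ennreal (A * (\<epsilon> powr s * ln (1 / \<epsilon>)))"
    proof (rule ennreal_leI)
      have "ln 2 \<le> ln (1 / \<epsilon>)" using e by (intro ln_mono) (auto simp: field_simps)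
      then have "1 \<le> ln (1 / \<epsilon>) / ln 2" by simp
      then have "\<epsilon> powr s / (m + 1) * 1 \<le> \<epsilon> powr s / (m + 1) * (ln (1 / \<epsilon>) / ln 2)"
        using m by (intro mult_left_mono) auto
      moreover have "A * (\<epsilon> powr s * ln (1 / \<epsilon>)) = \<epsilon> powr s / (m + 1) * (ln (1 / \<epsilon>) / ln 2) + \<epsilon> powr s * (ln (1 / \<epsilon>) / q)"
        by (simp add: A_def distrib_right)
      ultimately show "\<epsilon> powr s / (m + 1) + \<epsilon> powr s * (ln (1 / \<epsilon>) / q) \<le> A * (\<epsilon> powr s * ln (1 / \<epsilon>))" by simp
    qed
    finally show ?thesis .
  qed
  then show ?thesis using A by blast
qed

text \<open>Here the van der Corput bound is integrable at \<open>0\<close>, and the width of the horn is irrelevant.\<close>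

lemma section_majorant_integral_below:
  assumes m: "m > -1" and s: "s * q < m + 1"
  shows "\<exists>A\<ge>0. \<forall>\<epsilon>. 0 < \<epsilon> \<longrightarrow> \<epsilon> \<le> 1 / 2 \<longrightarrow> (\<integral>\<^sup>+x. ennreal (section_majorant m q s \<epsilon> x) \<partial>lborel) \<le> ennreal (A * \<epsilon> powr s)"
proof -
  define A where "A = 1 / (m - q * s + 1)"
  have A: "A \<ge> 0" using s by (simp add: A_def mult.commute)
  have "(\<integral>\<^sup>+x. ennreal (section_majorant m q s \<epsilon> x) \<partial>lborel) \<le> ennreal (A * \<epsilon> powr s)" if e: "0 < \<epsilon>" for \<epsilon>
  proof -
    have "section_majorant m q s \<epsilon> x \<le> \<epsilon> powr s * (indicator {0..1} x * x powr (m - q * s))" for x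
    proof (cases "0 < x \<and> x \<le> 1")
      case True
      have "x powr m * min 1 ((\<epsilon> / x powr q) powr s) \<le> x powr m * (\<epsilon> / x powr q) powr s"
        by (intro mult_left_mono) auto
      then show ?thesis using True section_majorant_power[of x \<epsilon> m q s] e by (simp add: section_majorant_def)
    next
      case False
      then consider "x = 0" | "x \<notin> {0..1}" by force
      then show ?thesis by cases (auto simp: section_majorant_def)
    qed
    then have "(\<integral>\<^sup>+x. ennreal (section_majorant m q s \<epsilon> x) \<partial>lborel) \<le> (\<integral>\<^sup>+x. ennreal (\<epsilon> powr s) * ennreal (indicator {0..1} x * x powr (m - q * s)) \<partial>lborel)"
      by (intro nn_integral_mono) (simp add: ennreal_mult[symmetric] ennreal_leI)
    also have "\<dots> = ennreal (\<epsilon> powr s) * ennreal (1 powr (m - q * s + 1) / (m - q * s + 1))"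
      using nn_integral_powr_0[of "m - q * s" 1] s by (simp add: nn_integral_cmult mult.commute)
    also have "\<dots> = ennreal (A * \<epsilon> powr s)" using s by (simp add: A_def mult.commute flip: ennreal_mult)
    finally show ?thesis .
  qed
  then show ?thesis using A by blast
qed

text \<open>A neighbourhood of the curve \<open>y = z x^m\<close> in the right half plane, whose width is
comparable to \<open>x^m\<close>; in the variable \<open>y / x^m\<close> it is the interval of radius \<open>\<delta>\<close> around \<open>z\<close>.\<close>

definition horn :: "real \<Rightarrow> real \<Rightarrow> real \<Rightarrow> real \<Rightarrow> (real \<times> real) set" where
  "horn m z \<delta> r = {(x, y). 0 < x \<and> x < r \<and> \<bar>y - z * x powr m\<bar> \<le> \<delta> * x powr m}"

lemma horn_measurable: "horn m z \<delta> r \<in> sets borel"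
proof -
  have f: "fst \<in> borel_measurable (borel :: (real \<times> real) measure)"
    by (rule borel_measurable_continuous_onI[OF continuous_on_fst[OF continuous_on_id]])
  have s: "snd \<in> borel_measurable (borel :: (real \<times> real) measure)"
    by (rule borel_measurable_continuous_onI[OF continuous_on_snd[OF continuous_on_id]])
  have gen: "{p \<in> space M. 0 < a p \<and> a p < r \<and> \<bar>b p - z * a p powr m\<bar> \<le> \<delta> * a p powr m} \<in> sets M"
    if [measurable]: "a \<in> borel_measurable M" "b \<in> borel_measurable M" for a b :: "real \<times> real \<Rightarrow> real" and M
    by measurable
  have "horn m z \<delta> r = {p \<in> space borel. 0 < fst p \<and> fst p < r \<and> \<bar>snd p - z * fst p powr m\<bar> \<le> \<delta> * fst p powr m}"
    by (auto simp: horn_def)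
  then show ?thesis by (simp only: gen[OF f s])
qed

lemma horn_mono:
  assumes "\<delta> \<le> \<delta>'" "r \<le> r'"
  shows "horn m z \<delta> r \<subseteq> horn m z \<delta>' r'"
proof (rule subrelI)
  fix x y assume "(x, y) \<in> horn m z \<delta> r"
  then have h: "0 < x" "x < r" "\<bar>y - z * x powr m\<bar> \<le> \<delta> * x powr m" by (simp_all add: horn_def)
  have l: "\<delta> * x powr m \<le> \<delta>' * x powr m" using assms by (intro mult_right_mono) auto
  show "(x, y) \<in> horn m z \<delta>' r'"
    using h(1,2) assms(2) order_trans[OF h(3) l] by (simp add: horn_def)
qed

lemma horn_subset_centered: "horn m z \<delta> r \<subseteq> horn m 0 (\<bar>z\<bar> + \<delta>) r"
proof (clarsimp simp: horn_def)
  fix x y assume "0 < x" and h: "\<bar>y - z * x powr m\<bar> \<le> \<delta> * x powr m"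
  have "\<bar>y\<bar> \<le> \<bar>y - z * x powr m\<bar> + \<bar>z * x powr m\<bar>" by linarith
  also have "\<dots> \<le> \<delta> * x powr m + \<bar>z\<bar> * x powr m" using h by (simp add: abs_mult)
  finally show "\<bar>y\<bar> \<le> (\<bar>z\<bar> + \<delta>) * x powr m" by (simp add: algebra_simps)
qed

lemma horn_domain:
  assumes V: "open V" "(0, 0) \<in> V" and m: "m \<ge> 1"
  shows "\<exists>r>0. r \<le> 1 \<and> horn m 0 B r \<subseteq> V"
proof -
  obtain \<delta> where \<delta>: "\<delta> > 0" "\<delta> \<le> 1" "{-\<delta>..\<delta>} \<times> {-\<delta>..\<delta>} \<subseteq> V"
    using open_contains_square[OF V] by blast
  define r where "r = \<delta> / (1 + \<bar>B\<bar>)"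
  have r: "r > 0" "r \<le> \<delta>" "r * (1 + \<bar>B\<bar>) = \<delta>" using \<delta> by (auto simp: r_def field_simps)
  have "horn m 0 B r \<subseteq> V"
  proof (clarsimp simp: horn_def)
    fix x y assume x: "0 < x" "x < r" and y: "\<bar>y\<bar> \<le> B * x powr m"
    have "x powr m \<le> x powr 1" using x r \<delta> m by (intro powr_mono') auto
    then have xm: "x powr m \<le> x" using x by simp
    have "B * x powr m \<le> \<bar>B\<bar> * x powr m" by (intro mult_right_mono) auto
    also have "\<dots> \<le> \<bar>B\<bar> * x" using xm by (intro mult_left_mono) auto
    also have "\<dots> \<le> \<bar>B\<bar> * r" using x by (intro mult_left_mono) auto
    also have "\<dots> \<le> \<delta>" using r by (simp add: algebra_simps)
    finally have "\<bar>y\<bar> \<le> \<delta>" using y by simp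
    then show "(x, y) \<in> V" using x r by (intro subsetD[OF \<delta>(3)]) auto
  qed
  then show ?thesis using r \<delta> by (intro exI[of _ r]) auto
qed

lemma horn_continuous:
  assumes "germ_smooth g" "m \<ge> 1"
  shows "\<exists>r>0. continuous_on (horn m 0 B r) g"
proof -
  obtain V where V: "open V" "(0, 0) \<in> V" "smooth_on V g" using assms(1) unfolding germ_smooth_def by blast
  obtain r where "r > 0" "horn m 0 B r \<subseteq> V" using horn_domain[OF V(1,2) assms(2)] by blast
  then show ?thesis using smooth_on_continuous_on[OF V(3)] continuous_on_subset by blast
qed

lemma poly_pderiv_order_nonzero:
  fixes P :: "real poly"
  assumes "P \<noteq> 0"
  shows "poly ((pderiv ^^ order z P) P) z \<noteq> 0"
  using assms
proof (induction "order z P" arbitrary: P)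
  case 0
  then show ?case by (metis funpow_0 order_root)
next
  case (Suc n)
  have o: "order z P \<noteq> 0" using Suc.hyps(2) by simp
  have "pderiv P \<noteq> 0"
  proof
    assume "pderiv P = 0"
    then have "degree P = 0" by (simp add: pderiv_eq_0_iff)
    then have "order z P \<le> 0" using order_degree[OF Suc.prems, of z] by simp
    then show False using o by simp
  qed
  moreover have "order z P = Suc (order z (pderiv P))"
    using o Suc.prems by (intro order_pderiv) (auto simp: order_root)
  ultimately show ?case using Suc.hyps(1)[of "pderiv P"] Suc.hyps(2) by (simp add: funpow_swap1)
qed

text \<open>Differentiating \<open>N\<close> times in \<open>y\<close> differentiates the edge polynomial \<open>N\<close> times, and at a root
of order \<open>N\<close> the result does not vanish. By \<open>weighted_limit\<close> the derivative of \<open>g\<close> thus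
keeps its sign and its size \<open>x^(q - m N)\<close> in a thin horn. For \<open>N = 0\<close> this is a lower
bound for \<open>g\<close> itself.\<close>

lemma deriv_lower_bound:
  assumes g: "germ_smooth g" and m: "m \<ge> 1" and w: "weight_ge g m q" and P: "edge_poly g m q \<noteq> 0"
    and N: "N = order z0 (edge_poly g m q)"
  shows "\<exists>c>0. \<exists>\<delta>>0. \<exists>r>0. \<exists>\<sigma>\<in>{-1, 1}. \<forall>x y. (x, y) \<in> horn m z0 \<delta> r \<longrightarrow> c * x powr (q - m * real N) \<le> \<sigma> * (D2 ^^ N) g (x, y)"
proof -
  let ?G = "(D2 ^^ N) g" and ?q = "q - m * real N"
  define PN where "PN = (pderiv ^^ N) (edge_poly g m q)"
  have ep: "edge_poly ?G m ?q = PN" unfolding PN_def using m by (intro edge_poly_D2_iter) simp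
  have nz: "poly PN z0 \<noteq> 0" unfolding PN_def N by (rule poly_pderiv_order_nonzero[OF P])
  define c where "c = \<bar>poly PN z0\<bar>"
  have c: "c > 0" using nz by (simp add: c_def)
  define \<sigma> :: real where "\<sigma> = sgn (poly PN z0)"
  have \<sigma>: "\<sigma> \<in> {-1, 1}" "\<sigma> * poly PN z0 = c" "\<bar>\<sigma>\<bar> = 1" using nz by (auto simp: \<sigma>_def c_def sgn_if)
  have "continuous (at z0) (poly PN)" by (simp add: poly_isCont)
  then obtain \<delta>0 where \<delta>0: "\<delta>0 > 0" "\<And>z. dist z z0 < \<delta>0 \<Longrightarrow> dist (poly PN z) (poly PN z0) < c / 4"
    using c unfolding continuous_at_eps_delta by (metis zero_less_divide_iff zero_less_numeral)
  define \<delta> where "\<delta> = min 1 (\<delta>0 / 2)"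
  have \<delta>: "\<delta> > 0" "\<delta> \<le> 1" "\<delta> < \<delta>0" using \<delta>0 by (auto simp: \<delta>_def)
  define B where "B = \<bar>z0\<bar> + 1"
  have "uniform_limit {-B..B} (\<lambda>x z. ?G (x, x powr m * z) / x powr ?q) (poly PN) (at_right 0)"
    unfolding ep[symmetric] by (rule weighted_limit[OF germ_smooth_D2_iter[OF g] m weight_ge_D2_iter[OF w]])
  then have "\<forall>\<^sub>F x in at_right 0. \<forall>z\<in>{-B..B}. dist (?G (x, x powr m * z) / x powr ?q) (poly PN z) < c / 4"
    using c by (intro uniform_limitD) auto
  then obtain r where r: "r > 0" "\<And>x z. 0 < x \<Longrightarrow> x < r \<Longrightarrow> z \<in> {-B..B} \<Longrightarrow> dist (?G (x, x powr m * z) / x powr ?q) (poly PN z) < c / 4"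
    unfolding eventually_at_right_field by blast
  have "c / 2 * x powr ?q \<le> \<sigma> * ?G (x, y)" if h: "(x, y) \<in> horn m z0 \<delta> r" for x y
  proof -
    have x: "0 < x" "x < r" and y: "\<bar>y - z0 * x powr m\<bar> \<le> \<delta> * x powr m" using h by (auto simp: horn_def)
    have xm: "x powr m > 0" using x by simp
    define z where "z = y / x powr m"
    have yz: "y = x powr m * z" using xm by (simp add: z_def)
    have "\<bar>z - z0\<bar> * x powr m = \<bar>(z - z0) * x powr m\<bar>" using xm by (simp add: abs_mult)
    also have "(z - z0) * x powr m = y - z0 * x powr m" by (simp add: yz algebra_simps)
    finally have "\<bar>z - z0\<bar> * x powr m = \<bar>y - z0 * x powr m\<bar>" .
    then have "\<bar>z - z0\<bar> * x powr m \<le> \<delta> * x powr m" using y by simp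
    then have zd: "\<bar>z - z0\<bar> \<le> \<delta>" using xm by simp
    have "z \<in> {-B..B}" using zd \<delta> by (auto simp: B_def abs_le_iff)
    then have 1: "\<bar>?G (x, y) / x powr ?q - poly PN z\<bar> < c / 4" using r(2)[OF x, of z] by (simp add: yz dist_real_def)
    have 2: "\<bar>poly PN z - poly PN z0\<bar> < c / 4" using \<delta>0(2)[of z] zd \<delta> by (simp add: dist_real_def)
    have "\<bar>\<sigma> * (?G (x, y) / x powr ?q) - c\<bar> = \<bar>\<sigma> * (?G (x, y) / x powr ?q - poly PN z0)\<bar>"
      using \<sigma>(2) by (simp add: algebra_simps)
    also have "\<dots> = \<bar>?G (x, y) / x powr ?q - poly PN z0\<bar>" using \<sigma>(3) by (simp only: abs_mult mult_1_left)
    also have "\<dots> < c / 2" using 1 2 by linarith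
    finally have "c / 2 \<le> \<sigma> * (?G (x, y) / x powr ?q)" by linarith
    then have "c / 2 \<le> (\<sigma> * ?G (x, y)) / x powr ?q" by simp
    then show ?thesis using x by (simp add: pos_le_divide_eq)
  qed
  then show ?thesis using c \<delta>(1) r(1) \<sigma>(1) by (intro exI[of _ "c / 2"] conjI exI[of _ \<delta>] exI[of _ r] bexI[of _ \<sigma>]) auto
qed

lemma van_der_corput_sublevel:
  assumes "N \<ge> 1"
  shows "\<exists>C>0. \<forall>(g :: nat \<Rightarrow> real \<Rightarrow> real) a b c \<epsilon> \<sigma>. 0 < c \<longrightarrow> 0 < \<epsilon> \<longrightarrow> \<sigma> \<in> {-1, 1} \<longrightarrow>
     (\<forall>i<N. \<forall>y\<in>{a..b}. (g i has_real_derivative g (Suc i) y) (at y within {a..b})) \<longrightarrow>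
     (\<forall>y\<in>{a..b}. c \<le> \<sigma> * g N y) \<longrightarrow>
     emeasure lborel {y\<in>{a..b}. \<bar>g 0 y\<bar> \<le> \<epsilon>} \<le> ennreal (C * (\<epsilon> / c) powr (1 / real N))"
proof -
  obtain n where n: "N = Suc n" using assms by (cases N) auto
  obtain C where C: "C > 0" "\<forall>(g :: nat \<Rightarrow> real \<Rightarrow> real) a b c \<epsilon>. 0 < c \<longrightarrow> 0 < \<epsilon> \<longrightarrow>
     (\<forall>i\<le>n. \<forall>y\<in>{a..b}. (g i has_real_derivative g (Suc i) y) (at y within {a..b})) \<longrightarrow>
     (\<forall>y\<in>{a..b}. c \<le> g (Suc n) y) \<longrightarrow>
     emeasure lborel {y\<in>{a..b}. \<bar>g 0 y\<bar> \<le> \<epsilon>} \<le> ennreal (C * (\<epsilon> / c) powr (1 / real (Suc n)))"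
    using van_der_corput_pos[of n] by (elim exE conjE)
  have "emeasure lborel {y\<in>{a..b}. \<bar>g 0 y\<bar> \<le> \<epsilon>} \<le> ennreal (C * (\<epsilon> / c) powr (1 / real N))"
    if c: "0 < c" "0 < \<epsilon>" and s: "\<sigma> \<in> {-1, 1}"
      and d: "\<forall>i<N. \<forall>y\<in>{a..b}. (g i has_real_derivative g (Suc i) y) (at y within {a..b})"
      and l: "\<forall>y\<in>{a..b}. c \<le> \<sigma> * g N y" for g :: "nat \<Rightarrow> real \<Rightarrow> real" and a b c \<epsilon> \<sigma>
  proof -
    have "((\<lambda>y. \<sigma> * g i y) has_real_derivative \<sigma> * g (Suc i) y) (at y within {a..b})" if "i \<le> n" "y \<in> {a..b}" for i y
      using d that n by (intro DERIV_cmult) auto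
    then have "emeasure lborel {y\<in>{a..b}. \<bar>\<sigma> * g 0 y\<bar> \<le> \<epsilon>} \<le> ennreal (C * (\<epsilon> / c) powr (1 / real (Suc n)))"
      using C(2)[rule_format, where g = "\<lambda>i y. \<sigma> * g i y" and a = a and b = b and c = c and \<epsilon> = \<epsilon>] c l n by simp
    moreover have "\<bar>\<sigma> * g 0 y\<bar> = \<bar>g 0 y\<bar>" for y using s by (auto simp: abs_mult)
    ultimately show ?thesis unfolding n by simp
  qed
  then show ?thesis using C(1) by (intro exI[of _ C] conjI allI impI) auto
qed

text \<open>For \<open>N \<ge> 1\<close> this is van der Corput's estimate on the section, compared with the trivial bound
by the width of the horn. For \<open>N = 0\<close> the section is empty as soon as
\<open>\<epsilon> < c x^q\<close>, so any exponent \<open>s > 0\<close> is admissible.\<close>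

lemma section_bound:
  assumes g: "germ_smooth g" and m: "m \<ge> 1" and w: "weight_ge g m q" and P: "edge_poly g m q \<noteq> 0"
    and N: "N = order z0 (edge_poly g m q)" and s: "s > 0" "N \<ge> 1 \<Longrightarrow> s = 1 / real N"
  shows "\<exists>\<delta>>0. \<exists>r>0. r \<le> 1 \<and> continuous_on (horn m z0 \<delta> r) g \<and> (\<exists>A\<ge>0. \<forall>\<epsilon>>0. \<forall>x.
    emeasure lborel {y. (x, y) \<in> {p \<in> horn m z0 \<delta> r. \<bar>g p\<bar> \<le> \<epsilon>}} \<le> ennreal (A * section_majorant m q s \<epsilon> x))"
proof -
  obtain c \<delta> r0 \<sigma> where c: "c > 0" and \<delta>: "\<delta> > 0" and r0: "r0 > 0" and \<sigma>: "\<sigma> \<in> {-1, 1}"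
    and low: "\<And>x y. (x, y) \<in> horn m z0 \<delta> r0 \<Longrightarrow> c * x powr (q - m * real N) \<le> \<sigma> * (D2 ^^ N) g (x, y)"
    using deriv_lower_bound[OF g m w P N] by blast
  obtain V where V: "open V" "(0, 0) \<in> V" "smooth_on V g" using g unfolding germ_smooth_def by blast
  obtain r1 where r1: "r1 > 0" "r1 \<le> 1" "horn m 0 (\<bar>z0\<bar> + \<delta>) r1 \<subseteq> V" using horn_domain[OF V(1,2) m] by blast
  define r where "r = min r0 r1"
  have r: "r > 0" "r \<le> 1" using r0 r1 by (auto simp: r_def)
  have HV: "horn m z0 \<delta> r \<subseteq> V"
    using horn_subset_centered[of m z0 \<delta> r] horn_mono[of "\<bar>z0\<bar> + \<delta>" "\<bar>z0\<bar> + \<delta>" r r1 m 0] r1(3) by (auto simp: r_def)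
  have H0: "horn m z0 \<delta> r \<subseteq> horn m z0 \<delta> r0" by (rule horn_mono) (auto simp: r_def)
  have cont: "continuous_on (horn m z0 \<delta> r) g"
    by (rule continuous_on_subset[OF smooth_on_continuous_on[OF V(3)] HV])
  have outside: "{y. (x, y) \<in> {p \<in> horn m z0 \<delta> r. \<bar>g p\<bar> \<le> \<epsilon>}} = {}" if "\<not> (0 < x \<and> x < r)" for x \<epsilon>
    using that by (auto simp: horn_def)
  have width: "emeasure lborel {y. (x, y) \<in> {p \<in> horn m z0 \<delta> r. \<bar>g p\<bar> \<le> \<epsilon>}} \<le> ennreal (2 * \<delta> * x powr m)" for x \<epsilon>
  proof -
    have "{y. (x, y) \<in> {p \<in> horn m z0 \<delta> r. \<bar>g p\<bar> \<le> \<epsilon>}} \<subseteq> {z0 * x powr m - \<delta> * x powr m..z0 * x powr m + \<delta> * x powr m}"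
      by (auto simp: horn_def abs_le_iff)
    then have "emeasure lborel {y. (x, y) \<in> {p \<in> horn m z0 \<delta> r. \<bar>g p\<bar> \<le> \<epsilon>}} \<le> emeasure lborel {z0 * x powr m - \<delta> * x powr m..z0 * x powr m + \<delta> * x powr m}"
      by (rule emeasure_mono) simp
    also have "\<dots> = ennreal (2 * \<delta> * x powr m)" using \<delta> by simp
    finally show ?thesis .
  qed
  have "\<exists>A\<ge>0. \<forall>\<epsilon>>0. \<forall>x. emeasure lborel {y. (x, y) \<in> {p \<in> horn m z0 \<delta> r. \<bar>g p\<bar> \<le> \<epsilon>}} \<le> ennreal (A * section_majorant m q s \<epsilon> x)"
  proof (cases "N = 0")
    case True
    define A where "A = 2 * \<delta> * max 1 ((1 / c) powr s)"
    have A: "A \<ge> 0" using \<delta> by (simp add: A_def)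
    have "emeasure lborel {y. (x, y) \<in> {p \<in> horn m z0 \<delta> r. \<bar>g p\<bar> \<le> \<epsilon>}} \<le> ennreal (A * section_majorant m q s \<epsilon> x)" if e: "\<epsilon> > 0" for x \<epsilon>
    proof (cases "0 < x \<and> x < r")
      case x: True
      show ?thesis
      proof (cases "\<epsilon> < c * x powr q")
        case small: True
        have "{y. (x, y) \<in> {p \<in> horn m z0 \<delta> r. \<bar>g p\<bar> \<le> \<epsilon>}} = {}"
        proof (rule ccontr)
          assume "\<not> ?thesis"
          then obtain y where y: "(x, y) \<in> horn m z0 \<delta> r" "\<bar>g (x, y)\<bar> \<le> \<epsilon>" by auto
          have "c * x powr q \<le> \<sigma> * g (x, y)" using low[of x y] y(1) H0 True by auto
          also have "\<dots> \<le> \<bar>g (x, y)\<bar>" using \<sigma> by auto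
          finally show False using y(2) small by simp
        qed
        then show ?thesis by (simp only:) simp
      next
        case False
        have xq: "x powr q > 0" using x by simp
        have "c \<le> \<epsilon> / x powr q" using False xq by (simp add: pos_le_divide_eq)
        then have "c powr s \<le> (\<epsilon> / x powr q) powr s" using c s by (intro powr_mono2) auto
        then have "(1 / c) powr s * c powr s \<le> (1 / c) powr s * (\<epsilon> / x powr q) powr s"
          by (rule mult_left_mono) simp
        moreover have "(1 / c) powr s * c powr s = 1" using c by (simp flip: powr_mult)
        ultimately have "1 \<le> (1 / c) powr s * (\<epsilon> / x powr q) powr s" by (simp only:)
        then have "1 \<le> max 1 ((1 / c) powr s) * min 1 ((\<epsilon> / x powr q) powr s)"
        proof (cases "(\<epsilon> / x powr q) powr s \<ge> 1")
          case False
          have "(1 / c) powr s * (\<epsilon> / x powr q) powr s \<le> max 1 ((1 / c) powr s) * (\<epsilon> / x powr q) powr s"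
            by (intro mult_right_mono) auto
          then show ?thesis using False \<open>1 \<le> (1 / c) powr s * (\<epsilon> / x powr q) powr s\<close> by simp
        qed simp
        then have "2 * \<delta> * x powr m * 1 \<le> 2 * \<delta> * x powr m * (max 1 ((1 / c) powr s) * min 1 ((\<epsilon> / x powr q) powr s))"
          using \<delta> by (intro mult_left_mono) auto
        also have "\<dots> = A * section_majorant m q s \<epsilon> x" using x r by (simp add: A_def section_majorant_def)
        finally show ?thesis using width[of x \<epsilon>] by (simp add: order_trans[OF _ ennreal_leI])
      qed
    next
      case False
      show ?thesis unfolding outside[OF False] by simp
    qed
    then show ?thesis using A by blast
  next
    case False
    then have N1: "N \<ge> 1" by simp
    have sN: "s = 1 / real N" by (rule s(2)[OF N1])
    obtain C where C: "C > 0" "\<forall>(g :: nat \<Rightarrow> real \<Rightarrow> real) a b c \<epsilon> \<sigma>. 0 < c \<longrightarrow> 0 < \<epsilon> \<longrightarrow> \<sigma> \<in> {-1, 1} \<longrightarrow>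
     (\<forall>i<N. \<forall>y\<in>{a..b}. (g i has_real_derivative g (Suc i) y) (at y within {a..b})) \<longrightarrow>
     (\<forall>y\<in>{a..b}. c \<le> \<sigma> * g N y) \<longrightarrow>
     emeasure lborel {y\<in>{a..b}. \<bar>g 0 y\<bar> \<le> \<epsilon>} \<le> ennreal (C * (\<epsilon> / c) powr (1 / real N))"
      using van_der_corput_sublevel[OF N1] by (elim exE conjE)
    define A where "A = max (2 * \<delta>) (C * (1 / c) powr s)"
    have A: "A \<ge> 0" using \<delta> by (simp add: A_def)
    have "emeasure lborel {y. (x, y) \<in> {p \<in> horn m z0 \<delta> r. \<bar>g p\<bar> \<le> \<epsilon>}} \<le> ennreal (A * section_majorant m q s \<epsilon> x)" if e: "\<epsilon> > 0" for x \<epsilon>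
    proof (cases "0 < x \<and> x < r")
      case x: True
      let ?a = "z0 * x powr m - \<delta> * x powr m" and ?b = "z0 * x powr m + \<delta> * x powr m"
      have inH: "(x, y) \<in> horn m z0 \<delta> r" if "y \<in> {?a..?b}" for y using that x by (auto simp: horn_def abs_le_iff)
      have set: "{y. (x, y) \<in> {p \<in> horn m z0 \<delta> r. \<bar>g p\<bar> \<le> \<epsilon>}} = {y \<in> {?a..?b}. \<bar>g (x, y)\<bar> \<le> \<epsilon>}"
        using x by (auto simp: horn_def abs_le_iff)
      let ?c = "c * x powr (q - m * real N)"
      have c': "?c > 0" using c x by simp
      have der: "\<forall>i<N. \<forall>y\<in>{?a..?b}. ((\<lambda>y. (D2 ^^ i) g (x, y)) has_real_derivative (D2 ^^ Suc i) g (x, y)) (at y within {?a..?b})"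
      proof (intro allI impI ballI)
        fix i y assume "y \<in> {?a..?b}"
        then have "(x, y) \<in> V" using inH HV by blast
        then have "((\<lambda>y. (D2 ^^ i) g (x, y)) has_real_derivative D2 ((D2 ^^ i) g) (x, y)) (at y)"
          by (rule has_real_derivative_D2[OF smooth_on_D2_iter[OF V(3)]])
        then show "((\<lambda>y. (D2 ^^ i) g (x, y)) has_real_derivative (D2 ^^ Suc i) g (x, y)) (at y within {?a..?b})"
          by (simp add: has_field_derivative_at_within)
      qed
      have lw: "\<forall>y\<in>{?a..?b}. ?c \<le> \<sigma> * (D2 ^^ N) g (x, y)"
        using low inH H0 by blast
      have "emeasure lborel {y\<in>{?a..?b}. \<bar>(D2 ^^ 0) g (x, y)\<bar> \<le> \<epsilon>} \<le> ennreal (C * (\<epsilon> / ?c) powr (1 / real N))"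
        using C(2)[THEN spec[of _ "\<lambda>i y. (D2 ^^ i) g (x, y)"], THEN spec[of _ ?a], THEN spec[of _ ?b], THEN spec[of _ ?c], THEN spec[of _ \<epsilon>], THEN spec[of _ \<sigma>]]
          c' e \<sigma> der lw by blast
      then have b1: "emeasure lborel {y. (x, y) \<in> {p \<in> horn m z0 \<delta> r. \<bar>g p\<bar> \<le> \<epsilon>}} \<le> ennreal (C * (\<epsilon> / ?c) powr (1 / real N))"
        unfolding set by simp
      have "\<epsilon> / ?c = (1 / c) * (\<epsilon> / x powr q) * x powr (m * real N)"
        using x by (simp add: powr_diff)
      then have "(\<epsilon> / ?c) powr s = (1 / c) powr s * (\<epsilon> / x powr q) powr s * (x powr (m * real N)) powr s"
        using c e by (simp only: powr_mult)
      also have "(x powr (m * real N)) powr s = x powr m" using N1 by (simp add: powr_powr sN)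
      finally have eq: "C * (\<epsilon> / ?c) powr (1 / real N) = (C * (1 / c) powr s) * (x powr m * (\<epsilon> / x powr q) powr s)"
        unfolding sN[symmetric] by simp
      have section_majorant: "A * section_majorant m q s \<epsilon> x = A * (x powr m * min 1 ((\<epsilon> / x powr q) powr s))"
        using x r by (simp add: section_majorant_def)
      show ?thesis
      proof (cases "(\<epsilon> / x powr q) powr s \<le> 1")
        case True
        have "(C * (1 / c) powr s) * (x powr m * (\<epsilon> / x powr q) powr s) \<le> A * section_majorant m q s \<epsilon> x"
          unfolding section_majorant using True by (simp add: A_def mult_right_mono)
        then show ?thesis using order_trans[OF b1[unfolded eq] ennreal_leI] by blast
      next
        case False
        have "2 * \<delta> * x powr m \<le> A * section_majorant m q s \<epsilon> x"
          unfolding section_majorant using False by (simp add: A_def mult_right_mono)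
        then show ?thesis using order_trans[OF width[of x \<epsilon>] ennreal_leI] by blast
      qed
    next
      case False
      show ?thesis unfolding outside[OF False] by simp
    qed
    then show ?thesis using A by blast
  qed
  then show ?thesis using \<delta> r cont by blast
qed

lemma horn_bound_of_section_majorant:
  assumes cont: "continuous_on (horn m z0 \<delta> r) g"
    and A: "A \<ge> 0" "\<And>\<epsilon> x. \<epsilon> > 0 \<Longrightarrow> emeasure lborel {y. (x, y) \<in> {p \<in> horn m z0 \<delta> r. \<bar>g p\<bar> \<le> \<epsilon>}} \<le> ennreal (A * section_majorant m q s \<epsilon> x)"
    and B: "B \<ge> 0" "\<And>\<epsilon>. 0 < \<epsilon> \<Longrightarrow> \<epsilon> \<le> 1 / 2 \<Longrightarrow> (\<integral>\<^sup>+x. ennreal (section_majorant m q s \<epsilon> x) \<partial>lborel) \<le> ennreal (B * (\<epsilon> powr (1 / h) * ln (1 / \<epsilon>) ^ l))"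
  shows "sublevel_bound h l g (horn m z0 \<delta> r)"
proof -
  have "emeasure lborel {p \<in> horn m z0 \<delta> r. \<bar>g p\<bar> \<le> \<epsilon>} \<le> ennreal ((A * B) * (\<epsilon> powr (1 / h) * ln (1 / \<epsilon>) ^ l))" if e: "0 < \<epsilon>" "\<epsilon> \<le> 1 / 2" for \<epsilon>
  proof -
    have "emeasure lborel {p \<in> horn m z0 \<delta> r. \<bar>g p\<bar> \<le> \<epsilon>} \<le> (\<integral>\<^sup>+x. ennreal (A * section_majorant m q s \<epsilon> x) \<partial>lborel)"
      by (rule emeasure_sections[OF sublevel_measurable[OF horn_measurable cont] A(2)[OF e(1)]])
    also have "\<dots> = ennreal A * (\<integral>\<^sup>+x. ennreal (section_majorant m q s \<epsilon> x) \<partial>lborel)"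
      using A(1) section_majorant_nonneg by (simp add: ennreal_mult nn_integral_cmult)
    also have "\<dots> \<le> ennreal A * ennreal (B * (\<epsilon> powr (1 / h) * ln (1 / \<epsilon>) ^ l))"
      by (intro mult_left_mono B(2) e) simp
    also have "\<dots> = ennreal ((A * B) * (\<epsilon> powr (1 / h) * ln (1 / \<epsilon>) ^ l))"
    proof -
      have "0 \<le> \<epsilon> powr (1 / h) * ln (1 / \<epsilon>) ^ l" using e by (intro mult_nonneg_nonneg zero_le_power ln_ge_zero) auto
      then show ?thesis using A(1) B(1) by (simp add: ennreal_mult[symmetric] mult.assoc)
    qed
    finally show ?thesis .
  qed
  then show ?thesis unfolding sublevel_bound_def using horn_measurable cont A(1) B(1)
    by (intro conjI exI[of _ "A * B"]) auto
qed

text \<open>The three cases compare the order \<open>N\<close> of the root with \<open>d = q / (1 + m)\<close>; they are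
\<open>N < d\<close>, \<open>N = d\<close> with a logarithm, and \<open>d < N \<le> h\<close>.\<close>

lemma horn_bound_root:
  assumes g: "germ_smooth g" and m: "m \<ge> 1" and q: "q > 0" and w: "weight_ge g m q" and P: "edge_poly g m q \<noteq> 0"
    and N: "N = order z0 (edge_poly g m q)" and h: "h > 0" "q / (1 + m) \<le> h"
    and cases: "real N * (m + 1) < q \<or> (real N * (m + 1) = q \<and> l = 1) \<or> (q < real N * (m + 1) \<and> real N \<le> h)"
  shows "\<exists>\<delta>>0. \<exists>r>0. sublevel_bound h l g (horn m z0 \<delta> r)"
proof -
  \<comment> \<open>For \<open>N = 0\<close> any exponent with \<open>s q > m + 1\<close> puts the integral in the first regime.\<close>
  define s where "s = (if N = 0 then (m + 2) / q else 1 / real N)"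
  have s: "s > 0" "N \<ge> 1 \<Longrightarrow> s = 1 / real N" using m q by (auto simp: s_def)
  obtain \<delta> r A where \<delta>: "\<delta> > 0" "r > 0" and cont: "continuous_on (horn m z0 \<delta> r) g" and A: "A \<ge> 0"
    "\<And>\<epsilon> x. \<epsilon> > 0 \<Longrightarrow> emeasure lborel {y. (x, y) \<in> {p \<in> horn m z0 \<delta> r. \<bar>g p\<bar> \<le> \<epsilon>}} \<le> ennreal (A * section_majorant m q s \<epsilon> x)"
    using section_bound[OF g m w P N s] by blast
  have hd: "1 / h \<le> (m + 1) / q" using h q m by (simp add: field_simps)
  have "\<exists>B\<ge>0. \<forall>\<epsilon>. 0 < \<epsilon> \<longrightarrow> \<epsilon> \<le> 1 / 2 \<longrightarrow> (\<integral>\<^sup>+x. ennreal (section_majorant m q s \<epsilon> x) \<partial>lborel) \<le> ennreal (B * (\<epsilon> powr (1 / h) * ln (1 / \<epsilon>) ^ l))"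
  proof -
    have absorb: "\<exists>B\<ge>0. \<forall>\<epsilon>. 0 < \<epsilon> \<longrightarrow> \<epsilon> \<le> 1 / 2 \<longrightarrow> (\<integral>\<^sup>+x. ennreal (section_majorant m q s \<epsilon> x) \<partial>lborel) \<le> ennreal (B * (\<epsilon> powr (1 / h) * ln (1 / \<epsilon>) ^ l))"
      if B: "B \<ge> 0" "\<forall>\<epsilon>. 0 < \<epsilon> \<longrightarrow> \<epsilon> \<le> 1 / 2 \<longrightarrow> (\<integral>\<^sup>+x. ennreal (section_majorant m q s \<epsilon> x) \<partial>lborel) \<le> ennreal (B * \<epsilon> powr e)" and he: "1 / h \<le> e" for B e
    proof -
      have "(\<integral>\<^sup>+x. ennreal (section_majorant m q s \<epsilon> x) \<partial>lborel) \<le> ennreal ((B / ln 2 ^ l) * (\<epsilon> powr (1 / h) * ln (1 / \<epsilon>) ^ l))" if e: "0 < \<epsilon>" "\<epsilon> \<le> 1 / 2" for \<epsilon>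
      proof -
        have "B * \<epsilon> powr e \<le> B * ((1 / ln 2 ^ l) * (\<epsilon> powr (1 / h) * ln (1 / \<epsilon>) ^ l))"
          by (rule mult_left_mono[OF log_absorb[OF e he] B(1)])
        also have "\<dots> = (B / ln 2 ^ l) * (\<epsilon> powr (1 / h) * ln (1 / \<epsilon>) ^ l)" by simp
        finally show ?thesis using order_trans[OF B(2)[rule_format, OF e] ennreal_leI] by blast
      qed
      then show ?thesis using B(1) by (intro exI[of _ "B / ln 2 ^ l"]) auto
    qed
    consider (lt) "real N * (m + 1) < q" | (eq) "real N * (m + 1) = q" "l = 1" | (gt) "q < real N * (m + 1)" "real N \<le> h"
      using cases by blast
    then show ?thesis
    proof cases
      case lt
      have "s * q > m + 1"
      proof (cases "N = 0")
        case True
        then show ?thesis using q by (simp add: s_def)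
      next
        case False
        then show ?thesis using lt by (simp add: s_def field_simps)
      qed
      then obtain B where "B \<ge> 0" "\<forall>\<epsilon>. 0 < \<epsilon> \<longrightarrow> \<epsilon> \<le> 1 / 2 \<longrightarrow> (\<integral>\<^sup>+x. ennreal (section_majorant m q s \<epsilon> x) \<partial>lborel) \<le> ennreal (B * \<epsilon> powr ((m + 1) / q))"
        using section_majorant_integral_above[of m q s] m q by auto
      then show ?thesis using absorb hd by blast
    next
      case eq
      have "N \<noteq> 0"
      proof
        assume "N = 0"
        then show False using eq(1) q by simp
      qed
      then have s': "s = 1 / real N" by (simp add: s_def)
      have sq: "s * q = m + 1" using eq \<open>N \<noteq> 0\<close> by (simp add: s' field_simps)
      then have s1: "s = (m + 1) / q" using q by (simp add: field_simps)
      obtain B where B: "B \<ge> 0" "\<forall>\<epsilon>. 0 < \<epsilon> \<longrightarrow> \<epsilon> \<le> 1 / 2 \<longrightarrow> (\<integral>\<^sup>+x. ennreal (section_majorant m q s \<epsilon> x) \<partial>lborel) \<le> ennreal (B * (\<epsilon> powr s * ln (1 / \<epsilon>)))"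
        using section_majorant_integral_equal[of m q s] m q sq by auto
      have "(\<integral>\<^sup>+x. ennreal (section_majorant m q s \<epsilon> x) \<partial>lborel) \<le> ennreal (B * (\<epsilon> powr (1 / h) * ln (1 / \<epsilon>) ^ l))" if e: "0 < \<epsilon>" "\<epsilon> \<le> 1 / 2" for \<epsilon>
      proof -
        have "\<epsilon> powr s \<le> \<epsilon> powr (1 / h)" using e hd s1 by (intro powr_mono') auto
        moreover have "0 \<le> ln (1 / \<epsilon>)" using e by (intro ln_ge_zero) auto
        ultimately have "B * (\<epsilon> powr s * ln (1 / \<epsilon>)) \<le> B * (\<epsilon> powr (1 / h) * ln (1 / \<epsilon>) ^ l)"
          using B(1) eq(2) by (intro mult_left_mono) (auto intro: mult_right_mono)
        then show ?thesis using order_trans[OF B(2)[rule_format, OF e] ennreal_leI] by blast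
      qed
      then show ?thesis using B(1) by blast
    next
      case gt
      have N0: "N \<noteq> 0"
      proof
        assume "N = 0"
        then show False using gt(1) q by simp
      qed
      then have "s * q < m + 1" using gt by (simp add: s_def field_simps)
      then obtain B where B: "B \<ge> 0" "\<forall>\<epsilon>. 0 < \<epsilon> \<longrightarrow> \<epsilon> \<le> 1 / 2 \<longrightarrow> (\<integral>\<^sup>+x. ennreal (section_majorant m q s \<epsilon> x) \<partial>lborel) \<le> ennreal (B * \<epsilon> powr s)"
        using section_majorant_integral_below[of m s q] m by auto
      have "1 / h \<le> s" using gt(2) N0 h(1) by (simp add: s_def frac_le)
      then show ?thesis using absorb[OF B] by blast
    qed
  qed
  then obtain B where B: "B \<ge> 0" "\<And>\<epsilon>. 0 < \<epsilon> \<Longrightarrow> \<epsilon> \<le> 1 / 2 \<Longrightarrow> (\<integral>\<^sup>+x. ennreal (section_majorant m q s \<epsilon> x) \<partial>lborel) \<le> ennreal (B * (\<epsilon> powr (1 / h) * ln (1 / \<epsilon>) ^ l))"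
    by blast
  show ?thesis using horn_bound_of_section_majorant[OF cont A B] \<delta> by blast
qed

text \<open>The weak form of Descartes' rule that ignores signs. By induction: a power of the variable may be
divided out, and otherwise differentiation removes exactly one coefficient and lowers the order
of a root by at most one.\<close>

lemma order_less_card_coeffs:
  fixes P :: "real poly"
  assumes "P \<noteq> 0" "z \<noteq> 0"
  shows "order z P < card {k. coeff P k \<noteq> 0}"
  using assms(1)
proof (induction "degree P" arbitrary: P rule: less_induct)
  case less
  have fin: "finite {k. coeff Q k \<noteq> 0}" for Q :: "real poly"
    by (rule finite_subset[of _ "{..degree Q}"]) (auto intro: le_degree)
  show ?case
  proof (cases "degree P = 0")
    case True
    then have "order z P = 0" using order_degree[OF less.prems, of z] by simp
    moreover have "coeff P 0 \<noteq> 0" using True less.prems by (metis leading_coeff_0_iff)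
    then have "card {k. coeff P k \<noteq> 0} > 0" using fin[of P] by (auto simp: card_gt_0_iff)
    ultimately show ?thesis by simp
  next
    case deg: False
    obtain a Q where PQ: "P = pCons a Q" by (cases P) auto
    have Q0: "Q \<noteq> 0" using deg PQ by auto
    have dQ: "degree Q < degree P" using PQ Q0 by simp
    show ?thesis
    proof (cases "a = 0")
      case True
      have e: "P = [:0, 1:] * Q" using PQ True by simp
      have "order z P = order z [:0, 1:] + order z Q" unfolding e by (rule order_mult) (use Q0 in simp)
      also have "order z [:0, 1::real:] = 0" by (rule order_0I) (use assms(2) in simp)
      finally have o: "order z P = order z Q" by simp
      have "{k. coeff P k \<noteq> 0} = Suc ` {k. coeff Q k \<noteq> 0}"
      proof (rule set_eqI)
        fix k show "k \<in> {k. coeff P k \<noteq> 0} \<longleftrightarrow> k \<in> Suc ` {k. coeff Q k \<noteq> 0}"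
          unfolding PQ True by (cases k) auto
      qed
      then have "card {k. coeff P k \<noteq> 0} = card {k. coeff Q k \<noteq> 0}" by (simp add: card_image)
      then show ?thesis using less.hyps[OF dQ Q0] o by simp
    next
      case False
      have pd: "pderiv P \<noteq> 0" using deg by (simp add: pderiv_eq_0_iff)
      have dp: "degree (pderiv P) < degree P" using deg by (simp add: degree_pderiv)
      have le: "order z P \<le> Suc (order z (pderiv P))"
      proof (cases "poly P z = 0")
        case True
        show ?thesis using order_pderiv[OF less.prems True] by simp
      next
        case False
        then show ?thesis by (simp add: order_0I)
      qed
      have "{k. coeff P k \<noteq> 0} = insert 0 (Suc ` {k. coeff (pderiv P) k \<noteq> 0})"
      proof (rule set_eqI)
        fix k show "k \<in> {k. coeff P k \<noteq> 0} \<longleftrightarrow> k \<in> insert 0 (Suc ` {k. coeff (pderiv P) k \<noteq> 0})"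
          unfolding PQ using False by (cases k) (auto simp: coeff_pderiv)
      qed
      then have "card {k. coeff P k \<noteq> 0} = Suc (card {k. coeff (pderiv P) k \<noteq> 0})"
        using fin[of "pderiv P"] by (simp add: card_image)
      then show ?thesis using less.hyps[OF dp pd] le by simp
    qed
  qed
qed

lemma order_le_half_degree:
  fixes P :: "real poly"
  assumes "P \<noteq> 0" "z \<noteq> 0" and gap: "\<And>k. coeff P k = 0 \<or> coeff P (Suc k) = 0"
  shows "2 * order z P \<le> degree P"
proof -
  let ?S = "{k. coeff P k \<noteq> 0}"
  have "inj_on (\<lambda>k. k div 2) ?S"
  proof (rule inj_onI)
    fix x y assume x: "x \<in> ?S" and y: "y \<in> ?S" and e: "x div 2 = y div 2"
    have "x = y \<or> y = Suc x \<or> x = Suc y" using e by presburger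
    then show "x = y" using gap x y by auto
  qed
  then have "card ?S = card ((\<lambda>k. k div 2) ` ?S)" by (simp add: card_image)
  also have "\<dots> \<le> card {..degree P div 2}"
    by (rule card_mono) (auto intro!: div_le_mono le_degree)
  finally have "card ?S \<le> degree P div 2 + 1" by simp
  then show ?thesis using order_less_card_coeffs[OF assms(1,2)] by linarith
qed

text \<open>If the line \<open>j + m k = q\<close> contains lattice points with consecutive \<open>k\<close>, then \<open>m\<close> is an
integer. Otherwise the edge polynomial has no two consecutive coefficients, so a nonzero root has
order at most half the degree, and the degree is at most \<open>q / m\<close>. For \<open>m > 1\<close> this contradicts an
order of at least \<open>q / (1 + m)\<close>.\<close>

lemma high_root_integer_slope:
  assumes m: "m \<ge> 1" and q: "q > 0" and P: "edge_poly g m q \<noteq> 0" and z: "z \<noteq> 0"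
    and N: "q \<le> real (order z (edge_poly g m q)) * (m + 1)"
  shows "\<exists>n\<ge>1. m = real n"
proof (rule ccontr)
  assume no: "\<not> ?thesis"
  let ?P = "edge_poly g m q"
  have gap: "coeff ?P k = 0 \<or> coeff ?P (Suc k) = 0" for k
  proof (rule ccontr)
    assume "\<not> ?thesis"
    then have nz: "coeff ?P k \<noteq> 0" "coeff ?P (Suc k) \<noteq> 0" by auto
    have m0: "m > 0" using m by simp
    obtain j where j: "real j + m * real k = q" by (rule coeff_edge_poly_nonzeroE[OF m0 nz(1)])
    obtain j' where j': "real j' + m * real (Suc k) = q" by (rule coeff_edge_poly_nonzeroE[OF m0 nz(2)])
    have "m = real j - real j'" using j j' by (simp add: algebra_simps)
    then have "m = real (j - j')" "j - j' \<ge> 1" using m by linarith+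
    then show False using no by blast
  qed
  have half: "2 * order z ?P \<le> degree ?P" by (rule order_le_half_degree[OF P z gap])
  have "coeff ?P (degree ?P) \<noteq> 0" using P by simp
  then obtain j where "real j + m * real (degree ?P) = q"
    using coeff_edge_poly_nonzeroE[of m g q "degree ?P"] m by (metis less_le_trans zero_less_one)
  then have d: "m * real (degree ?P) \<le> q" by simp
  have "real (2 * order z ?P) \<le> real (degree ?P)" using half by (simp only: of_nat_le_iff)
  then have "m * (2 * real (order z ?P)) \<le> m * real (degree ?P)" using m by (intro mult_left_mono) auto
  then have 1: "2 * m * real (order z ?P) \<le> q" using d by simp
  have "m \<noteq> 1" using no by (metis of_nat_1 order_refl)
  then have m1: "m > 1" using m by simp
  have pos: "real (order z ?P) > 0" using N q m by (smt (verit) mult_nonneg_nonneg mult_not_zero of_nat_0_le_iff)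
  have "real (order z ?P) * (m + 1) < real (order z ?P) * (2 * m)"
    using pos m1 by (intro mult_strict_left_mono) auto
  then show False using 1 N by (simp add: mult_ac)
qed

section \<open>Passing to the next edge of the Newton polyhedron\<close>

text \<open>Rotating the supporting line around its lowest support point \<open>(a, N)\<close> keeps all points with
\<open>k \<ge> N\<close> above it. It stops at the first point with \<open>k < N\<close>, if there is one; the minimal
slope exists because only finitely many points lie below any given slope.\<close>

lemma next_slope:
  assumes m: "m > 0" and w: "weight_ge g m (real a + m * real N)"
    and face: "\<And>j k. (j, k) \<in> taylor_support g \<Longrightarrow> real j + m * real k = real a + m * real N \<Longrightarrow> N \<le> k"
  shows "(\<forall>\<mu>>m. weight_ge g \<mu> (real a + \<mu> * real N)) \<or>
    (\<exists>m1>m. weight_ge g m1 (real a + m1 * real N) \<and> (\<exists>j k. (j, k) \<in> taylor_support g \<and> k < N \<and> real j + m1 * real k = real a + m1 * real N))"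
proof -
  let ?S = "{(j, k). (j, k) \<in> taylor_support g \<and> k < N}"
  define sl where "sl = (\<lambda>(j, k). (real j - real a) / (real N - real k))"
  have upper: "real a + \<mu> * real N \<le> real j + \<mu> * real k"
    if "(j, k) \<in> taylor_support g" "N \<le> k" "\<mu> > m" for j k \<mu>
  proof -
    have "real a + m * real N \<le> real j + m * real k" using w that(1) unfolding weight_ge_def by auto
    moreover have "(\<mu> - m) * real N \<le> (\<mu> - m) * real k" using that by (intro mult_left_mono) auto
    ultimately show ?thesis by (simp add: algebra_simps)
  qed
  have slope: "real a + \<mu> * real N \<le> real j + \<mu> * real k \<longleftrightarrow> \<mu> \<le> sl (j, k)"
    "real a + \<mu> * real N = real j + \<mu> * real k \<longleftrightarrow> \<mu> = sl (j, k)" if "k < N" for j k \<mu>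
    using that by (auto simp: sl_def field_simps)
  show ?thesis
  proof (cases "?S = {}")
    case True
    have "weight_ge g \<mu> (real a + \<mu> * real N)" if "\<mu> > m" for \<mu>
      unfolding weight_ge_def
    proof clarify
      fix j k assume jk: "(j, k) \<in> taylor_support g"
      then have "N \<le> k" using True by (auto simp: not_less[symmetric])
      then show "real a + \<mu> * real N \<le> real j + \<mu> * real k" using upper jk that by blast
    qed
    then show ?thesis by blast
  next
    case False
    then obtain j0 k0 where jk0: "(j0, k0) \<in> taylor_support g" "k0 < N" by auto
    have gt: "m < sl (j, k)" if "(j, k) \<in> taylor_support g" "k < N" for j k
    proof -
      have "real a + m * real N \<le> real j + m * real k" using w that(1) unfolding weight_ge_def by auto
      moreover have "real j + m * real k \<noteq> real a + m * real N" using face[OF that(1)] that(2) by auto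
      ultimately show ?thesis using slope[OF that(2), of m j] by auto
    qed
    define T where "T = {p \<in> ?S. sl p \<le> sl (j0, k0)}"
    have "T \<subseteq> {..nat \<lceil>real a + sl (j0, k0) * real N\<rceil>} \<times> {..<N}"
    proof (rule subrelI)
      fix j k assume jk: "(j, k) \<in> T"
      then have k: "k < N" "(j, k) \<in> taylor_support g" and s: "sl (j, k) \<le> sl (j0, k0)" by (auto simp: T_def)
      have pos: "sl (j0, k0) > 0" using gt[OF jk0] m by linarith
      have "(real j - real a) \<le> sl (j0, k0) * (real N - real k)" using s k by (simp add: sl_def field_simps)
      also have "\<dots> \<le> sl (j0, k0) * real N" using pos by (intro mult_left_mono) auto
      finally have "real j \<le> real a + sl (j0, k0) * real N" by simp
      then show "(j, k) \<in> {..nat \<lceil>real a + sl (j0, k0) * real N\<rceil>} \<times> {..<N}" using k by (simp add: le_nat_iff) linarith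
    qed
    then have fin: "finite T" by (rule finite_subset) simp
    have T0: "(j0, k0) \<in> T" using jk0 by (simp add: T_def)
    define m1 where "m1 = Min (sl ` T)"
    have "m1 \<in> sl ` T" unfolding m1_def using fin T0 by (intro Min_in) auto
    then obtain j1 k1 where jk1: "(j1, k1) \<in> taylor_support g" "k1 < N" "sl (j1, k1) = m1" by (auto simp: T_def)
    have m1: "m < m1" using gt[OF jk1(1,2)] jk1(3) by simp
    have min: "m1 \<le> sl (j, k)" if "(j, k) \<in> taylor_support g" "k < N" for j k
    proof (cases "sl (j, k) \<le> sl (j0, k0)")
      case True
      then have "(j, k) \<in> T" using that by (simp add: T_def)
      then show ?thesis unfolding m1_def using fin by (intro Min_le) auto
    next
      case False
      have "m1 \<le> sl (j0, k0)" unfolding m1_def using fin T0 by (intro Min_le) auto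
      then show ?thesis using False by simp
    qed
    have "weight_ge g m1 (real a + m1 * real N)"
      unfolding weight_ge_def
    proof clarify
      fix j k assume jk: "(j, k) \<in> taylor_support g"
      show "real a + m1 * real N \<le> real j + m1 * real k"
        using upper[OF jk _ m1] min[OF jk] slope(1)[of k m1 j] by (cases "k < N") auto
    qed
    moreover have "real j1 + m1 * real k1 = real a + m1 * real N" using slope(2)[OF jk1(2), of m1 j1] jk1(3) by simp
    ultimately show ?thesis using m1 jk1 by blast
  qed
qed

text \<open>A root of order at least \<open>q / (1 + m)\<close> can be moved to \<open>0\<close> by a smooth shear: if it is not
already \<open>0\<close>, the weight is an integer by \<open>high_root_integer_slope\<close>.\<close>

lemma recenter:
  assumes f: "phase_function f" and \<phi>: "local_coordinates \<phi>" and m: "m \<ge> 1" and q: "q > 0"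
    and w: "weight_ge (f \<circ> \<phi>) m q" and P: "edge_poly (f \<circ> \<phi>) m q \<noteq> 0"
    and z: "q \<le> real (order z (edge_poly (f \<circ> \<phi>) m q)) * (m + 1)"
  shows "\<exists>n\<ge>1. (z \<noteq> 0 \<longrightarrow> m = real n) \<and> local_coordinates (\<phi> \<circ> shear z n) \<and> weight_ge (f \<circ> (\<phi> \<circ> shear z n)) m q \<and>
     edge_poly (f \<circ> (\<phi> \<circ> shear z n)) m q \<noteq> 0 \<and>
     order 0 (edge_poly (f \<circ> (\<phi> \<circ> shear z n)) m q) = order z (edge_poly (f \<circ> \<phi>) m q)"
proof (cases "z = 0")
  case True
  have e: "\<phi> \<circ> shear z 1 = \<phi>" using True by (auto simp: shear_def fun_eq_iff)
  show ?thesis by (rule exI[of _ 1], unfold e) (use assms True in auto)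
next
  case False
  obtain n where n: "n \<ge> 1" "m = real n" using high_root_integer_slope[OF m q P False z] by blast
  have g: "germ_smooth (f \<circ> \<phi>)" by (rule chart_germ_smooth[OF f \<phi>])
  have lc: "local_coordinates (\<phi> \<circ> shear z n)" by (rule local_coordinates_comp[OF \<phi> local_coordinates_shear[OF n(1)]])
  have e: "edge_poly (f \<circ> (\<phi> \<circ> shear z n)) m q = pcompose (edge_poly (f \<circ> \<phi>) m q) [:z, 1:]"
    using edge_poly_shear(2)[OF g n(2,1) w, of z] by (simp add: o_assoc)
  have w': "weight_ge (f \<circ> (\<phi> \<circ> shear z n)) m q"
    using edge_poly_shear(1)[OF g n(2,1) w, of z] by (simp add: o_assoc)
  have "edge_poly (f \<circ> (\<phi> \<circ> shear z n)) m q \<noteq> 0"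
    unfolding e using P by (simp add: pcompose_eq_0_iff)
  then show ?thesis using n lc w' order_pcompose_shift[OF P, of z] e by (intro exI[of _ n]) simp
qed

lemma coeff_eq_0_below_order:
  fixes P :: "real poly"
  assumes "P \<noteq> 0"
  shows "k < order 0 P \<Longrightarrow> coeff P k = 0" "coeff P (order 0 P) \<noteq> 0"
proof -
  have 1: "(\<forall>k<n. coeff P k = 0) \<longleftrightarrow> n \<le> order 0 P" for n
    using monom_1_dvd_iff[OF assms, of n] monom_1_dvd_iff'[of n P] by simp
  show "k < order 0 P \<Longrightarrow> coeff P k = 0" using 1[of "order 0 P"] by simp
  show "coeff P (order 0 P) \<noteq> 0"
  proof
    assume "coeff P (order 0 P) = 0"
    then have "\<forall>k<Suc (order 0 P). coeff P k = 0" using 1[of "order 0 P"] by (auto simp: less_Suc_eq)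
    then show False using 1[of "Suc (order 0 P)"] by simp
  qed
qed

text \<open>The order of the edge polynomial at \<open>0\<close> is the height of the lower end of the edge.\<close>

lemma lowest_vertex:
  assumes m: "m > 0" and P: "edge_poly g m q \<noteq> 0" and N: "order 0 (edge_poly g m q) = N"
  obtains a where "(a, N) \<in> taylor_support g" "real a + m * real N = q"
    "\<And>j k. (j, k) \<in> taylor_support g \<Longrightarrow> real j + m * real k = q \<Longrightarrow> N \<le> k"
proof -
  have "coeff (edge_poly g m q) N \<noteq> 0" using coeff_eq_0_below_order(2)[OF P] N by simp
  then obtain a where a: "real a + m * real N = q" "(a, N) \<in> taylor_support g"
    by (rule coeff_edge_poly_nonzeroE[OF m])
  have "N \<le> k" if "(j, k) \<in> taylor_support g" "real j + m * real k = q" for j k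
  proof (rule ccontr)
    assume "\<not> N \<le> k"
    then have "coeff (edge_poly g m q) k = 0" using coeff_eq_0_below_order(1)[OF P, of k] N by simp
    then show False using coeff_edge_poly[OF m that(2), of g] that(1) by (simp add: taylor_support_def)
  qed
  then show ?thesis using that a by blast
qed

text \<open>After recentering, the lower end of the edge is \<open>(N, N)\<close>. A line between the edge and the
next supporting line through this point meets the support nowhere else, and
\<open>vertex_multiplicity\<close> applies.\<close>

lemma critical_root_multiplicity:
  assumes f: "phase_function f" and \<phi>: "local_coordinates \<phi>" and m: "m \<ge> 1" and q: "q > 0"
    and w: "weight_ge (f \<circ> \<phi>) m q" and P: "edge_poly (f \<circ> \<phi>) m q \<noteq> 0"
    and z: "real (order z (edge_poly (f \<circ> \<phi>) m q)) * (m + 1) = q"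
  shows "newton_multiplicity f = 1"
proof -
  obtain n where \<psi>: "local_coordinates (\<phi> \<circ> shear z n)" and w': "weight_ge (f \<circ> (\<phi> \<circ> shear z n)) m q"
    and P': "edge_poly (f \<circ> (\<phi> \<circ> shear z n)) m q \<noteq> 0"
    and o: "order 0 (edge_poly (f \<circ> (\<phi> \<circ> shear z n)) m q) = order z (edge_poly (f \<circ> \<phi>) m q)"
    using recenter[OF f \<phi> m q w P, of z] z by auto
  define N where "N = order z (edge_poly (f \<circ> \<phi>) m q)"
  define \<psi> where "\<psi> = \<phi> \<circ> shear z n"
  let ?g = "f \<circ> \<psi>"
  have m0: "m > 0" using m by simp
  obtain a where a: "(a, N) \<in> taylor_support ?g" "real a + m * real N = q"
    and face: "\<And>j k. (j, k) \<in> taylor_support ?g \<Longrightarrow> real j + m * real k = q \<Longrightarrow> N \<le> k"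
    using lowest_vertex[OF m0 P' o[folded N_def]] unfolding \<psi>_def by blast
  have "real a = real N" using a(2) z unfolding N_def[symmetric] by (simp add: algebra_simps)
  then have aN: "a = N" by simp
  have N1: "N \<ge> 1" using z q unfolding N_def[symmetric] by (cases N) auto
  have w'': "weight_ge ?g m (real N + m * real N)" using w' a(2) aN by (simp add: \<psi>_def)
  have ns: "(\<forall>\<mu>>m. weight_ge ?g \<mu> (real N + \<mu> * real N)) \<or>
    (\<exists>m1>m. weight_ge ?g m1 (real N + m1 * real N) \<and> (\<exists>j k. (j, k) \<in> taylor_support ?g \<and> k < N \<and> real j + m1 * real k = real N + m1 * real N))"
    by (rule next_slope[OF m0 w'']) (use face a(2) aN in auto)
  then obtain m1 where m1: "m1 > m" "weight_ge ?g m1 (real N + m1 * real N)"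
    by (metis less_add_one)
  \<comment> \<open>Strictly between the two supporting weights only the common vertex remains.\<close>
  define \<mu> where "\<mu> = (m + m1) / 2"
  have \<mu>: "m < \<mu>" "\<mu> < m1" using m1 by (auto simp: \<mu>_def)
  have le: "real N + \<mu> * real N \<le> real j + \<mu> * real k \<and> (real j + \<mu> * real k = real N + \<mu> * real N \<longrightarrow> (j, k) = (N, N))"
    if jk: "(j, k) \<in> taylor_support ?g" for j k
  proof -
    have 1: "real N + m * real N \<le> real j + m * real k" using w'' jk unfolding weight_ge_def by auto
    have 2: "real N + m1 * real N \<le> real j + m1 * real k" using m1(2) jk unfolding weight_ge_def by auto
    have avg: "real j + \<mu> * real k = ((real j + m * real k) + (real j + m1 * real k)) / 2"
      "real N + \<mu> * real N = ((real N + m * real N) + (real N + m1 * real N)) / 2"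
      by (simp_all add: \<mu>_def field_simps)
    have "(j, k) = (N, N)" if "real j + \<mu> * real k = real N + \<mu> * real N"
    proof -
      have eq: "((real j + m * real k) + (real j + m1 * real k)) / 2 = ((real N + m * real N) + (real N + m1 * real N)) / 2"
        using that unfolding avg .
      have gen: "a1 = b1 \<and> a2 = b2" if "b1 \<le> a1" "b2 \<le> a2" "(a1 + a2) / 2 = (b1 + b2) / 2" for a1 a2 b1 b2 :: real
        using that by auto
      from gen[OF 1 2 eq] have 3: "real j + m * real k = real N + m * real N" and "real j + m1 * real k = real N + m1 * real N"
        by blast+
      with 3 have "(m1 - m) * real k = (m1 - m) * real N" by (simp add: algebra_simps)
      then have "k = N" using m1 by simp
      then show ?thesis using 3 by simp
    qed
    moreover have "real N + \<mu> * real N \<le> real j + \<mu> * real k" 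
    proof -
      have gen: "(b1 + b2) / 2 \<le> (a1 + a2) / 2" if "b1 \<le> a1" "b2 \<le> a2" for a1 a2 b1 b2 :: real
        using that by simp
      show ?thesis unfolding avg by (rule gen[OF 1 2])
    qed
    ultimately show ?thesis by blast
  qed
  show ?thesis
  proof (rule vertex_multiplicity[OF f _ N1, of \<psi> \<mu> "real N + \<mu> * real N"])
    show "local_coordinates \<psi>" using \<psi> by (simp add: \<psi>_def)
    show "\<mu> > 0" using \<mu> m by simp
    show "weight_ge ?g \<mu> (real N + \<mu> * real N)" unfolding weight_ge_def using le by auto
    show "(N, N) \<in> taylor_support ?g" using a aN by simp
    show "\<And>j k. (j, k) \<in> taylor_support ?g \<Longrightarrow> real j + \<mu> * real k = real N + \<mu> * real N \<Longrightarrow> (j, k) = (N, N)"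
      using le by blast
  qed simp
qed

lemma sublevel_bound_finite_cover:
  assumes T: "T \<in> sets borel" "continuous_on T g" and fin: "finite D"
    and R: "\<And>z. z \<in> D \<Longrightarrow> sublevel_bound h l g (R z)" and cover: "T \<subseteq> (\<Union>z\<in>D. R z)"
  shows "sublevel_bound h l g T"
proof -
  have "sublevel_bound h l g (T \<inter> (\<Union>z\<in>D. R z))"
    using fin R
  proof (induction D rule: finite_induct)
    case empty
    show ?case unfolding sublevel_bound_def by (auto intro!: exI[of _ 0])
  next
    case (insert x F)
    have 1: "sublevel_bound h l g (T \<inter> (\<Union>z\<in>F. R z))" by (rule insert.IH) (use insert.prems in auto)
    have Rx: "sublevel_bound h l g (R x)" by (rule insert.prems) simp
    then have "R x \<in> sets borel" unfolding sublevel_bound_def by blast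
    then have 2: "sublevel_bound h l g (T \<inter> R x)"
      using T(1) by (intro sublevel_bound_subset[OF Rx] Int_lower2 sets.Int)
    have "T \<inter> (\<Union>z\<in>insert x F. R z) = (T \<inter> R x) \<union> (T \<inter> (\<Union>z\<in>F. R z))" by auto
    moreover have "sublevel_bound h l g ((T \<inter> R x) \<union> (T \<inter> (\<Union>z\<in>F. R z)))"
      by (intro sublevel_bound_union 1 2 continuous_on_subset[OF T(2)]) auto
    ultimately show ?case by simp
  qed
  moreover have "T \<inter> (\<Union>z\<in>D. R z) = T" using cover by auto
  ultimately show ?thesis by simp
qed

text \<open>Compactness of \<open>[-C, C]\<close> in the variable \<open>y / x^m\<close>.\<close>

lemma horn_bound_all_roots:
  assumes g: "germ_smooth g" and m: "m \<ge> 1" and q: "q > 0" and w: "weight_ge g m q" and P: "edge_poly g m q \<noteq> 0"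
    and local: "\<And>z. \<exists>\<delta>>0. \<exists>r>0. sublevel_bound h l g (horn m z \<delta> r)"
  shows "\<exists>r>0. sublevel_bound h l g (horn m 0 C r)"
proof -
  obtain \<delta> r where \<delta>: "\<And>z. \<delta> z > 0" "\<And>z. r z > 0" "\<And>z. sublevel_bound h l g (horn m z (\<delta> z) (r z))"
    using local by metis
  have "{-C..C} \<subseteq> (\<Union>z\<in>{-C..C}. ball z (\<delta> z))" using \<delta>(1) by force
  then obtain D where D: "D \<subseteq> {-C..C}" "finite D" "{-C..C} \<subseteq> (\<Union>z\<in>D. ball z (\<delta> z))"
    using compactE_image[OF compact_Icc, of "{-C..C}" "\<lambda>z. ball z (\<delta> z)" "-C" C] by (metis open_ball)
  obtain r0 where r0: "r0 > 0" "continuous_on (horn m 0 C r0) g" using horn_continuous[OF g m] by blast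
  define r1 where "r1 = Min (insert r0 (r ` D))"
  have r1: "r1 > 0" "r1 \<le> r0" "\<And>z. z \<in> D \<Longrightarrow> r1 \<le> r z" unfolding r1_def using D(2) r0 \<delta>(2) by auto
  have cover: "horn m 0 C r1 \<subseteq> (\<Union>z\<in>D. horn m z (\<delta> z) (r z))"
  proof (rule subrelI)
    fix x y assume "(x, y) \<in> horn m 0 C r1"
    then have x: "0 < x" "x < r1" and y: "\<bar>y\<bar> \<le> C * x powr m" by (auto simp: horn_def)
    have xm: "x powr m > 0" using x by simp
    have "y / x powr m \<in> {-C..C}" using y xm by (auto simp: abs_le_iff field_simps)
    then obtain z where z: "z \<in> D" "\<bar>y / x powr m - z\<bar> < \<delta> z"
      using D(3) by (force simp: dist_real_def abs_minus_commute)
    have "\<bar>y - z * x powr m\<bar> = \<bar>(y / x powr m - z) * x powr m\<bar>" using xm by (simp add: algebra_simps)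
    also have "\<dots> = \<bar>y / x powr m - z\<bar> * x powr m" using xm by (simp add: abs_mult)
    also have "\<dots> \<le> \<delta> z * x powr m" using z(2) xm by (intro mult_right_mono) auto
    finally have "\<bar>y - z * x powr m\<bar> \<le> \<delta> z * x powr m" .
    then have "(x, y) \<in> horn m z (\<delta> z) (r z)" using x r1(3)[OF z(1)] by (simp add: horn_def)
    then show "(x, y) \<in> (\<Union>z\<in>D. horn m z (\<delta> z) (r z))" using z(1) by blast
  qed
  have "sublevel_bound h l g (horn m 0 C r1)"
    by (rule sublevel_bound_finite_cover[OF horn_measurable continuous_on_subset[OF r0(2) horn_mono] D(2) \<delta>(3) cover])
      (use r1(2) in auto)
  then show ?thesis using r1(1) by blast
qed

text \<open>The shear preserves area and carries the horn around \<open>0\<close> to the horn around \<open>z\<close>.\<close>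

lemma horn_bound_shear:
  assumes g: "germ_smooth g" and m: "m \<ge> 1" and n: "z \<noteq> 0 \<longrightarrow> m = real n"
    and b: "\<exists>\<delta>>0. \<exists>r>0. sublevel_bound h l (g \<circ> shear z n) (horn m 0 \<delta> r)"
  shows "\<exists>\<delta>>0. \<exists>r>0. sublevel_bound h l g (horn m z \<delta> r)"
proof -
  obtain \<delta> r where \<delta>: "\<delta> > 0" "r > 0" "sublevel_bound h l (g \<circ> shear z n) (horn m 0 \<delta> r)" using b by blast
  obtain r0 where r0: "r0 > 0" "continuous_on (horn m 0 (\<bar>z\<bar> + \<delta>) r0) g" using horn_continuous[OF g m] by blast
  define r1 where "r1 = min r r0"
  have c: "continuous_on (horn m z \<delta> r1) g"
    using horn_subset_centered[of m z \<delta> r1] horn_mono[of "\<bar>z\<bar> + \<delta>" "\<bar>z\<bar> + \<delta>" r1 r0 m 0]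
    by (intro continuous_on_subset[OF r0(2)]) (auto simp: r1_def)
  have "sublevel_bound h l g (horn m z \<delta> r1)"
  proof (rule sublevel_bound_transform[OF distr_shear horn_measurable c _ \<delta>(3)])
    fix p assume p: "shear z n p \<in> horn m z \<delta> r1"
    obtain x y where xy: "p = (x, y)" by (cases p)
    have x: "0 < x" "x < r1" using p by (auto simp: xy shear_def horn_def)
    have e: "z * x ^ n = z * x powr m" using n x by (cases "z = 0") (auto simp: powr_realpow)
    have "\<bar>(y + z * x ^ n) - z * x powr m\<bar> \<le> \<delta> * x powr m" using p by (simp add: xy shear_def horn_def)
    then have "\<bar>y\<bar> \<le> \<delta> * x powr m" unfolding e by simp
    then show "p \<in> horn m 0 \<delta> r" using x by (simp add: xy horn_def r1_def)
  qed
  then show ?thesis using \<delta> r0 by (intro exI[of _ \<delta>] conjI exI[of _ r1]) (auto simp: r1_def)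
qed

text \<open>In Taylor's formula in \<open>y\<close> around \<open>y = 0\<close>, the term of order \<open>N\<close> has size at least
\<open>x^a |y|^N\<close>. With \<open>|y| = u x^m1\<close> it is \<open>x^q1 u^N\<close>, \<open>q1 = a + m1 N\<close>, while the terms of
order \<open>k < N\<close> are at most a multiple of \<open>x^q1 u^k\<close>, because the support lies above the line of weight
\<open>m1\<close>. Thus the term of order \<open>N\<close> dominates as soon as \<open>u\<close> is large.\<close>

lemma lower_bound_above_edge:
  assumes g: "germ_smooth g" and m: "m \<ge> 1" and w: "weight_ge g m q" and P: "edge_poly g m q \<noteq> 0"
    and N: "N = order 0 (edge_poly g m q)" "N \<ge> 1" and q: "q = a + m * real N"
    and m1: "m < m1" and w1: "weight_ge g m1 (a + m1 * real N)"
  shows "\<exists>C. \<exists>\<delta>>0. \<exists>r>0. \<forall>x y. (x, y) \<in> horn m 0 \<delta> r \<longrightarrow> C * x powr m1 < \<bar>y\<bar> \<longrightarrow> x powr (a + m1 * real N) \<le> \<bar>g (x, y)\<bar>"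
proof -
  let ?q1 = "a + m1 * real N"
  have m1': "m1 \<ge> 1" using m m1 by simp
  obtain c \<delta> r0 \<sigma> where c: "c > 0" and \<delta>: "\<delta> > 0" and r0: "r0 > 0" and \<sigma>: "\<sigma> \<in> {-1, 1}"
    and low: "\<And>x y. (x, y) \<in> horn m 0 \<delta> r0 \<Longrightarrow> c * x powr (q - m * real N) \<le> \<sigma> * (D2 ^^ N) g (x, y)"
    using deriv_lower_bound[OF g m w P N(1)] by blast
  obtain V where V: "open V" "(0, 0) \<in> V" "smooth_on V g" using g unfolding germ_smooth_def by blast
  obtain r1 where r1: "r1 > 0" "r1 \<le> 1" "horn m 0 \<delta> r1 \<subseteq> V" using horn_domain[OF V(1,2) m] by blast
  define L where "L = (\<lambda>k. \<bar>poly (edge_poly ((D2 ^^ k) g) m1 (?q1 - m1 * real k)) 0\<bar> + 1)"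
  have "\<forall>k\<in>{..<N}. \<forall>\<^sub>F x in at_right 0. \<bar>(D2 ^^ k) g (x, 0) / x powr (?q1 - m1 * real k)\<bar> \<le> L k"
  proof
    fix k
    have "((\<lambda>x. (D2 ^^ k) g (x, x powr m1 * 0) / x powr (?q1 - m1 * real k)) \<longlongrightarrow> poly (edge_poly ((D2 ^^ k) g) m1 (?q1 - m1 * real k)) 0) (at_right 0)"
      by (rule weighted_limit_pointwise[OF germ_smooth_D2_iter[OF g] m1' weight_ge_D2_iter[OF w1]])
    then have "\<forall>\<^sub>F x in at_right 0. dist ((D2 ^^ k) g (x, x powr m1 * 0) / x powr (?q1 - m1 * real k)) (poly (edge_poly ((D2 ^^ k) g) m1 (?q1 - m1 * real k)) 0) < 1"
      by (rule tendstoD) simp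
    then show "\<forall>\<^sub>F x in at_right 0. \<bar>(D2 ^^ k) g (x, 0) / x powr (?q1 - m1 * real k)\<bar> \<le> L k"
      by eventually_elim (simp add: L_def dist_real_def)
  qed
  then have "\<forall>\<^sub>F x in at_right 0. \<forall>k\<in>{..<N}. \<bar>(D2 ^^ k) g (x, 0) / x powr (?q1 - m1 * real k)\<bar> \<le> L k"
    by (intro eventually_ball_finite) auto
  then obtain r2 where r2: "r2 > 0" "\<And>x k. 0 < x \<Longrightarrow> x < r2 \<Longrightarrow> k < N \<Longrightarrow> \<bar>(D2 ^^ k) g (x, 0) / x powr (?q1 - m1 * real k)\<bar> \<le> L k"
    unfolding eventually_at_right_field by blast
  define A where "A = (\<Sum>k<N. L k)"
  have L0: "L k \<ge> 0" for k by (simp add: L_def)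
  define C where "C = max 1 (fact N * (A + 1) / c)"
  define r where "r = min r0 (min r1 r2)"
  have r: "r > 0" using r0 r1 r2 by (simp add: r_def)
  have "x powr ?q1 \<le> \<bar>g (x, y)\<bar>" if h: "(x, y) \<in> horn m 0 \<delta> r" and big: "C * x powr m1 < \<bar>y\<bar>" for x y
  proof -
    have x: "0 < x" "x < r0" "x < r1" "x < r2" and y: "\<bar>y\<bar> \<le> \<delta> * x powr m" using h by (auto simp: horn_def r_def)
    have inH: "(x, t) \<in> horn m 0 \<delta> r0" "(x, t) \<in> V" if "\<bar>t\<bar> \<le> \<bar>y\<bar>" for t
      using that x y r1(3) by (auto simp: horn_def)
    have "\<exists>t. \<bar>t\<bar> \<le> \<bar>y\<bar> \<and> g (x, y) = (\<Sum>k<N. (D2 ^^ k) g (x, 0) / fact k * y ^ k) + (D2 ^^ N) g (x, t) / fact N * y ^ N"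
    proof (rule Maclaurin_bi_le[where diff = "\<lambda>k t. (D2 ^^ k) g (x, t)" and f = "\<lambda>t. g (x, t)"])
      show "\<forall>k t. k < N \<and> \<bar>t\<bar> \<le> \<bar>y\<bar> \<longrightarrow> DERIV (\<lambda>t. (D2 ^^ k) g (x, t)) t :> (D2 ^^ Suc k) g (x, t)"
        using has_real_derivative_D2[OF smooth_on_D2_iter[OF V(3)]] inH(2) by auto
    qed simp
    then obtain t where t: "\<bar>t\<bar> \<le> \<bar>y\<bar>"
      "g (x, y) = (\<Sum>k<N. (D2 ^^ k) g (x, 0) / fact k * y ^ k) + (D2 ^^ N) g (x, t) / fact N * y ^ N" by blast
    define u where "u = \<bar>y\<bar> / x powr m1"
    have xm: "x powr m1 > 0" using x by simp
    have yu: "\<bar>y\<bar> = x powr m1 * u" using xm by (simp add: u_def)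
    have uC: "C < u" using big xm by (simp add: u_def pos_less_divide_eq)
    have u1: "1 \<le> u" using uC by (simp add: C_def)
    have yk: "\<bar>y\<bar> ^ k = x powr (m1 * real k) * u ^ k" for k
      using x by (simp add: yu power_mult_distrib powr_powr flip: powr_realpow)
    have terms: "\<bar>(D2 ^^ k) g (x, 0) / fact k * y ^ k\<bar> \<le> x powr ?q1 * (L k * u ^ (N - 1))" if k: "k < N" for k
    proof -
      have px: "x powr (?q1 - m1 * real k) > 0" using x by simp
      have 1: "\<bar>(D2 ^^ k) g (x, 0)\<bar> \<le> L k * x powr (?q1 - m1 * real k)"
        using r2(2)[OF x(1,4) k] px by (simp add: abs_div_pos[symmetric] pos_divide_le_eq)
      have "\<bar>(D2 ^^ k) g (x, 0) / fact k * y ^ k\<bar> = \<bar>(D2 ^^ k) g (x, 0)\<bar> / fact k * \<bar>y\<bar> ^ k"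
        by (simp add: abs_mult power_abs)
      also have "\<dots> \<le> \<bar>(D2 ^^ k) g (x, 0)\<bar> / 1 * \<bar>y\<bar> ^ k"
        by (intro mult_right_mono divide_left_mono) (auto simp: fact_ge_1)
      also have "\<dots> \<le> (L k * x powr (?q1 - m1 * real k)) * \<bar>y\<bar> ^ k"
        using 1 by (intro mult_right_mono) auto
      also have "\<dots> = (x powr (?q1 - m1 * real k) * x powr (m1 * real k)) * (L k * u ^ k)"
        unfolding yk by (simp only: mult_ac)
      also have "x powr (?q1 - m1 * real k) * x powr (m1 * real k) = x powr ?q1"
        by (simp flip: powr_add)
      also have "x powr ?q1 * (L k * u ^ k) \<le> x powr ?q1 * (L k * u ^ (N - 1))"
        using k u1 L0[of k] by (intro mult_left_mono power_increasing) auto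
      finally show ?thesis .
    qed
    have S: "\<bar>\<Sum>k<N. (D2 ^^ k) g (x, 0) / fact k * y ^ k\<bar> \<le> x powr ?q1 * (A * u ^ (N - 1))"
    proof -
      have "\<bar>\<Sum>k<N. (D2 ^^ k) g (x, 0) / fact k * y ^ k\<bar> \<le> (\<Sum>k<N. x powr ?q1 * (L k * u ^ (N - 1)))"
        by (rule order_trans[OF sum_abs sum_mono]) (rule terms, simp)
      also have "\<dots> = x powr ?q1 * (A * u ^ (N - 1))"
        by (simp only: A_def sum_distrib_right sum_distrib_left)
      finally show ?thesis .
    qed
    have "c * x powr a \<le> \<sigma> * (D2 ^^ N) g (x, t)" using low[OF inH(1)[OF t(1)]] q by simp
    also have "\<dots> \<le> \<bar>(D2 ^^ N) g (x, t)\<bar>" using \<sigma> by auto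
    finally have Dlow: "c * x powr a \<le> \<bar>(D2 ^^ N) g (x, t)\<bar>" .
    have "x powr ?q1 * (c / fact N * u ^ N) = c * x powr a / fact N * \<bar>y\<bar> ^ N"
      unfolding yk by (simp add: powr_add)
    also have "\<dots> \<le> \<bar>(D2 ^^ N) g (x, t)\<bar> / fact N * \<bar>y\<bar> ^ N"
      using Dlow by (intro mult_right_mono divide_right_mono) auto
    also have "\<dots> = \<bar>(D2 ^^ N) g (x, t) / fact N * y ^ N\<bar>" by (simp add: abs_mult power_abs)
    finally have top: "x powr ?q1 * (c / fact N * u ^ N) \<le> \<bar>(D2 ^^ N) g (x, t) / fact N * y ^ N\<bar>" .
    have "u ^ N = u * u ^ (N - 1)" using N(2) by (cases N) auto
    then have e: "c / fact N * u ^ N - A * u ^ (N - 1) = (c * u / fact N - A) * u ^ (N - 1)"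
      by (simp add: algebra_simps)
    have "fact N * (A + 1) / c \<le> u" using uC by (simp add: C_def)
    then have "A + 1 \<le> c * u / fact N" using c by (simp add: field_simps)
    then have "1 * 1 \<le> (c * u / fact N - A) * u ^ (N - 1)"
      using u1 by (intro mult_mono) auto
    then have "x powr ?q1 * 1 \<le> x powr ?q1 * (c / fact N * u ^ N - A * u ^ (N - 1))"
      unfolding e by (intro mult_left_mono) auto
    also have "\<dots> = x powr ?q1 * (c / fact N * u ^ N) - x powr ?q1 * (A * u ^ (N - 1))" by (simp only: right_diff_distrib)
    also have "\<dots> \<le> \<bar>(D2 ^^ N) g (x, t) / fact N * y ^ N\<bar> - \<bar>\<Sum>k<N. (D2 ^^ k) g (x, 0) / fact k * y ^ k\<bar>"
      by (intro diff_mono top S)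
    also have "\<dots> \<le> \<bar>g (x, y)\<bar>" unfolding t(2) by linarith
    finally show ?thesis by simp
  qed
  then have "\<forall>x y. (x, y) \<in> horn m 0 \<delta> r \<longrightarrow> C * x powr m1 < \<bar>y\<bar> \<longrightarrow> x powr ?q1 \<le> \<bar>g (x, y)\<bar>" by simp
  then show ?thesis by (intro exI[of _ C] exI[of _ \<delta>] exI[of _ r] conjI \<delta> r)
qed

text \<open>In a chart only the roots of order greater than \<open>q / (1 + m)\<close> need a further argument: they
are recentered, and the hypothesis \<open>rec\<close> is asked for a root at \<open>0\<close>.\<close>

lemma horn_bound_root_chart:
  assumes f: "phase_function f" and \<phi>: "local_coordinates \<phi>" and m: "m \<ge> 1" and q: "q > 0"
    and w: "weight_ge (f \<circ> \<phi>) m q" and P: "edge_poly (f \<circ> \<phi>) m q \<noteq> 0"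
    and rec: "\<And>\<psi> n. q < real (order z (edge_poly (f \<circ> \<phi>) m q)) * (m + 1) \<Longrightarrow> (z \<noteq> 0 \<longrightarrow> m = real n) \<Longrightarrow>
        local_coordinates \<psi> \<Longrightarrow> weight_ge (f \<circ> \<psi>) m q \<Longrightarrow> edge_poly (f \<circ> \<psi>) m q \<noteq> 0 \<Longrightarrow>
        order 0 (edge_poly (f \<circ> \<psi>) m q) = order z (edge_poly (f \<circ> \<phi>) m q) \<Longrightarrow>
        \<exists>\<delta>>0. \<exists>r>0. sublevel_bound (height f) (newton_multiplicity f) (f \<circ> \<psi>) (horn m 0 \<delta> r)"
  shows "\<exists>\<delta>>0. \<exists>r>0. sublevel_bound (height f) (newton_multiplicity f) (f \<circ> \<phi>) (horn m z \<delta> r)"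
proof -
  let ?N = "order z (edge_poly (f \<circ> \<phi>) m q)"
  have g: "germ_smooth (f \<circ> \<phi>)" by (rule chart_germ_smooth[OF f \<phi>])
  have d: "q / (1 + m) \<le> height f" using weight_le_height[OF f \<phi> _ w] m by simp
  have "0 < q / (1 + m)" using q m by (intro divide_pos_pos) linarith+
  then have h: "height f > 0" using d by linarith
  consider (lt) "real ?N * (m + 1) < q" | (eq) "real ?N * (m + 1) = q" | (gt) "q < real ?N * (m + 1)" by linarith
  then show ?thesis
  proof cases
    case lt
    then show ?thesis using horn_bound_root[OF g m q w P refl h d] by blast
  next
    case eq
    have "newton_multiplicity f = 1" by (rule critical_root_multiplicity[OF f \<phi> m q w P eq])
    then show ?thesis using horn_bound_root[OF g m q w P refl h d] eq by blast
  next
    case gt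
    obtain n where n: "z \<noteq> 0 \<longrightarrow> m = real n" and \<psi>: "local_coordinates (\<phi> \<circ> shear z n)"
      "weight_ge (f \<circ> (\<phi> \<circ> shear z n)) m q" "edge_poly (f \<circ> (\<phi> \<circ> shear z n)) m q \<noteq> 0"
      "order 0 (edge_poly (f \<circ> (\<phi> \<circ> shear z n)) m q) = ?N"
      using recenter[OF f \<phi> m q w P less_imp_le[OF gt]] by blast
    have "\<exists>\<delta>>0. \<exists>r>0. sublevel_bound (height f) (newton_multiplicity f) ((f \<circ> \<phi>) \<circ> shear z n) (horn m 0 \<delta> r)"
      using rec[OF gt n \<psi>] by (simp only: o_assoc)
    then show ?thesis by (rule horn_bound_shear[OF g m n])
  qed
qed

text \<open>In the horn of weight \<open>m\<close> the region \<open>|y| > C x^m1\<close> meets the sublevel set only for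
\<open>x \<le> \<epsilon>^(1/q1)\<close>, by \<open>lower_bound_above_edge\<close>. The van der Corput bound, integrated over this
short range of \<open>x\<close>, gives \<open>\<epsilon>^((1+m1)/q1)\<close>, and \<open>q1 / (1 + m1) \<le> h\<close>. What remains is a
horn of the larger weight \<open>m1\<close>.\<close>

lemma horn_bound_combine:
  assumes g: "germ_smooth g" and m: "m \<ge> 1" and q: "q > 0" and w: "weight_ge g m q" and P: "edge_poly g m q \<noteq> 0"
    and N: "N = order 0 (edge_poly g m q)" "q < real N * (m + 1)" and qa: "q = real a + m * real N"
    and m1: "m < m1" and w1: "weight_ge g m1 (real a + m1 * real N)" and h: "h > 0" "(real a + m1 * real N) / (1 + m1) \<le> h"
    and inner: "\<And>C. \<exists>r>0. sublevel_bound h l g (horn m1 0 C r)"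
  shows "\<exists>\<delta>>0. \<exists>r>0. sublevel_bound h l g (horn m 0 \<delta> r)"
proof -
  define q1 where "q1 = real a + m1 * real N"
  have N1: "N \<ge> 1" using N(2) q m by (cases N) auto
  have q1: "q1 > 0" using N1 m m1 by (simp add: q1_def add_nonneg_pos)
  define s where "s = 1 / real N"
  have s: "s > 0" "N \<ge> 1 \<Longrightarrow> s = 1 / real N" using N1 by (auto simp: s_def)
  obtain C \<delta>1 r1 where C: "\<delta>1 > 0" "r1 > 0" "\<And>x y. (x, y) \<in> horn m 0 \<delta>1 r1 \<Longrightarrow> C * x powr m1 < \<bar>y\<bar> \<Longrightarrow> x powr q1 \<le> \<bar>g (x, y)\<bar>"
    using lower_bound_above_edge[OF g m w P N(1) N1 qa m1 w1] unfolding q1_def by blast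
  obtain \<delta>2 r2 A where \<delta>2: "\<delta>2 > 0" "r2 > 0" "r2 \<le> 1" and cont: "continuous_on (horn m 0 \<delta>2 r2) g" and A: "A \<ge> 0"
    "\<And>\<epsilon> x. \<epsilon> > 0 \<Longrightarrow> emeasure lborel {y. (x, y) \<in> {p \<in> horn m 0 \<delta>2 r2. \<bar>g p\<bar> \<le> \<epsilon>}} \<le> ennreal (A * section_majorant m q s \<epsilon> x)"
    using section_bound[OF g m w P N(1) s] by blast
  obtain r3 where r3: "r3 > 0" "sublevel_bound h l g (horn m1 0 C r3)" using inner by blast
  obtain B where B: "B \<ge> 0" "\<And>\<epsilon>. 0 < \<epsilon> \<Longrightarrow> \<epsilon> \<le> 1 / 2 \<Longrightarrow>
        emeasure lborel {p\<in>horn m1 0 C r3. \<bar>g p\<bar> \<le> \<epsilon>} \<le> ennreal (B * (\<epsilon> powr (1 / h) * ln (1 / \<epsilon>) ^ l))"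
    and c3: "continuous_on (horn m1 0 C r3) g"
    using r3(2) unfolding sublevel_bound_def by blast
  define \<delta> where "\<delta> = min \<delta>1 \<delta>2"
  define r where "r = min r1 (min r2 r3)"
  have \<delta>r: "\<delta> > 0" "r > 0" "r \<le> 1" using C \<delta>2 r3 by (auto simp: \<delta>_def r_def)
  let ?T = "horn m 0 \<delta> r"
  have T1: "?T \<subseteq> horn m 0 \<delta>1 r1" and T2: "?T \<subseteq> horn m 0 \<delta>2 r2"
    by (rule horn_mono; simp add: \<delta>_def r_def)+
  have contT: "continuous_on ?T g" by (rule continuous_on_subset[OF cont T2])
  define e1 where "e1 = m - q * s + 1"
  have e1: "e1 > 0"
  proof -
    have "q / real N < m + 1" using N(2) N1 by (simp add: pos_divide_less_eq mult.commute)
    then show ?thesis by (simp add: e1_def s_def)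
  qed
  define D where "D = (A / e1 / ln 2 ^ l + B)"
  have D0: "D \<ge> 0" using A(1) B(1) e1 by (simp add: D_def)
  have "emeasure lborel {p\<in>?T. \<bar>g p\<bar> \<le> \<epsilon>} \<le> ennreal (D * (\<epsilon> powr (1 / h) * ln (1 / \<epsilon>) ^ l))" if e: "0 < \<epsilon>" "\<epsilon> \<le> 1 / 2" for \<epsilon>
  proof -
    \<comment> \<open>To the right of \<open>x1\<close> the lower bound \<open>x^q1\<close> exceeds \<open>\<epsilon>\<close>.\<close>
    define x1 where "x1 = \<epsilon> powr (1 / q1)"
    have x1: "x1 > 0" using e by (simp add: x1_def)
    let ?S1 = "{p\<in>?T. \<bar>g p\<bar> \<le> \<epsilon>} \<inter> {p. fst p \<le> x1}"
    let ?S2 = "{p\<in>horn m1 0 C r3. \<bar>g p\<bar> \<le> \<epsilon>}"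
    have mS: "?S1 \<in> sets borel" "?S2 \<in> sets borel"
    proof -
      have "closed {p :: real \<times> real. fst p \<le> x1}" by (intro closed_Collect_le continuous_intros)
      then show "?S1 \<in> sets borel" by (intro sets.Int sublevel_measurable[OF horn_measurable contT] borel_closed)
      show "?S2 \<in> sets borel" by (rule sublevel_measurable[OF horn_measurable c3])
    qed
    have sub: "{p\<in>?T. \<bar>g p\<bar> \<le> \<epsilon>} \<subseteq> ?S1 \<union> ?S2"
    proof
      fix p assume p: "p \<in> {p\<in>?T. \<bar>g p\<bar> \<le> \<epsilon>}"
      obtain x y where xy: "p = (x, y)" by (cases p)
      have x: "0 < x" "x < r" and gp: "\<bar>g (x, y)\<bar> \<le> \<epsilon>" and pT: "(x, y) \<in> ?T" using p by (auto simp: xy horn_def)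
      show "p \<in> ?S1 \<union> ?S2"
      proof (cases "x \<le> x1")
        case True
        then show ?thesis using p by (simp add: xy)
      next
        case False
        have "x1 powr q1 < x powr q1" using False x1 q1 by (intro powr_less_mono2) auto
        also have "x1 powr q1 = \<epsilon>" using e q1 by (simp add: x1_def powr_powr)
        finally have "\<not> C * x powr m1 < \<bar>y\<bar>" using C(3)[of x y] T1 pT gp by fastforce
        then have "(x, y) \<in> horn m1 0 C r3" using x by (simp add: horn_def r_def)
        then show ?thesis using gp by (simp add: xy)
      qed
    qed
    have S1: "emeasure lborel ?S1 \<le> ennreal (A / e1 * \<epsilon> powr ((1 + m1) / q1))"
    proof -
      have "emeasure lborel {y. (x, y) \<in> ?S1} \<le> ennreal (A * \<epsilon> powr s) * ennreal (indicator {0..x1} x * x powr (m - q * s))" for x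
      proof (cases "0 < x \<and> x < r \<and> x \<le> x1")
        case True
        have mono: "{y. (x, y) \<in> ?S1} \<subseteq> {y. (x, y) \<in> {p \<in> horn m 0 \<delta>2 r2. \<bar>g p\<bar> \<le> \<epsilon>}}" using T2 by auto
        have meas: "{y. (x, y) \<in> {p \<in> horn m 0 \<delta>2 r2. \<bar>g p\<bar> \<le> \<epsilon>}} \<in> sets lborel"
          using emeasure_by_sections(2)[OF sublevel_measurable[OF horn_measurable cont, of \<epsilon>], of x] by (simp add: vimage_def)
        have "emeasure lborel {y. (x, y) \<in> ?S1} \<le> ennreal (A * section_majorant m q s \<epsilon> x)"
          by (rule order_trans[OF emeasure_mono[OF mono meas] A(2)[OF e(1)]])
        also have "section_majorant m q s \<epsilon> x \<le> \<epsilon> powr s * x powr (m - q * s)"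
        proof -
          have "section_majorant m q s \<epsilon> x = x powr m * min 1 ((\<epsilon> / x powr q) powr s)" using True \<delta>r by (simp add: section_majorant_def)
          also have "\<dots> \<le> x powr m * (\<epsilon> / x powr q) powr s" by (intro mult_left_mono) auto
          also have "\<dots> = \<epsilon> powr s * x powr (m - q * s)" using True e by (intro section_majorant_power) auto
          finally show ?thesis .
        qed
        then have "ennreal (A * section_majorant m q s \<epsilon> x) \<le> ennreal (A * (\<epsilon> powr s * x powr (m - q * s)))"
          by (intro ennreal_leI mult_left_mono A(1))
        also have "\<dots> = ennreal (A * \<epsilon> powr s) * ennreal (indicator {0..x1} x * x powr (m - q * s))"
          using True A(1) by (simp add: ennreal_mult[symmetric] mult.assoc)
        finally show ?thesis .
      next
        case False
        then have em: "{y. (x, y) \<in> ?S1} = {}" by (auto simp: horn_def)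
        show ?thesis unfolding em by simp
      qed
      then have "emeasure lborel ?S1 \<le> (\<integral>\<^sup>+x. ennreal (A * \<epsilon> powr s) * ennreal (indicator {0..x1} x * x powr (m - q * s)) \<partial>lborel)"
        by (rule emeasure_sections[OF mS(1)])
      also have "\<dots> = ennreal (A * \<epsilon> powr s) * ennreal (x1 powr e1 / e1)"
        using nn_integral_powr_0[of "m - q * s" x1] e1 x1 by (simp add: nn_integral_cmult e1_def)
      also have "\<dots> = ennreal ((A * \<epsilon> powr s) * (x1 powr e1 / e1))"
        using A(1) e1 by (intro ennreal_mult[symmetric]) auto
      also have "(A * \<epsilon> powr s) * (x1 powr e1 / e1) = A / e1 * (\<epsilon> powr s * x1 powr e1)" by simp
      also have "\<epsilon> powr s * x1 powr e1 = \<epsilon> powr ((1 + m1) / q1)"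
      proof -
        have "s + 1 / q1 * e1 = (1 + m1) / q1"
        proof -
          have "e1 * real N = real N - real a" using N1 by (simp add: e1_def s_def qa field_simps)
          moreover have "s * real N = 1" using N1 by (simp add: s_def)
          moreover have "(s + 1 / q1 * e1) * (q1 * real N) = (s * real N) * q1 + e1 * real N"
            using q1 by (simp add: algebra_simps)
          ultimately have "(s + 1 / q1 * e1) * (q1 * real N) = q1 + (real N - real a)"
            by simp
          also have "\<dots> = (1 + m1) * real N" by (simp add: q1_def algebra_simps)
          also have "\<dots> = (1 + m1) / q1 * (q1 * real N)" using q1 by simp
          finally show ?thesis using q1 N1 by (simp add: eq_divide_eq)
        qed
        then show ?thesis using e by (simp add: x1_def powr_powr flip: powr_add)
      qed
      finally show ?thesis .
    qed
    have hq: "1 / h \<le> (1 + m1) / q1" using h q1 m m1 unfolding q1_def[symmetric] by (simp add: field_simps)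
    have w0: "0 \<le> \<epsilon> powr (1 / h) * ln (1 / \<epsilon>) ^ l" using e by (intro mult_nonneg_nonneg zero_le_power ln_ge_zero) auto
    have "A / e1 * \<epsilon> powr ((1 + m1) / q1) \<le> A / e1 * ((1 / ln 2 ^ l) * (\<epsilon> powr (1 / h) * ln (1 / \<epsilon>) ^ l))"
      using A(1) e1 by (intro mult_left_mono log_absorb e hq) auto
    also have "\<dots> = (A / e1 / ln 2 ^ l) * (\<epsilon> powr (1 / h) * ln (1 / \<epsilon>) ^ l)" by simp
    finally have S1': "emeasure lborel ?S1 \<le> ennreal ((A / e1 / ln 2 ^ l) * (\<epsilon> powr (1 / h) * ln (1 / \<epsilon>) ^ l))"
      using order_trans[OF S1 ennreal_leI] by blast
    have "emeasure lborel {p\<in>?T. \<bar>g p\<bar> \<le> \<epsilon>} \<le> emeasure lborel (?S1 \<union> ?S2)"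
      by (rule emeasure_mono[OF sub]) (use mS in \<open>simp only: sets_lborel sets.Un\<close>)
    also have "\<dots> \<le> emeasure lborel ?S1 + emeasure lborel ?S2"
      by (rule emeasure_subadditive) (use mS in \<open>simp_all only: sets_lborel\<close>)
    also have "\<dots> \<le> ennreal ((A / e1 / ln 2 ^ l) * (\<epsilon> powr (1 / h) * ln (1 / \<epsilon>) ^ l)) + ennreal (B * (\<epsilon> powr (1 / h) * ln (1 / \<epsilon>) ^ l))"
      by (intro add_mono S1' B(2) e)
    also have "\<dots> = ennreal (D * (\<epsilon> powr (1 / h) * ln (1 / \<epsilon>) ^ l))"
    proof -
      have "0 \<le> (A / e1 / ln 2 ^ l) * (\<epsilon> powr (1 / h) * ln (1 / \<epsilon>) ^ l)" by (rule mult_nonneg_nonneg[OF _ w0]) (use A(1) e1 in simp)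
      moreover have "0 \<le> B * (\<epsilon> powr (1 / h) * ln (1 / \<epsilon>) ^ l)" by (rule mult_nonneg_nonneg[OF B(1) w0])
      ultimately show ?thesis unfolding D_def distrib_right by (rule ennreal_plus[symmetric])
    qed
    finally show ?thesis .
  qed
  then have "sublevel_bound h l g ?T" unfolding sublevel_bound_def using horn_measurable contT D0 by blast
  then show ?thesis using \<delta>r by blast
qed

text \<open>The edge from \<open>(a, N)\<close> to the lower support point \<open>(j, k)\<close> has an edge polynomial of degree \<open>N\<close>, because points
above \<open>(a, N)\<close> lie off the new line, and its order at \<open>0\<close> is less than \<open>N\<close>.\<close>

lemma next_edge:
  assumes m: "m > 0" and w: "weight_ge g m (real a + m * real N)" and aN: "(a, N) \<in> taylor_support g"
    and m1: "m < m1" and w1: "weight_ge g m1 (real a + m1 * real N)"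
    and low: "(j, k) \<in> taylor_support g" "k < N" "real j + m1 * real k = real a + m1 * real N"
  defines "P \<equiv> edge_poly g m1 (real a + m1 * real N)"
  shows "P \<noteq> 0" "order 0 P < N" "order z P \<le> N"
proof -
  have m1': "m1 > 0" using m m1 by simp
  have cN: "coeff P N \<noteq> 0" unfolding P_def using coeff_edge_poly[where g=g and j=a and k=N and q="real a + m1 * real N", OF m1' refl] aN by (simp add: taylor_support_def)
  then show P0: "P \<noteq> 0" by auto
  have ck: "coeff P k \<noteq> 0" unfolding P_def using coeff_edge_poly[OF m1' low(3), of g] low(1) by (simp add: taylor_support_def)
  then have "\<not> k < order 0 P" using coeff_eq_0_below_order(1)[OF P0, of k] by blast
  then show "order 0 P < N" using low(2) by simp
  have "coeff P i = 0" if "N < i" for i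
  proof (rule ccontr)
    assume "coeff P i \<noteq> 0"
    then obtain b where b: "real b + m1 * real i = real a + m1 * real N" "(b, i) \<in> taylor_support g"
      unfolding P_def by (rule coeff_edge_poly_nonzeroE[OF m1'])
    have "real a + m * real N \<le> real b + m * real i" using w b(2) unfolding weight_ge_def by auto
    moreover have "(m1 - m) * real N < (m1 - m) * real i" using that m1 by simp
    ultimately show False using b(1) by (simp add: algebra_simps)
  qed
  then have "degree P \<le> N" by (intro degree_le) auto
  then show "order z P \<le> N" using order_degree[OF P0, of z] by simp
qed

text \<open>The recursion over the edges. The outer induction is on the order \<open>N\<close> of the root at \<open>0\<close>. If
\<open>N\<close> exceeds the height, then so does the distance of any line through \<open>(a, N)\<close> of large
weight, so \<open>weight_le_height\<close> bounds the admissible weights by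
\<open>M = (h - a) / (N - h)\<close>, and there is a next edge, of weight \<open>m1 \<le> M\<close>. A root of order
\<open>N\<close> on that edge is nonzero by \<open>next_edge\<close>, hence \<open>m1\<close> is an integer above \<open>m\<close>. Recentering keeps \<open>N\<close>
and the lower vertex \<open>(a, N)\<close>, and so keeps \<open>M\<close>; the inner induction therefore counts the integers
between \<open>m\<close> and \<open>M\<close>. The bound \<open>M\<close> is written in terms of \<open>m\<close> and \<open>q = a + m N\<close>, since
\<open>a\<close> is not available before the induction starts.\<close>

lemma horn_bound_high_root:
  assumes f: "phase_function f"
  shows "local_coordinates \<phi> \<Longrightarrow> m \<ge> 1 \<Longrightarrow> q > 0 \<Longrightarrow> weight_ge (f \<circ> \<phi>) m q \<Longrightarrow> edge_poly (f \<circ> \<phi>) m q \<noteq> 0 \<Longrightarrow>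
    order 0 (edge_poly (f \<circ> \<phi>) m q) = N \<Longrightarrow> q < real N * (m + 1) \<Longrightarrow>
    \<exists>\<delta>>0. \<exists>r>0. sublevel_bound (height f) (newton_multiplicity f) (f \<circ> \<phi>) (horn m 0 \<delta> r)"
proof (induction N arbitrary: \<phi> m q rule: less_induct)
  case (less N)
  note outer = less.IH
  let ?h = "height f" and ?l = "newton_multiplicity f"
  \<comment> \<open>With \<open>q = a + m N\<close> this is \<open>(h - a) / (N - h)\<close>.\<close>
  let ?M = "\<lambda>m q. (?h - (q - m * real N)) / (real N - ?h)"
  from less.prems show ?case
  proof (induction "nat \<lfloor>?M m q\<rfloor> - nat \<lfloor>m\<rfloor>" arbitrary: \<phi> m q rule: less_induct)
    case less
    note \<phi> = less.prems(1) and m = less.prems(2) and q = less.prems(3) and w = less.prems(4)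
      and P = less.prems(5) and o = less.prems(6) and gt = less.prems(7)
    let ?g = "f \<circ> \<phi>"
    have g: "germ_smooth ?g" by (rule chart_germ_smooth[OF f \<phi>])
    have m0: "m > 0" using m by simp
    have d: "q / (1 + m) \<le> ?h" using weight_le_height[OF f \<phi> _ w] m by simp
    have "0 < q / (1 + m)" using q m by (intro divide_pos_pos) linarith+
    then have h: "?h > 0" using d by linarith
    show ?case
    proof (cases "real N \<le> ?h")
      case True
      then show ?thesis using horn_bound_root[OF g m q w P o[symmetric] h d] gt by blast
    next
      case False
      then have hN: "?h < real N" by simp
      obtain a where a: "(a, N) \<in> taylor_support ?g" "real a + m * real N = q"
        and face: "\<And>j k. (j, k) \<in> taylor_support ?g \<Longrightarrow> real j + m * real k = q \<Longrightarrow> N \<le> k"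
        using lowest_vertex[OF m0 P o] by blast
      define M where "M = (?h - real a) / (real N - ?h)"
      have Mq: "?M m q = M" using a(2) by (simp add: M_def algebra_simps)
      have slope_le: "\<mu> \<le> M" if "\<mu> > m" "weight_ge ?g \<mu> (real a + \<mu> * real N)" for \<mu>
      proof -
        have "(real a + \<mu> * real N) / (1 + \<mu>) \<le> ?h" using weight_le_height[OF f \<phi> _ that(2)] that(1) m by simp
        then have "real a + \<mu> * real N \<le> ?h * (1 + \<mu>)" using that(1) m by (simp add: pos_divide_le_eq)
        then have "\<mu> * (real N - ?h) \<le> ?h - real a" by (simp add: algebra_simps)
        then show ?thesis using hN by (simp add: M_def pos_le_divide_eq)
      qed
      have w': "weight_ge ?g m (real a + m * real N)" using w a(2) by simp
      have ns: "(\<forall>\<mu>>m. weight_ge ?g \<mu> (real a + \<mu> * real N)) \<or>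
        (\<exists>m1>m. weight_ge ?g m1 (real a + m1 * real N) \<and> (\<exists>j k. (j, k) \<in> taylor_support ?g \<and> k < N \<and> real j + m1 * real k = real a + m1 * real N))"
        by (rule next_slope[OF m0 w']) (use face a(2) in auto)
      have "\<not> (\<forall>\<mu>>m. weight_ge ?g \<mu> (real a + \<mu> * real N))"
      proof
        assume all: "\<forall>\<mu>>m. weight_ge ?g \<mu> (real a + \<mu> * real N)"
        have "max (m + 1) (M + 1) > m" by simp
        then have "max (m + 1) (M + 1) \<le> M" using slope_le all by blast
        then show False by simp
      qed
      then obtain m1 j k where m1: "m1 > m" and w1: "weight_ge ?g m1 (real a + m1 * real N)"
        and jk: "(j, k) \<in> taylor_support ?g" "k < N" "real j + m1 * real k = real a + m1 * real N"
        using ns by blast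
      define q1 where "q1 = real a + m1 * real N"
      note ne = next_edge[OF m0 w' a(1) m1 w1 jk]
      have m1': "m1 \<ge> 1" using m m1 by simp
      have q1: "q1 > 0" using jk(2) m1' by (simp add: q1_def add_nonneg_pos)
      have w1': "weight_ge ?g m1 q1" using w1 by (simp add: q1_def)
      have P1: "edge_poly ?g m1 q1 \<noteq> 0" using ne(1) by (simp add: q1_def)
      have d1: "q1 / (1 + m1) \<le> ?h" using weight_le_height[OF f \<phi> _ w1'] m1' by simp
      have local: "\<exists>\<delta>>0. \<exists>r>0. sublevel_bound ?h ?l ?g (horn m1 z \<delta> r)" for z
      proof (rule horn_bound_root_chart[OF f \<phi> m1' q1 w1' P1])
        fix \<psi> n assume gt1: "q1 < real (order z (edge_poly ?g m1 q1)) * (m1 + 1)" and n: "z \<noteq> 0 \<longrightarrow> m1 = real n"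
          and \<psi>: "local_coordinates \<psi>" "weight_ge (f \<circ> \<psi>) m1 q1" "edge_poly (f \<circ> \<psi>) m1 q1 \<noteq> 0"
            "order 0 (edge_poly (f \<circ> \<psi>) m1 q1) = order z (edge_poly ?g m1 q1)"
        show "\<exists>\<delta>>0. \<exists>r>0. sublevel_bound ?h ?l (f \<circ> \<psi>) (horn m1 0 \<delta> r)"
        proof (cases "order z (edge_poly ?g m1 q1) < N")
          case True
          show ?thesis by (rule outer[OF True \<psi>(1) m1' q1 \<psi>(2,3,4) gt1])
        next
          case False
          then have oN: "order z (edge_poly ?g m1 q1) = N" using ne(3)[of z] by (simp add: q1_def)
          have "z \<noteq> 0" using ne(2) oN by (auto simp: q1_def)
          then have mn: "m1 = real n" using n by blast
          have "m1 \<le> M" by (rule slope_le[OF m1 w1])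
          then have nM: "int n \<le> \<lfloor>M\<rfloor>" using mn by (simp add: le_floor_iff)
          have "\<lfloor>m\<rfloor> < int n" using m1 mn by (simp add: floor_less_iff)
          moreover have "0 \<le> \<lfloor>m\<rfloor>" "\<lfloor>m1\<rfloor> = int n" using m mn by simp_all
          ultimately have lt: "nat \<lfloor>m\<rfloor> < nat \<lfloor>m1\<rfloor>" "nat \<lfloor>m\<rfloor> < nat \<lfloor>M\<rfloor>" using nM by linarith+
          have Mq1: "?M m1 q1 = M" by (simp add: M_def q1_def)
          have dec: "nat \<lfloor>?M m1 q1\<rfloor> - nat \<lfloor>m1\<rfloor> < nat \<lfloor>?M m q\<rfloor> - nat \<lfloor>m\<rfloor>"
            unfolding Mq Mq1 using lt by linarith
          show ?thesis by (rule less.hyps[OF dec \<psi>(1) m1' q1 \<psi>(2,3)]) (use \<psi>(4) oN gt1 in simp_all)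
        qed
      qed
      have inner: "\<exists>r>0. sublevel_bound ?h ?l ?g (horn m1 0 C r)" for C
        by (rule horn_bound_all_roots[OF g m1' q1 w1' P1 local])
      show ?thesis
        by (rule horn_bound_combine[OF g m q w P o[symmetric] gt a(2)[symmetric] m1 w1 h d1[unfolded q1_def] inner])
    qed
  qed
qed

text \<open>The starting point is weight \<open>1\<close>, for which \<open>q\<close> is the order of vanishing and the horn is
a cone around the positive \<open>x\<close>-axis.\<close>

lemma cone_bound:
  assumes f: "phase_function f" and \<phi>: "local_coordinates \<phi>"
  shows "\<exists>r>0. sublevel_bound (height f) (newton_multiplicity f) (f \<circ> \<phi>) (horn 1 0 1 r)"
proof -
  let ?g = "f \<circ> \<phi>"
  define n where "n = (LEAST n. \<exists>j k. (j, k) \<in> taylor_support ?g \<and> j + k = n)"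
  have ex: "\<exists>n. \<exists>j k. (j, k) \<in> taylor_support ?g \<and> j + k = n"
    using chart_finite_type[OF f \<phi>] unfolding finite_type_def by auto
  obtain j k where jk: "(j, k) \<in> taylor_support ?g" "j + k = n"
    using LeastI_ex[OF ex] unfolding n_def by blast
  have least: "n \<le> j' + k'" if "(j', k') \<in> taylor_support ?g" for j' k'
    unfolding n_def by (rule Least_le) (use that in blast)
  have "n \<noteq> 0" using jk chart_support_nonzero[OF f \<phi>] by (cases "j = 0 \<and> k = 0") auto
  then have q: "real n > 0" by simp
  have w: "weight_ge ?g 1 (real n)"
    unfolding weight_ge_def
  proof clarify
    fix j' k' assume "(j', k') \<in> taylor_support ?g"
    from least[OF this] show "real n \<le> real j' + 1 * real k'" by linarith
  qed
  have "real j + 1 * real k = real n" using jk(2) by linarith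
  then have "coeff (edge_poly ?g 1 (real n)) k = taylor_coeff ?g j k" by (intro coeff_edge_poly) auto
  then have P: "edge_poly ?g 1 (real n) \<noteq> 0" using jk(1) by (auto simp: taylor_support_def)
  have g: "germ_smooth ?g" by (rule chart_germ_smooth[OF f \<phi>])
  have "\<exists>\<delta>>0. \<exists>r>0. sublevel_bound (height f) (newton_multiplicity f) ?g (horn 1 z \<delta> r)" for z
  proof (rule horn_bound_root_chart[OF f \<phi> order_refl q w P])
    fix \<psi> assume gt: "real n < real (order z (edge_poly ?g 1 (real n))) * (1 + 1)"
      and \<psi>: "local_coordinates \<psi>" "weight_ge (f \<circ> \<psi>) 1 (real n)" "edge_poly (f \<circ> \<psi>) 1 (real n) \<noteq> 0"
        "order 0 (edge_poly (f \<circ> \<psi>) 1 (real n)) = order z (edge_poly ?g 1 (real n))"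
    show "\<exists>\<delta>>0. \<exists>r>0. sublevel_bound (height f) (newton_multiplicity f) (f \<circ> \<psi>) (horn 1 0 \<delta> r)"
      by (rule horn_bound_high_root[OF f \<psi>(1) order_refl q \<psi>(2,3,4) gt])
  qed
  then show ?thesis by (rule horn_bound_all_roots[OF g order_refl q w P])
qed

section \<open>The Mittag-Leffler function as a power series\<close>

text \<open>The reciprocal Gamma function is entire, so that \<open>\<gamma>\<close> may be any real number here.\<close>

definition ml :: "real \<Rightarrow> real \<Rightarrow> complex \<Rightarrow> complex" where
  "ml \<alpha> \<gamma> z = (\<Sum>k. of_real (rGamma (\<alpha> * real k + \<gamma>)) * z ^ k)"

lemma mittag_leffler_eq_ml: "mittag_leffler \<alpha> \<beta> = ml \<alpha> \<beta>"
proof -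
  have "inverse (Gamma (complex_of_real x)) = of_real (rGamma x)" for x
    by (metis Gamma_complex_of_real of_real_inverse rGamma_inverse_Gamma)
  then show ?thesis
    unfolding mittag_leffler_def ml_def divide_inverse by (simp only: mult.commute)
qed

text \<open>The part of the Gamma integral beyond \<open>T\<close> is at least \<open>T^(x-1) exp(-T)\<close>. With \<open>T\<close> free this
gives super-exponential decay, enough for the power series to be entire.\<close>

lemma rGamma_le:
  fixes x T :: real
  assumes "x \<ge> 1" "T > 0"
  shows "0 \<le> rGamma x" "rGamma x \<le> exp T * T powr (1 - x)"
proof -
  have G: "Gamma x > 0" using assms by simp
  then show "0 \<le> rGamma x" by (simp add: rGamma_inverse_Gamma)
  have 1: "((\<lambda>t. t powr (x - 1) / exp t) has_integral Gamma x) {0..}"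
    using assms by (intro Gamma_integral_real) auto
  have 2: "((\<lambda>t. T powr (x - 1) * exp (- 1 * t)) has_integral T powr (x - 1) * (exp (- 1 * T) / 1)) {T..}"
    using has_integral_exp_minus_to_infinity[of 1 T] by (intro has_integral_mult_right) simp
  have "T powr (x - 1) * (exp (- 1 * T) / 1) \<le> Gamma x"
  proof (rule order_trans)
    have "(\<lambda>t. t powr (x - 1) / exp t) absolutely_integrable_on {0..}"
      using 1 by (intro nonnegative_absolutely_integrable_1) (auto simp: has_integral_integrable)
    then have "(\<lambda>t. t powr (x - 1) / exp t) absolutely_integrable_on {T..}"
      by (rule set_integrable_subset) (use assms in auto)
    then have 3: "(\<lambda>t. t powr (x - 1) / exp t) integrable_on {T..}"
      using absolutely_integrable_on_def by blast
    show "integral {T..} (\<lambda>t. t powr (x - 1) / exp t) \<le> Gamma x"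
      using integral_subset_le[OF _ 3 has_integral_integrable[OF 1]] 1 assms by (auto simp: integral_unique)
    show "T powr (x - 1) * (exp (- 1 * T) / 1) \<le> integral {T..} (\<lambda>t. t powr (x - 1) / exp t)"
    proof (rule has_integral_le[OF 2 integrable_integral[OF 3]])
    fix t assume "t \<in> {T..}"
    then have "T powr (x - 1) \<le> t powr (x - 1)" using assms by (intro powr_mono2) auto
    then show "T powr (x - 1) * exp (- 1 * t) \<le> t powr (x - 1) / exp t"
      by (simp add: exp_minus divide_inverse mult_right_mono)
    qed
  qed
  then have "inverse (Gamma x) \<le> inverse (T powr (x - 1) * exp (- T))"
    using assms by (intro le_imp_inverse_le) auto
  also have "\<dots> = exp T * T powr (1 - x)"
    by (simp add: exp_minus mult.commute flip: powr_minus)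
  finally show "rGamma x \<le> exp T * T powr (1 - x)"
    by (simp add: rGamma_inverse_Gamma)
qed

lemma ml_summable:
  assumes "0 < \<alpha>"
  shows "summable (\<lambda>k. norm (of_real (rGamma (\<alpha> * real k + \<gamma>)) * z ^ k :: complex))"
proof -
  \<comment> \<open>Chosen so that \<open>T^\<alpha>\<close> exceeds \<open>2 |z|\<close>, which makes the terms decrease geometrically.\<close>
  define T where "T = (2 * norm z + 1) powr (1 / \<alpha>)"
  have z1: "2 * norm z + 1 > 0" by (simp add: add_nonneg_pos)
  have T: "T > 0" "T powr \<alpha> = 2 * norm z + 1"
    using assms z1 by (auto simp: T_def powr_powr)
  obtain N where N: "real N \<ge> (1 - \<gamma>) / \<alpha>" using real_arch_simple by blast
  show ?thesis
  proof (rule summable_comparison_test')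
    show "summable (\<lambda>k. exp T * T powr (1 - \<gamma>) * (1 / 2) ^ k)"
      by (intro summable_mult summable_geometric) simp
    fix k assume "N \<le> k"
    then have "real k \<ge> (1 - \<gamma>) / \<alpha>" using N by linarith
    then have k: "\<alpha> * real k + \<gamma> \<ge> 1" using assms by (simp add: field_simps)
    have "norm (of_real (rGamma (\<alpha> * real k + \<gamma>)) * z ^ k :: complex) = rGamma (\<alpha> * real k + \<gamma>) * norm z ^ k"
      using rGamma_le(1)[OF k T(1)] by (simp add: norm_mult norm_power)
    also have "\<dots> \<le> exp T * T powr (1 - (\<alpha> * real k + \<gamma>)) * norm z ^ k"
      by (intro mult_right_mono rGamma_le(2)[OF k T(1)]) simp
    also have "T powr (1 - (\<alpha> * real k + \<gamma>)) = T powr (1 - \<gamma>) / (2 * norm z + 1) ^ k"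
    proof -
      have "1 - (\<alpha> * real k + \<gamma>) = (1 - \<gamma>) - \<alpha> * real k" by simp
      then show ?thesis
        using T z1 by (simp only: powr_diff powr_powr[symmetric]) (simp add: powr_realpow)
    qed
    also have "exp T * (T powr (1 - \<gamma>) / (2 * norm z + 1) ^ k) * norm z ^ k
        = exp T * T powr (1 - \<gamma>) * (norm z / (2 * norm z + 1)) ^ k"
      by (simp add: power_divide)
    also have "\<dots> \<le> exp T * T powr (1 - \<gamma>) * (1 / 2) ^ k"
      by (intro mult_left_mono power_mono) (use z1 in \<open>auto simp: field_simps\<close>)
    finally show "norm (norm (of_real (rGamma (\<alpha> * real k + \<gamma>)) * z ^ k :: complex)) \<le> exp T * T powr (1 - \<gamma>) * (1 / 2) ^ k"
      by simp
  qed
qed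

lemma ml_summable': "0 < \<alpha> \<Longrightarrow> summable (\<lambda>k. of_real (rGamma (\<alpha> * real k + \<gamma>)) * z ^ k :: complex)"
  by (rule summable_norm_cancel[OF ml_summable])

lemma ml_has_field_derivative:
  assumes "0 < \<alpha>"
  shows "(ml \<alpha> \<gamma> has_field_derivative (\<Sum>k. diffs (\<lambda>k. of_real (rGamma (\<alpha> * real k + \<gamma>))) k * z ^ k)) (at z)"
  unfolding ml_def[abs_def]
  by (rule termdiffs_strong_converges_everywhere) (rule ml_summable'[OF assms])

lemma ml_holomorphic: "0 < \<alpha> \<Longrightarrow> ml \<alpha> \<gamma> holomorphic_on S"
  unfolding holomorphic_on_def field_differentiable_def
  by (intro ballI exI) (rule has_field_derivative_at_within[OF ml_has_field_derivative])

lemma ml_recurrence: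
  assumes "0 < \<alpha>"
  shows "ml \<alpha> \<gamma> z = of_real (rGamma \<gamma>) + z * ml \<alpha> (\<gamma> + \<alpha>) z"
proof -
  have "ml \<alpha> \<gamma> z = (\<Sum>k. of_real (rGamma (\<alpha> * real (Suc k) + \<gamma>)) * z ^ Suc k) + of_real (rGamma \<gamma>)"
    unfolding ml_def using suminf_split_head[OF ml_summable'[OF assms, of \<gamma> z]] by simp
  also have "(\<Sum>k. of_real (rGamma (\<alpha> * real (Suc k) + \<gamma>)) * z ^ Suc k)
      = (\<Sum>k. z * (of_real (rGamma (\<alpha> * real k + (\<gamma> + \<alpha>))) * z ^ k))"
    by (simp add: algebra_simps)
  also have "\<dots> = z * ml \<alpha> (\<gamma> + \<alpha>) z"
    unfolding ml_def by (rule suminf_mult[OF ml_summable'[OF assms]])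
  finally show ?thesis by simp
qed

text \<open>From \<open>1/\<Gamma>(w) = w/\<Gamma>(w+1)\<close> applied to each coefficient.\<close>

lemma ml_lower:
  assumes "0 < \<alpha>"
  shows "ml \<alpha> (\<gamma> - 1) z = of_real (\<gamma> - 1) * ml \<alpha> \<gamma> z + of_real \<alpha> * z * deriv (ml \<alpha> \<gamma>) z"
proof -
  let ?a = "\<lambda>k. of_real (rGamma (\<alpha> * real k + \<gamma>)) :: complex"
  have d: "deriv (ml \<alpha> \<gamma>) z = (\<Sum>k. diffs ?a k * z ^ k)"
    using ml_has_field_derivative[OF assms] DERIV_imp_deriv by blast
  have s: "summable (\<lambda>k. diffs ?a k * z ^ k)"
    by (rule termdiff_converges_all) (rule ml_summable'[OF assms])
  have s2: "(\<lambda>k. of_nat k * ?a k * z ^ k) sums (z * deriv (ml \<alpha> \<gamma>) z)"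
  proof -
    have "(\<lambda>k. z * (diffs ?a k * z ^ k)) sums (z * deriv (ml \<alpha> \<gamma>) z)"
      unfolding d by (rule sums_mult[OF summable_sums[OF s]])
    then have "(\<lambda>k. of_nat (Suc k) * ?a (Suc k) * z ^ (Suc k)) sums (z * deriv (ml \<alpha> \<gamma>) z)"
      by (simp add: diffs_def mult_ac)
    then show ?thesis
      by (subst (asm) sums_Suc_iff) simp
  qed
  have s1: "(\<lambda>k. ?a k * z ^ k) sums ml \<alpha> \<gamma> z"
    unfolding ml_def by (rule summable_sums[OF ml_summable'[OF assms]])
  have "(\<lambda>k. of_real (\<gamma> - 1) * (?a k * z ^ k) + of_real \<alpha> * (of_nat k * ?a k * z ^ k)) sums
     (of_real (\<gamma> - 1) * ml \<alpha> \<gamma> z + of_real \<alpha> * (z * deriv (ml \<alpha> \<gamma>) z))"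
    by (intro sums_add sums_mult s1 s2)
  moreover have "of_real (\<gamma> - 1) * (?a k * z ^ k) + of_real \<alpha> * (of_nat k * ?a k * z ^ k)
      = of_real (rGamma (\<alpha> * real k + (\<gamma> - 1))) * z ^ k" for k
  proof -
    have "rGamma (\<alpha> * real k + (\<gamma> - 1)) = (\<alpha> * real k + (\<gamma> - 1)) * rGamma (\<alpha> * real k + \<gamma>)"
      using rGamma_plus1[of "\<alpha> * real k + (\<gamma> - 1)"] by (simp add: algebra_simps)
    then have "complex_of_real (rGamma (\<alpha> * real k + (\<gamma> - 1)))
        = of_real (\<alpha> * real k + (\<gamma> - 1)) * of_real (rGamma (\<alpha> * real k + \<gamma>))"
      by (simp only: of_real_mult)
    moreover have "complex_of_real (\<alpha> * real k + (\<gamma> - 1)) = of_real \<alpha> * of_nat k + of_real (\<gamma> - 1)"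
      by simp
    ultimately show ?thesis by (simp only:) (simp add: algebra_simps)
  qed
  ultimately show ?thesis
    unfolding ml_def[of \<alpha> "\<gamma> - 1"] by (simp add: sums_iff mult_ac)
qed

text \<open>A double sector around the imaginary axis. Cauchy estimates need some room, so bounds on the axis
alone would not suffice.\<close>

definition sector :: "real \<Rightarrow> complex set" where
  "sector \<eta> = {z. \<bar>Re z\<bar> \<le> \<eta> * \<bar>Im z\<bar>}"

text \<open>By Cauchy's estimate on a disc of radius proportional to \<open>|Im z|\<close> inside the larger
sector, \<open>z\<close> times the derivative is bounded on the smaller one, and \<open>ml_lower\<close> applies.\<close>

lemma ml_bounded_lower:
  assumes "0 < \<alpha>" "0 < \<eta>" "bounded (ml \<alpha> \<gamma> ` sector \<eta>)"
  shows "bounded (ml \<alpha> (\<gamma> - 1) ` sector (\<eta> / 2))"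
proof -
  obtain B where B: "\<And>z. z \<in> sector \<eta> \<Longrightarrow> norm (ml \<alpha> \<gamma> z) \<le> B"
    using assms(3) unfolding bounded_iff by auto
  have "norm (ml \<alpha> \<gamma> 0) \<le> B" by (rule B) (simp add: sector_def)
  then have B0: "B \<ge> 0" by (rule order_trans[OF norm_ge_zero])
  \<comment> \<open>The disc of radius \<open>\<rho> |Im z|\<close> around a point of the half sector stays in the full sector: \<open>\<eta>/2 + \<rho> = \<eta> (1 - \<rho>)\<close>.\<close>
  define \<rho> where "\<rho> = \<eta> / (2 * (1 + \<eta>))"
  have \<rho>: "\<rho> > 0" "\<rho> * (1 + \<eta>) = \<eta> / 2" using assms by (auto simp: \<rho>_def field_simps)
  have sub: "z \<in> sector \<eta>" if "z \<in> sector (\<eta> / 2)" for z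
  proof -
    have "\<eta> / 2 * \<bar>Im z\<bar> \<le> \<eta> * \<bar>Im z\<bar>" using assms by (intro mult_right_mono) auto
    then show ?thesis using that unfolding sector_def mem_Collect_eq by linarith
  qed
  have "norm (ml \<alpha> (\<gamma> - 1) z) \<le> \<bar>\<gamma> - 1\<bar> * B + \<alpha> * ((1 + \<eta> / 2) * B / \<rho>)" if z: "z \<in> sector (\<eta> / 2)" for z
  proof -
    have "norm (z * deriv (ml \<alpha> \<gamma>) z) \<le> (1 + \<eta> / 2) * B / \<rho>"
    proof (cases "Im z = 0")
      case True
      then have "z = 0" using z by (auto simp: sector_def complex_eq_iff)
      then show ?thesis using B0 \<rho> assms by simp
    next
      case False
      let ?r = "\<rho> * \<bar>Im z\<bar>"
      have r: "?r > 0" using False \<rho> by simp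
      have "norm ((deriv ^^ 1) (ml \<alpha> \<gamma>) z) \<le> fact 1 * B / ?r ^ 1"
      proof (rule Cauchy_inequality)
        show "ml \<alpha> \<gamma> holomorphic_on ball z ?r" by (rule ml_holomorphic[OF assms(1)])
        show "continuous_on (cball z ?r) (ml \<alpha> \<gamma>)"
          by (intro holomorphic_on_imp_continuous_on ml_holomorphic assms)
        show "0 < ?r" by (rule r)
        fix w assume w: "norm (z - w) = ?r"
        have "\<bar>Re (z - w)\<bar> \<le> ?r" "\<bar>Im (z - w)\<bar> \<le> ?r"
          using w abs_Re_le_cmod abs_Im_le_cmod by metis+
        then have 1: "\<bar>Re w\<bar> \<le> \<bar>Re z\<bar> + ?r" and 2: "\<bar>Im z\<bar> - ?r \<le> \<bar>Im w\<bar>" by auto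
        have "\<bar>Re w\<bar> \<le> \<eta> / 2 * \<bar>Im z\<bar> + ?r" using 1 z by (simp add: sector_def)
        also have "\<dots> = \<eta> * (\<bar>Im z\<bar> - ?r)"
        proof -
          have "(\<rho> * (1 + \<eta>)) * \<bar>Im z\<bar> = \<eta> / 2 * \<bar>Im z\<bar>" by (simp only: \<rho>(2))
          then show ?thesis by (simp add: algebra_simps)
        qed
        also have "\<dots> \<le> \<eta> * \<bar>Im w\<bar>" using 2 assms by (intro mult_left_mono) auto
        finally show "norm (ml \<alpha> \<gamma> w) \<le> B" by (intro B) (simp add: sector_def)
      qed
      then have d: "norm (deriv (ml \<alpha> \<gamma>) z) \<le> B / ?r" by simp
      have "norm z \<le> \<bar>Re z\<bar> + \<bar>Im z\<bar>" by (rule cmod_le)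
      also have "\<dots> \<le> (1 + \<eta> / 2) * \<bar>Im z\<bar>" using z by (simp add: sector_def algebra_simps)
      finally have "norm (z * deriv (ml \<alpha> \<gamma>) z) \<le> ((1 + \<eta> / 2) * \<bar>Im z\<bar>) * (B / ?r)"
        unfolding norm_mult using d B0 r assms(2) by (intro mult_mono) auto
      also have "\<dots> = (1 + \<eta> / 2) * B / \<rho>" using False by simp
      finally show ?thesis .
    qed
    then have 1: "norm (of_real \<alpha> * z * deriv (ml \<alpha> \<gamma>) z) \<le> \<alpha> * ((1 + \<eta> / 2) * B / \<rho>)"
      using mult_left_mono[of _ _ \<alpha>] assms(1) by (simp add: norm_mult mult.assoc del: times_divide_eq_right)
    have 2: "norm (of_real (\<gamma> - 1) * ml \<alpha> \<gamma> z) \<le> \<bar>\<gamma> - 1\<bar> * B"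
      unfolding norm_mult norm_of_real by (rule mult_left_mono[OF B[OF sub[OF z]]]) simp
    show ?thesis unfolding ml_lower[OF assms(1)] using norm_triangle_mono[OF 2 1] .
  qed
  then show ?thesis unfolding bounded_iff by blast
qed

section \<open>Convolution and Laplace kernels\<close>

text \<open>Termwise Beta integrals. Summation and integration may be exchanged because the norms of the terms have
integrals that form an absolutely convergent Mittag-Leffler series.\<close>

lemma ml_convolution_unit:
  assumes a: "0 < \<alpha>" and d: "0 < \<delta>"
  shows "has_bochner_integral lborel
     (\<lambda>s. indicator {0..1} s *\<^sub>R (of_real ((1 - s) powr (\<delta> - 1)) * ml \<alpha> 1 (w * of_real (s powr \<alpha>))))
     (of_real (Gamma \<delta>) * ml \<alpha> (1 + \<delta>) w)"
proof -
  define b where "b = (\<lambda>k s. indicator {0..1} s *\<^sub>R (s powr (\<alpha> * real k + 1 - 1) * (1 - s) powr (\<delta> - 1)) :: real)"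
  define c where "c = (\<lambda>k. of_real (rGamma (\<alpha> * real k + 1)) * w ^ k :: complex)"
  have pos: "\<alpha> * real k + 1 > 0" for k using a by (simp add: add_nonneg_pos)
  have bI: "integrable lborel (b k)" for k
    using integrable_Beta[OF pos d, of k] unfolding b_def set_integrable_def .
  have bV: "integral\<^sup>L lborel (b k) = Beta (\<alpha> * real k + 1) \<delta>" for k
    using set_borel_integral_eq_integral(2)[OF integrable_Beta[OF pos d, of k]] has_integral_Beta_real[OF pos d, of k]
    unfolding b_def set_lebesgue_integral_def by (simp add: integral_unique)
  have b0: "b k s \<ge> 0" for k s unfolding b_def by simp
  have cb: "c k * of_real (Beta (\<alpha> * real k + 1) \<delta>) = of_real (Gamma \<delta>) * (of_real (rGamma (\<alpha> * real k + (1 + \<delta>))) * w ^ k)" for k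
  proof -
    have "rGamma (\<alpha> * real k + 1) * Beta (\<alpha> * real k + 1) \<delta> = Gamma \<delta> * rGamma (\<alpha> * real k + (1 + \<delta>))"
      using Gamma_real_pos[OF pos, of k] by (simp add: Beta_def rGamma_inverse_Gamma field_simps add.assoc)
    then have "complex_of_real (rGamma (\<alpha> * real k + 1)) * of_real (Beta (\<alpha> * real k + 1) \<delta>)
        = of_real (Gamma \<delta>) * of_real (rGamma (\<alpha> * real k + (1 + \<delta>)))"
      by (simp only: of_real_mult[symmetric])
    then show ?thesis by (simp add: c_def mult_ac)
  qed
  define f where "f = (\<lambda>k s. c k * of_real (b k s))"
  have fI: "integrable lborel (f k)" for k
    unfolding f_def by (intro integrable_mult_right integrable_of_real bI)
  have fV: "integral\<^sup>L lborel (f k) = of_real (Gamma \<delta>) * (of_real (rGamma (\<alpha> * real k + (1 + \<delta>))) * w ^ k)" for k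
    unfolding f_def cb[symmetric] bV[symmetric] by simp
  have fN: "(LINT s|lborel. norm (f k s)) = norm (integral\<^sup>L lborel (f k))" for k
  proof -
    have "(LINT s|lborel. norm (f k s)) = (LINT s|lborel. norm (c k) * b k s)"
      unfolding f_def by (intro Bochner_Integration.integral_cong) (simp_all add: norm_mult b0)
    also have "\<dots> = norm (c k) * Beta (\<alpha> * real k + 1) \<delta>" by (simp add: bV)
    also have "\<dots> = norm (integral\<^sup>L lborel (f k))"
    proof -
      have "Beta (\<alpha> * real k + 1) \<delta> \<ge> 0" unfolding bV[symmetric] by (rule integral_nonneg_AE) (simp add: b0)
      then show ?thesis unfolding fV cb[symmetric] norm_mult by simp
    qed
    finally show ?thesis .
  qed
  have sum1: "summable (\<lambda>k. LINT s|lborel. norm (f k s))"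
    unfolding fN fV norm_mult[of "of_real (Gamma \<delta>)"] by (intro summable_mult ml_summable a)
  have pt: "f k s = (indicator {0..1} s * of_real ((1 - s) powr (\<delta> - 1))) * (of_real (rGamma (\<alpha> * real k + 1)) * (w * of_real (s powr \<alpha>)) ^ k)"
    if "s \<noteq> 0" for k s
  proof (cases "0 \<le> s \<and> s \<le> 1")
    case True
    then have "s > 0" using that by auto
    then have "(s powr \<alpha>) ^ k = s powr (\<alpha> * real k)" by (simp add: powr_powr flip: powr_realpow)
    then have "complex_of_real (s powr \<alpha>) ^ k = of_real (s powr (\<alpha> * real k))" by (metis of_real_power)
    then show ?thesis using True by (simp add: f_def b_def c_def power_mult_distrib mult_ac)
  next
    case False
    then have "s \<notin> {0..1}" by simp
    then show ?thesis by (simp add: f_def b_def)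
  qed
  have ne: "AE s in lborel. s \<noteq> (0::real)" by (rule AE_lborel_singleton)
  have sum2: "AE s in lborel. summable (\<lambda>k. norm (f k s))"
    using ne
  proof eventually_elim
    case (elim s)
    show ?case unfolding pt[OF elim] norm_mult[of "indicator {0..1} s * of_real ((1 - s) powr (\<delta> - 1))"]
      by (intro summable_mult ml_summable a)
  qed
  have 1: "integrable lborel (\<lambda>s. \<Sum>k. f k s)"
    by (rule integrable_suminf[OF fI sum2 sum1])
  have 2: "(LINT s|lborel. (\<Sum>k. f k s)) = of_real (Gamma \<delta>) * ml \<alpha> (1 + \<delta>) w"
    unfolding integral_suminf[OF fI sum2 sum1] fV ml_def by (intro suminf_mult ml_summable' a)
  have eq: "AE s in lborel. (\<Sum>k. f k s) = indicator {0..1} s *\<^sub>R (of_real ((1 - s) powr (\<delta> - 1)) * ml \<alpha> 1 (w * of_real (s powr \<alpha>)))"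
    using ne
  proof eventually_elim
    case (elim s)
    show ?case unfolding pt[OF elim] ml_def suminf_mult[OF ml_summable'[OF a]]
      by (simp add: indicator_def)
  qed
  have m: "(\<lambda>s. indicator {0..1} s *\<^sub>R (of_real ((1 - s) powr (\<delta> - 1)) * ml \<alpha> 1 (w * of_real (s powr \<alpha>)))) \<in> borel_measurable lborel"
  proof -
    have [measurable]: "ml \<alpha> 1 \<in> borel_measurable borel"
      by (intro borel_measurable_continuous_onI holomorphic_on_imp_continuous_on ml_holomorphic a)
    show ?thesis by measurable
  qed
  have "has_bochner_integral lborel (\<lambda>s. \<Sum>k. f k s) (of_real (Gamma \<delta>) * ml \<alpha> (1 + \<delta>) w)"
    using 1 2 by (simp add: has_bochner_integral_iff)
  then show ?thesis
    using has_bochner_integral_cong_AE[OF borel_measurable_integrable[OF 1] m eq] by simp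
qed

lemma ml_convolution:
  assumes a: "0 < \<alpha>" and d: "0 < \<delta>" and t: "0 < t"
  shows "has_bochner_integral lborel
     (\<lambda>s. indicator {0..t} s *\<^sub>R (of_real ((t - s) powr (\<delta> - 1)) * ml \<alpha> 1 (z * of_real (s powr \<alpha>))))
     (of_real (Gamma \<delta> * t powr \<delta>) * ml \<alpha> (1 + \<delta>) (z * of_real (t powr \<alpha>)))"
proof -
  let ?f = "\<lambda>s. indicator {0..t} s *\<^sub>R (of_real ((t - s) powr (\<delta> - 1)) * ml \<alpha> 1 (z * of_real (s powr \<alpha>)))"
  let ?w = "z * of_real (t powr \<alpha>)"
  have eq: "?f (0 + t * s) = of_real (t powr (\<delta> - 1)) * (indicator {0..1} s *\<^sub>R (of_real ((1 - s) powr (\<delta> - 1)) * ml \<alpha> 1 (?w * of_real (s powr \<alpha>))))" for s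
  proof (cases "0 \<le> s \<and> s \<le> 1")
    case True
    have "(t - t * s) = t * (1 - s)" by (simp add: algebra_simps)
    then have "(t - t * s) powr (\<delta> - 1) = t powr (\<delta> - 1) * (1 - s) powr (\<delta> - 1)"
      using True t by (simp only: powr_mult)
    moreover have "(t * s) powr \<alpha> = t powr \<alpha> * s powr \<alpha>" using True t by (simp add: powr_mult)
    moreover have "t * s \<in> {0..t}" using True t by (simp add: mult_le_cancel_left1)
    ultimately show ?thesis using True by (simp add: mult_ac)
  next
    case False
    then have "t * s \<notin> {0..t}" using t by (auto simp: zero_le_mult_iff mult_le_cancel_left1)
    then show ?thesis using False by (auto simp: indicator_def)
  qed
  have "has_bochner_integral lborel (\<lambda>s. ?f (0 + t * s)) (of_real (t powr (\<delta> - 1)) * (of_real (Gamma \<delta>) * ml \<alpha> (1 + \<delta>) ?w))"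
    unfolding eq by (intro has_bochner_integral_mult_right ml_convolution_unit a d)
  also have "of_real (t powr (\<delta> - 1)) * (of_real (Gamma \<delta>) * ml \<alpha> (1 + \<delta>) ?w) = (of_real (Gamma \<delta> * t powr \<delta>) * ml \<alpha> (1 + \<delta>) ?w) /\<^sub>R \<bar>t\<bar>"
    using t by (simp add: powr_diff scaleR_conv_of_real field_simps)
  finally show ?thesis
    using lborel_has_bochner_integral_real_affine_iff[of t ?f _ 0] t by simp
qed

text \<open>The convolution \<open>W\<close> of \<open>exp(-c t)\<close> with \<open>v\<close> solves \<open>W' = v - c W\<close>, \<open>W 0 = 0\<close>. Hence the
derivative of \<open>|W|^2\<close> is at most \<open>2 Re (cnj v * W)\<close>, and integration gives \<open>|W 1|^2\<close> as a lower bound.\<close>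

lemma exp_kernel_nonneg:
  fixes v :: "real \<Rightarrow> complex"
  assumes v: "continuous_on {0..1} v" and c: "Re c \<ge> 0"
  shows "Re (integral {0..1} (\<lambda>t. cnj (v t) * integral {0..t} (\<lambda>s. exp (- (of_real (t - s) * c)) * v s))) \<ge> 0"
proof -
  define W where "W = (\<lambda>t. exp (- (of_real t * c)) * integral {0..t} (\<lambda>s. exp (of_real s * c) * v s))"
  have inner: "integral {0..t} (\<lambda>s. exp (- (of_real (t - s) * c)) * v s) = W t" for t
  proof -
    have e: "exp (- (of_real (t - s) * c)) = exp (- (of_real t * c)) * exp (of_real s * c)" for s
      by (simp add: algebra_simps exp_add[symmetric])
    show ?thesis unfolding W_def e mult.assoc by (rule integral_mult_right)
  qed
  have cf: "continuous_on {0..1} (\<lambda>s. exp (of_real s * c) * v s)"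
    by (intro continuous_intros v)
  have dW: "(W has_vector_derivative (v t - c * W t)) (at t within {0..1})" if t: "t \<in> {0..1}" for t
  proof -
    have "((\<lambda>t. exp (- (of_real t * c))) has_vector_derivative (- c * exp (- (of_real t * c)))) (at t within {0..1})"
      by (rule has_vector_derivative_real_field[of "\<lambda>z. exp (- (z * c))"]) (auto intro!: derivative_eq_intros)
    from has_vector_derivative_mult[OF this integral_has_vector_derivative[OF cf t]]
    have "(W has_vector_derivative exp (- (of_real t * c)) * (exp (of_real t * c) * v t)
        + - c * exp (- (of_real t * c)) * integral {0..t} (\<lambda>s. exp (of_real s * c) * v s)) (at t within {0..1})"
      unfolding W_def .
    also have "exp (- (of_real t * c)) * (exp (of_real t * c) * v t)
        + - c * exp (- (of_real t * c)) * integral {0..t} (\<lambda>s. exp (of_real s * c) * v s) = v t - c * W t"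
      by (simp add: W_def exp_minus field_simps)
    finally show ?thesis .
  qed
  have cW: "continuous_on {0..1} W"
    unfolding continuous_on_eq_continuous_within using has_vector_derivative_continuous[OF dW] by simp
  have A1: "((\<lambda>t. W t \<bullet> (v t - c * W t) + (v t - c * W t) \<bullet> W t) has_integral (W 1 \<bullet> W 1 - W 0 \<bullet> W 0)) {0..1}"
  proof (rule fundamental_theorem_of_calculus)
    fix t :: real assume "t \<in> {0..1}"
    from bounded_bilinear.has_vector_derivative[OF bounded_bilinear_inner dW[OF this] dW[OF this]]
    show "((\<lambda>t. W t \<bullet> W t) has_vector_derivative W t \<bullet> (v t - c * W t) + (v t - c * W t) \<bullet> W t) (at t within {0..1})" .
  qed simp
  have A2: "((\<lambda>t. 2 * (v t \<bullet> W t)) has_integral 2 * integral {0..1} (\<lambda>t. v t \<bullet> W t)) {0..1}"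
    by (intro has_integral_mult_right integrable_integral integrable_continuous_interval continuous_intros v cW)
  have A3: "W t \<bullet> (v t - c * W t) + (v t - c * W t) \<bullet> W t \<le> 2 * (v t \<bullet> W t)" for t
  proof -
    have "W t \<bullet> (c * W t) = Re c * (norm (W t))\<^sup>2"
      by (simp only: cmod_power2) (simp add: inner_complex_def algebra_simps power2_eq_square)
    then have "0 \<le> W t \<bullet> (c * W t)" using c by simp
    then show ?thesis by (simp add: inner_diff_right inner_diff_left inner_commute)
  qed
  have "W 1 \<bullet> W 1 - W 0 \<bullet> W 0 \<le> 2 * integral {0..1} (\<lambda>t. v t \<bullet> W t)"
    by (rule has_integral_le[OF A1 A2 A3])
  moreover have "W 0 = 0" unfolding W_def by simp
  then have "W 0 \<bullet> W 0 = 0" by simp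
  ultimately have nn: "0 \<le> integral {0..1} (\<lambda>t. v t \<bullet> W t)"
    using inner_ge_zero[of "W 1"] by linarith
  have int: "(\<lambda>t. cnj (v t) * W t) integrable_on {0..1}"
    by (intro integrable_continuous_interval continuous_intros v cW)
  have "Re (integral {0..1} (\<lambda>t. cnj (v t) * W t)) = integral {0..1} (\<lambda>t. Re (cnj (v t) * W t))"
    using integral_linear[OF int bounded_linear_Re] by (simp add: o_def)
  also have "(\<lambda>t. Re (cnj (v t) * W t)) = (\<lambda>t. v t \<bullet> W t)"
    by (simp add: inner_complex_def fun_eq_iff)
  finally show ?thesis unfolding inner using nn by simp
qed

text \<open>For \<open>\<tau> > 0\<close> and \<open>Re p = 1\<close> the integral over \<open>r\<close> of this kernel at \<open>\<tau> p\<close> is \<open>K(p) \<tau>^(\<alpha>-1)\<close>: the fractional kernel is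
a superposition of the exponentials \<open>exp(-r \<tau> p)\<close>, and the direction \<open>p\<close> of the exponents is free.\<close>

definition laplace_kernel :: "real \<Rightarrow> complex \<Rightarrow> real \<Rightarrow> complex" where
  "laplace_kernel \<alpha> p r = indicator {0..} r *\<^sub>R (of_real (r powr (- \<alpha>)) * exp (- (of_real r * p)))"

lemma Gamma_has_bochner_integral:
  fixes s :: real
  assumes "s > 0"
  shows "has_bochner_integral lborel (\<lambda>r. indicator {0..} r * r powr (s - 1) / exp r) (Gamma s)"
  by (rule has_bochner_integral_nn_integral) 
    (use Gamma_conv_nn_integral_real[OF assms] Gamma_real_pos[OF assms] in \<open>auto simp: indicator_def\<close>)

lemma norm_laplace_kernel:
  "norm (laplace_kernel \<alpha> p r) = indicator {0..} r * r powr (- \<alpha>) / exp (r * Re p)"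
  unfolding laplace_kernel_def by (simp add: norm_mult norm_inverse norm_exp_eq_Re exp_minus divide_inverse indicator_def)

lemma laplace_kernel_measurable [measurable]: "(\<lambda>x. laplace_kernel \<alpha> (P x) (R x)) \<in> borel_measurable M"
  if [measurable]: "P \<in> borel_measurable M" "R \<in> borel_measurable M"
  unfolding laplace_kernel_def by measurable

lemma laplace_kernel_scale:
  assumes "\<tau> > 0"
  shows "laplace_kernel \<alpha> p (0 + \<tau> * r) = of_real (\<tau> powr (- \<alpha>)) * laplace_kernel \<alpha> (of_real \<tau> * p) r"
  using assms unfolding laplace_kernel_def 
  by (cases "r \<ge> 0") (auto simp: powr_mult indicator_def zero_le_mult_iff mult_ac)

lemma laplace_kernel_integral:
  assumes a: "0 < \<alpha>" "\<alpha> < 1" and p: "Re p = 1" and t: "\<tau> > 0"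
  shows "has_bochner_integral lborel (laplace_kernel \<alpha> (of_real \<tau> * p)) (of_real (\<tau> powr (\<alpha> - 1)) * integral\<^sup>L lborel (laplace_kernel \<alpha> p))"
    and "has_bochner_integral lborel (\<lambda>r. norm (laplace_kernel \<alpha> (of_real \<tau> * p) r)) (\<tau> powr (\<alpha> - 1) * Gamma (1 - \<alpha>))"
    and "integrable lborel (laplace_kernel \<alpha> p)"
proof -
  have N: "has_bochner_integral lborel (\<lambda>r. norm (laplace_kernel \<alpha> p r)) (Gamma (1 - \<alpha>))"
    using Gamma_has_bochner_integral[of "1 - \<alpha>"] a unfolding norm_laplace_kernel p by simp
  show I: "integrable lborel (laplace_kernel \<alpha> p)"
    using N by (subst integrable_norm_iff[symmetric]) (auto simp: has_bochner_integral_iff)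
  let ?K = "integral\<^sup>L lborel (laplace_kernel \<alpha> p)"
  have e: "\<tau> powr \<alpha> * \<tau> powr (- \<alpha>) = 1" using t by (simp flip: powr_add)
  have sc: "laplace_kernel \<alpha> (of_real \<tau> * p) r = of_real (\<tau> powr \<alpha>) * laplace_kernel \<alpha> p (0 + \<tau> * r)" for r
    unfolding laplace_kernel_scale[OF t] mult.assoc[symmetric] of_real_mult[symmetric] e by simp
  have "has_bochner_integral lborel (laplace_kernel \<alpha> p) ?K" using I by (simp add: has_bochner_integral_iff)
  then have "has_bochner_integral lborel (\<lambda>r. laplace_kernel \<alpha> p (0 + \<tau> * r)) (?K /\<^sub>R \<bar>\<tau>\<bar>)"
    using lborel_has_bochner_integral_real_affine_iff[of \<tau> "laplace_kernel \<alpha> p" ?K 0] t by simp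
  then have "has_bochner_integral lborel (\<lambda>r. laplace_kernel \<alpha> (of_real \<tau> * p) r) (of_real (\<tau> powr \<alpha>) * (?K /\<^sub>R \<bar>\<tau>\<bar>))"
    unfolding sc by (rule has_bochner_integral_mult_right)
  moreover have "of_real (\<tau> powr \<alpha>) * (?K /\<^sub>R \<bar>\<tau>\<bar>) = of_real (\<tau> powr (\<alpha> - 1)) * ?K"
    using t by (simp add: powr_diff scaleR_conv_of_real field_simps)
  ultimately show "has_bochner_integral lborel (laplace_kernel \<alpha> (of_real \<tau> * p)) (of_real (\<tau> powr (\<alpha> - 1)) * ?K)"
    by simp
  have "has_bochner_integral lborel (\<lambda>r. norm (laplace_kernel \<alpha> p (0 + \<tau> * r))) (Gamma (1 - \<alpha>) /\<^sub>R \<bar>\<tau>\<bar>)"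
    using lborel_has_bochner_integral_real_affine_iff[of \<tau> "\<lambda>r. norm (laplace_kernel \<alpha> p r)" "Gamma (1 - \<alpha>)" 0] t N by simp
  then have "has_bochner_integral lborel (\<lambda>r. \<tau> powr \<alpha> * norm (laplace_kernel \<alpha> p (0 + \<tau> * r))) (\<tau> powr \<alpha> * (Gamma (1 - \<alpha>) /\<^sub>R \<bar>\<tau>\<bar>))"
    by (rule has_bochner_integral_mult_right)
  moreover have "\<tau> powr \<alpha> * (Gamma (1 - \<alpha>) /\<^sub>R \<bar>\<tau>\<bar>) = \<tau> powr (\<alpha> - 1) * Gamma (1 - \<alpha>)"
    using t by (simp add: powr_diff field_simps)
  moreover have "norm (laplace_kernel \<alpha> (of_real \<tau> * p) r) = \<tau> powr \<alpha> * norm (laplace_kernel \<alpha> p (0 + \<tau> * r))" for r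
    unfolding sc norm_mult by simp
  ultimately show "has_bochner_integral lborel (\<lambda>r. norm (laplace_kernel \<alpha> (of_real \<tau> * p) r)) (\<tau> powr (\<alpha> - 1) * Gamma (1 - \<alpha>))"
    by (simp only:)
qed

text \<open>\<open>K(1 + i/2)\<close> has a nonzero argument. The inequality \<open>sin t \<ge> t - t^3/6\<close> reduces this
to a comparison of two Gamma values; the smallness of the imaginary part \<open>1/2\<close> is what makes the
comparison succeed.\<close>

lemma laplace_kernel_Im:
  assumes a: "0 < \<alpha>" "\<alpha> < 1"
  shows "Im (integral\<^sup>L lborel (laplace_kernel \<alpha> (Complex 1 (1 / 2)))) < 0"
proof -
  let ?p = "Complex 1 (1 / 2)"
  have I: "integrable lborel (laplace_kernel \<alpha> ?p)" by (rule laplace_kernel_integral(3)[OF a, of _ 1]) auto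
  \<comment> \<open>A lower bound for \<open>- Im\<close> of the kernel, from \<open>sin (r/2) \<ge> r/2 - r^3/48\<close>.\<close>
  define S where "S = (\<lambda>r. indicator {0..} r * r powr (2 - \<alpha> - 1) / exp r / 2 - indicator {0..} r * r powr (4 - \<alpha> - 1) / exp r / 48 :: real)"
  have S: "has_bochner_integral lborel S (Gamma (2 - \<alpha>) / 2 - Gamma (4 - \<alpha>) / 48)"
    unfolding S_def using a by (intro has_bochner_integral_diff has_bochner_integral_divide Gamma_has_bochner_integral) auto
  have le: "S r \<le> - Im (laplace_kernel \<alpha> ?p r)" for r
  proof (cases "r > 0")
    case True
    have "\<bar>sin (r / 2) - (\<Sum>m<3. sin_coeff m * (r / 2) ^ m)\<bar> \<le> inverse (fact 3) * \<bar>r / 2\<bar> ^ 3"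
      by (rule Maclaurin_sin_bound)
    moreover have "(\<Sum>m<3. sin_coeff m * (r / 2) ^ m) = r / 2"
      by (simp add: eval_nat_numeral sin_coeff_def)
    ultimately have "\<bar>sin (r / 2) - r / 2\<bar> \<le> inverse (fact 3) * \<bar>r / 2\<bar> ^ 3"
      by (simp only:)
    also have "\<dots> = r ^ 3 / 48" using True by (simp add: fact_numeral power_divide)
    finally have sn: "r / 2 - r ^ 3 / 48 \<le> sin (r / 2)"
      by linarith
    have "r powr (2 - \<alpha> - 1) = r powr (- \<alpha>) * r" "r powr (4 - \<alpha> - 1) = r powr (- \<alpha>) * r ^ 3"
      using True by (simp_all add: powr_diff powr_minus field_simps powr_numeral power3_eq_cube)
    then have "S r = (r powr (- \<alpha>) / exp r) * (r / 2 - r ^ 3 / 48)"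
      using True by (simp add: S_def algebra_simps diff_divide_distrib)
    also have "\<dots> \<le> (r powr (- \<alpha>) / exp r) * sin (r / 2)"
      by (rule mult_left_mono[OF sn]) simp
    also have "\<dots> = - Im (laplace_kernel \<alpha> ?p r)"
    proof -
      have "Im (laplace_kernel \<alpha> ?p r) = r powr (- \<alpha>) * (exp (- r) * sin (- (r / 2)))"
        using True by (simp add: laplace_kernel_def Im_exp)
      then have "- Im (laplace_kernel \<alpha> ?p r) = r powr (- \<alpha>) * (exp (- r) * sin (r / 2))" by simp
      also have "\<dots> = (r powr (- \<alpha>) / exp r) * sin (r / 2)" by (simp only: exp_minus divide_inverse mult.assoc)
      finally show ?thesis by (rule sym)
    qed
    finally show ?thesis .
  next
    case False
    then consider "r < 0" | "r = 0" by linarith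
    then show ?thesis by cases (simp_all add: S_def laplace_kernel_def)
  qed
  have "Gamma (2 - \<alpha>) / 2 - Gamma (4 - \<alpha>) / 48 \<le> (LINT r|lborel. - Im (laplace_kernel \<alpha> ?p r))"
    unfolding has_bochner_integral_integral_eq[OF S, symmetric]
    using S I le by (intro integral_mono) (auto simp: has_bochner_integral_iff)
  also have "\<dots> = - Im (integral\<^sup>L lborel (laplace_kernel \<alpha> ?p))"
    using I by simp
  finally have 1: "Gamma (2 - \<alpha>) / 2 - Gamma (4 - \<alpha>) / 48 \<le> - Im (integral\<^sup>L lborel (laplace_kernel \<alpha> ?p))" .
  have G: "Gamma (2 - \<alpha>) > 0" using a by (intro Gamma_real_pos) simp
  have nn: "3 - \<alpha> \<notin> \<int>\<^sub>\<le>\<^sub>0" "2 - \<alpha> \<notin> \<int>\<^sub>\<le>\<^sub>0"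
    using nonpos_Ints_nonpos[of "3 - \<alpha>"] nonpos_Ints_nonpos[of "2 - \<alpha>"] a by auto
  have "Gamma (4 - \<alpha>) = (3 - \<alpha>) * Gamma (3 - \<alpha>)" using Gamma_plus1[OF nn(1)] by (simp add: add.commute)
  also have "Gamma (3 - \<alpha>) = (2 - \<alpha>) * Gamma (2 - \<alpha>)" using Gamma_plus1[OF nn(2)] by (simp add: add.commute)
  finally have "Gamma (4 - \<alpha>) = ((3 - \<alpha>) * (2 - \<alpha>)) * Gamma (2 - \<alpha>)" by simp
  also have "\<dots> \<le> (3 * 2) * Gamma (2 - \<alpha>)"
    using a G by (intro mult_right_mono mult_mono) auto
  finally show ?thesis using 1 G by linarith
qed

lemma laplace_kernel_cnj: "laplace_kernel \<alpha> (cnj p) r = cnj (laplace_kernel \<alpha> p r)"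
  unfolding laplace_kernel_def by (simp add: exp_cnj)

section \<open>The quadratic form of the fractional kernel\<close>

text \<open>The pairing of \<open>V\<close> with its convolution by \<open>t^(\<alpha>-1)\<close>. The function \<open>V\<close> is defined on the whole
line and will vanish off \<open>[0, 1]\<close>.\<close>

definition frac_form :: "real \<Rightarrow> (real \<Rightarrow> complex) \<Rightarrow> complex" where
  "frac_form \<alpha> V = (LINT t|lborel. LINT s|lborel.
     (if s < t then of_real ((t - s) powr (\<alpha> - 1)) * (V s * cnj (V t)) else 0))"

lemma cnj_measurable [measurable (raw)]: "f \<in> borel_measurable M \<Longrightarrow> (\<lambda>x. cnj (f x)) \<in> borel_measurable M"
  by (rule measurable_compose[OF _ borel_measurable_continuous_onI]) (auto intro: continuous_intros)

lemma triangle_kernel_integral: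
  fixes \<alpha> t :: real
  assumes a: "0 < \<alpha>" and t: "t \<ge> 0"
  shows "has_bochner_integral lborel (\<lambda>s. indicator {0..t} s * (t - s) powr (\<alpha> - 1)) (t powr \<alpha> / \<alpha>)"
proof -
  have "((\<lambda>x. x powr (\<alpha> - 1)) has_integral (t powr (\<alpha> - 1 + 1) / (\<alpha> - 1 + 1))) {0..t}"
    using has_integral_powr_from_0[of "\<alpha> - 1" t] a t by simp
  moreover have "t powr (\<alpha> - 1 + 1) / (\<alpha> - 1 + 1) = t powr \<alpha> / \<alpha>" by simp
  ultimately have "((\<lambda>x. if x \<in> {0..t} then x powr (\<alpha> - 1) else 0) has_integral (t powr \<alpha> / \<alpha>)) UNIV"
    by (simp only: has_integral_restrict_UNIV)
  then have "((\<lambda>x. indicator {0..t} x * x powr (\<alpha> - 1)) has_integral (t powr \<alpha> / \<alpha>)) UNIV"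
    by (rule has_integral_eq[rotated]) (auto simp: indicator_def)
  then have "has_bochner_integral lborel (\<lambda>x. indicator {0..t} x * x powr (\<alpha> - 1)) (t powr \<alpha> / \<alpha>)"
    by (intro has_bochner_integral_nn_integral nn_integral_has_integral_lborel) (use a in auto)
  then have "has_bochner_integral lborel (\<lambda>s. indicator {0..t} (t + (-1) * s) * (t + (-1) * s) powr (\<alpha> - 1)) (t powr \<alpha> / \<alpha>)"
    by (subst (asm) lborel_has_bochner_integral_real_affine_iff[of "-1" _ _ t]) simp_all
  moreover have "indicator {0..t} (t + (-1) * s) = (indicator {0..t} s :: real)" for s
    by (auto simp: indicator_def)
  ultimately show ?thesis by simp
qed

lemma integrable_triangle:
  assumes a: "0 < \<alpha>"
  shows "integrable (lborel :: (real \<times> real) measure)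
    (\<lambda>(t, s). indicator {0..1} t * (indicator {0..t} s * (t - s) powr (\<alpha> - 1)))"
  unfolding lborel_prod[symmetric]
proof (rule lborel_pair.Fubini_integrable)
  show "(\<lambda>(t, s). indicator {0..1} t * (indicator {0..t} s * (t - s) powr (\<alpha> - 1))) \<in> borel_measurable (lborel \<Otimes>\<^sub>M lborel)"
    unfolding indicator_def atLeastAtMost_iff by measurable
  have nn: "norm (case (t, s) of (t, s) \<Rightarrow> indicator {0..1} t * (indicator {0..t} s * (t - s) powr (\<alpha> - 1)))
       = indicator {0..1} t * (indicator {0..t} s * (t - s) powr (\<alpha> - 1))" for t s :: real
    by (simp add: indicator_def)
  have "(\<integral>s. indicator {0..1} t * (indicator {0..t} s * (t - s) powr (\<alpha> - 1)) \<partial>lborel) = indicator {0..1} t *\<^sub>R (t powr \<alpha> / \<alpha>)" for t :: real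
    using has_bochner_integral_integral_eq[OF triangle_kernel_integral[OF a, of t]] by (simp add: indicator_def)
  moreover have "set_integrable lborel {0..1::real} (\<lambda>t. t powr \<alpha> / \<alpha>)"
    by (intro borel_integrable_atLeastAtMost' continuous_on_divide continuous_on_powr' continuous_on_id continuous_on_const) (use a in auto)
  ultimately show "integrable lborel (\<lambda>t. \<integral>s. norm (case (t, s) of (t, s) \<Rightarrow> indicator {0..1} t * (indicator {0..t} s * (t - s) powr (\<alpha> - 1))) \<partial>lborel)"
    unfolding nn set_integrable_def by (simp only:)
  show "AE t in lborel. integrable lborel (\<lambda>s. case (t, s) of (t, s) \<Rightarrow> indicator {0..1} t * (indicator {0..t} s * (t - s) powr (\<alpha> - 1)))"
  proof (rule AE_I2)
    fix t :: real
    show "integrable lborel (\<lambda>s. case (t, s) of (t, s) \<Rightarrow> indicator {0..1} t * (indicator {0..t} s * (t - s) powr (\<alpha> - 1)))"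
    proof (cases "t \<ge> 0")
      case True
      have "integrable lborel (\<lambda>s. indicator {0..t} s * (t - s) powr (\<alpha> - 1))"
        by (rule integrable.intros[OF triangle_kernel_integral[OF a True]])
      then show ?thesis by simp
    qed simp
  qed
qed

text \<open>Extension of a continuous function on \<open>[0, 1]\<close> by zero, so that all integrals extend over the line and
Fubini's theorem applies to product measures without restricting domains.\<close>

context
  fixes \<alpha> :: real and v :: "real \<Rightarrow> complex" and V :: "real \<Rightarrow> complex"
  assumes a: "0 < \<alpha>" "\<alpha> < 1" and v: "continuous_on {0..1} v"
  defines "V \<equiv> \<lambda>s. indicator {0..1} s *\<^sub>R v s"
begin

lemma V_measurable [measurable]: "V \<in> borel_measurable borel"
  unfolding V_def by (intro borel_measurable_continuous_on_indicator v) auto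

lemma V_bounded: "\<exists>B\<ge>0. \<forall>s. norm (V s) \<le> B"
proof -
  have "compact (v ` {0..1})" by (intro compact_continuous_image v) auto
  then obtain B where B: "\<And>s. s \<in> {0..1} \<Longrightarrow> norm (v s) \<le> B"
    using compact_imp_bounded bounded_iff by (metis image_eqI)
  show ?thesis
    by (rule exI[of _ "max B 0"]) (use B in \<open>auto simp: V_def indicator_def le_max_iff_disj\<close>)
qed

lemma V_outside: "s \<notin> {0..1} \<Longrightarrow> V s = 0"
  unfolding V_def by simp

lemma V_inside: "s \<in> {0..1} \<Longrightarrow> V s = v s"
  unfolding V_def by simp

definition laplace_integrand :: "complex \<Rightarrow> real \<times> real \<Rightarrow> real \<Rightarrow> complex" where
  "laplace_integrand p x r = (if snd x < fst x then laplace_kernel \<alpha> (of_real (fst x - snd x) * p) r * (V (snd x) * cnj (V (fst x))) else 0)"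

lemma fst_snd_measurable: "fst \<in> borel_measurable (lborel :: (real \<times> real) measure)"
    "snd \<in> borel_measurable (lborel :: (real \<times> real) measure)"
proof -
  show "fst \<in> borel_measurable (lborel :: (real \<times> real) measure)"
    using borel_measurable_continuous_onI[OF continuous_on_fst[OF continuous_on_id]] by simp
  show "snd \<in> borel_measurable (lborel :: (real \<times> real) measure)"
    using borel_measurable_continuous_onI[OF continuous_on_snd[OF continuous_on_id]] by simp
qed

lemma laplace_integrand_measurable: "case_prod (laplace_integrand p) \<in> borel_measurable ((lborel :: (real \<times> real) measure) \<Otimes>\<^sub>M lborel)"
proof -
  have gen: "(\<lambda>x. if f2 x < f1 x then laplace_kernel \<alpha> (of_real (f1 x - f2 x) * p) (f3 x) * (V (f2 x) * cnj (V (f1 x))) else 0) \<in> borel_measurable M"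
    if [measurable]: "f1 \<in> borel_measurable M" "f2 \<in> borel_measurable M" "f3 \<in> borel_measurable M"
    for f1 f2 f3 :: "'z \<Rightarrow> real" and M
    by measurable
  have "case_prod (laplace_integrand p) = (\<lambda>y. if snd (fst y) < fst (fst y) then laplace_kernel \<alpha> (of_real (fst (fst y) - snd (fst y)) * p) (snd y) * (V (snd (fst y)) * cnj (V (fst (fst y)))) else 0)"
    by (auto simp: laplace_integrand_def fun_eq_iff)
  also have "\<dots> \<in> borel_measurable ((lborel :: (real \<times> real) measure) \<Otimes>\<^sub>M lborel)"
  proof (rule gen)
    show "(\<lambda>y. fst (fst y)) \<in> borel_measurable ((lborel :: (real \<times> real) measure) \<Otimes>\<^sub>M (lborel :: real measure))"
      by (rule measurable_compose[OF measurable_fst fst_snd_measurable(1)])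
    show "(\<lambda>y. snd (fst y)) \<in> borel_measurable ((lborel :: (real \<times> real) measure) \<Otimes>\<^sub>M (lborel :: real measure))"
      by (rule measurable_compose[OF measurable_fst fst_snd_measurable(2)])
    show "snd \<in> borel_measurable ((lborel :: (real \<times> real) measure) \<Otimes>\<^sub>M (lborel :: real measure))"
      using measurable_snd[of "lborel :: (real \<times> real) measure" "lborel :: real measure"] by simp
  qed
  finally show ?thesis .
qed

lemma product_bound:
  assumes "\<And>s. norm (V s) \<le> B" "snd x < fst x"
  shows "norm (V (snd x) * cnj (V (fst x))) * (fst x - snd x) powr (\<alpha> - 1)
    \<le> B\<^sup>2 * (case x of (t, s) \<Rightarrow> indicator {0..1} t * (indicator {0..t} s * (t - s) powr (\<alpha> - 1)))"
proof (cases "0 \<le> snd x \<and> fst x \<le> 1")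
  case True
  have "norm (V (snd x)) * norm (V (fst x)) \<le> B * B"
    using assms(1) by (intro mult_mono) (auto intro: order_trans[OF norm_ge_zero])
  then have "norm (V (snd x) * cnj (V (fst x))) * (fst x - snd x) powr (\<alpha> - 1) \<le> B\<^sup>2 * (fst x - snd x) powr (\<alpha> - 1)"
    unfolding norm_mult complex_mod_cnj power2_eq_square by (rule mult_right_mono) simp
  then show ?thesis using True assms(2) by (simp add: split_beta indicator_def)
next
  case False
  then have "V (snd x) = 0 \<or> V (fst x) = 0" using V_outside by auto
  then show ?thesis by (auto simp: split_beta)
qed

lemma laplace_integrand_integrable:
  assumes p: "Re p = 1"
  shows "integrable ((lborel :: (real \<times> real) measure) \<Otimes>\<^sub>M lborel) (case_prod (laplace_integrand p))"
proof (rule lborel_pair.Fubini_integrable[OF laplace_integrand_measurable])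
  obtain B where B: "\<And>s. norm (V s) \<le> B" using V_bounded by blast
  have val: "(\<integral>r. norm (case (x, r) of (x, r) \<Rightarrow> laplace_integrand p x r) \<partial>lborel)
      = (if snd x < fst x then norm (V (snd x) * cnj (V (fst x))) * ((fst x - snd x) powr (\<alpha> - 1) * Gamma (1 - \<alpha>)) else 0)" for x
    using has_bochner_integral_integral_eq[OF laplace_kernel_integral(2)[OF a p, of "fst x - snd x"]]
    by (simp add: laplace_integrand_def norm_mult mult.commute)
  show "integrable lborel (\<lambda>x. \<integral>r. norm (case (x, r) of (x, r) \<Rightarrow> laplace_integrand p x r) \<partial>lborel)"
    unfolding val
  proof (rule Bochner_Integration.integrable_bound)
    show "integrable lborel (\<lambda>x. Gamma (1 - \<alpha>) * (B\<^sup>2 * (case x of (t, s) \<Rightarrow> indicator {0..1} t * (indicator {0..t} s * (t - s) powr (\<alpha> - 1)))))"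
      by (intro integrable_mult_right integrable_triangle a)
    show "(\<lambda>x. if snd x < fst x then norm (V (snd x) * cnj (V (fst x))) * ((fst x - snd x) powr (\<alpha> - 1) * Gamma (1 - \<alpha>)) else 0) \<in> borel_measurable lborel"
    proof -
      have gen: "(\<lambda>x. if f2 x < f1 x then norm (V (f2 x) * cnj (V (f1 x))) * ((f1 x - f2 x) powr (\<alpha> - 1) * Gamma (1 - \<alpha>)) else 0) \<in> borel_measurable M"
        if [measurable]: "f1 \<in> borel_measurable M" "f2 \<in> borel_measurable M" for f1 f2 :: "real \<times> real \<Rightarrow> real" and M
        by measurable
      show ?thesis by (rule gen[OF fst_snd_measurable])
    qed
    have G: "Gamma (1 - \<alpha>) \<ge> 0" using a by (intro Gamma_real_nonneg) simp
    show "AE x in lborel. norm (if snd x < fst x then norm (V (snd x) * cnj (V (fst x))) * ((fst x - snd x) powr (\<alpha> - 1) * Gamma (1 - \<alpha>)) else 0)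
       \<le> norm (Gamma (1 - \<alpha>) * (B\<^sup>2 * (case x of (t, s) \<Rightarrow> indicator {0..1} t * (indicator {0..t} s * (t - s) powr (\<alpha> - 1)))))"
    proof (rule AE_I2)
      fix x :: "real \<times> real"
      show "norm (if snd x < fst x then norm (V (snd x) * cnj (V (fst x))) * ((fst x - snd x) powr (\<alpha> - 1) * Gamma (1 - \<alpha>)) else 0)
       \<le> norm (Gamma (1 - \<alpha>) * (B\<^sup>2 * (case x of (t, s) \<Rightarrow> indicator {0..1} t * (indicator {0..t} s * (t - s) powr (\<alpha> - 1)))))"
      proof (cases "snd x < fst x")
        case True
        have "norm (if snd x < fst x then norm (V (snd x) * cnj (V (fst x))) * ((fst x - snd x) powr (\<alpha> - 1) * Gamma (1 - \<alpha>)) else 0)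
           = norm (V (snd x) * cnj (V (fst x))) * ((fst x - snd x) powr (\<alpha> - 1) * Gamma (1 - \<alpha>))"
          using True G by (simp add: abs_mult)
        also have "norm (V (snd x) * cnj (V (fst x))) * ((fst x - snd x) powr (\<alpha> - 1) * Gamma (1 - \<alpha>))
           = Gamma (1 - \<alpha>) * (norm (V (snd x) * cnj (V (fst x))) * (fst x - snd x) powr (\<alpha> - 1))" by (simp only: mult_ac)
        also have "\<dots> \<le> Gamma (1 - \<alpha>) * (B\<^sup>2 * (case x of (t, s) \<Rightarrow> indicator {0..1} t * (indicator {0..t} s * (t - s) powr (\<alpha> - 1))))"
          by (rule mult_left_mono[OF product_bound[OF B True] G])
        also have "\<dots> \<le> norm (Gamma (1 - \<alpha>) * (B\<^sup>2 * (case x of (t, s) \<Rightarrow> indicator {0..1} t * (indicator {0..t} s * (t - s) powr (\<alpha> - 1)))))"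
          unfolding real_norm_def by (rule abs_ge_self)
        finally show ?thesis .
      qed simp
    qed
  qed
  show "AE x in lborel. integrable lborel (\<lambda>r. case (x, r) of (x, r) \<Rightarrow> laplace_integrand p x r)"
  proof (rule AE_I2)
    fix x :: "real \<times> real"
    show "integrable lborel (\<lambda>r. case (x, r) of (x, r) \<Rightarrow> laplace_integrand p x r)"
      using integrable.intros[OF laplace_kernel_integral(1)[OF a p, of "fst x - snd x"]]
      by (cases "snd x < fst x") (simp_all add: laplace_integrand_def)
  qed
qed

lemma frac_form_integrable:
  "integrable (lborel :: (real \<times> real) measure) (\<lambda>(t, s). if s < t then of_real ((t - s) powr (\<alpha> - 1)) * (V s * cnj (V t)) else 0)"
proof -
  obtain B where B: "\<And>s. norm (V s) \<le> B" using V_bounded by blast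
  show ?thesis
  proof (rule Bochner_Integration.integrable_bound)
  show "integrable lborel (\<lambda>x. B\<^sup>2 * (case x of (t, s) \<Rightarrow> indicator {0..1} t * (indicator {0..t} s * (t - s) powr (\<alpha> - 1))))"
    by (intro integrable_mult_right integrable_triangle a)
  have gen: "(\<lambda>x. if f2 x < f1 x then of_real ((f1 x - f2 x) powr (\<alpha> - 1)) * (V (f2 x) * cnj (V (f1 x))) else 0) \<in> borel_measurable M"
    if [measurable]: "f1 \<in> borel_measurable M" "f2 \<in> borel_measurable M" for f1 f2 :: "real \<times> real \<Rightarrow> real" and M
    by measurable
  show "(\<lambda>(t, s). if s < t then of_real ((t - s) powr (\<alpha> - 1)) * (V s * cnj (V t)) else 0) \<in> borel_measurable lborel"
    unfolding split_beta' by (rule gen[OF fst_snd_measurable])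
  show "AE x in lborel. norm (case x of (t, s) \<Rightarrow> if s < t then of_real ((t - s) powr (\<alpha> - 1)) * (V s * cnj (V t)) else 0)
      \<le> norm (B\<^sup>2 * (case x of (t, s) \<Rightarrow> indicator {0..1} t * (indicator {0..t} s * (t - s) powr (\<alpha> - 1))))"
  proof (rule AE_I2)
    fix x :: "real \<times> real"
    obtain t s where x: "x = (t, s)" by (cases x)
    show "norm (case x of (t, s) \<Rightarrow> if s < t then of_real ((t - s) powr (\<alpha> - 1)) * (V s * cnj (V t)) else 0)
      \<le> norm (B\<^sup>2 * (case x of (t, s) \<Rightarrow> indicator {0..1} t * (indicator {0..t} s * (t - s) powr (\<alpha> - 1))))"
      using product_bound[OF B, of x] unfolding x by (simp add: norm_mult mult_ac)
  qed
  qed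
qed

lemma frac_form_eq:
  "frac_form \<alpha> V = (LINT x|lborel. (case x of (t, s) \<Rightarrow> if s < t then of_real ((t - s) powr (\<alpha> - 1)) * (V s * cnj (V t)) else 0))"
  using lborel_pair.integral_fst[of "\<lambda>t s. if s < t then of_real ((t - s) powr (\<alpha> - 1)) * (V s * cnj (V t)) else 0"]
    frac_form_integrable unfolding frac_form_def lborel_prod by simp

text \<open>For fixed \<open>r\<close> the form has an exponential kernel and is nonnegative by \<open>exp_kernel_nonneg\<close>.\<close>

lemma exp_form_nonneg:
  assumes p: "Re p = 1" and r: "r \<ge> 0"
  shows "Re (LINT x|lborel. laplace_integrand p x r) \<ge> 0"
proof -
  define h where "h = (\<lambda>t s. (if s < t then exp (- (of_real (t - s) * (of_real r * p))) * (V s * cnj (V t)) else 0))"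
  obtain B where B: "B \<ge> 0" "\<And>s. norm (V s) \<le> B" using V_bounded by blast
  have hI: "integrable (lborel :: (real \<times> real) measure) (case_prod h)"
  proof (rule Bochner_Integration.integrable_bound)
    show "integrable (lborel :: (real \<times> real) measure) (\<lambda>x. B\<^sup>2 * indicator ({0..1} \<times> {0..1}) x)"
    proof (intro integrable_mult_right integrable_real_indicator)
      have "emeasure lborel ({0..1} \<times> {0..1} :: (real \<times> real) set) = 1"
        unfolding lborel_prod[symmetric] by (subst lborel.emeasure_pair_measure_Times) auto
      then show "emeasure lborel ({0..1} \<times> {0..1} :: (real \<times> real) set) < \<infinity>" by simp
    qed (simp add: borel_Times)
    have gen: "(\<lambda>x. if f2 x < f1 x then exp (- (of_real (f1 x - f2 x) * (of_real r * p))) * (V (f2 x) * cnj (V (f1 x))) else 0) \<in> borel_measurable M"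
      if [measurable]: "f1 \<in> borel_measurable M" "f2 \<in> borel_measurable M" for f1 f2 :: "real \<times> real \<Rightarrow> real" and M
      by measurable
    show "case_prod h \<in> borel_measurable lborel"
      unfolding split_beta' h_def by (rule gen[OF fst_snd_measurable])
    show "AE x in lborel. norm (case_prod h x) \<le> norm (B\<^sup>2 * indicator ({0..1} \<times> {0..1}) x)"
    proof (rule AE_I2)
      fix x :: "real \<times> real"
      obtain t s where x: "x = (t, s)" by (cases x)
      show "norm (case_prod h x) \<le> norm (B\<^sup>2 * indicator ({0..1} \<times> {0..1}) x)"
      proof (cases "s < t \<and> s \<in> {0..1} \<and> t \<in> {0..1}")
        case True
        have 1: "norm (exp (- (of_real (t - s) * (of_real r * p)))) \<le> 1"
          using True r p by (simp add: norm_exp_eq_Re)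
        have 2: "norm (V s) * norm (V t) \<le> B * B"
          using B by (intro mult_mono) auto
        have "norm (h t s) \<le> 1 * (B * B)"
          using True unfolding h_def by (simp only: if_True norm_mult complex_mod_cnj) (rule mult_mono[OF 1 2], simp_all)
        then show ?thesis using True by (simp add: x power2_eq_square)
      next
        case False
        then have "h t s = 0" using V_outside unfolding h_def by auto
        then show ?thesis by (simp add: x)
      qed
    qed
  qed
  have integrand_eq: "laplace_integrand p x r = of_real (r powr (- \<alpha>)) * case_prod h x" for x
    using r by (simp add: laplace_integrand_def h_def laplace_kernel_def split_beta mult_ac)
  have inner: "(LINT s|lborel. h t s) = (if t \<in> {0..1} then cnj (v t) * integral {0..t} (\<lambda>s. exp (- (of_real (t - s) * (of_real r * p))) * v s) else 0)" for t
  proof (cases "t \<in> {0..1}")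
    case True
    have si: "set_integrable lborel {0..t} (\<lambda>s. exp (- (of_real (t - s) * (of_real r * p))) * v s)"
      by (intro borel_integrable_atLeastAtMost' continuous_intros continuous_on_subset[OF v]) (use True in auto)
    have "(LINT s|lborel. h t s) = (LINT s|lborel. cnj (v t) * (indicator {0..t} s *\<^sub>R (exp (- (of_real (t - s) * (of_real r * p))) * v s)))"
    proof (rule integral_cong_AE)
      show "AE s in lborel. h t s = cnj (v t) * (indicator {0..t} s *\<^sub>R (exp (- (of_real (t - s) * (of_real r * p))) * v s))"
        using AE_lborel_singleton[of t]
      proof eventually_elim
        case (elim s)
        show ?case
        proof (cases "0 \<le> s \<and> s < t")
          case True
          then show ?thesis using \<open>t \<in> {0..1}\<close> by (simp add: h_def V_inside mult_ac)
        next
          case False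
          then show ?thesis using elim V_outside[of s] by (auto simp: h_def)
        qed
      qed
      show "h t \<in> borel_measurable lborel" unfolding h_def by measurable
      show "(\<lambda>s. cnj (v t) * (indicator {0..t} s *\<^sub>R (exp (- (of_real (t - s) * (of_real r * p))) * v s))) \<in> borel_measurable lborel"
        using si unfolding set_integrable_def by (intro borel_measurable_times borel_measurable_const borel_measurable_integrable)
    qed
    also have "\<dots> = cnj (v t) * (LINT s:{0..t}|lborel. exp (- (of_real (t - s) * (of_real r * p))) * v s)"
      unfolding set_lebesgue_integral_def by (rule integral_mult_right_zero)
    also have "\<dots> = cnj (v t) * integral {0..t} (\<lambda>s. exp (- (of_real (t - s) * (of_real r * p))) * v s)"
      by (simp only: set_borel_integral_eq_integral(2)[OF si])
    finally show ?thesis using True by simp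
  next
    case False
    then have "h t s = 0" for s using V_outside[of t] unfolding h_def by simp
    then have "(LINT s|lborel. h t s) = 0" by simp
    then show ?thesis by (simp only: False if_False)
  qed
  have "(LINT x|lborel. case_prod h x) = (LINT t|lborel. LINT s|lborel. h t s)"
    using lborel_pair.integral_fst[of h] hI unfolding lborel_prod by simp
  also have "\<dots> = (LINT t:{0..1}|lborel. cnj (v t) * integral {0..t} (\<lambda>s. exp (- (of_real (t - s) * (of_real r * p))) * v s))"
    unfolding inner set_lebesgue_integral_def by (intro Bochner_Integration.integral_cong) auto
  also have "\<dots> = integral {0..1} (\<lambda>t. cnj (v t) * integral {0..t} (\<lambda>s. exp (- (of_real (t - s) * (of_real r * p))) * v s))"
  proof (rule set_borel_integral_eq_integral(2))
    have "integrable lborel (\<lambda>t. LINT s|lborel. h t s)"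
      using lborel_pair.integrable_fst[of h] hI unfolding lborel_prod by simp
    also have "(\<lambda>t. LINT s|lborel. h t s) = (\<lambda>t. indicator {0..1} t *\<^sub>R (cnj (v t) * integral {0..t} (\<lambda>s. exp (- (of_real (t - s) * (of_real r * p))) * v s)))"
      unfolding inner by (auto simp: indicator_def)
    finally show "set_integrable lborel {0..1} (\<lambda>t. cnj (v t) * integral {0..t} (\<lambda>s. exp (- (of_real (t - s) * (of_real r * p))) * v s))"
      unfolding set_integrable_def .
  qed
  finally have eq: "(LINT x|lborel. case_prod h x) = integral {0..1} (\<lambda>t. cnj (v t) * integral {0..t} (\<lambda>s. exp (- (of_real (t - s) * (of_real r * p))) * v s))" .
  have "Re (LINT x|lborel. case_prod h x) \<ge> 0"
    unfolding eq by (rule exp_kernel_nonneg[OF v]) (use p r in simp)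
  then show ?thesis unfolding integrand_eq by simp
qed

text \<open>Integrating the nonnegative forms of the exponential kernels over \<open>r\<close> gives \<open>K(p)\<close> times the fractional form.\<close>

lemma frac_form_pos:
  assumes p: "Re p = 1"
  shows "Re (integral\<^sup>L lborel (laplace_kernel \<alpha> p) * frac_form \<alpha> V) \<ge> 0"
proof -
  let ?K = "integral\<^sup>L lborel (laplace_kernel \<alpha> p)"
  have val: "(\<integral>r. laplace_integrand p x r \<partial>lborel) = ?K * (case x of (t, s) \<Rightarrow> if s < t then of_real ((t - s) powr (\<alpha> - 1)) * (V s * cnj (V t)) else 0)" for x
    using has_bochner_integral_integral_eq[OF laplace_kernel_integral(1)[OF a p, of "fst x - snd x"]]
    by (cases "snd x < fst x") (simp_all add: laplace_integrand_def split_beta mult_ac)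
  have "?K * frac_form \<alpha> V = (LINT x|lborel. \<integral>r. laplace_integrand p x r \<partial>lborel)"
    unfolding val frac_form_eq by simp
  also have "\<dots> = (\<integral>r. (LINT x|lborel. laplace_integrand p x r) \<partial>lborel)"
    by (rule lborel_pair.Fubini_integral[OF laplace_integrand_integrable[OF p], symmetric])
  finally have eq: "?K * frac_form \<alpha> V = (\<integral>r. (LINT x|lborel. laplace_integrand p x r) \<partial>lborel)" .
  have I: "integrable lborel (\<lambda>r. LINT x|lborel. laplace_integrand p x r)"
    by (rule lborel_pair.integrable_snd[OF laplace_integrand_integrable[OF p]])
  have nn: "Re (LINT x|lborel. laplace_integrand p x r) \<ge> 0" for r
  proof (cases "r \<ge> 0")
    case False
    then have "laplace_integrand p x r = 0" for x by (simp add: laplace_integrand_def laplace_kernel_def)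
    then show ?thesis by simp
  qed (rule exp_form_nonneg[OF p])
  have "Re (?K * frac_form \<alpha> V) = (\<integral>r. Re (LINT x|lborel. laplace_integrand p x r) \<partial>lborel)"
    unfolding eq using I by simp
  also have "\<dots> \<ge> 0" by (intro integral_nonneg_AE AE_I2 nn)
  finally show ?thesis .
qed

end

text \<open>The form \<open>Q\<close> satisfies \<open>Re (K Q) \<ge> 0\<close> and \<open>Re (cnj K * Q) \<ge> 0\<close> with \<open>K = K(1 + i/2)\<close> not real, so it
lies in a sector strictly smaller than the right half plane.\<close>

lemma frac_form_sector:
  assumes a: "0 < \<alpha>" "\<alpha> < 1"
  shows "\<exists>L>0. \<forall>v. continuous_on {0..1} v \<longrightarrow>
    \<bar>Im (frac_form \<alpha> (\<lambda>s. indicator {0..1} s *\<^sub>R v s))\<bar> \<le> L * Re (frac_form \<alpha> (\<lambda>s. indicator {0..1} s *\<^sub>R v s))"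
proof -
  define K where "K = integral\<^sup>L lborel (laplace_kernel \<alpha> (Complex 1 (1 / 2)))"
  have Kc: "integral\<^sup>L lborel (laplace_kernel \<alpha> (Complex 1 (- (1 / 2)))) = cnj K"
  proof -
    have "Complex 1 (- (1 / 2)) = cnj (Complex 1 (1 / 2))" by (simp add: complex_eq_iff)
    then have e: "laplace_kernel \<alpha> (Complex 1 (- (1 / 2))) = (\<lambda>r. cnj (laplace_kernel \<alpha> (Complex 1 (1 / 2)) r))"
      by (simp only: laplace_kernel_cnj fun_eq_iff) simp
    show ?thesis unfolding K_def e by (rule Bochner_Integration.integral_cnj)
  qed
  have G: "Gamma (1 - \<alpha>) > 0" using a by (intro Gamma_real_pos) simp
  have K1: "integral\<^sup>L lborel (laplace_kernel \<alpha> 1) = of_real (Gamma (1 - \<alpha>))"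
  proof -
    have "laplace_kernel \<alpha> 1 r = of_real (norm (laplace_kernel \<alpha> 1 r))" for r
      unfolding norm_laplace_kernel by (simp add: laplace_kernel_def indicator_def exp_minus divide_inverse exp_of_real)
    moreover have "has_bochner_integral lborel (\<lambda>r. norm (laplace_kernel \<alpha> 1 r)) (Gamma (1 - \<alpha>))"
      using laplace_kernel_integral(2)[OF a, of 1 1] by simp
    then have "has_bochner_integral lborel (\<lambda>r. of_real (norm (laplace_kernel \<alpha> 1 r)) :: complex) (of_real (Gamma (1 - \<alpha>)))"
      by (rule has_bochner_integral_of_real)
    ultimately show ?thesis by (metis (no_types, lifting) Bochner_Integration.integral_cong has_bochner_integral_integral_eq)
  qed
  have ImK: "Im K < 0" unfolding K_def by (rule laplace_kernel_Im[OF a])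
  have "\<bar>Im Q\<bar> \<le> ((\<bar>Re K\<bar> + 1) / - Im K) * Re Q"
    if "continuous_on {0..1} v" and Q: "Q = frac_form \<alpha> (\<lambda>s. indicator {0..1} s *\<^sub>R v s)" for v Q
  proof -
    have "Re (K * Q) \<ge> 0" unfolding K_def Q by (rule frac_form_pos[OF a that(1)]) simp
    moreover have "Re (cnj K * Q) \<ge> 0" unfolding Kc[symmetric] Q by (rule frac_form_pos[OF a that(1)]) simp
    ultimately have 1: "\<bar>Im Q\<bar> * - Im K \<le> Re K * Re Q"
      using ImK by (auto simp: abs_if algebra_simps)
    have "Re (integral\<^sup>L lborel (laplace_kernel \<alpha> 1) * Q) \<ge> 0" unfolding Q by (rule frac_form_pos[OF a that(1)]) simp
    then have "Re Q \<ge> 0" unfolding K1 using G by (simp add: zero_le_mult_iff)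
    then have "Re K * Re Q \<le> (\<bar>Re K\<bar> + 1) * Re Q" by (intro mult_right_mono) auto
    then show ?thesis using 1 ImK by (simp add: field_simps)
  qed
  then show ?thesis using ImK by (intro exI[of _ "(\<bar>Re K\<bar> + 1) / - Im K"]) (auto simp: divide_pos_neg)
qed

section \<open>Decay of the Mittag-Leffler function on the imaginary axis\<close>

text \<open>Multiplying the Volterra equation by the conjugate of \<open>u\<close> and integrating gives
\<open>z Q = \<Gamma>(\<alpha>) (N - c)\<close>, where \<open>Q\<close> is the fractional form, \<open>N\<close> the square of the \<open>L^2\<close> norm, and
\<open>c\<close> the integral of the conjugate of \<open>u\<close>. For \<open>z\<close> nearly imaginary the imaginary part of this identity, together with
the sector bound on \<open>Q\<close>, controls \<open>|Im z| Re Q\<close> by \<open>|c|\<close>; the real part then gives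
\<open>N \<le> C |c|\<close>. Since \<open>|c|\<close> is at most the square root of \<open>N\<close>, this bounds \<open>N\<close>.\<close>

lemma ml_L2_bound:
  assumes a: "0 < \<alpha>" "\<alpha> < 1"
  shows "\<exists>\<eta>>0. \<exists>C. \<forall>z\<in>sector \<eta>. 
    (LINT s|lborel. (norm (indicator {0..1} s *\<^sub>R ml \<alpha> 1 (z * of_real (s powr \<alpha>))))\<^sup>2) \<le> C"
proof -
  obtain L where L: "L > 0" "\<And>v. continuous_on {0..1} v \<Longrightarrow>
    \<bar>Im (frac_form \<alpha> (\<lambda>s. indicator {0..1} s *\<^sub>R v s))\<bar> \<le> L * Re (frac_form \<alpha> (\<lambda>s. indicator {0..1} s *\<^sub>R v s))"
    using frac_form_sector[OF a] by blast
  \<comment> \<open>So thin that \<open>|Re z| |Im Q|\<close> is at most half of \<open>|Im z| Re Q\<close>.\<close>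
  define \<eta> where "\<eta> = 1 / (2 * L)"
  have \<eta>: "\<eta> > 0" "\<eta> * L = 1 / 2" using L by (auto simp: \<eta>_def)
  define C where "C = 1 + 2 * (\<eta> + L)"
  have C: "C \<ge> 1" using \<eta> L by (simp add: C_def)
  have G: "Gamma \<alpha> > 0" using a by (intro Gamma_real_pos)
  have "(LINT s|lborel. (norm (indicator {0..1} s *\<^sub>R ml \<alpha> 1 (z * of_real (s powr \<alpha>))))\<^sup>2) \<le> C\<^sup>2"
    if z: "z \<in> sector \<eta>" for z
  proof -
    define v where "v = (\<lambda>s. ml \<alpha> 1 (z * of_real (s powr \<alpha>)))"
    define V where "V = (\<lambda>s. indicator {0..1} s *\<^sub>R v s)"
    have cml: "continuous_on UNIV (ml \<alpha> 1)"
      by (intro holomorphic_on_imp_continuous_on ml_holomorphic a)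
    have cpw: "continuous_on {0..1} (\<lambda>s. z * of_real (s powr \<alpha>))"
      by (intro continuous_on_mult continuous_on_const continuous_on_of_real continuous_on_powr' continuous_on_id) (use a in auto)
    have cv: "continuous_on {0..1} v"
      unfolding v_def by (rule continuous_on_compose2[OF cml cpw]) simp
    define N where "N = (LINT t|lborel. (norm (V t))\<^sup>2)"
    define c where "c = (LINT t|lborel. cnj (V t))"
    have IV: "integrable lborel V"
      using borel_integrable_atLeastAtMost'[OF cv] unfolding V_def set_integrable_def .
    have IV2: "integrable lborel (\<lambda>t. (norm (V t))\<^sup>2)"
    proof -
      have "set_integrable lborel {0..1} (\<lambda>t. (norm (v t))\<^sup>2)"
        by (intro borel_integrable_atLeastAtMost' continuous_intros cv)
      moreover have "(norm (V t))\<^sup>2 = indicator {0..1} t *\<^sub>R (norm (v t))\<^sup>2" for t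
        unfolding V_def by (simp add: indicator_def)
      ultimately show ?thesis unfolding set_integrable_def by simp
    qed
    have inner: "z * (LINT s|lborel. (if s < t then of_real ((t - s) powr (\<alpha> - 1)) * (V s * cnj (V t)) else 0))
       = of_real (Gamma \<alpha>) * (of_real ((norm (V t))\<^sup>2) - cnj (V t))" for t
    proof (cases "0 < t \<and> t \<le> 1")
      case True
      have "(LINT s|lborel. (if s < t then of_real ((t - s) powr (\<alpha> - 1)) * (V s * cnj (V t)) else 0))
        = (LINT s|lborel. cnj (V t) * (indicator {0..t} s *\<^sub>R (of_real ((t - s) powr (\<alpha> - 1)) * ml \<alpha> 1 (z * of_real (s powr \<alpha>)))))"
      proof (intro Bochner_Integration.integral_cong refl)
        fix s
        consider "s < 0" | "0 \<le> s \<and> s < t" | "s = t" | "s > t" by linarith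
        then show "(if s < t then of_real ((t - s) powr (\<alpha> - 1)) * (V s * cnj (V t)) else 0)
          = cnj (V t) * (indicator {0..t} s *\<^sub>R (of_real ((t - s) powr (\<alpha> - 1)) * ml \<alpha> 1 (z * of_real (s powr \<alpha>))))"
          by cases (use True in \<open>simp_all add: V_def v_def mult_ac\<close>)
      qed
      also have "\<dots> = cnj (V t) * (of_real (Gamma \<alpha> * t powr \<alpha>) * ml \<alpha> (1 + \<alpha>) (z * of_real (t powr \<alpha>)))"
        unfolding integral_mult_right_zero has_bochner_integral_integral_eq[OF ml_convolution[OF a(1) a(1) conjunct1[OF True]]] ..
      finally have "z * (LINT s|lborel. (if s < t then of_real ((t - s) powr (\<alpha> - 1)) * (V s * cnj (V t)) else 0))
        = of_real (Gamma \<alpha>) * cnj (V t) * ((z * of_real (t powr \<alpha>)) * ml \<alpha> (1 + \<alpha>) (z * of_real (t powr \<alpha>)))"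
        by (simp add: mult_ac)
      also have "(z * of_real (t powr \<alpha>)) * ml \<alpha> (1 + \<alpha>) (z * of_real (t powr \<alpha>)) = V t - 1"
        using ml_recurrence[OF a(1), of 1 "z * of_real (t powr \<alpha>)"] True by (simp add: V_def v_def rGamma_inverse_Gamma)
      finally show ?thesis
        by (simp only: complex_norm_square) (simp add: algebra_simps)
    next
      case False
      show ?thesis
      proof (cases "t = 0")
        case True
        have "(if s < t then of_real ((t - s) powr (\<alpha> - 1)) * (V s * cnj (V t)) else 0) = 0" for s
          using True by (simp add: V_def)
        moreover have "V 0 = 1"
          using ml_recurrence[OF a(1), of 1 0] by (simp add: V_def v_def rGamma_inverse_Gamma)
        ultimately show ?thesis using True by simp
      next
        case tF: False
        then have "V t = 0" using False by (simp add: V_def)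
        then show ?thesis by (simp cong: if_cong)
      qed
    qed
    let ?Q = "frac_form \<alpha> V"
    have "z * ?Q = (LINT t|lborel. of_real (Gamma \<alpha>) * (of_real ((norm (V t))\<^sup>2) - cnj (V t)))"
      unfolding frac_form_def inner[symmetric] by (rule integral_mult_right_zero[symmetric])
    also have "\<dots> = of_real (Gamma \<alpha>) * (LINT t|lborel. (of_real ((norm (V t))\<^sup>2) - cnj (V t)))"
      by (rule integral_mult_right_zero)
    also have "(LINT t|lborel. (of_real ((norm (V t))\<^sup>2) - cnj (V t))) = of_real N - c"
    proof -
      have I1: "integrable lborel (\<lambda>t. complex_of_real ((norm (V t))\<^sup>2))"
        by (rule integrable_of_real[OF IV2])
      show ?thesis
        unfolding N_def c_def Bochner_Integration.integral_diff[OF I1 integrable_cnj[OF IV]] integral_complex_of_real ..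
    qed
    finally have eq: "z * ?Q = of_real (Gamma \<alpha>) * (of_real N - c)" .
    have sec: "\<bar>Im ?Q\<bar> \<le> L * Re ?Q" using L(2)[OF cv] unfolding V_def .
    define q where "q = Re ?Q / Gamma \<alpha>"
    define s where "s = Im ?Q / Gamma \<alpha>"
    have sq: "\<bar>s\<bar> \<le> L * q" using sec G by (simp add: s_def q_def divide_right_mono)
    have q0: "q \<ge> 0" using sq L(1) by (smt (verit) zero_le_mult_iff)
    have re: "Re z * q - Im z * s = N - Re c" and im: "Re z * s + Im z * q = - Im c"
      using arg_cong[OF eq, of Re] arg_cong[OF eq, of Im] G by (simp_all add: q_def s_def field_simps)
    have zs: "\<bar>Re z\<bar> \<le> \<eta> * \<bar>Im z\<bar>" using z by (simp add: sector_def)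
    have "\<bar>Im z\<bar> * q = \<bar>- Im c - Re z * s\<bar>" using im q0 by (metis abs_mult abs_of_nonneg add_diff_cancel_left' diff_add_cancel)
    also have "\<dots> \<le> norm c + \<bar>Re z\<bar> * \<bar>s\<bar>"
      using abs_triangle_ineq4[of "- Im c" "Re z * s"] abs_Im_le_cmod[of c] by (simp add: abs_mult)
    also have "\<bar>Re z\<bar> * \<bar>s\<bar> \<le> (\<eta> * \<bar>Im z\<bar>) * (L * q)"
      by (rule mult_mono[OF zs sq]) (use \<eta> in auto)
    also have "(\<eta> * \<bar>Im z\<bar>) * (L * q) = (\<eta> * L) * (\<bar>Im z\<bar> * q)" by (simp add: mult_ac)
    finally have yq: "\<bar>Im z\<bar> * q \<le> 2 * norm c" unfolding \<eta>(2) by simp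
    have "N = Re c + Re z * q - Im z * s" using re by simp
    also have "\<dots> \<le> norm c + \<bar>Re z\<bar> * q + \<bar>Im z\<bar> * \<bar>s\<bar>"
    proof -
      have "Re z * q \<le> \<bar>Re z\<bar> * q" using q0 by (intro mult_right_mono) auto
      moreover have "- (Im z * s) \<le> \<bar>Im z\<bar> * \<bar>s\<bar>" unfolding abs_mult[symmetric] by (rule abs_ge_minus_self)
      moreover have "Re c \<le> norm c" by (rule complex_Re_le_cmod)
      ultimately show ?thesis by linarith
    qed
    also have "\<dots> \<le> norm c + (\<eta> * \<bar>Im z\<bar>) * q + \<bar>Im z\<bar> * (L * q)"
      by (intro add_mono mult_right_mono mult_left_mono zs sq q0) auto
    also have "\<dots> = norm c + (\<eta> + L) * (\<bar>Im z\<bar> * q)" by (simp add: algebra_simps)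
    also have "\<dots> \<le> norm c + (\<eta> + L) * (2 * norm c)"
      using yq \<eta> L(1) by (intro add_left_mono mult_left_mono) auto
    finally have Nc: "N \<le> C * norm c" by (simp add: C_def algebra_simps)
    have "norm c \<le> (LINT t|lborel. norm (cnj (V t)))" unfolding c_def by (rule integral_norm_bound)
    \<comment> \<open>Young's inequality with the weight \<open>C\<close> absorbs half of \<open>N\<close> on the left of \<open>N \<le> C |c|\<close>.\<close>
    also have "\<dots> \<le> (LINT t|lborel. (norm (V t))\<^sup>2 / (2 * C) + indicator {0..1} t * (C / 2))"
    proof (rule integral_mono)
      show "integrable lborel (\<lambda>t. norm (cnj (V t)))" using IV by simp
      show "integrable lborel (\<lambda>t. (norm (V t))\<^sup>2 / (2 * C) + indicator {0..1} t * (C / 2))"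
        by (intro Bochner_Integration.integrable_add integrable_divide IV2 integrable_mult_left integrable_real_indicator) auto
      fix t
      show "norm (cnj (V t)) \<le> (norm (V t))\<^sup>2 / (2 * C) + indicator {0..1} t * (C / 2)"
      proof (cases "t \<in> {0..1}")
        case True
        have "0 \<le> (norm (V t) - C)\<^sup>2 / (2 * C)" using C by simp
        also have "\<dots> = (norm (V t))\<^sup>2 / (2 * C) + C / 2 - norm (V t)"
          using C by (simp add: power2_eq_square field_simps)
        finally show ?thesis using True by simp
      qed (simp add: V_def)
    qed
    also have "\<dots> = N / (2 * C) + C / 2"
      unfolding N_def using IV2 by simp
    finally have "C * norm c \<le> C * (N / (2 * C) + C / 2)"
      using C by (intro mult_left_mono) auto
    also have "\<dots> = N / 2 + C\<^sup>2 / 2" using C by (simp add: field_simps power2_eq_square)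
    finally have "N \<le> C\<^sup>2" using Nc by simp
    then show ?thesis unfolding N_def V_def v_def .
  qed
  then show ?thesis using \<eta>(1) by blast
qed

text \<open>By \<open>ml_convolution_unit\<close> the function is an integral of \<open>u\<close> against \<open>(1-s)^(\<gamma>-2)\<close>, which is square
integrable exactly when \<open>\<gamma> > 3/2\<close>.\<close>

lemma ml_bounded_large:
  assumes a: "0 < \<alpha>" "\<alpha> < 1" and g: "\<gamma> > 3 / 2"
  shows "\<exists>\<eta>>0. bounded (ml \<alpha> \<gamma> ` sector \<eta>)"
proof -
  obtain \<eta> C where \<eta>: "\<eta> > 0" and C: "\<And>z. z \<in> sector \<eta> \<Longrightarrow>
    (LINT s|lborel. (norm (indicator {0..1} s *\<^sub>R ml \<alpha> 1 (z * of_real (s powr \<alpha>))))\<^sup>2) \<le> C"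
    using ml_L2_bound[OF a] by blast
  define \<delta> where "\<delta> = \<gamma> - 1"
  have \<delta>: "\<delta> > 1 / 2" "1 + \<delta> = \<gamma>" using g by (auto simp: \<delta>_def)
  have G: "Gamma \<delta> > 0" using \<delta> by (intro Gamma_real_pos) simp
  define B where "B = 1 powr (2 * \<delta> - 1) / (2 * \<delta> - 1)"
  have B: "has_bochner_integral lborel (\<lambda>s. indicator {0..1} s * (1 - s) powr (2 * \<delta> - 1 - 1)) B"
    unfolding B_def by (rule triangle_kernel_integral) (use \<delta> in auto)
  have "norm (ml \<alpha> \<gamma> z) \<le> (B + C) / 2 / Gamma \<delta>" if z: "z \<in> sector \<eta>" for z
  proof -
    let ?V = "\<lambda>s. indicator {0..1} s *\<^sub>R ml \<alpha> 1 (z * of_real (s powr \<alpha>))"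
    let ?f = "\<lambda>s. indicator {0..1} s *\<^sub>R (of_real ((1 - s) powr (\<delta> - 1)) * ml \<alpha> 1 (z * of_real (s powr \<alpha>)))"
    have I: "has_bochner_integral lborel ?f (of_real (Gamma \<delta>) * ml \<alpha> (1 + \<delta>) z)"
      using \<delta> by (intro ml_convolution_unit a) auto
    have cml: "continuous_on UNIV (ml \<alpha> 1)"
      by (intro holomorphic_on_imp_continuous_on ml_holomorphic a)
    have cpw: "continuous_on {0..1} (\<lambda>s. z * of_real (s powr \<alpha>))"
      by (intro continuous_on_mult continuous_on_const continuous_on_of_real continuous_on_powr' continuous_on_id) (use a in auto)
    have cv: "continuous_on {0..1} (\<lambda>s. ml \<alpha> 1 (z * of_real (s powr \<alpha>)))"
      by (rule continuous_on_compose2[OF cml cpw]) simp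
    have IV2: "integrable lborel (\<lambda>t. (norm (?V t))\<^sup>2)"
    proof -
      have "set_integrable lborel {0..1} (\<lambda>t. (norm (ml \<alpha> 1 (z * of_real (t powr \<alpha>))))\<^sup>2)"
        by (intro borel_integrable_atLeastAtMost' continuous_on_power continuous_on_norm cv)
      moreover have "(norm (?V t))\<^sup>2 = indicator {0..1} t *\<^sub>R (norm (ml \<alpha> 1 (z * of_real (t powr \<alpha>))))\<^sup>2" for t
        by (simp add: indicator_def)
      ultimately show ?thesis unfolding set_integrable_def by simp
    qed
    have "Gamma \<delta> * norm (ml \<alpha> \<gamma> z) = norm (LINT s|lborel. ?f s)"
      unfolding has_bochner_integral_integral_eq[OF I] \<delta>(2) using G by (simp add: norm_mult)
    also have "\<dots> \<le> (LINT s|lborel. norm (?f s))" by (rule integral_norm_bound)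
    also have "\<dots> \<le> (LINT s|lborel. (indicator {0..1} s * (1 - s) powr (2 * \<delta> - 1 - 1) + (norm (?V s))\<^sup>2) / 2)"
    proof (rule integral_mono)
      show "integrable lborel (\<lambda>s. norm (?f s))" by (rule integrable_norm[OF integrable.intros[OF I]])
      show "integrable lborel (\<lambda>s. (indicator {0..1} s * (1 - s) powr (2 * \<delta> - 1 - 1) + (norm (?V s))\<^sup>2) / 2)"
        by (intro integrable_divide Bochner_Integration.integrable_add IV2 integrable.intros[OF B])
      fix s :: real
      show "norm (?f s) \<le> (indicator {0..1} s * (1 - s) powr (2 * \<delta> - 1 - 1) + (norm (?V s))\<^sup>2) / 2"
      proof (cases "s \<in> {0..1}")
        case True
        let ?p = "(1 - s) powr (\<delta> - 1)" and ?m = "norm (ml \<alpha> 1 (z * of_real (s powr \<alpha>)))"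
        have "?p\<^sup>2 = (1 - s) powr (2 * \<delta> - 1 - 1)"
          by (simp add: power2_eq_square flip: powr_add)
        moreover have "0 \<le> (?p - ?m)\<^sup>2" by simp
        ultimately have "?p * ?m \<le> ((1 - s) powr (2 * \<delta> - 1 - 1) + ?m\<^sup>2) / 2"
          by (simp add: power2_diff)
        then show ?thesis using True by (simp add: norm_mult)
      qed simp
    qed
    also have "\<dots> = (B + (LINT s|lborel. (norm (?V s))\<^sup>2)) / 2"
      using IV2 B by (simp add: has_bochner_integral_iff)
    also have "\<dots> \<le> (B + C) / 2" using C[OF z] by simp
    finally show ?thesis using G by (simp add: field_simps)
  qed
  then show ?thesis using \<eta> unfolding bounded_iff by blast
qed

text \<open>Descent from \<open>\<gamma> + n > 3/2\<close> in unit steps; the sector shrinks by half in each step.\<close>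

lemma ml_bounded:
  assumes a: "0 < \<alpha>" "\<alpha> < 1"
  shows "\<exists>\<eta>>0. bounded (ml \<alpha> \<gamma> ` sector \<eta>)"
proof -
  have "\<exists>\<eta>>0. bounded (ml \<alpha> \<gamma> ` sector \<eta>)" if "\<gamma> + real n > 3 / 2" for n \<gamma>
    using that
  proof (induction n arbitrary: \<gamma>)
    case 0
    then show ?case using ml_bounded_large[OF a] by simp
  next
    case (Suc n)
    then have "(\<gamma> + 1) + real n > 3 / 2" by simp
    then obtain \<eta> where "\<eta> > 0" "bounded (ml \<alpha> (\<gamma> + 1) ` sector \<eta>)" using Suc.IH by blast
    then have "bounded (ml \<alpha> (\<gamma> + 1 - 1) ` sector (\<eta> / 2))" by (intro ml_bounded_lower a)
    then show ?case using \<open>\<eta> > 0\<close> by (intro exI[of _ "\<eta> / 2"]) simp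
  qed
  moreover obtain n where "real n > 3 / 2 - \<gamma>" using reals_Archimedean2 by blast
  then have "\<gamma> + real n > 3 / 2" by linarith
  ultimately show ?thesis by blast
qed

text \<open>The recurrence expresses \<open>y E_{\<alpha>,\<beta>}(i y)\<close> through the bounded function \<open>E_{\<alpha>,\<beta>-\<alpha>}\<close>.\<close>

lemma ml_decay:
  assumes a: "0 < \<alpha>" "\<alpha> < 1"
  shows "\<exists>M>0. \<forall>y::real. norm (ml \<alpha> \<beta> (\<i> * of_real y)) \<le> M / (1 + \<bar>y\<bar>)"
proof -
  have im: "\<i> * of_real y \<in> sector \<eta>" if "\<eta> > 0" for y \<eta> using that by (simp add: sector_def)
  obtain B1 where B1: "\<And>y. norm (ml \<alpha> \<beta> (\<i> * of_real y)) \<le> B1"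
  proof -
    obtain \<eta> where \<eta>: "\<eta> > 0" "bounded (ml \<alpha> \<beta> ` sector \<eta>)" using ml_bounded[OF a] by blast
    then obtain B where "\<And>z. z \<in> sector \<eta> \<Longrightarrow> norm (ml \<alpha> \<beta> z) \<le> B" unfolding bounded_iff by auto
    then show ?thesis using that im[OF \<eta>(1)] by blast
  qed
  obtain B2 where B2: "\<And>y. norm (ml \<alpha> (\<beta> - \<alpha>) (\<i> * of_real y)) \<le> B2"
  proof -
    obtain \<eta> where \<eta>: "\<eta> > 0" "bounded (ml \<alpha> (\<beta> - \<alpha>) ` sector \<eta>)" using ml_bounded[OF a] by blast
    then obtain B where "\<And>z. z \<in> sector \<eta> \<Longrightarrow> norm (ml \<alpha> (\<beta> - \<alpha>) z) \<le> B" unfolding bounded_iff by auto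
    then show ?thesis using that im[OF \<eta>(1)] by blast
  qed
  define M where "M = B1 + B2 + \<bar>rGamma (\<beta> - \<alpha>)\<bar> + 1"
  have B0: "B1 \<ge> 0" "B2 \<ge> 0"
    using B1[of 0] B2[of 0] norm_ge_zero order_trans by blast+
  have "norm (ml \<alpha> \<beta> (\<i> * of_real y)) \<le> M / (1 + \<bar>y\<bar>)" for y
  proof -
    let ?E = "ml \<alpha> \<beta> (\<i> * of_real y)"
    have "ml \<alpha> (\<beta> - \<alpha>) (\<i> * of_real y) = of_real (rGamma (\<beta> - \<alpha>)) + \<i> * of_real y * ?E"
      using ml_recurrence[OF a(1), of "\<beta> - \<alpha>" "\<i> * of_real y"] by simp
    then have "\<i> * of_real y * ?E = ml \<alpha> (\<beta> - \<alpha>) (\<i> * of_real y) - of_real (rGamma (\<beta> - \<alpha>))" by simp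
    then have "norm (\<i> * of_real y * ?E) \<le> B2 + \<bar>rGamma (\<beta> - \<alpha>)\<bar>"
      using norm_triangle_ineq4[of "ml \<alpha> (\<beta> - \<alpha>) (\<i> * of_real y)" "of_real (rGamma (\<beta> - \<alpha>)) :: complex"] B2[of y] by simp
    then have "\<bar>y\<bar> * norm ?E \<le> B2 + \<bar>rGamma (\<beta> - \<alpha>)\<bar>" by (simp add: norm_mult)
    then have "(1 + \<bar>y\<bar>) * norm ?E \<le> M" using B1[of y] by (simp add: M_def algebra_simps)
    then show ?thesis by (simp add: field_simps add_pos_nonneg)
  qed
  moreover have "M > 0" using B0 by (simp add: M_def add_nonneg_pos)
  ultimately show ?thesis by blast
qed

section \<open>From sublevel sets to the oscillatory integral\<close>

text \<open>A ball is covered by the four cones around the half axes and the origin. Reflecting and swapping the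
coordinates maps each cone to the one treated in \<open>cone_bound\<close>, and these maps are
themselves admissible charts.\<close>

lemma ball_bound:
  assumes f: "phase_function f"
  shows "\<exists>r>0. sublevel_bound (height f) (newton_multiplicity f) f (ball (0, 0) r)"
proof -
  let ?S = "sublevel_bound (height f) (newton_multiplicity f)"
  obtain V where V: "open V" "(0, 0) \<in> V" "smooth_on V f"
    using phase_germ_smooth[OF f] unfolding germ_smooth_def by blast
  obtain r0 where r0: "r0 > 0" "ball (0, 0) r0 \<subseteq> V" using openE[OF V(1,2)] by blast
  have id: "(\<lambda>p :: real \<times> real. p) \<in> borel_measurable borel" "distr lborel borel (\<lambda>p :: real \<times> real. p) = lborel"
    by (simp_all add: distr_id2)
  have sr: "swap \<circ> reflect \<in> borel_measurable borel" "reflect \<circ> swap \<in> borel_measurable borel"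
    "distr lborel borel (swap \<circ> reflect) = lborel"
  proof -
    show "swap \<circ> reflect \<in> borel_measurable borel" "reflect \<circ> swap \<in> borel_measurable borel"
      by (rule measurable_comp; rule distr_swap(1) distr_reflect(1))+
    have "distr lborel borel (swap \<circ> reflect) = distr (distr lborel borel reflect) borel swap"
      using distr_distr[of swap borel borel reflect lborel] distr_swap(1) distr_reflect(1) by simp
    then show "distr lborel borel (swap \<circ> reflect) = lborel" by (simp only: distr_swap(2) distr_reflect(2))
  qed
  obtain r1 where r1: "r1 > 0" "?S (f \<circ> (\<lambda>p. p)) (horn 1 0 1 r1)"
    using cone_bound[OF f local_coordinates_id] by blast
  obtain r2 where r2: "r2 > 0" "?S (f \<circ> reflect) (horn 1 0 1 r2)"
    using cone_bound[OF f local_coordinates_reflect] by blast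
  obtain r3 where r3: "r3 > 0" "?S (f \<circ> swap) (horn 1 0 1 r3)"
    using cone_bound[OF f local_coordinates_swap] by blast
  obtain r4 where r4: "r4 > 0" "?S (f \<circ> (swap \<circ> reflect)) (horn 1 0 1 r4)"
    using cone_bound[OF f local_coordinates_comp[OF local_coordinates_swap local_coordinates_reflect]] by blast
  define r where "r = min r0 (min (min r1 r2) (min r3 r4))"
  have r: "r > 0" "r \<le> r0" "r \<le> r1" "r \<le> r2" "r \<le> r3" "r \<le> r4" using r0 r1 r2 r3 r4 by (auto simp: r_def)
  let ?B = "ball (0, 0) r :: (real \<times> real) set"
  have cont: "continuous_on ?B f"
    by (rule continuous_on_subset[OF smooth_on_continuous_on[OF V(3)]]) (use r(2) r0(2) subset_ball[OF r(2)] in blast)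
  have B: "?B \<in> sets borel" by simp
  have piece: "?S f {p\<in>?B. \<tau> p \<in> horn 1 0 1 r}"
    if \<sigma>: "\<sigma> \<in> borel_measurable borel" "distr lborel borel \<sigma> = lborel" and \<tau>: "\<tau> \<in> borel_measurable borel" "\<And>p. \<tau> (\<sigma> p) = p"
      and s: "?S (f \<circ> \<sigma>) (horn 1 0 1 s)" and rs: "r \<le> s" for \<sigma> \<tau> s
  proof (rule sublevel_bound_transform[OF \<sigma> _ _ _ s])
    have "\<tau> -` horn 1 0 1 r \<inter> space borel \<in> sets borel" by (rule measurable_sets[OF \<tau>(1) horn_measurable])
    then have "?B \<inter> (\<tau> -` horn 1 0 1 r) \<in> sets borel" using sets.Int[OF B] by simp
    moreover have "{p\<in>?B. \<tau> p \<in> horn 1 0 1 r} = ?B \<inter> (\<tau> -` horn 1 0 1 r)" by auto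
    ultimately show "{p\<in>?B. \<tau> p \<in> horn 1 0 1 r} \<in> sets borel" by simp
    show "continuous_on {p\<in>?B. \<tau> p \<in> horn 1 0 1 r} f" by (rule continuous_on_subset[OF cont]) auto
    show "p \<in> horn 1 0 1 s" if "\<sigma> p \<in> {p\<in>?B. \<tau> p \<in> horn 1 0 1 r}" for p
      using that \<tau>(2)[of p] horn_mono[OF order_refl rs, of 1 0 1] by auto
  qed
  have S0: "?S f {(0, 0)}"
    unfolding sublevel_bound_def
  proof (intro conjI exI[of _ "0::real"] allI impI)
    fix \<epsilon> :: real
    have "emeasure lborel {p \<in> {(0, 0)}. \<bar>f p\<bar> \<le> \<epsilon>} \<le> emeasure lborel {(0::real, 0::real)}"
      by (rule emeasure_mono) auto
    then show "emeasure lborel {p \<in> {(0, 0)}. \<bar>f p\<bar> \<le> \<epsilon>} \<le> ennreal (0 * (\<epsilon> powr (1 / height f) * ln (1 / \<epsilon>) ^ newton_multiplicity f))"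
      by simp
  qed simp_all
  have rr: "reflect (reflect p) = p" "swap (swap p) = p" for p by (simp_all add: reflect_def swap_def)
  define R where "R = (\<lambda>k::nat. if k = 0 then {(0, 0)} else if k = 1 then {p\<in>?B. p \<in> horn 1 0 1 r}
    else if k = 2 then {p\<in>?B. reflect p \<in> horn 1 0 1 r} else if k = 3 then {p\<in>?B. swap p \<in> horn 1 0 1 r}
    else {p\<in>?B. (reflect \<circ> swap) p \<in> horn 1 0 1 r})"
  have "?S f ?B"
  proof (rule sublevel_bound_finite_cover[OF B cont, of "{..4}" _ _ R])
    fix k
    have "?S f {p\<in>?B. p \<in> horn 1 0 1 r}" by (rule piece[OF id id(1) _ r1(2) r(3)]) simp
    moreover have "?S f {p\<in>?B. reflect p \<in> horn 1 0 1 r}" by (rule piece[OF distr_reflect distr_reflect(1) rr(1) r2(2) r(4)])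
    moreover have "?S f {p\<in>?B. swap p \<in> horn 1 0 1 r}" by (rule piece[OF distr_swap distr_swap(1) rr(2) r3(2) r(5)])
    moreover have "?S f {p\<in>?B. (reflect \<circ> swap) p \<in> horn 1 0 1 r}"
      by (rule piece[OF sr(1,3,2) _ r4(2) r(6)]) (simp add: rr)
    ultimately show "?S f (R k)" unfolding R_def using S0 by (simp split: if_split)
  next
    show "?B \<subseteq> (\<Union>k\<in>{..4}. R k)"
    proof
      fix p assume p: "p \<in> ?B"
      obtain x y where xy: "p = (x, y)" by (cases p)
      have n: "norm p < r" using p by (simp add: dist_norm norm_Pair xy)
      have ab: "\<bar>x\<bar> < r" "\<bar>y\<bar> < r"
        using norm_fst_le[of x y] norm_snd_le[of y x] n by (simp_all add: xy)
      consider "x = 0 \<and> y = 0" | "x > 0" "\<bar>y\<bar> \<le> x" | "x < 0" "\<bar>y\<bar> \<le> - x" | "y > 0" "\<bar>x\<bar> \<le> y" | "y < 0" "\<bar>x\<bar> \<le> - y"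
        by linarith
      then have "\<exists>k\<in>{..4}. p \<in> R k"
      proof cases
        case 1 then show ?thesis by (intro bexI[of _ 0]) (simp_all add: R_def xy)
      next
        case 2 then show ?thesis using p ab by (intro bexI[of _ 1]) (simp_all add: R_def xy horn_def)
      next
        case 3 then show ?thesis using p ab by (intro bexI[of _ 2]) (simp_all add: R_def xy horn_def reflect_def)
      next
        case 4 then show ?thesis using p ab by (intro bexI[of _ 3]) (simp_all add: R_def xy horn_def swap_def)
      next
        case 5 then show ?thesis using p ab by (intro bexI[of _ 4]) (simp_all add: R_def xy horn_def swap_def reflect_def)
      qed
      then show "p \<in> (\<Union>k\<in>{..4}. R k)" by blast
    qed
  qed simp
  then show ?thesis using r(1) by blast
qed

text \<open>The first dyadic level \<open>2^j\<close> above \<open>u\<close> already contributes \<open>2 / 2^j \<ge> 1 / (1 + u)\<close>.\<close>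

lemma dyadic_majorant:
  fixes u :: real
  assumes "0 \<le> u"
  shows "1 / (1 + u) \<le> (\<Sum>j\<le>J. 2 / 2 ^ j * indicator {..2 ^ j} u) + 1 / 2 ^ J"
proof (induction J)
  case 0
  have "1 / (1 + u) \<le> 1" using assms by simp
  then show ?case by (simp add: indicator_def)
next
  case (Suc J)
  show ?case
  proof (cases "u \<le> 2 ^ Suc J")
    case True
    have "1 / 2 ^ J \<le> 3 / (2 * 2 ^ J :: real)" by (simp add: divide_simps)
    then show ?thesis using True Suc by (simp add: indicator_def)
  next
    case False
    have "1 / (1 + u) \<le> 1 / 2 ^ Suc J" using False assms by (intro divide_left_mono mult_pos_pos) auto
    moreover have "0 \<le> (\<Sum>j\<le>Suc J. 2 / 2 ^ j * indicator {..2 ^ j} u :: real)" by (intro sum_nonneg) auto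
    ultimately show ?thesis by linarith
  qed
qed

text \<open>The levels stop at the largest \<open>2^J \<le> \<Lambda> / 2\<close>, so that each level \<open>|f| \<le> 2^j / \<Lambda>\<close> is within the range
\<open>\<epsilon> \<le> 1/2\<close> of the sublevel bound; the rest of the integral is \<open>O(1/\<Lambda>)\<close>.\<close>

lemma integral_le_dyadic_sum:
  assumes A: "A \<ge> 0" "\<And>\<epsilon>. 0 < \<epsilon> \<Longrightarrow> \<epsilon> \<le> 1 / 2 \<Longrightarrow> emeasure lborel {p\<in>B. \<bar>f p\<bar> \<le> \<epsilon>} \<le> ennreal (A * (\<epsilon> powr (1 / h) * ln (1 / \<epsilon>) ^ l))"
    and B: "B \<in> sets borel" "continuous_on B (f :: real \<times> real \<Rightarrow> real)" "emeasure lborel B \<le> ennreal K" "K \<ge> 0"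
    and \<Lambda>: "\<Lambda> \<ge> 2"
  shows "\<exists>J. 2 * 2 ^ J \<le> \<Lambda> \<and> (\<integral>\<^sup>+p. ennreal (1 / (1 + \<Lambda> * \<bar>f p\<bar>)) * indicator B p \<partial>lborel)
    \<le> ennreal ((\<Sum>j\<le>J. 2 / 2 ^ j * (A * ((2 ^ j / \<Lambda>) powr (1 / h) * ln (\<Lambda> / 2 ^ j) ^ l))) + K * (4 / \<Lambda>))"
proof -
  have ex: "\<exists>n. \<Lambda> / 4 < 2 ^ n" using real_arch_pow[of 2 "\<Lambda> / 4"] by simp
  define J where "J = (LEAST n. \<Lambda> / 4 < 2 ^ n)"
  have J1: "\<Lambda> / 4 < 2 ^ J" unfolding J_def by (rule LeastI_ex[OF ex])
  have J2: "2 * 2 ^ J \<le> \<Lambda>"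
  proof (cases J)
    case (Suc n)
    then have "\<not> \<Lambda> / 4 < 2 ^ n" using not_less_Least[of n "\<lambda>n. \<Lambda> / 4 < 2 ^ n"] by (simp add: J_def)
    then show ?thesis using Suc by simp
  qed (use \<Lambda> in simp)
  let ?E = "\<lambda>j. {p\<in>B. \<bar>f p\<bar> \<le> 2 ^ j / \<Lambda>}"
  let ?T = "\<lambda>j. A * ((2 ^ j / \<Lambda>) powr (1 / h) * ln (\<Lambda> / 2 ^ j) ^ l)"
  have jl: "0 < 2 ^ j / \<Lambda>" "2 ^ j / \<Lambda> \<le> 1 / 2" "1 / (2 ^ j / \<Lambda>) = \<Lambda> / 2 ^ j" if "j \<le> J" for j
  proof -
    have "(2::real) ^ j \<le> 2 ^ J" using that by simp
    then have "2 * 2 ^ j \<le> \<Lambda>" using J2 by linarith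
    then show "2 ^ j / \<Lambda> \<le> 1 / 2" using \<Lambda> by (simp add: divide_simps)
  qed (use \<Lambda> in simp_all)
  have T: "emeasure lborel (?E j) \<le> ennreal (?T j)" "0 \<le> ?T j" if "j \<le> J" for j
  proof -
    show "emeasure lborel (?E j) \<le> ennreal (?T j)" using A(2)[OF jl(1,2)[OF that]] unfolding jl(3)[OF that] .
    have "1 \<le> 1 / (2 ^ j / \<Lambda>)" using jl(1,2)[OF that] by (simp only: le_divide_eq_1_pos)
    then have "0 \<le> ln (\<Lambda> / 2 ^ j)" unfolding jl(3)[OF that] by (rule ln_ge_zero)
    then show "0 \<le> ?T j" using A(1) by simp
  qed
  have mE: "?E j \<in> sets lborel" for j using sublevel_measurable[OF B(1,2)] by simp
  have pt: "ennreal (1 / (1 + \<Lambda> * \<bar>f p\<bar>)) * indicator B p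
      \<le> (\<Sum>j\<le>J. ennreal (2 / 2 ^ j) * indicator (?E j) p) + ennreal (4 / \<Lambda>) * indicator B p" for p
  proof (cases "p \<in> B")
    case True
    have u: "0 \<le> \<Lambda> * \<bar>f p\<bar>" using \<Lambda> by simp
    have iE: "indicator {..2 ^ j} (\<Lambda> * \<bar>f p\<bar>) = (indicator (?E j) p :: real)" for j
      using True \<Lambda> by (simp add: indicator_def pos_le_divide_eq mult.commute)
    have "1 / 2 ^ J \<le> 4 / \<Lambda>" using J1 \<Lambda> by (simp add: divide_simps)
    then have "1 / (1 + \<Lambda> * \<bar>f p\<bar>) \<le> (\<Sum>j\<le>J. 2 / 2 ^ j * indicator (?E j) p) + 4 / \<Lambda>"
      using dyadic_majorant[OF u, of J] unfolding iE by linarith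
    then have "ennreal (1 / (1 + \<Lambda> * \<bar>f p\<bar>)) \<le> ennreal ((\<Sum>j\<le>J. 2 / 2 ^ j * indicator (?E j) p) + 4 / \<Lambda>)"
      by (rule ennreal_leI)
    also have "\<dots> = ennreal (\<Sum>j\<le>J. 2 / 2 ^ j * indicator (?E j) p) + ennreal (4 / \<Lambda>)"
      using \<Lambda> by (intro ennreal_plus sum_nonneg) auto
    also have "ennreal (\<Sum>j\<le>J. 2 / 2 ^ j * indicator (?E j) p) = (\<Sum>j\<le>J. ennreal (2 / 2 ^ j * indicator (?E j) p))"
      by (rule sum_ennreal[symmetric]) auto
    also have "\<dots> = (\<Sum>j\<le>J. ennreal (2 / 2 ^ j) * indicator (?E j) p)"
      by (intro sum.cong refl) (simp add: indicator_def)
    finally show ?thesis using True by simp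
  qed simp
  have "(\<integral>\<^sup>+p. ennreal (1 / (1 + \<Lambda> * \<bar>f p\<bar>)) * indicator B p \<partial>lborel)
      \<le> (\<integral>\<^sup>+p. (\<Sum>j\<le>J. ennreal (2 / 2 ^ j) * indicator (?E j) p) + ennreal (4 / \<Lambda>) * indicator B p \<partial>lborel)"
    by (rule nn_integral_mono) (rule pt)
  also have "\<dots> = (\<integral>\<^sup>+p. (\<Sum>j\<le>J. ennreal (2 / 2 ^ j) * indicator (?E j) p) \<partial>lborel) + (\<integral>\<^sup>+p. ennreal (4 / \<Lambda>) * indicator B p \<partial>lborel)"
    by (rule nn_integral_add) (use mE B(1) in measurable)
  also have "(\<integral>\<^sup>+p. (\<Sum>j\<le>J. ennreal (2 / 2 ^ j) * indicator (?E j) p) \<partial>lborel) = (\<Sum>j\<le>J. (\<integral>\<^sup>+p. ennreal (2 / 2 ^ j) * indicator (?E j) p \<partial>lborel))"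
    by (rule nn_integral_sum) (use mE in measurable)
  also have "\<dots> = (\<Sum>j\<le>J. ennreal (2 / 2 ^ j) * emeasure lborel (?E j))"
    by (intro sum.cong refl nn_integral_cmult_indicator mE)
  also have "(\<integral>\<^sup>+p. ennreal (4 / \<Lambda>) * indicator B p \<partial>lborel) = ennreal (4 / \<Lambda>) * emeasure lborel B"
    using B(1) by (intro nn_integral_cmult_indicator) simp
  also have "(\<Sum>j\<le>J. ennreal (2 / 2 ^ j) * emeasure lborel (?E j)) + ennreal (4 / \<Lambda>) * emeasure lborel B
      \<le> (\<Sum>j\<le>J. ennreal (2 / 2 ^ j) * ennreal (?T j)) + ennreal (4 / \<Lambda>) * ennreal K"
    by (intro add_mono sum_mono mult_left_mono T B(3)) auto
  also have "(\<Sum>j\<le>J. ennreal (2 / 2 ^ j) * ennreal (?T j)) = (\<Sum>j\<le>J. ennreal (2 / 2 ^ j * ?T j))"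
    by (intro sum.cong refl ennreal_mult[symmetric] T(2)) auto
  also have "\<dots> = ennreal (\<Sum>j\<le>J. 2 / 2 ^ j * ?T j)"
    by (intro sum_ennreal mult_nonneg_nonneg T(2)) auto
  also have "ennreal (4 / \<Lambda>) * ennreal K = ennreal (K * (4 / \<Lambda>))"
    using \<Lambda> B(4) by (simp add: ennreal_mult[symmetric] mult.commute)
  also have "ennreal (\<Sum>j\<le>J. 2 / 2 ^ j * ?T j) + ennreal (K * (4 / \<Lambda>)) = ennreal ((\<Sum>j\<le>J. 2 / 2 ^ j * ?T j) + K * (4 / \<Lambda>))"
    using \<Lambda> B(4) by (intro ennreal_plus[symmetric] sum_nonneg mult_nonneg_nonneg T(2)) auto
  finally show ?thesis using J2 by (intro exI[of _ J] conjI)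
qed

lemma ln_ge_1: "x \<ge> 3 \<Longrightarrow> 1 \<le> ln (x::real)"
  using ln_ge_iff[of x 1] exp_le by linarith

text \<open>The \<open>j\<close>-th dyadic term is \<open>\<Lambda>^(-1/h)\<close> times the \<open>j\<close>-th power of \<open>\<rho> = 2^(1/h - 1) < 1\<close>, up to
logarithms, and the geometric series converges.\<close>

lemma integral_bound_height_gt_1:
  assumes s: "sublevel_bound h l f B" and B: "emeasure lborel B < \<infinity>" and h: "h > 1"
  shows "\<exists>D\<ge>0. \<forall>\<Lambda>\<ge>3. (\<integral>\<^sup>+p. ennreal (1 / (1 + \<Lambda> * \<bar>f p\<bar>)) * indicator B p \<partial>lborel) \<le> ennreal (D * (ln \<Lambda> ^ l / \<Lambda> powr (1 / h)))"
proof -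
  obtain A where A: "A \<ge> 0" "\<And>\<epsilon>. 0 < \<epsilon> \<Longrightarrow> \<epsilon> \<le> 1 / 2 \<Longrightarrow>
      emeasure lborel {p\<in>B. \<bar>f p\<bar> \<le> \<epsilon>} \<le> ennreal (A * (\<epsilon> powr (1 / h) * ln (1 / \<epsilon>) ^ l))"
    and mB: "B \<in> sets borel" "continuous_on B f"
    using s unfolding sublevel_bound_def by blast
  define K where "K = measure lborel B"
  have K: "emeasure lborel B \<le> ennreal K" "K \<ge> 0"
    using B by (simp_all add: K_def emeasure_eq_ennreal_measure)
  define \<rho> where "\<rho> = (2::real) powr (1 / h) / 2"
  have "(2::real) powr (1 / h) < 2 powr 1" using h by (intro powr_less_mono) auto
  then have \<rho>: "0 \<le> \<rho>" "\<rho> < 1" by (simp_all add: \<rho>_def)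
  define D where "D = 2 * A / (1 - \<rho>) + 4 * K"
  have D: "D \<ge> 0" using A(1) K(2) \<rho> by (simp add: D_def)
  have "(\<integral>\<^sup>+p. ennreal (1 / (1 + \<Lambda> * \<bar>f p\<bar>)) * indicator B p \<partial>lborel) \<le> ennreal (D * (ln \<Lambda> ^ l / \<Lambda> powr (1 / h)))" if \<Lambda>: "\<Lambda> \<ge> 3" for \<Lambda>
  proof -
    have "\<Lambda> \<ge> 2" using \<Lambda> by simp
    then obtain J where J: "2 * 2 ^ J \<le> \<Lambda>" and I: "(\<integral>\<^sup>+p. ennreal (1 / (1 + \<Lambda> * \<bar>f p\<bar>)) * indicator B p \<partial>lborel)
      \<le> ennreal ((\<Sum>j\<le>J. 2 / 2 ^ j * (A * ((2 ^ j / \<Lambda>) powr (1 / h) * ln (\<Lambda> / 2 ^ j) ^ l))) + K * (4 / \<Lambda>))"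
      using integral_le_dyadic_sum[OF A mB K] by blast
    let ?w = "ln \<Lambda> ^ l / \<Lambda> powr (1 / h)"
    have w: "?w \<ge> 0" using ln_ge_1[OF \<Lambda>] by simp
    have "2 / 2 ^ j * (A * ((2 ^ j / \<Lambda>) powr (1 / h) * ln (\<Lambda> / 2 ^ j) ^ l)) \<le> (2 * A * ?w) * \<rho> ^ j" if j: "j \<le> J" for j
    proof -
      have "(2::real) ^ j \<le> 2 ^ J" using j by simp
      then have "2 ^ j \<le> \<Lambda>" using J zero_le_power[of "2::real" J] by linarith
      then have l0: "0 \<le> ln (\<Lambda> / 2 ^ j)" by (intro ln_ge_zero) simp
      have l1: "ln (\<Lambda> / 2 ^ j) \<le> ln \<Lambda>" using \<Lambda> by (simp add: ln_div ln_realpow)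
      have "((2::real) ^ j) powr (1 / h) = (2 powr (1 / h)) ^ j"
        by (simp add: powr_powr mult.commute flip: powr_realpow)
      then have p: "(2 ^ j / \<Lambda>) powr (1 / h) = (2 powr (1 / h)) ^ j / \<Lambda> powr (1 / h)" using \<Lambda> by (simp add: powr_divide)
      have "2 / 2 ^ j * (A * ((2 ^ j / \<Lambda>) powr (1 / h) * ln (\<Lambda> / 2 ^ j) ^ l)) \<le> 2 / 2 ^ j * (A * ((2 ^ j / \<Lambda>) powr (1 / h) * ln \<Lambda> ^ l))"
        using A(1) l0 l1 by (intro mult_left_mono power_mono) auto
      also have "\<dots> = (2 * A * ?w) * \<rho> ^ j" unfolding p \<rho>_def power_divide by (simp add: mult_ac)
      finally show ?thesis .
    qed
    then have "(\<Sum>j\<le>J. 2 / 2 ^ j * (A * ((2 ^ j / \<Lambda>) powr (1 / h) * ln (\<Lambda> / 2 ^ j) ^ l))) \<le> (\<Sum>j\<le>J. (2 * A * ?w) * \<rho> ^ j)"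
      by (intro sum_mono) simp
    also have "\<dots> = (2 * A * ?w) * (\<Sum>j\<le>J. \<rho> ^ j)" by (rule sum_distrib_left[symmetric])
    also have "\<dots> \<le> (2 * A * ?w) * (1 / (1 - \<rho>))"
    proof (intro mult_left_mono)
      have "(\<Sum>j\<le>J. \<rho> ^ j) = (1 - \<rho> ^ Suc J) / (1 - \<rho>)" using sum_gp0[of \<rho> J] \<rho> by simp
      also have "\<dots> \<le> 1 / (1 - \<rho>)" using \<rho> by (intro divide_right_mono) auto
      finally show "(\<Sum>j\<le>J. \<rho> ^ j) \<le> 1 / (1 - \<rho>)" .
      show "0 \<le> 2 * A * ?w" using A(1) w by (intro mult_nonneg_nonneg) auto
    qed
    finally have 1: "(\<Sum>j\<le>J. 2 / 2 ^ j * (A * ((2 ^ j / \<Lambda>) powr (1 / h) * ln (\<Lambda> / 2 ^ j) ^ l))) \<le> (2 * A / (1 - \<rho>)) * ?w" by (simp add: mult.commute)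
    have "\<Lambda> powr (1 / h) \<le> \<Lambda> powr 1" using \<Lambda> h by (intro powr_mono) auto
    then have "1 / \<Lambda> \<le> 1 / \<Lambda> powr (1 / h)" using \<Lambda> by (intro divide_left_mono) auto
    also have "\<dots> \<le> ?w" using ln_ge_1[OF \<Lambda>] by (intro divide_right_mono one_le_power) auto
    finally have "4 * K * (1 / \<Lambda>) \<le> 4 * K * ?w" using K(2) by (intro mult_left_mono) auto
    then have 2: "K * (4 / \<Lambda>) \<le> 4 * K * ?w" by (simp add: mult.commute)
    have "(\<Sum>j\<le>J. 2 / 2 ^ j * (A * ((2 ^ j / \<Lambda>) powr (1 / h) * ln (\<Lambda> / 2 ^ j) ^ l))) + K * (4 / \<Lambda>) \<le> D * ?w"
      using add_mono[OF 1 2] unfolding D_def distrib_right .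
    then show ?thesis by (rule order_trans[OF I ennreal_leI])
  qed
  then show ?thesis using D by (intro exI[of _ D]) simp
qed

text \<open>For \<open>h = 1\<close> each of the \<open>J + 1 \<le> ln \<Lambda> / ln 2\<close> dyadic terms is \<open>O(ln \<Lambda> / \<Lambda>)\<close>.\<close>

lemma integral_bound_height_1:
  assumes s: "sublevel_bound 1 l f B" and B: "emeasure lborel B < \<infinity>" and l: "l \<le> 1"
  shows "\<exists>D\<ge>0. \<forall>\<Lambda>\<ge>3. (\<integral>\<^sup>+p. ennreal (1 / (1 + \<Lambda> * \<bar>f p\<bar>)) * indicator B p \<partial>lborel) \<le> ennreal (D * (ln \<Lambda> ^ 2 / \<Lambda>))"
proof -
  obtain A where A: "A \<ge> 0" "\<And>\<epsilon>. 0 < \<epsilon> \<Longrightarrow> \<epsilon> \<le> 1 / 2 \<Longrightarrow>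
      emeasure lborel {p\<in>B. \<bar>f p\<bar> \<le> \<epsilon>} \<le> ennreal (A * (\<epsilon> powr (1 / 1) * ln (1 / \<epsilon>) ^ l))"
    and mB: "B \<in> sets borel" "continuous_on B f"
    using s unfolding sublevel_bound_def by blast
  define K where "K = measure lborel B"
  have K: "emeasure lborel B \<le> ennreal K" "K \<ge> 0"
    using B by (simp_all add: K_def emeasure_eq_ennreal_measure)
  define D where "D = 2 * A / ln 2 + 4 * K"
  have D: "D \<ge> 0" using A(1) K(2) by (simp add: D_def)
  have "(\<integral>\<^sup>+p. ennreal (1 / (1 + \<Lambda> * \<bar>f p\<bar>)) * indicator B p \<partial>lborel) \<le> ennreal (D * (ln \<Lambda> ^ 2 / \<Lambda>))" if \<Lambda>: "\<Lambda> \<ge> 3" for \<Lambda>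
  proof -
    have "\<Lambda> \<ge> 2" using \<Lambda> by simp
    then obtain J where J: "2 * 2 ^ J \<le> \<Lambda>" and I: "(\<integral>\<^sup>+p. ennreal (1 / (1 + \<Lambda> * \<bar>f p\<bar>)) * indicator B p \<partial>lborel)
      \<le> ennreal ((\<Sum>j\<le>J. 2 / 2 ^ j * (A * ((2 ^ j / \<Lambda>) powr (1 / 1) * ln (\<Lambda> / 2 ^ j) ^ l))) + K * (4 / \<Lambda>))"
      using integral_le_dyadic_sum[OF A mB K] by blast
    have ln1: "1 \<le> ln \<Lambda>" by (rule ln_ge_1[OF \<Lambda>])
    have lnl: "ln \<Lambda> ^ l \<le> ln \<Lambda>" using power_increasing[OF l ln1] by simp
    have "2 / 2 ^ j * (A * ((2 ^ j / \<Lambda>) powr (1 / 1) * ln (\<Lambda> / 2 ^ j) ^ l)) \<le> 2 * A * (ln \<Lambda> / \<Lambda>)" if j: "j \<le> J" for j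
    proof -
      have "(2::real) ^ j \<le> 2 ^ J" using j by simp
      then have "2 ^ j \<le> \<Lambda>" using J zero_le_power[of "2::real" J] by linarith
      then have l0: "0 \<le> ln (\<Lambda> / 2 ^ j)" by (intro ln_ge_zero) simp
      have l1: "ln (\<Lambda> / 2 ^ j) \<le> ln \<Lambda>" using \<Lambda> by (simp add: ln_div ln_realpow)
      have "ln (\<Lambda> / 2 ^ j) ^ l \<le> ln \<Lambda>" using power_mono[OF l1 l0, of l] lnl by linarith
      then have "2 / 2 ^ j * (A * ((2 ^ j / \<Lambda>) powr (1 / 1) * ln (\<Lambda> / 2 ^ j) ^ l)) \<le> 2 / 2 ^ j * (A * ((2 ^ j / \<Lambda>) powr (1 / 1) * ln \<Lambda>))"
        using A(1) by (intro mult_left_mono) auto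
      also have "\<dots> = 2 * A * (ln \<Lambda> / \<Lambda>)" using \<Lambda> by simp
      finally show ?thesis .
    qed
    then have "(\<Sum>j\<le>J. 2 / 2 ^ j * (A * ((2 ^ j / \<Lambda>) powr (1 / 1) * ln (\<Lambda> / 2 ^ j) ^ l))) \<le> (\<Sum>j\<le>J. 2 * A * (ln \<Lambda> / \<Lambda>))"
      by (intro sum_mono) simp
    also have "\<dots> = (real J + 1) * (2 * A * (ln \<Lambda> / \<Lambda>))" by simp
    also have "\<dots> \<le> (ln \<Lambda> / ln 2) * (2 * A * (ln \<Lambda> / \<Lambda>))"
    proof (rule mult_right_mono)
      have "ln (2 ^ Suc J) \<le> ln \<Lambda>" using J \<Lambda> by (subst ln_le_cancel_iff) auto
      then have "(real J + 1) * ln 2 \<le> ln \<Lambda>" by (simp add: ln_realpow add.commute del: power_Suc)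
      then show "real J + 1 \<le> ln \<Lambda> / ln 2" by (simp add: pos_le_divide_eq)
      show "0 \<le> 2 * A * (ln \<Lambda> / \<Lambda>)" using A(1) ln1 \<Lambda> by simp
    qed
    also have "\<dots> = (2 * A / ln 2) * (ln \<Lambda> ^ 2 / \<Lambda>)" by (simp add: power2_eq_square)
    finally have 1: "(\<Sum>j\<le>J. 2 / 2 ^ j * (A * ((2 ^ j / \<Lambda>) powr (1 / 1) * ln (\<Lambda> / 2 ^ j) ^ l))) \<le> (2 * A / ln 2) * (ln \<Lambda> ^ 2 / \<Lambda>)" .
    have "1 / \<Lambda> \<le> ln \<Lambda> ^ 2 / \<Lambda>" using ln1 \<Lambda> by (intro divide_right_mono one_le_power) auto
    then have "4 * K * (1 / \<Lambda>) \<le> 4 * K * (ln \<Lambda> ^ 2 / \<Lambda>)" using K(2) by (intro mult_left_mono) auto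
    then have 2: "K * (4 / \<Lambda>) \<le> 4 * K * (ln \<Lambda> ^ 2 / \<Lambda>)" by (simp add: mult.commute)
    have "(\<Sum>j\<le>J. 2 / 2 ^ j * (A * ((2 ^ j / \<Lambda>) powr (1 / 1) * ln (\<Lambda> / 2 ^ j) ^ l))) + K * (4 / \<Lambda>) \<le> D * (ln \<Lambda> ^ 2 / \<Lambda>)"
      using add_mono[OF 1 2] unfolding D_def distrib_right .
    then show ?thesis by (rule order_trans[OF I ennreal_leI])
  qed
  then show ?thesis using D by (intro exI[of _ D]) simp
qed

text \<open>The essential supremum is an extended real, and its real part is meaningful only because it is finite (the
amplitude is continuous with compact support) and nonnegative (the closure of \<open>U\<close> has positive measure).\<close>

lemma Linf_norm_on_AE:
  assumes \<psi>: "test_function_on U \<psi>" and U: "open U" "U \<noteq> {}"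
  shows "0 \<le> Linf_norm_on (closure U) \<psi>" and "AE x in lborel. x \<in> U \<longrightarrow> norm (\<psi> x) \<le> Linf_norm_on (closure U) \<psi>"
proof -
  let ?M = "restrict_space lborel (closure U)" and ?S = "closure {x. \<psi> x \<noteq> 0}"
  let ?e = "esssup ?M (\<lambda>x. ereal (norm (\<psi> x)))"
  have cont: "continuous_on UNIV \<psi>" using \<psi> smooth_on_continuous_on unfolding test_function_on_def by blast
  have "(\<lambda>x. ereal (norm (\<psi> x))) \<in> borel_measurable lborel"
    using borel_measurable_continuous_onI[OF cont] by measurable
  then have meas: "(\<lambda>x. ereal (norm (\<psi> x))) \<in> borel_measurable ?M" by (rule measurable_restrict_space1)
  have "compact (\<psi> ` ?S)"
    using \<psi> unfolding test_function_on_def by (intro compact_continuous_image continuous_on_subset[OF cont]) auto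
  then obtain b where b: "\<And>x. x \<in> ?S \<Longrightarrow> norm (\<psi> x) \<le> b" 
    using compact_imp_bounded[of "\<psi> ` ?S"] unfolding bounded_iff by blast
  have bound: "norm (\<psi> x) \<le> max 0 b" for x
  proof (cases "\<psi> x = 0")
    case False
    then have "x \<in> ?S" using closure_subset[of "{x. \<psi> x \<noteq> 0}"] by blast
    then show ?thesis using b by fastforce
  qed simp
  have up: "?e \<le> ereal (max 0 b)" by (rule esssup_I[OF meas]) (intro AE_I2, simp only: ereal_less_eq bound)
  obtain z where z: "z \<in> U" using U(2) by blast
  obtain e where e: "e > 0" "ball z e \<subseteq> U" using openE[OF U(1) z] by blast
  have cl: "closure U \<in> sets lborel" by simp
  have "0 < emeasure lborel (ball z e)" using content_ball_pos[OF e(1), of z] by (auto simp: measure_def enn2real_positive_iff)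
  also have "\<dots> \<le> emeasure lborel (closure U)" by (rule emeasure_mono) (use e closure_subset in auto)
  finally have "emeasure ?M (space ?M) \<noteq> 0" using cl by (simp add: emeasure_restrict_space space_restrict_space)
  then have "(0::ereal) = esssup ?M (\<lambda>x. 0)" by (rule esssup_const[symmetric])
  also have "\<dots> \<le> ?e" by (rule esssup_mono) auto
  finally have lo: "0 \<le> ?e" .
  have fin: "ereal (Linf_norm_on (closure U) \<psi>) = ?e"
    unfolding Linf_norm_on_def using lo up by (intro ereal_real') (auto simp: max_def split: if_splits)
  show "0 \<le> Linf_norm_on (closure U) \<psi>" using lo unfolding fin[symmetric] by simp
  have "AE x in ?M. ereal (norm (\<psi> x)) \<le> ereal (Linf_norm_on (closure U) \<psi>)" unfolding fin by (rule esssup_AE)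
  then have "AE x in lborel. x \<in> closure U \<longrightarrow> norm (\<psi> x) \<le> Linf_norm_on (closure U) \<psi>"
    using cl by (subst (asm) AE_restrict_space_iff) auto
  then show "AE x in lborel. x \<in> U \<longrightarrow> norm (\<psi> x) \<le> Linf_norm_on (closure U) \<psi>"
    by eventually_elim (use closure_subset in blast)
qed

text \<open>If the integrand is not integrable, the Bochner integral is \<open>0\<close> by convention and the bound is trivial.\<close>

lemma oscillatory_integral_bound:
  fixes g :: "real \<times> real \<Rightarrow> complex" and L W :: real
  assumes g: "\<And>p. norm (g p) \<le> M / (1 + \<Lambda> * \<bar>f p\<bar>)" and M: "M \<ge> 0" and \<Lambda>: "\<Lambda> \<ge> 0"
    and L: "L \<ge> 0" "AE x in lborel. x \<in> U \<longrightarrow> norm (\<psi> x) \<le> L" and U: "U \<subseteq> B"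
    and I: "(\<integral>\<^sup>+p. ennreal (1 / (1 + \<Lambda> * \<bar>f p\<bar>)) * indicator B p \<partial>lborel) \<le> ennreal W" and W: "W \<ge> 0"
    and meas: "(\<lambda>p. ennreal (1 / (1 + \<Lambda> * \<bar>f p\<bar>)) * indicator B p) \<in> borel_measurable lborel"
  shows "norm (LINT x:U|lborel. g x * \<psi> x) \<le> M * L * W"
proof (cases "integrable lborel (\<lambda>x. indicator U x *\<^sub>R (g x * \<psi> x))")
  case True
  have "ennreal (norm (LINT x:U|lborel. g x * \<psi> x)) \<le> (\<integral>\<^sup>+x. norm (indicator U x *\<^sub>R (g x * \<psi> x)) \<partial>lborel)"
    unfolding set_lebesgue_integral_def by (rule integral_norm_bound_ennreal[OF True])
  also have "\<dots> \<le> (\<integral>\<^sup>+x. ennreal (M * L) * (ennreal (1 / (1 + \<Lambda> * \<bar>f x\<bar>)) * indicator B x) \<partial>lborel)"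
  proof (rule nn_integral_mono_AE)
    show "AE x in lborel. ennreal (norm (indicator U x *\<^sub>R (g x * \<psi> x))) \<le> ennreal (M * L) * (ennreal (1 / (1 + \<Lambda> * \<bar>f x\<bar>)) * indicator B x)"
      using L(2)
    proof eventually_elim
      case (elim x)
      show ?case
      proof (cases "x \<in> U")
        case True
        have "norm (g x) * norm (\<psi> x) \<le> (M / (1 + \<Lambda> * \<bar>f x\<bar>)) * L"
          using g[of x] elim True M \<Lambda> by (intro mult_mono) auto
        also have "\<dots> = M * L * (1 / (1 + \<Lambda> * \<bar>f x\<bar>))" by simp
        finally have "ennreal (norm (g x * \<psi> x)) \<le> ennreal (M * L * (1 / (1 + \<Lambda> * \<bar>f x\<bar>)))"
          unfolding norm_mult by (rule ennreal_leI)
        also have "\<dots> = ennreal (M * L) * ennreal (1 / (1 + \<Lambda> * \<bar>f x\<bar>))"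
          using M L(1) \<Lambda> by (intro ennreal_mult) auto
        finally show ?thesis using True U by (auto simp: indicator_def)
      qed simp
    qed
  qed
  also have "\<dots> = ennreal (M * L) * (\<integral>\<^sup>+x. ennreal (1 / (1 + \<Lambda> * \<bar>f x\<bar>)) * indicator B x \<partial>lborel)"
    by (rule nn_integral_cmult[OF meas])
  also have "\<dots> \<le> ennreal (M * L) * ennreal W" by (rule mult_left_mono[OF I]) simp
  also have "\<dots> = ennreal (M * L * W)" using M L(1) W by (intro ennreal_mult[symmetric]) auto
  finally show ?thesis using M L(1) W by (subst (asm) ennreal_le_iff) auto
next
  case False
  then have "(LINT x:U|lborel. g x * \<psi> x) = 0" unfolding set_lebesgue_integral_def by (rule not_integrable_integral_eq)
  then show ?thesis using M L(1) W by simp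
qed

theorem theorem2p2:
  fixes \<alpha> \<beta> :: real
  assumes "0 < \<alpha>" and "\<alpha> < 1" and "0 < \<beta>"
  shows "\<exists>C :: (real \<times> real) set \<Rightarrow> real.
    \<forall>f :: real \<times> real \<Rightarrow> real. phase_function f \<longrightarrow>
      (\<exists>r>0. \<forall>U. open U \<and> (0, 0) \<in> U \<and> U \<subseteq> ball (0, 0) r \<longrightarrow>
        (\<forall>\<^sub>F lam in at_top. \<forall>\<psi> :: real \<times> real \<Rightarrow> complex. test_function_on U \<psi> \<longrightarrow>
          (height f > 1 \<longrightarrow>
            norm (LINT x:U|lborel. mittag_leffler \<alpha> \<beta> (\<i> * complex_of_real (lam * f x)) * \<psi> x)
              \<le> C U * \<bar>ln lam\<bar> ^ newton_multiplicity f * Linf_norm_on (closure U) \<psi>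
                  / lam powr (1 / height f)) \<and>
          (height f = 1 \<longrightarrow>
            norm (LINT x:U|lborel. mittag_leffler \<alpha> \<beta> (\<i> * complex_of_real (lam * f x)) * \<psi> x)
              \<le> C U * \<bar>ln lam\<bar> ^ 2 * Linf_norm_on (closure U) \<psi> / lam)))"
proof -
  obtain M where M: "M > 0" "\<And>y::real. norm (mittag_leffler \<alpha> \<beta> (\<i> * of_real y)) \<le> M / (1 + \<bar>y\<bar>)"
    using ml_decay[OF assms(1,2)] unfolding mittag_leffler_eq_ml by blast
  show ?thesis
  \<comment> \<open>Sets of small diameter receive a large constant.\<close>
  proof (rule exI[of _ "\<lambda>U. 1 / diameter U"], intro allI impI)
    fix f assume f: "phase_function f"
    let ?h = "height f" and ?l = "newton_multiplicity f"
    obtain r0 where r0: "r0 > 0" "sublevel_bound ?h ?l f (ball (0, 0) r0)" using ball_bound[OF f] by blast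
    let ?B = "ball (0, 0) r0 :: (real \<times> real) set"
    let ?I = "\<lambda>\<Lambda>. \<integral>\<^sup>+p. ennreal (1 / (1 + \<Lambda> * \<bar>f p\<bar>)) * indicator ?B p \<partial>lborel"
    have fin: "emeasure lborel ?B < \<infinity>" by (rule emeasure_lborel_ball_finite)
    have contB: "continuous_on ?B f" using r0(2) unfolding sublevel_bound_def by blast
    have meas: "(\<lambda>p. ennreal (1 / (1 + \<Lambda> * \<bar>f p\<bar>)) * indicator ?B p) \<in> borel_measurable lborel" for \<Lambda>
    proof -
      have "f \<in> borel_measurable (restrict_space borel ?B)" by (rule borel_measurable_continuous_on_restrict[OF contB])
      then have "(\<lambda>p. ennreal (1 / (1 + \<Lambda> * \<bar>f p\<bar>))) \<in> borel_measurable (restrict_space borel ?B)" by measurable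
      then show ?thesis by (subst (asm) borel_measurable_restrict_space_iff_ennreal) simp_all
    qed
    have l1: "?l \<le> 1" by (simp add: newton_multiplicity_def)
    obtain D1 where D1: "D1 \<ge> 0" "?h > 1 \<Longrightarrow> \<forall>\<Lambda>\<ge>3. ?I \<Lambda> \<le> ennreal (D1 * (ln \<Lambda> ^ ?l / \<Lambda> powr (1 / ?h)))"
      using integral_bound_height_gt_1[OF r0(2) fin] by (cases "?h > 1") auto
    obtain D2 where D2: "D2 \<ge> 0" "?h = 1 \<Longrightarrow> \<forall>\<Lambda>\<ge>3. ?I \<Lambda> \<le> ennreal (D2 * (ln \<Lambda> ^ 2 / \<Lambda>))"
    proof (cases "?h = 1")
      case True
      have "sublevel_bound 1 ?l f ?B" using r0(2) by (simp only: True)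
      then show ?thesis using integral_bound_height_1[OF _ fin l1] that by blast
    qed auto
    define D where "D = M * (D1 + D2) + 1"
    have D: "D > 0" "M * D1 \<le> D" "M * D2 \<le> D" using M(1) D1(1) D2(1) by (simp_all add: D_def algebra_simps add_pos_nonneg)
    \<comment> \<open>A set inside this ball has diameter at most \<open>1 / D\<close>, so \<open>C U\<close> is at least the \<open>f\<close>-dependent constant \<open>D\<close>.\<close>
    define r where "r = min r0 (1 / (2 * D))"
    have r: "r > 0" "r \<le> r0" "r \<le> 1 / (2 * D)" using r0(1) D by (simp_all add: r_def)
    show "\<exists>r>0. \<forall>U. open U \<and> (0, 0) \<in> U \<and> U \<subseteq> ball (0, 0) r \<longrightarrow>
        (\<forall>\<^sub>F lam in at_top. \<forall>\<psi> :: real \<times> real \<Rightarrow> complex. test_function_on U \<psi> \<longrightarrow>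
          (height f > 1 \<longrightarrow>
            norm (LINT x:U|lborel. mittag_leffler \<alpha> \<beta> (\<i> * complex_of_real (lam * f x)) * \<psi> x)
              \<le> 1 / diameter U * \<bar>ln lam\<bar> ^ newton_multiplicity f * Linf_norm_on (closure U) \<psi>
                  / lam powr (1 / height f)) \<and>
          (height f = 1 \<longrightarrow>
            norm (LINT x:U|lborel. mittag_leffler \<alpha> \<beta> (\<i> * complex_of_real (lam * f x)) * \<psi> x)
              \<le> 1 / diameter U * \<bar>ln lam\<bar> ^ 2 * Linf_norm_on (closure U) \<psi> / lam))"
    proof (intro exI[of _ r] conjI r(1) allI impI)
      fix U :: "(real \<times> real) set"
      assume U: "open U \<and> (0, 0) \<in> U \<and> U \<subseteq> ball (0, 0) r"
      have UB: "U \<subseteq> ?B" using U subset_ball[OF r(2)] by blast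
      have dia: "D \<le> 1 / diameter U"
      proof -
        obtain e where e: "e > 0" "ball (0, 0) e \<subseteq> U" using openE[of U "(0, 0)"] U by blast
        have bd: "bounded U" using U bounded_subset[OF bounded_ball] by blast
        have "(e / 2, 0) \<in> ball (0 :: real, 0 :: real) e" using e(1) by (simp add: dist_norm)
        then have "dist (e / 2, 0) (0 :: real, 0 :: real) \<le> diameter U"
          using e(2) U by (intro diameter_bounded_bound bd) auto
        then have pos: "0 < diameter U" using e(1) by (simp add: dist_norm)
        have "diameter U \<le> diameter (ball (0 :: real, 0 :: real) r)"
          using U by (intro diameter_subset bounded_ball) simp
        also have "\<dots> = 2 * r" using r(1) by (simp add: diameter_ball)
        also have "\<dots> \<le> 1 / D" using r(3) D(1) by (simp add: field_simps)
        finally show ?thesis using pos D(1) by (simp add: field_simps)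
      qed
      show "\<forall>\<^sub>F lam in at_top. \<forall>\<psi> :: real \<times> real \<Rightarrow> complex. test_function_on U \<psi> \<longrightarrow>
          (height f > 1 \<longrightarrow>
            norm (LINT x:U|lborel. mittag_leffler \<alpha> \<beta> (\<i> * complex_of_real (lam * f x)) * \<psi> x)
              \<le> 1 / diameter U * \<bar>ln lam\<bar> ^ newton_multiplicity f * Linf_norm_on (closure U) \<psi>
                  / lam powr (1 / height f)) \<and>
          (height f = 1 \<longrightarrow>
            norm (LINT x:U|lborel. mittag_leffler \<alpha> \<beta> (\<i> * complex_of_real (lam * f x)) * \<psi> x)
              \<le> 1 / diameter U * \<bar>ln lam\<bar> ^ 2 * Linf_norm_on (closure U) \<psi> / lam)"
        using eventually_ge_at_top[of 3]
      proof (eventually_elim, intro allI impI)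
        fix \<Lambda> :: real and \<psi> :: "real \<times> real \<Rightarrow> complex"
        assume \<Lambda>: "3 \<le> \<Lambda>" and \<psi>: "test_function_on U \<psi>"
        let ?L = "Linf_norm_on (closure U) \<psi>"
        have L: "0 \<le> ?L" "AE x in lborel. x \<in> U \<longrightarrow> norm (\<psi> x) \<le> ?L"
          by (rule Linf_norm_on_AE[OF \<psi>]; use U in auto)+
        have ln0: "0 \<le> ln \<Lambda>" using ln_ge_1[OF \<Lambda>] by simp
        have dec: "norm (mittag_leffler \<alpha> \<beta> (\<i> * complex_of_real (\<Lambda> * f x))) \<le> M / (1 + \<Lambda> * \<bar>f x\<bar>)" for x
          using M(2)[of "\<Lambda> * f x"] \<Lambda> by (simp only: abs_mult abs_of_nonneg)
        have key: "norm (LINT x:U|lborel. mittag_leffler \<alpha> \<beta> (\<i> * complex_of_real (\<Lambda> * f x)) * \<psi> x) \<le> 1 / diameter U * w * ?L"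
          if w: "0 \<le> w" and I: "?I \<Lambda> \<le> ennreal (E * w)" and E: "0 \<le> E" "M * E \<le> D" for w E
        proof -
          have "norm (LINT x:U|lborel. mittag_leffler \<alpha> \<beta> (\<i> * complex_of_real (\<Lambda> * f x)) * \<psi> x) \<le> M * ?L * (E * w)"
            using M(1) \<Lambda> w E(1) by (intro oscillatory_integral_bound[OF dec _ _ L UB I _ meas]) auto
          also have "\<dots> = (M * E) * (w * ?L)" by (simp only: mult_ac)
          also have "\<dots> \<le> 1 / diameter U * (w * ?L)"
            using E(2) dia w L(1) by (intro mult_right_mono) auto
          finally show ?thesis by (simp only: mult_ac)
        qed
        show "(?h > 1 \<longrightarrow>
            norm (LINT x:U|lborel. mittag_leffler \<alpha> \<beta> (\<i> * complex_of_real (\<Lambda> * f x)) * \<psi> x)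
              \<le> 1 / diameter U * \<bar>ln \<Lambda>\<bar> ^ ?l * ?L / \<Lambda> powr (1 / ?h)) \<and>
          (?h = 1 \<longrightarrow>
            norm (LINT x:U|lborel. mittag_leffler \<alpha> \<beta> (\<i> * complex_of_real (\<Lambda> * f x)) * \<psi> x)
              \<le> 1 / diameter U * \<bar>ln \<Lambda>\<bar> ^ 2 * ?L / \<Lambda>)"
        proof (intro conjI impI)
          assume h: "?h > 1"
          have "?I \<Lambda> \<le> ennreal (D1 * (ln \<Lambda> ^ ?l / \<Lambda> powr (1 / ?h)))" using D1(2)[OF h] \<Lambda> by simp
          from key[OF _ this D1(1) D(2)] 
          show "norm (LINT x:U|lborel. mittag_leffler \<alpha> \<beta> (\<i> * complex_of_real (\<Lambda> * f x)) * \<psi> x)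
              \<le> 1 / diameter U * \<bar>ln \<Lambda>\<bar> ^ ?l * ?L / \<Lambda> powr (1 / ?h)" using ln0 by simp
        next
          assume h: "?h = 1"
          have "?I \<Lambda> \<le> ennreal (D2 * (ln \<Lambda> ^ 2 / \<Lambda>))" using D2(2)[OF h] \<Lambda> by simp
          from key[OF _ this D2(1) D(3)] 
          show "norm (LINT x:U|lborel. mittag_leffler \<alpha> \<beta> (\<i> * complex_of_real (\<Lambda> * f x)) * \<psi> x)
              \<le> 1 / diameter U * \<bar>ln \<Lambda>\<bar> ^ 2 * ?L / \<Lambda>" using ln0 \<Lambda> by simp
        qed
      qed
    qed
  qed
qed

end
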